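(* There exists a real-analytic flow on the torus $\mathbb{T}^2$, preserving a smooth probability measure and weakly mixing with respect to it, that is not reversible and such that no rational number different from $1$ is a scale of self-similarity of it.
   Context: A smooth measure is a measure with a smooth strictly positive density with respect to Lebesgue measure on $\mathbb{T}^2$. A measure-preserving flow $\mathcal{T}=(T_t)_{t\in\mathbb{R}}$ on $(X,\mathcal{B},\mu)$ is reversible if there is an invertible measure-preserving map $S:X\to X$ with $T_t\circ S=S\circ T_{-t}$ for each $t\in\mathbb{R}$ and $S^2=\mathrm{Id}$. A number $s\in\mathbb{R}^*=\mathbb{R}\setminus\{0\}$ is a scale of self-similarity of $\mathcal{T}$ if $\mathcal{T}$ is (measure-theoretically) isomorphic to the flow $\mathcal{T}\circ s=(T_{st})_{t\in\mathbb{R}}$. *)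

theory Defs
  imports "HOL-Analysis.Analysis" "HOL-Probability.Probability_Measure"
begin

section \<open>The torus\<close>

text \<open>
  The torus \<open>\<real>\<^sup>2 / \<int>\<^sup>2\<close> is realised as the product of two unit circles. The covering map
  \<open>torus_proj\<close> is invariant exactly under translation by \<open>\<int>\<^sup>2\<close> and maps the fundamental
  domain \<open>[0,1)\<^sup>2\<close> bijectively onto \<open>torus\<close>.
\<close>

definition torus :: "(complex \<times> complex) set" where
  "torus = sphere 0 1 \<times> sphere 0 1"

definition torus_proj :: "real \<times> real \<Rightarrow> complex \<times> complex" where
  "torus_proj p = (cis (2 * pi * fst p), cis (2 * pi * snd p))"

definition torus_lebesgue :: "(complex \<times> complex) measure" where
  "torus_lebesgue =
     distr (restrict_space lborel ({0..<1} \<times> {0..<1})) (restrict_space borel torus) torus_proj"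


section \<open>Smoothness and real analyticity\<close>

text \<open>\<open>C_k k f\<close>: all partial derivatives of order at most \<open>k\<close> exist and are continuous.\<close>

primrec C_k :: "nat \<Rightarrow> ('a::euclidean_space \<Rightarrow> real) \<Rightarrow> bool" where
  "C_k 0 f \<longleftrightarrow> continuous_on UNIV f"
| "C_k (Suc k) f \<longleftrightarrow>
     (\<forall>x. f differentiable (at x)) \<and> (\<forall>i\<in>Basis. C_k k (\<lambda>x. frechet_derivative f (at x) i))"

definition smooth :: "('a::euclidean_space \<Rightarrow> real) \<Rightarrow> bool" where
  "smooth f \<longleftrightarrow> (\<forall>k. C_k k f)"

text \<open>
  Near \<open>a\<close>, \<open>f\<close> is the sum of a convergent multivariate power series; the multi-indices are
  the extensional functions from \<open>Basis\<close> to the natural numbers.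
\<close>

definition real_analytic_at ::
    "('a::euclidean_space \<Rightarrow> 'b::euclidean_space) \<Rightarrow> 'a \<Rightarrow> bool" where
  "real_analytic_at f a \<longleftrightarrow>
     (\<exists>(c :: ('a \<Rightarrow> nat) \<Rightarrow> 'b) r. r > 0 \<and>
       (\<forall>x\<in>ball a r.
         ((\<lambda>\<alpha>. (\<Prod>i\<in>Basis. ((x - a) \<bullet> i) ^ \<alpha> i) *\<^sub>R c \<alpha>) has_sum f x)
           (Basis \<rightarrow>\<^sub>E UNIV)))"

definition real_analytic :: "('a::euclidean_space \<Rightarrow> 'b::euclidean_space) \<Rightarrow> bool" where
  "real_analytic f \<longleftrightarrow> (\<forall>a. real_analytic_at f a)"

definition smooth_torus_measure :: "(complex \<times> complex) measure \<Rightarrow> bool" where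
  "smooth_torus_measure \<mu> \<longleftrightarrow>
     (\<exists>h :: complex \<times> complex \<Rightarrow> real.
        smooth (h \<circ> torus_proj) \<and> (\<forall>z\<in>torus. h z > 0) \<and>
        \<mu> = density torus_lebesgue (\<lambda>z. ennreal (h z)))"

text \<open>
  As \<open>torus\<close> is an analytic submanifold of \<open>\<complex>\<^sup>2\<close> and \<open>torus_proj\<close> an analytic local
  diffeomorphism onto it, the condition below is joint analyticity of \<open>(t, z) \<mapsto> T t z\<close>
  on \<open>\<real> \<times> torus\<close>. Values of \<open>T t\<close> outside \<open>torus\<close> are irrelevant.
\<close>

definition real_analytic_torus_flow :: "(real \<Rightarrow> complex \<times> complex \<Rightarrow> complex \<times> complex) \<Rightarrow> bool" where
  "real_analytic_torus_flow T \<longleftrightarrow>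
     (\<forall>t. T t ` torus \<subseteq> torus) \<and>
     (\<forall>z\<in>torus. T 0 z = z) \<and>
     (\<forall>s t. \<forall>z\<in>torus. T (s + t) z = T s (T t z)) \<and>
     real_analytic (\<lambda>(t, p). T t (torus_proj p))"


section \<open>Measure-preserving flows\<close>

definition measure_preserving :: "'a measure \<Rightarrow> 'b measure \<Rightarrow> ('a \<Rightarrow> 'b) \<Rightarrow> bool" where
  "measure_preserving M N \<phi> \<longleftrightarrow> \<phi> \<in> measurable M N \<and> distr M N \<phi> = N"

definition measure_preserving_flow :: "'a measure \<Rightarrow> (real \<Rightarrow> 'a \<Rightarrow> 'a) \<Rightarrow> bool" where
  "measure_preserving_flow M T \<longleftrightarrow>
     (\<lambda>(t, x). T t x) \<in> measurable (borel \<Otimes>\<^sub>M M) M \<and>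
     (\<forall>t. measure_preserving M M (T t)) \<and>
     (\<forall>x\<in>space M. T 0 x = x) \<and>
     (\<forall>s t. \<forall>x\<in>space M. T (s + t) x = T s (T t x))"

definition weakly_mixing :: "'a measure \<Rightarrow> (real \<Rightarrow> 'a \<Rightarrow> 'a) \<Rightarrow> bool" where
  "weakly_mixing M T \<longleftrightarrow>
     (\<forall>A\<in>sets M. \<forall>B\<in>sets M.
        ((\<lambda>R. (1 / R) * integral {0..R}
            (\<lambda>t. \<bar>measure M (A \<inter> (T t -` B \<inter> space M)) - measure M A * measure M B\<bar>))
          \<longlongrightarrow> 0) at_top)"

text \<open>
  As usual in ergodic theory, maps between measure spaces are considered modulo null sets: the
  inverse, the intertwining relations and the involution property are required almost everywhere.
\<close>

definition invertible_measure_preserving :: "'a measure \<Rightarrow> 'b measure \<Rightarrow> ('a \<Rightarrow> 'b) \<Rightarrow> bool" where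
  "invertible_measure_preserving M N \<phi> \<longleftrightarrow>
     measure_preserving M N \<phi> \<and>
     (\<exists>\<psi>. measure_preserving N M \<psi> \<and>
        (AE x in M. \<psi> (\<phi> x) = x) \<and> (AE y in N. \<phi> (\<psi> y) = y))"

definition isomorphic_flows ::
    "'a measure \<Rightarrow> (real \<Rightarrow> 'a \<Rightarrow> 'a) \<Rightarrow> 'b measure \<Rightarrow> (real \<Rightarrow> 'b \<Rightarrow> 'b) \<Rightarrow> bool" where
  "isomorphic_flows M T N U \<longleftrightarrow>
     (\<exists>\<phi>. invertible_measure_preserving M N \<phi> \<and>
        (\<forall>t. AE x in M. \<phi> (T t x) = U t (\<phi> x)))"

definition reversible :: "'a measure \<Rightarrow> (real \<Rightarrow> 'a \<Rightarrow> 'a) \<Rightarrow> bool" where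
  "reversible M T \<longleftrightarrow>
     (\<exists>S. invertible_measure_preserving M M S \<and>
        (\<forall>t. AE x in M. T t (S x) = S (T (- t) x)) \<and>
        (AE x in M. S (S x) = x))"

definition self_similarity_scale :: "'a measure \<Rightarrow> (real \<Rightarrow> 'a \<Rightarrow> 'a) \<Rightarrow> real \<Rightarrow> bool" where
  "self_similarity_scale M T s \<longleftrightarrow> s \<noteq> 0 \<and> isomorphic_flows M T M (\<lambda>t. T (s * t))"

end

theory Submission
  imports Defs "HOL-Complex_Analysis.Complex_Analysis" "HOL-Real_Asymp.Real_Asymp"
begin

text \<open>
  The flow is a time change of the linear flow \<open>R\<^sub>s (x, y) = (x + \<alpha> s, y + s)\<close> with a Liouville number
  \<open>\<alpha>\<close>: put \<open>u\<^sub>n = q\<^sub>n x - p\<^sub>n y\<close> and \<open>\<epsilon>\<^sub>n = q\<^sub>n \<alpha> - p\<^sub>n\<close>, let \<open>g\<^sub>n = exp (n c)\<close> for a 1-periodic entire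
  profile \<open>c\<close>, and let \<open>T\<^sub>t = R\<^sub>s\<close> where \<open>s = \<sigma>(t, x, y)\<close> solves
  \<open>s + (\<Sum>n. g\<^sub>n (u\<^sub>n + s \<epsilon>\<^sub>n) - g\<^sub>n u\<^sub>n) = t\<close>.

  At times \<open>m\<close> with \<open>m \<epsilon>\<^sub>n \<approx> \<theta>\<close> only the \<open>n\<close>-th summand matters, and it compares \<open>exp (n c)\<close> at \<open>u\<^sub>n\<close> and
  \<open>u\<^sub>n + \<theta>\<close>. Where one of \<open>c u\<close>, \<open>c (u + \<theta>)\<close> is positive, the time-\<open>m\<close> map shears strongly, and
  integration by parts in \<open>x\<close> shows that \<open>T\<^sub>m\<close> decorrelates there. Where both are negative and \<open>m\<close> is a
  multiple of \<open>q\<^sub>n\<close>, it hardly moves \<open>y\<close>. Hence the triple correlations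
  \<open>\<mu> (A \<inter> T\<^sub>m\<^sup>-\<^sup>1 A \<inter> T\<^sub>m\<^sub>'\<^sup>-\<^sup>1 A)\<close> with \<open>m \<epsilon>\<^sub>n \<approx> \<theta>\<close>, \<open>m' \<epsilon>\<^sub>n \<approx> \<theta>'\<close> are asymptotically at most \<open>2 \<mu>(A)\<^sup>2\<close> if at each \<open>u\<close>
  one of \<open>c u\<close>, \<open>c (u + \<theta>)\<close>, \<open>c (u + \<theta>')\<close> is positive, but at least a constant times \<open>\<mu> A\<close> for thin
  horizontal bands \<open>A\<close> if \<open>c\<close> is negative at \<open>0\<close>, \<open>\<theta>\<close> and \<open>\<theta>'\<close>.

  The profile is positive except close to \<open>0\<close>, \<open>1/10\<close> and \<open>3/10\<close>. With \<open>\<theta> = 1/2\<close> the flow mixes along a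
  sequence of times, so it is weakly mixing. As \<open>{0, 1/10, 3/10}\<close> is not symmetric modulo 1, the triple
  correlations at \<open>(1/10, 3/10)\<close> and \<open>(-1/10, -3/10)\<close> differ, which excludes the scale \<open>-1\<close> and
  reversibility. If \<open>\<bar>s\<bar> > 1\<close>, then \<open>\<theta> = 1 / (2 s\<^sup>k)\<close> is close to \<open>0\<close> for large \<open>k\<close> while \<open>s\<^sup>k \<theta> = 1/2\<close>, and
  the scale \<open>s\<close> is excluded in the same way; scales with \<open>\<bar>s\<bar> < 1\<close> are inverted.
\<close>

section \<open>Correlations of flows\<close>

text \<open>Pair correlations cannot tell a flow from its inverse: by invariance a set overlaps
  equally with its preimages under the times t and -t. Three sets are the least that can see the
  direction of time, which is why triple correlations carry the argument. The two asymptotics are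
  compared on sets of small measure, a quadratic bound against a linear one. An isomorphism may send
  a band to any set of the same measure, so the quadratic bound, and with it decorrelation, must
  hold for all Borel sets; rigidity is needed only for one explicit family. The exponential form
  answers two conflicting demands on a single analytic summand: to be negligible at some phases and
  to shear without bound at others. The sign of the profile decides which. The price is exponential
  growth on complex strips; it is paid by the Liouville property, since the speed of the n-th phase
  is made small only after the bound on the n-th summand is known. The same freedom separates the
  scales, so that at the chosen times every other summand is an error term.\<close>

text \<open>Cauchy-Schwarz for the indicator of \<open>A\<close> against a signed sum of the centred
  indicators of the \<open>X i\<close>. The signs turn the pairing into the sum of absolute
  deviations; in the squared norm of the signed sum a diagonal term is at most 1 and an off-diagonal
  term at most \<open>e\<close>.\<close>

lemma (in prob_space) sum_correlations_bound:
  fixes X :: "'i \<Rightarrow> 'a set"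
  assumes fin: "finite I" and A: "A \<in> sets M" and X: "\<And>i. i \<in> I \<Longrightarrow> X i \<in> sets M"
    and b: "\<And>i. i \<in> I \<Longrightarrow> measure M (X i) = b"
    and e: "\<And>i j. i \<in> I \<Longrightarrow> j \<in> I \<Longrightarrow> i \<noteq> j \<Longrightarrow> \<bar>measure M (X i \<inter> X j) - b\<^sup>2\<bar> \<le> e"
    and e0: "e \<ge> 0"
  shows "(\<Sum>i\<in>I. \<bar>measure M (A \<inter> X i) - measure M A * b\<bar>)\<^sup>2 \<le> real (card I) + (real (card I))\<^sup>2 * e"
proof -
  define d where "d i = measure M (A \<inter> X i) - measure M A * b" for i
  define s where "s i = (if d i \<ge> 0 then 1 else - 1 :: real)" for i
  define f where "f i x = indicator (X i) x - b" for i x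
  define F where "F x = (\<Sum>i\<in>I. s i * f i x)" for x
  have [measurable]: "A \<in> sets M" by fact
  have int_ind: "integrable M (indicator Y :: _ \<Rightarrow> real)" if "Y \<in> sets M" for Y
    using that by (simp add: emeasure_eq_measure)
  have intAF: "has_bochner_integral M (\<lambda>x. indicator A x * F x) (\<Sum>i\<in>I. s i * d i)"
  proof -
    have "has_bochner_integral M (\<lambda>x. indicator A x * f i x) (d i)" if "i \<in> I" for i
    proof -
      have "has_bochner_integral M (\<lambda>x. indicator (A \<inter> X i) x - indicator A x * b) (d i)"
        unfolding d_def using A X that
        by (intro has_bochner_integral_diff has_bochner_integral_mult_left has_bochner_integral_real_indicator)
           (auto simp: emeasure_eq_measure)
      moreover have "(\<lambda>x. indicator (A \<inter> X i) x - indicator A x * b) = (\<lambda>x. indicator A x * f i x)"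
        by (auto simp: f_def indicator_def fun_eq_iff)
      ultimately show ?thesis by simp
    qed
    then have "has_bochner_integral M (\<lambda>x. \<Sum>i\<in>I. s i * (indicator A x * f i x)) (\<Sum>i\<in>I. s i * d i)"
      by (intro has_bochner_integral_sum has_bochner_integral_mult_right) auto
    then show ?thesis by (simp add: F_def sum_distrib_left mult_ac)
  qed
  have intFF: "has_bochner_integral M (\<lambda>x. F x * F x)
      (\<Sum>i\<in>I. \<Sum>j\<in>I. s i * s j * (measure M (X i \<inter> X j) - b\<^sup>2))"
  proof -
    have "has_bochner_integral M (\<lambda>x. f i x * f j x) (measure M (X i \<inter> X j) - b\<^sup>2)"
      if "i \<in> I" "j \<in> I" for i j
    proof -
      have "has_bochner_integral M (\<lambda>x. indicator (X i \<inter> X j) x - indicator (X i) x * b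
          - indicator (X j) x * b + b\<^sup>2) (measure M (X i \<inter> X j) - measure M (X i) * b
          - measure M (X j) * b + measure M (space M) *\<^sub>R b\<^sup>2)"
        using X that
        by (intro has_bochner_integral_diff has_bochner_integral_add has_bochner_integral_mult_left
            has_bochner_integral_real_indicator)
           (auto simp: emeasure_eq_measure has_bochner_integral_iff)
      moreover have "(\<lambda>x. indicator (X i \<inter> X j) x - indicator (X i) x * b - indicator (X j) x * b + b\<^sup>2)
          = (\<lambda>x. f i x * f j x)"
        by (auto simp: f_def indicator_def fun_eq_iff power2_eq_square algebra_simps)
      moreover have "measure M (X i \<inter> X j) - measure M (X i) * b
          - measure M (X j) * b + measure M (space M) *\<^sub>R b\<^sup>2 = measure M (X i \<inter> X j) - b\<^sup>2"
        using b that by (simp add: prob_space power2_eq_square)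
      ultimately show ?thesis by metis
    qed
    then have "has_bochner_integral M (\<lambda>x. \<Sum>i\<in>I. \<Sum>j\<in>I. s i * s j * (f i x * f j x))
      (\<Sum>i\<in>I. \<Sum>j\<in>I. s i * s j * (measure M (X i \<inter> X j) - b\<^sup>2))"
      by (intro has_bochner_integral_sum has_bochner_integral_mult_right) auto
    then show ?thesis by (simp add: F_def sum_product mult_ac)
  qed
  define c where "c = (\<Sum>i\<in>I. s i * d i)"
  define q where "q = (\<Sum>i\<in>I. \<Sum>j\<in>I. s i * s j * (measure M (X i \<inter> X j) - b\<^sup>2))"
  \<comment> \<open>The integrand is the square of \<open>F - c\<close> on \<open>A\<close> and the
    square of \<open>F\<close> off \<open>A\<close>. Its nonnegative integral gives
    \<open>c\<^sup>2 \<le> q\<close>, because \<open>measure M A \<le> 1\<close>.\<close>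
  have hb: "has_bochner_integral M (\<lambda>x. F x * F x - 2 * c * (indicator A x * F x) + c\<^sup>2 * indicator A x)
     (q - 2 * c * c + c\<^sup>2 * measure M A)"
    using intAF intFF A unfolding c_def[symmetric] q_def[symmetric]
    by (intro has_bochner_integral_diff has_bochner_integral_add has_bochner_integral_mult_right
        has_bochner_integral_real_indicator) (auto simp: emeasure_eq_measure)
  have "0 \<le> q - 2 * c * c + c\<^sup>2 * measure M A"
    unfolding has_bochner_integral_integral_eq[OF hb, symmetric]
  proof (rule integral_nonneg_AE)
    show "AE x in M. 0 \<le> F x * F x - 2 * c * (indicator A x * F x) + c\<^sup>2 * indicator A x"
    proof (rule AE_I2)
      fix x
      show "0 \<le> F x * F x - 2 * c * (indicator A x * F x) + c\<^sup>2 * indicator A x"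
        using zero_le_power2[of "F x - c"] zero_le_power2[of "F x"]
        by (auto simp: indicator_def power2_eq_square algebra_simps)
    qed
  qed
  moreover have "c\<^sup>2 * measure M A \<le> c\<^sup>2" by (simp add: mult_left_le)
  ultimately have "c\<^sup>2 \<le> q" by (simp add: power2_eq_square)
  have cd: "c = (\<Sum>i\<in>I. \<bar>d i\<bar>)"
    unfolding c_def by (intro sum.cong) (auto simp: s_def)
  have "q \<le> (\<Sum>i\<in>I. \<Sum>j\<in>I. (if i = j then 1 else 0) + e)"
    unfolding q_def
  proof (intro sum_mono)
    fix i j assume ij: "i \<in> I" "j \<in> I"
    have "s i * s j * (measure M (X i \<inter> X j) - b\<^sup>2) \<le> \<bar>s i * s j * (measure M (X i \<inter> X j) - b\<^sup>2)\<bar>" by simp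
    also have "\<dots> = \<bar>measure M (X i \<inter> X j) - b\<^sup>2\<bar>" by (auto simp: abs_mult s_def)
    also have "\<dots> \<le> (if i = j then 1 else 0) + e"
    proof (cases "i = j")
      case True
      have "b \<ge> 0" "b \<le> 1" using b[OF ij(1)] measure_nonneg[of M "X i"] prob_le_1[of "X i"] by auto
      then have "b - b\<^sup>2 \<ge> 0" "b - b\<^sup>2 \<le> 1" by (auto simp: power2_eq_square mult_left_le)
          (smt (verit) mult_nonneg_nonneg)
      then show ?thesis using True b[OF ij(1)] e0 by auto
    next
      case False
      then show ?thesis using e[OF ij] by simp
    qed
    finally show "s i * s j * (measure M (X i \<inter> X j) - b\<^sup>2) \<le> (if i = j then 1 else 0) + e" .
  qed
  also have "\<dots> = real (card I) + (real (card I))\<^sup>2 * e"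
    using fin by (simp add: sum.distrib power2_eq_square algebra_simps)
  finally show ?thesis
    using \<open>c\<^sup>2 \<le> q\<close> cd unfolding d_def by simp
qed

section \<open>Weak mixing from one mixing sequence of times\<close>

lemma measure_preserving_flow_sets:
  assumes "measure_preserving_flow M T" "B \<in> sets M"
  shows "T t -` B \<inter> space M \<in> sets M"
  using assms by (auto simp: measure_preserving_flow_def measure_preserving_def)

lemma measure_preserving_flow_measure:
  assumes "measure_preserving_flow M T" "B \<in> sets M"
  shows "measure M (T t -` B \<inter> space M) = measure M B"
  using assms measure_distr[of "T t" M M B]
  by (auto simp: measure_preserving_flow_def measure_preserving_def)

lemma measure_preserving_flow_space:
  assumes "measure_preserving_flow M T" "x \<in> space M"
  shows "T t x \<in> space M"
  using assms by (auto simp: measure_preserving_flow_def measure_preserving_def dest: measurable_space)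

lemma measure_preserving_flow_vimage:
  assumes "measure_preserving_flow M T"
  shows "T s -` (T t -` B \<inter> space M) \<inter> space M = T (s + t) -` B \<inter> space M"
  using assms measure_preserving_flow_space[OF assms]
  by (auto simp: measure_preserving_flow_def add.commute[of s t])

text \<open>Along a mixing sequence one can pick times whose pairwise differences decorrelate \<open>B\<close>; the
  translates of \<open>B\<close> by these times are almost orthogonal, so no set can correlate with many of them.\<close>

lemma weakly_mixing_if_mixing_sequence:
  assumes M: "prob_space M" and T: "measure_preserving_flow M T"
    and mix: "\<And>A B. A \<in> sets M \<Longrightarrow> B \<in> sets M \<Longrightarrow>
       (\<lambda>n. measure M (A \<inter> (T (t n) -` B \<inter> space M))) \<longlonglongrightarrow> measure M A * measure M B"
  shows "weakly_mixing M T"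
  unfolding weakly_mixing_def
proof (intro ballI)
  fix A B assume A: "A \<in> sets M" and B: "B \<in> sets M"
  interpret prob_space M by fact
  define c where "c s = \<bar>measure M (A \<inter> (T s -` B \<inter> space M)) - measure M A * measure M B\<bar>" for s
  have c01: "0 \<le> c s" "c s \<le> 1" for s
  proof -
    have "measure M A * measure M B \<le> 1" "0 \<le> measure M A * measure M B"
      by (auto simp: mult_le_one)
    moreover have "0 \<le> measure M (A \<inter> (T s -` B \<inter> space M))" "measure M (A \<inter> (T s -` B \<inter> space M)) \<le> 1"
      by auto
    ultimately show "0 \<le> c s" "c s \<le> 1"
      unfolding c_def by linarith+
  qed
  have meas: "c \<in> borel_measurable borel"
  proof -
    have jm: "(\<lambda>(t, x). T t x) \<in> measurable (borel \<Otimes>\<^sub>M M) M"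
      using T by (simp add: measure_preserving_flow_def)
    have "{p \<in> space (borel \<Otimes>\<^sub>M M). snd p \<in> A \<and> (case p of (t, x) \<Rightarrow> T t x) \<in> B} \<in> sets (borel \<Otimes>\<^sub>M M)"
      using jm A B by measurable
    then have "(\<lambda>s. emeasure M (Pair s -` {p \<in> space (borel \<Otimes>\<^sub>M M). snd p \<in> A \<and> (case p of (t, x) \<Rightarrow> T t x) \<in> B}))
       \<in> borel_measurable borel"
      by (rule measurable_emeasure_Pair)
    moreover have "Pair s -` {p \<in> space (borel \<Otimes>\<^sub>M M). snd p \<in> A \<and> (case p of (t, x) \<Rightarrow> T t x) \<in> B}
       = A \<inter> (T s -` B \<inter> space M)" for s
      using sets.sets_into_space[OF A] by (auto simp: space_pair_measure)
    ultimately have "(\<lambda>s. emeasure M (A \<inter> (T s -` B \<inter> space M))) \<in> borel_measurable borel" by simp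
    then have "(\<lambda>s. measure M (A \<inter> (T s -` B \<inter> space M))) \<in> borel_measurable borel"
      unfolding measure_def by measurable
    then show ?thesis unfolding c_def by measurable
  qed
  have cint: "c integrable_on {a..b}" for a b
  proof -
    have "integrable lborel (\<lambda>x. indicator {a..b} x *\<^sub>R c x)"
      by (rule integrableI_bounded_set_indicator[where B = 1])
         (use meas c01 in \<open>auto simp: emeasure_lborel_Icc_eq intro!: AE_I2\<close>)
    then have "set_integrable lborel {a..b} c" by (simp add: set_integrable_def)
    then show ?thesis by (rule set_borel_integral_eq_integral(1))
  qed
  have int_le: "integral {a..b} c \<le> b - a" if "a \<le> b" for a b
    using integral_le[OF cint integrable_const_ivl[of 1 a b]] c01 that by simp
  have int_ge: "integral {a..b} c \<ge> 0" for a b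
    by (rule integral_nonneg[OF cint]) (use c01 in auto)
  have lim: "((\<lambda>R. (1 / R) * integral {0..R} c) \<longlongrightarrow> 0) at_top"
  proof (rule tendstoI)
    fix d :: real assume d: "d > 0"
    \<comment> \<open>\<open>N \<ge> 8 / d\<^sup>2\<close> and \<open>e = d\<^sup>2 / 8\<close> make
      each of \<open>N\<close> and \<open>N\<^sup>2 * e\<close> at most
      \<open>N\<^sup>2 * d\<^sup>2 / 8\<close>, so that their sum is at most the square of
      \<open>N * d / 2\<close>.\<close>
    define N where "N = nat \<lceil>8 / d\<^sup>2\<rceil> + 1"
    define e where "e = d\<^sup>2 / 8"
    have e: "e > 0" using d by (simp add: e_def)
    have N: "N > 0" "real N \<ge> 8 / d\<^sup>2"
      unfolding N_def by (simp_all add: le_nat_iff) linarith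
    have ex: "\<exists>\<tau> :: nat \<Rightarrow> real. (\<forall>i<k. \<forall>j<k. i \<noteq> j \<longrightarrow>
        \<bar>measure M ((T (\<tau> i) -` B \<inter> space M) \<inter> (T (\<tau> j) -` B \<inter> space M)) - (measure M B)\<^sup>2\<bar> \<le> e)" for k
    proof (induction k)
      case 0
      then show ?case by auto
    next
      case (Suc k)
      then obtain \<tau> where \<tau>: "\<And>i j. i < k \<Longrightarrow> j < k \<Longrightarrow> i \<noteq> j \<Longrightarrow>
        \<bar>measure M ((T (\<tau> i) -` B \<inter> space M) \<inter> (T (\<tau> j) -` B \<inter> space M)) - (measure M B)\<^sup>2\<bar> \<le> e" by blast
      have "eventually (\<lambda>n. \<forall>i\<in>{..<k}. dist (measure M ((T (\<tau> i) -` B \<inter> space M) \<inter> (T (t n) -` B \<inter> space M)))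
          (measure M (T (\<tau> i) -` B \<inter> space M) * measure M B) < e) sequentially"
        by (intro eventually_ball_finite ballI tendstoD mix)
           (use B e measure_preserving_flow_sets[OF T B] in auto)
      then obtain n where n: "\<And>i. i < k \<Longrightarrow> dist (measure M ((T (\<tau> i) -` B \<inter> space M) \<inter> (T (t n) -` B \<inter> space M)))
          (measure M (T (\<tau> i) -` B \<inter> space M) * measure M B) < e"
        by (auto simp: eventually_sequentially)
      have n': "\<bar>measure M ((T (\<tau> i) -` B \<inter> space M) \<inter> (T (t n) -` B \<inter> space M)) - (measure M B)\<^sup>2\<bar> \<le> e"
        if "i < k" for i
        using n[OF that] by (simp add: measure_preserving_flow_measure[OF T B] dist_real_def power2_eq_square)
      show ?case
        by (rule exI[of _ "\<tau>(k := t n)"])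
           (auto simp: less_Suc_eq n' \<tau> Int_commute[of "T (t n) -` B \<inter> space M"])
    qed
    obtain \<tau> where \<tau>: "\<And>i j. i < N \<Longrightarrow> j < N \<Longrightarrow> i \<noteq> j \<Longrightarrow>
        \<bar>measure M ((T (\<tau> i) -` B \<inter> space M) \<inter> (T (\<tau> j) -` B \<inter> space M)) - (measure M B)\<^sup>2\<bar> \<le> e"
      using ex[of N] by auto
    \<comment> \<open>Uniform in \<open>s\<close>: by invariance, adding \<open>s\<close> to all
      chosen times leaves their pairwise correlations unchanged.\<close>
    have key: "(\<Sum>i<N. c (s + \<tau> i)) \<le> real N * (d / 2)" for s
    proof -
      have "(\<Sum>i\<in>{..<N}. c (s + \<tau> i))\<^sup>2 \<le> real (card {..<N}) + (real (card {..<N}))\<^sup>2 * e"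
        unfolding c_def
      proof (rule sum_correlations_bound)
        fix i j assume ij: "i \<in> {..<N}" "j \<in> {..<N}" "i \<noteq> j"
        have "T s -` ((T (\<tau> i) -` B \<inter> space M) \<inter> (T (\<tau> j) -` B \<inter> space M)) \<inter> space M
          = (T s -` (T (\<tau> i) -` B \<inter> space M) \<inter> space M) \<inter> (T s -` (T (\<tau> j) -` B \<inter> space M) \<inter> space M)"
          by auto
        also have "\<dots> = (T (s + \<tau> i) -` B \<inter> space M) \<inter> (T (s + \<tau> j) -` B \<inter> space M)"
          by (simp only: measure_preserving_flow_vimage[OF T])
        finally have "measure M ((T (s + \<tau> i) -` B \<inter> space M) \<inter> (T (s + \<tau> j) -` B \<inter> space M))
          = measure M ((T (\<tau> i) -` B \<inter> space M) \<inter> (T (\<tau> j) -` B \<inter> space M))"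
          using measure_preserving_flow_measure[OF T, of "(T (\<tau> i) -` B \<inter> space M) \<inter> (T (\<tau> j) -` B \<inter> space M)" s]
            measure_preserving_flow_sets[OF T B] by auto
        then show "\<bar>measure M ((T (s + \<tau> i) -` B \<inter> space M) \<inter> (T (s + \<tau> j) -` B \<inter> space M)) - (measure M B)\<^sup>2\<bar> \<le> e"
          using \<tau> ij by simp
      qed (use A e measure_preserving_flow_sets[OF T B] measure_preserving_flow_measure[OF T B] in simp_all)
      also have "\<dots> = real N + (real N)\<^sup>2 * e" by simp
      also have "\<dots> \<le> (real N)\<^sup>2 * (d\<^sup>2 / 8) + (real N)\<^sup>2 * (d\<^sup>2 / 8)"
      proof -
        have "1 \<le> real N * (d\<^sup>2 / 8)" using N d by (simp add: field_simps)
        then have "real N * 1 \<le> real N * (real N * (d\<^sup>2 / 8))" by (intro mult_left_mono) auto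
        then show ?thesis by (simp add: e_def power2_eq_square mult_ac)
      qed
      also have "\<dots> = (real N * (d / 2))\<^sup>2" by (simp add: power2_eq_square)
      finally show ?thesis by (rule power2_le_imp_le) (use d in simp)
    qed
    define K where "K = Max ((\<lambda>i. \<bar>\<tau> i\<bar>) ` {..<N})"
    have K: "\<bar>\<tau> i\<bar> \<le> K" if "i < N" for i unfolding K_def using that by (intro Max_ge) auto
    have K0: "K \<ge> 0" using K[OF N(1)] by linarith
    \<comment> \<open>A translation of the time variable costs at most its length because
      \<open>0 \<le> c \<le> 1\<close>. Averaging over the \<open>N\<close> translates replaces
      \<open>c\<close> by the small average in \<open>key\<close>, up to the constant
      \<open>K\<close>, which disappears after division by \<open>R\<close>.\<close>
    have shift: "integral {0..R} c \<le> integral {0..R} (\<lambda>s. c (s + h)) + \<bar>h\<bar>" if "R \<ge> 0" for R h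
    proof -
      have eq: "integral {0..R} (\<lambda>s. c (s + h)) = integral {h..R + h} c"
        using integral_shift_Icc_real[of 0 R c h] by (simp add: add.commute o_def)
      have *: "integral {0..R} c \<le> integral {h..R+h} c + \<bar>h\<bar>"
      proof (cases "h \<ge> 0")
        case True
        have "integral {0..R} c \<le> integral {0..R+h} c"
          by (rule integral_subset_le) (use True cint c01 in auto)
        also have "\<dots> = integral {0..h} c + integral {h..R+h} c"
          using Henstock_Kurzweil_Integration.integral_combine[of 0 h "R+h" c] cint that True by simp
        finally show ?thesis using int_le[of 0 h] True by simp
      next
        case False
        have "integral {0..R} c \<le> integral {h..R} c"
          by (rule integral_subset_le) (use False cint c01 in auto)
        also have "\<dots> \<le> integral {h..R+h} c + integral {R+h..R} c"
          using Henstock_Kurzweil_Integration.integral_combine[of h "R+h" R c] cint that False by simp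
        finally show ?thesis using int_le[of "R+h" R] False by simp
      qed
      then show ?thesis using eq by simp
    qed
    have cint': "(\<lambda>s. c (s + h)) integrable_on {0..R}" for h R
      using cint[of "0 + h" "R + h"] integrable_on_shift_Icc_real[of c h 0 R] by (simp add: add.commute o_def)
    have bound: "integral {0..R} c \<le> R * (d / 2) + K" if R: "R \<ge> 0" for R
    proof -
      have "real N * integral {0..R} c = (\<Sum>i<N. integral {0..R} c)" by simp
      also have "\<dots> \<le> (\<Sum>i<N. integral {0..R} (\<lambda>s. c (s + \<tau> i)) + K)"
      proof (rule sum_mono)
        fix i assume "i \<in> {..<N}"
        then show "integral {0..R} c \<le> integral {0..R} (\<lambda>s. c (s + \<tau> i)) + K"
          using shift[OF R, of "\<tau> i"] K[of i] by simp
      qed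
      also have "\<dots> = integral {0..R} (\<lambda>s. \<Sum>i<N. c (s + \<tau> i)) + real N * K"
        by (simp add: sum.distrib integral_sum cint')
      also have "integral {0..R} (\<lambda>s. \<Sum>i<N. c (s + \<tau> i)) \<le> integral {0..R} (\<lambda>s. real N * (d / 2))"
        by (rule integral_le) (use key cint' in \<open>auto intro!: integrable_sum\<close>)
      also have "\<dots> = R * (real N * (d / 2))" using R by simp
      finally have "real N * integral {0..R} c \<le> real N * (R * (d / 2) + K)"
        by (simp add: algebra_simps)
      then show ?thesis using N by (simp add: mult_le_cancel_left)
    qed
    have "eventually (\<lambda>R. R > 4 * K / d + 1) at_top" by (rule eventually_gt_at_top)
    then show "eventually (\<lambda>R. dist ((1 / R) * integral {0..R} c) 0 < d) at_top"
    proof eventually_elim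
      case (elim R)
      have R: "R > 0" using elim K0 d by (smt (verit) divide_nonneg_pos)
      have "4 * K / d < R" using elim by linarith
      then have "K < R * d / 4" using d by (simp add: field_simps)
      then have "integral {0..R} c < R * d" using bound[of R] R d by (simp add: field_simps) (smt (verit) mult_pos_pos)
      then show ?case using int_ge[of 0 R] R by (simp add: dist_real_def field_simps)
    qed
  qed
  then show "((\<lambda>R. 1 / R * integral {0..R} (\<lambda>t. \<bar>measure M (A \<inter> (T t -` B \<inter> space M)) - measure M A * measure M B\<bar>))
     \<longlongrightarrow> 0) at_top"
    unfolding c_def .
qed

section \<open>Triple correlations as an isomorphism invariant\<close>

text \<open>The only trace of an isomorphism between \<open>T\<close> and \<open>T\<close> run at
  speed \<open>r\<close> that the rest of the proof uses. The set \<open>A'\<close> may depend on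
  \<open>A\<close> but has to serve all pairs of times.\<close>

definition similar_triple_correlations :: "'a measure \<Rightarrow> (real \<Rightarrow> 'a \<Rightarrow> 'a) \<Rightarrow> real \<Rightarrow> bool" where
  "similar_triple_correlations M T r \<longleftrightarrow>
     (\<forall>A\<in>sets M. \<exists>A'\<in>sets M. measure M A' = measure M A \<and>
       (\<forall>t u. measure M (A \<inter> (T t -` A \<inter> space M) \<inter> (T u -` A \<inter> space M)) =
              measure M (A' \<inter> (T (r * t) -` A' \<inter> space M) \<inter> (T (r * u) -` A' \<inter> space M))))"

lemma similar_triple_correlations_mult:
  assumes "similar_triple_correlations M T r" "similar_triple_correlations M T s"
  shows "similar_triple_correlations M T (r * s)"
  unfolding similar_triple_correlations_def
proof
  fix A assume "A \<in> sets M"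
  with assms(2) obtain A' where A': "A' \<in> sets M" "measure M A' = measure M A"
    "\<And>t u. measure M (A \<inter> (T t -` A \<inter> space M) \<inter> (T u -` A \<inter> space M)) =
              measure M (A' \<inter> (T (s * t) -` A' \<inter> space M) \<inter> (T (s * u) -` A' \<inter> space M))"
    unfolding similar_triple_correlations_def by meson
  with assms(1) obtain A'' where "A'' \<in> sets M" "measure M A'' = measure M A'"
    "\<And>t u. measure M (A' \<inter> (T t -` A' \<inter> space M) \<inter> (T u -` A' \<inter> space M)) =
              measure M (A'' \<inter> (T (r * t) -` A'' \<inter> space M) \<inter> (T (r * u) -` A'' \<inter> space M))"
    unfolding similar_triple_correlations_def by meson
  with A' show "\<exists>A'\<in>sets M. measure M A' = measure M A \<and>
       (\<forall>t u. measure M (A \<inter> (T t -` A \<inter> space M) \<inter> (T u -` A \<inter> space M)) =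
         measure M (A' \<inter> (T (r * s * t) -` A' \<inter> space M) \<inter> (T (r * s * u) -` A' \<inter> space M)))"
    by (intro bexI[of _ A'']) (simp_all add: mult.assoc)
qed

text \<open>An exclusion that works for large speeds reaches every \<open>r\<close> with
  \<open>\<bar>r\<bar> > 1\<close> through its powers.\<close>

lemma similar_triple_correlations_power:
  assumes "similar_triple_correlations M T r"
  shows "similar_triple_correlations M T (r ^ Suc k)"
  by (induction k) (use assms similar_triple_correlations_mult in auto)

lemma measure_preserving_vimage:
  assumes "measure_preserving M N \<phi>" "A \<in> sets N"
  shows "\<phi> -` A \<inter> space M \<in> sets M" "measure M (\<phi> -` A \<inter> space M) = measure N A"
  using assms measure_distr[of \<phi> M N A] by (auto simp: measure_preserving_def)

lemma measure_preserving_AE: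
  assumes "measure_preserving M N \<phi>" "AE y in N. P y"
  shows "AE x in M. P (\<phi> x)"
proof -
  obtain Z where Z: "{y \<in> space N. \<not> P y} \<subseteq> Z" "Z \<in> null_sets N"
    using assms(2) by (auto simp: eventually_ae_filter)
  have m: "\<phi> \<in> measurable M N" and d: "distr M N \<phi> = N"
    using assms(1) by (auto simp: measure_preserving_def)
  have "\<phi> -` Z \<inter> space M \<in> null_sets M"
    using Z(2) null_sets_distr_iff[OF m, of Z] by (simp add: d null_sets_def)
  moreover have "{x \<in> space M. \<not> P (\<phi> x)} \<subseteq> \<phi> -` Z \<inter> space M"
    using Z(1) measurable_space[OF m] by auto
  ultimately show ?thesis unfolding eventually_ae_filter by blast
qed

text \<open>Pulling a set back through the isomorphism turns the times \<open>s * t\<close> into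
  \<open>t\<close>, which is the claim for \<open>1 / s\<close>. For \<open>s\<close> itself the set
  is first pulled back through the inverse; pulling back once more returns the original set only up
  to a null set, so the two sets are compared almost everywhere at all three times.\<close>

lemma self_similarity_scale_imp_similar:
  assumes T: "measure_preserving_flow M T" and s: "self_similarity_scale M T s"
  shows "similar_triple_correlations M T s" and "similar_triple_correlations M T (1 / s)"
proof -
  from s obtain \<phi> \<psi> where s0: "s \<noteq> 0" and \<phi>: "measure_preserving M M \<phi>" and \<psi>: "measure_preserving M M \<psi>"
    and \<psi>\<phi>: "AE x in M. \<psi> (\<phi> x) = x" and \<phi>\<psi>: "AE x in M. \<phi> (\<psi> x) = x"
    and eq: "\<And>t. AE x in M. \<phi> (T t x) = T (s * t) (\<phi> x)"
    unfolding self_similarity_scale_def isomorphic_flows_def invertible_measure_preserving_def by blast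
  have Tm: "measure_preserving M M (T t)" for t using T by (simp add: measure_preserving_flow_def)
  note Ts = measure_preserving_flow_sets[OF T] and sp = measure_preserving_flow_space[OF T]
  have \<phi>sp: "\<phi> x \<in> space M" if "x \<in> space M" for x
    using \<phi> that by (auto simp: measure_preserving_def dest: measurable_space)
  have pull: "measure M ((\<phi> -` A \<inter> space M) \<inter> (T t -` (\<phi> -` A \<inter> space M) \<inter> space M) \<inter> (T u -` (\<phi> -` A \<inter> space M) \<inter> space M))
      = measure M (A \<inter> (T (s * t) -` A \<inter> space M) \<inter> (T (s * u) -` A \<inter> space M))"
    if A: "A \<in> sets M" for A t u
  proof -
    let ?B = "\<phi> -` A \<inter> space M"
    have B: "?B \<in> sets M" using measure_preserving_vimage[OF \<phi> A] by simp
    have "measure M (?B \<inter> (T t -` ?B \<inter> space M) \<inter> (T u -` ?B \<inter> space M)) =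
       measure M (\<phi> -` (A \<inter> (T (s * t) -` A \<inter> space M) \<inter> (T (s * u) -` A \<inter> space M)) \<inter> space M)"
    proof (rule measure_eq_AE)
      show "AE x in M. x \<in> ?B \<inter> (T t -` ?B \<inter> space M) \<inter> (T u -` ?B \<inter> space M) \<longleftrightarrow>
         x \<in> \<phi> -` (A \<inter> (T (s * t) -` A \<inter> space M) \<inter> (T (s * u) -` A \<inter> space M)) \<inter> space M"
        using eq[of t] eq[of u] AE_space by eventually_elim (use sp \<phi>sp in auto)
      show "?B \<inter> (T t -` ?B \<inter> space M) \<inter> (T u -` ?B \<inter> space M) \<in> sets M"
        using B Ts[OF B] by auto
      show "\<phi> -` (A \<inter> (T (s * t) -` A \<inter> space M) \<inter> (T (s * u) -` A \<inter> space M)) \<inter> space M \<in> sets M"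
        by (rule measure_preserving_vimage[OF \<phi>]) (use A Ts[OF A] in auto)
    qed
    also have "\<dots> = measure M (A \<inter> (T (s * t) -` A \<inter> space M) \<inter> (T (s * u) -` A \<inter> space M))"
      by (rule measure_preserving_vimage[OF \<phi>]) (use A Ts[OF A] in auto)
    finally show ?thesis .
  qed
  show "similar_triple_correlations M T (1 / s)"
    unfolding similar_triple_correlations_def
  proof
    fix A assume A: "A \<in> sets M"
    show "\<exists>A'\<in>sets M. measure M A' = measure M A \<and>
       (\<forall>t u. measure M (A \<inter> (T t -` A \<inter> space M) \<inter> (T u -` A \<inter> space M)) =
         measure M (A' \<inter> (T (1 / s * t) -` A' \<inter> space M) \<inter> (T (1 / s * u) -` A' \<inter> space M)))"
      by (intro bexI[of _ "\<phi> -` A \<inter> space M"] conjI allI)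
         (use measure_preserving_vimage[OF \<phi> A] pull[OF A] s0 in simp_all)
  qed
  show "similar_triple_correlations M T s"
    unfolding similar_triple_correlations_def
  proof
    fix A assume A: "A \<in> sets M"
    let ?A = "\<psi> -` A \<inter> space M" and ?B = "\<phi> -` (\<psi> -` A \<inter> space M) \<inter> space M"
    have A': "?A \<in> sets M" "measure M ?A = measure M A" using measure_preserving_vimage[OF \<psi> A] by auto
    have B: "?B \<in> sets M" using measure_preserving_vimage[OF \<phi> A'(1)] by auto
    have AB: "AE x in M. x \<in> A \<longleftrightarrow> x \<in> ?B"
      using \<psi>\<phi> AE_space by eventually_elim (use \<phi>sp in auto)
    have ABt: "AE x in M. T t x \<in> A \<longleftrightarrow> T t x \<in> ?B" for t
      by (rule measure_preserving_AE[OF Tm AB])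
    have "measure M (A \<inter> (T t -` A \<inter> space M) \<inter> (T u -` A \<inter> space M)) =
         measure M (?B \<inter> (T t -` ?B \<inter> space M) \<inter> (T u -` ?B \<inter> space M))" for t u
    proof (rule measure_eq_AE)
      show "AE x in M. x \<in> A \<inter> (T t -` A \<inter> space M) \<inter> (T u -` A \<inter> space M) \<longleftrightarrow>
         x \<in> ?B \<inter> (T t -` ?B \<inter> space M) \<inter> (T u -` ?B \<inter> space M)"
        using AB ABt[of t] ABt[of u] AE_space by eventually_elim blast
      show "A \<inter> (T t -` A \<inter> space M) \<inter> (T u -` A \<inter> space M) \<in> sets M" using A Ts[OF A] by auto
      show "?B \<inter> (T t -` ?B \<inter> space M) \<inter> (T u -` ?B \<inter> space M) \<in> sets M" using B Ts[OF B] by auto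
    qed
    then show "\<exists>A'\<in>sets M. measure M A' = measure M A \<and>
       (\<forall>t u. measure M (A \<inter> (T t -` A \<inter> space M) \<inter> (T u -` A \<inter> space M)) =
         measure M (A' \<inter> (T (s * t) -` A' \<inter> space M) \<inter> (T (s * u) -` A' \<inter> space M)))"
      by (intro bexI[of _ ?A] conjI allI) (use A' pull[OF A'(1)] in simp_all)
  qed
qed

lemma reversible_imp_self_similarity_scale:
  assumes "reversible M T"
  shows "self_similarity_scale M T (- 1)"
proof -
  from assms obtain S where S: "invertible_measure_preserving M M S" "\<And>t. AE x in M. T t (S x) = S (T (- t) x)"
    unfolding reversible_def by blast
  have "AE x in M. S (T t x) = T (- 1 * t) (S x)" for t
    using S(2)[of "- t"] by eventually_elim simp
  with S(1) show ?thesis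
    unfolding self_similarity_scale_def isomorphic_flows_def by auto
qed

section \<open>Holomorphic families and real analyticity\<close>

lemma circle_diff_nonzero:
  assumes "norm a < r"
  shows "of_real r * cis t - a \<noteq> 0"
proof
  assume "of_real r * cis t - a = 0"
  then have "a = of_real r * cis t" by simp
  then have "norm a = \<bar>r\<bar>" by (simp add: norm_mult)
  then show False using assms by simp
qed

text \<open>Cauchy's formula with the circle parametrised over the unit interval. A derivative
  written as an integral over a fixed circle inherits continuity and holomorphy in further
  variables.\<close>

lemma deriv_eq_integral_circle:
  assumes f: "f holomorphic_on ball 0 R" and r: "norm a < r" "r < R"
  shows "deriv f a = integral (cbox 0 1) (\<lambda>t. f (of_real r * cis (2 * pi * t)) *
           (of_real r * cis (2 * pi * t) / (of_real r * cis (2 * pi * t) - a)\<^sup>2))"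
proof -
  have r0: "r > 0" using r norm_ge_zero[of a] by linarith
  have hc: "f holomorphic_on cball 0 r" by (rule holomorphic_on_subset[OF f]) (use r in auto)
  have "((\<lambda>u. f u / (u - a) ^ Suc 1) has_contour_integral (2 * pi * \<i>) / fact 1 * (deriv ^^ 1) f a) (circlepath 0 r)"
    by (rule Cauchy_has_contour_integral_higher_derivative_circlepath)
       (use hc r0 r in \<open>auto intro: holomorphic_on_imp_continuous_on holomorphic_on_subset[of _ "cball 0 r"]\<close>)
  then have "((\<lambda>t. f (circlepath 0 r t) / (circlepath 0 r t - a)\<^sup>2 *
       vector_derivative (circlepath 0 r) (at t within {0..1})) has_integral (2 * pi * \<i>) * deriv f a) {0..1}"
    by (simp add: has_contour_integral_def power2_eq_square)
  then have "((\<lambda>t. f (of_real r * cis (2 * pi * t)) / (of_real r * cis (2 * pi * t) - a)\<^sup>2 *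
       (2 * pi * \<i> * of_real r * cis (2 * pi * t))) has_integral (2 * pi * \<i>) * deriv f a) {0..1}"
  proof (rule has_integral_eq[rotated])
    fix t :: real assume t: "t \<in> {0..1}"
    then have vd: "vector_derivative (circlepath 0 r) (at t within {0..1}) = 2 * pi * \<i> * r * exp (2 * of_real pi * \<i> * t)"
      by (intro vector_derivative_circlepath01) auto
    show "f (circlepath 0 r t) / (circlepath 0 r t - a)\<^sup>2 * vector_derivative (circlepath 0 r) (at t within {0..1})
      = f (of_real r * cis (2 * pi * t)) / (of_real r * cis (2 * pi * t) - a)\<^sup>2 * (2 * pi * \<i> * of_real r * cis (2 * pi * t))"
      unfolding vd by (simp add: circlepath cis_conv_exp mult_ac)
  qed
  then have "((\<lambda>t. (1 / (2 * pi * \<i>)) * (f (of_real r * cis (2 * pi * t)) / (of_real r * cis (2 * pi * t) - a)\<^sup>2 *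
       (2 * pi * \<i> * of_real r * cis (2 * pi * t)))) has_integral (1 / (2 * pi * \<i>)) * ((2 * pi * \<i>) * deriv f a)) {0..1}"
    by (rule has_integral_mult_right)
  then show ?thesis
    by (simp add: integral_unique[symmetric] field_simps)
qed

lemma continuous_on_deriv_param:
  fixes F :: "complex \<Rightarrow> 'p::metric_space \<Rightarrow> complex"
  assumes cont: "continuous_on (ball 0 R \<times> X) (\<lambda>(a, x). F a x)"
    and hol: "\<And>x. x \<in> X \<Longrightarrow> (\<lambda>a. F a x) holomorphic_on ball 0 R"
  shows "continuous_on (ball 0 R \<times> X) (\<lambda>(a, x). deriv (\<lambda>a. F a x) a)"
proof -
  have loc: "continuous_on (ball 0 r \<times> X) (\<lambda>(a, x). deriv (\<lambda>a. F a x) a)" if r: "0 < r" "r < R" for r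
  proof -
    have "continuous_on (ball 0 r \<times> X) (\<lambda>p. integral (cbox 0 1) (\<lambda>t. F (of_real r * cis (2 * pi * t)) (snd p) *
           (of_real r * cis (2 * pi * t) / (of_real r * cis (2 * pi * t) - fst p)\<^sup>2)))"
    proof (rule integral_continuous_on_param)
      have "continuous_on ((ball 0 r \<times> X) \<times> cbox 0 1)
         (\<lambda>q. (\<lambda>(a, x). F a x) (of_real r * cis (2 * pi * snd q), snd (fst q)) *
           (of_real r * cis (2 * pi * snd q) / (of_real r * cis (2 * pi * snd q) - fst (fst q))\<^sup>2))"
      proof (intro continuous_intros continuous_on_compose2[OF cont])
        show "(\<lambda>q. (of_real r * cis (2 * pi * snd q), snd (fst q))) ` ((ball 0 r \<times> X) \<times> cbox 0 1) \<subseteq> ball 0 R \<times> X"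
          using r by (auto simp: norm_mult)
        show "\<forall>q\<in>(ball 0 r \<times> X) \<times> cbox 0 1. (of_real r * cis (2 * pi * snd q) - fst (fst q))\<^sup>2 \<noteq> 0"
          using circle_diff_nonzero by auto
      qed
      then show "continuous_on ((ball 0 r \<times> X) \<times> cbox 0 1)
         (\<lambda>(p, t). F (of_real r * cis (2 * pi * t)) (snd p) *
           (of_real r * cis (2 * pi * t) / (of_real r * cis (2 * pi * t) - fst p)\<^sup>2))"
        by (simp add: case_prod_unfold)
    qed
    then show ?thesis
    proof (rule continuous_on_eq)
      fix p :: "complex \<times> 'p" assume "p \<in> ball 0 r \<times> X"
      then show "integral (cbox 0 1) (\<lambda>t. F (of_real r * cis (2 * pi * t)) (snd p) *
           (of_real r * cis (2 * pi * t) / (of_real r * cis (2 * pi * t) - fst p)\<^sup>2)) = (case p of (a, x) \<Rightarrow> deriv (\<lambda>a. F a x) a)"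
        using deriv_eq_integral_circle[OF hol[of "snd p"], of "fst p" r] r by (auto simp: case_prod_unfold)
    qed
  qed
  show ?thesis
    unfolding continuous_on_eq_continuous_within
  proof
    fix p :: "complex \<times> 'p" assume p: "p \<in> ball 0 R \<times> X"
    define r where "r = (norm (fst p) + R) / 2"
    have r: "norm (fst p) < r" "r < R" "0 < r"
      using p norm_ge_zero[of "fst p"] unfolding r_def by (auto simp del: norm_ge_zero)
    have "continuous (at p within ball 0 r \<times> X) (\<lambda>(a, x). deriv (\<lambda>a. F a x) a)"
      using loc[OF r(3,2)] p r by (auto simp: continuous_on_eq_continuous_within)
    moreover have "at p within ball 0 R \<times> X = at p within ball 0 r \<times> X"
      by (rule at_within_nhd[of _ "ball 0 r \<times> UNIV"]) (use p r in \<open>auto intro!: open_Times\<close>)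
    ultimately show "continuous (at p within ball 0 R \<times> X) (\<lambda>(a, x). deriv (\<lambda>a. F a x) a)" by simp
  qed
qed

lemma holomorphic_deriv_param:
  fixes F :: "complex \<Rightarrow> complex \<Rightarrow> complex"
  assumes cont: "continuous_on (ball 0 R \<times> ball 0 R) (\<lambda>(a, b). F a b)"
    and hol1: "\<And>b. b \<in> ball 0 R \<Longrightarrow> (\<lambda>a. F a b) holomorphic_on ball 0 R"
    and hol2: "\<And>a. a \<in> ball 0 R \<Longrightarrow> F a holomorphic_on ball 0 R"
    and a: "a \<in> ball 0 R"
  shows "(\<lambda>b. deriv (\<lambda>a. F a b) a) holomorphic_on ball 0 R"
proof -
  define r where "r = (norm a + R) / 2"
  have r: "norm a < r" "r < R" "0 < r"
    using a norm_ge_zero[of a] unfolding r_def by (auto simp del: norm_ge_zero)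
  \<comment> \<open>Differentiation under the integral needs the derivative in \<open>b\<close>
    jointly continuous; this is the preceding continuity result with the two variables
    exchanged.\<close>
  have sw: "continuous_on (ball 0 R \<times> ball 0 R) (\<lambda>(b, a). F a b)"
  proof -
    have "continuous_on (ball 0 R \<times> ball 0 R) (\<lambda>p. (\<lambda>(a, b). F a b) (snd p, fst p))"
      by (intro continuous_on_compose2[OF cont] continuous_intros) auto
    then show ?thesis by (simp add: case_prod_unfold)
  qed
  have cd: "continuous_on (ball 0 R \<times> ball 0 R) (\<lambda>(b, a). deriv (F a) b)"
    using continuous_on_deriv_param[OF sw] hol2 by simp
  have ne: "of_real r * cis (2 * pi * t) - a \<noteq> 0" for t
    using circle_diff_nonzero r by simp
  have inb: "of_real r * cis (2 * pi * t) \<in> ball 0 R" for t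
    using r by (auto simp: norm_mult)
  have "(\<lambda>b. integral (cbox 0 1) (\<lambda>t. F (of_real r * cis (2 * pi * t)) b *
           (of_real r * cis (2 * pi * t) / (of_real r * cis (2 * pi * t) - a)\<^sup>2))) holomorphic_on ball 0 R"
  proof (rule leibniz_rule_holomorphic)
    fix b :: complex and t :: real assume b: "b \<in> ball 0 R"
    have "(F (of_real r * cis (2 * pi * t)) has_field_derivative deriv (F (of_real r * cis (2 * pi * t))) b) (at b)"
      by (rule holomorphic_derivI[OF hol2[OF inb] _ b]) auto
    then show "((\<lambda>b. F (of_real r * cis (2 * pi * t)) b *
           (of_real r * cis (2 * pi * t) / (of_real r * cis (2 * pi * t) - a)\<^sup>2)) has_field_derivative
         deriv (F (of_real r * cis (2 * pi * t))) b * (of_real r * cis (2 * pi * t) / (of_real r * cis (2 * pi * t) - a)\<^sup>2))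
         (at b within ball 0 R)"
      using has_field_derivative_at_within[OF DERIV_cmult_right] by blast
  next
    fix b :: complex assume b: "b \<in> ball 0 R"
    have "continuous_on (cbox 0 1) (\<lambda>t. (\<lambda>(a, b). F a b) (of_real r * cis (2 * pi * t), b) *
           (of_real r * cis (2 * pi * t) / (of_real r * cis (2 * pi * t) - a)\<^sup>2))"
      by (intro continuous_intros continuous_on_compose2[OF cont]) (use ne inb b in auto)
    then show "(\<lambda>t. F (of_real r * cis (2 * pi * t)) b *
           (of_real r * cis (2 * pi * t) / (of_real r * cis (2 * pi * t) - a)\<^sup>2)) integrable_on cbox 0 1"
      by (intro integrable_continuous) simp
  next
    have "continuous_on (ball 0 R \<times> cbox 0 1) (\<lambda>q. (\<lambda>(b, a). deriv (F a) b) (fst q, of_real r * cis (2 * pi * snd q)) *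
          (of_real r * cis (2 * pi * snd q) / (of_real r * cis (2 * pi * snd q) - a)\<^sup>2))"
      by (intro continuous_intros continuous_on_compose2[OF cd]) (use ne inb in auto)
    then show "continuous_on (ball 0 R \<times> cbox 0 1) (\<lambda>(b, t). deriv (F (of_real r * cis (2 * pi * t))) b *
          (of_real r * cis (2 * pi * t) / (of_real r * cis (2 * pi * t) - a)\<^sup>2))"
      by (simp add: case_prod_unfold)
  qed auto
  then show ?thesis
    by (rule holomorphic_transform) (use deriv_eq_integral_circle[OF hol1 r(1,2)] in auto)
qed

lemma continuous_on_higher_deriv_param:
  fixes F :: "complex \<Rightarrow> 'p::metric_space \<Rightarrow> complex"
  assumes "continuous_on (ball 0 R \<times> X) (\<lambda>(a, x). F a x)"
    and "\<And>x. x \<in> X \<Longrightarrow> (\<lambda>a. F a x) holomorphic_on ball 0 R"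
  shows "continuous_on (ball 0 R \<times> X) (\<lambda>(a, x). (deriv ^^ k) (\<lambda>a. F a x) a)"
proof (induction k)
  case (Suc k)
  have "continuous_on (ball 0 R \<times> X) (\<lambda>(a, x). deriv (\<lambda>a. (deriv ^^ k) (\<lambda>a. F a x) a) a)"
    using Suc assms(2) by (intro continuous_on_deriv_param holomorphic_higher_deriv) auto
  then show ?case by (simp add: o_def)
qed (use assms in simp)

lemma holomorphic_higher_deriv_param:
  fixes F :: "complex \<Rightarrow> complex \<Rightarrow> complex"
  assumes cont: "continuous_on (ball 0 R \<times> ball 0 R) (\<lambda>(a, b). F a b)"
    and hol1: "\<And>b. b \<in> ball 0 R \<Longrightarrow> (\<lambda>a. F a b) holomorphic_on ball 0 R"
    and hol2: "\<And>a. a \<in> ball 0 R \<Longrightarrow> F a holomorphic_on ball 0 R"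
  shows "a \<in> ball 0 R \<Longrightarrow> (\<lambda>b. (deriv ^^ k) (\<lambda>a. F a b) a) holomorphic_on ball 0 R"
proof (induction k arbitrary: a)
  case (Suc k)
  have "(\<lambda>b. deriv (\<lambda>a. (deriv ^^ k) (\<lambda>a. F a b) a) a) holomorphic_on ball 0 R"
    using continuous_on_higher_deriv_param[OF cont] Suc hol1
    by (intro holomorphic_deriv_param holomorphic_higher_deriv) auto
  then show ?case by (simp add: o_def)
qed (use hol2 in auto)

section \<open>Power series in three variables\<close>

text \<open>By Osgood's lemma this amounts to holomorphy in three variables; in this form it can be
  checked one variable at a time and passes to uniform limits.\<close>

definition holomorphic3 :: "real \<Rightarrow> (complex \<Rightarrow> complex \<Rightarrow> complex \<Rightarrow> complex) \<Rightarrow> bool" where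
  "holomorphic3 R F \<longleftrightarrow>
     continuous_on (ball 0 R \<times> ball 0 R \<times> ball 0 R) (\<lambda>(a, b, c). F a b c) \<and>
     (\<forall>b\<in>ball 0 R. \<forall>c\<in>ball 0 R. (\<lambda>a. F a b c) holomorphic_on ball 0 R) \<and>
     (\<forall>a\<in>ball 0 R. \<forall>c\<in>ball 0 R. (\<lambda>b. F a b c) holomorphic_on ball 0 R) \<and>
     (\<forall>a\<in>ball 0 R. \<forall>b\<in>ball 0 R. (\<lambda>c. F a b c) holomorphic_on ball 0 R)"

lemma norm_taylor_coeff_le:
  assumes "f holomorphic_on ball 0 R" "0 < r" "r < R" "\<And>z. norm z \<le> r \<Longrightarrow> norm (f z) \<le> B"
  shows "norm ((deriv ^^ k) f 0 / fact k) \<le> B / r ^ k"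
proof -
  have h: "f holomorphic_on cball 0 r" by (rule holomorphic_on_subset[OF assms(1)]) (use assms in auto)
  have "norm ((deriv ^^ k) f 0) \<le> fact k * B / r ^ k"
    by (rule Cauchy_inequality)
       (use h assms in \<open>auto intro: holomorphic_on_imp_continuous_on holomorphic_on_subset[of _ "cball 0 r"]\<close>)
  then show ?thesis by (simp add: norm_divide field_simps)
qed

lemma taylor_has_sum:
  assumes f: "f holomorphic_on ball 0 R" and r: "0 < r" "r < R" and z: "norm z < r"
  shows "((\<lambda>k. (deriv ^^ k) f 0 / fact k * z ^ k) has_sum f z) UNIV"
proof (rule norm_summable_imp_has_sum)
  have h: "f holomorphic_on cball 0 r" by (rule holomorphic_on_subset[OF f]) (use r in auto)
  have "bounded (f ` cball 0 r)"
    by (intro compact_imp_bounded compact_continuous_image holomorphic_on_imp_continuous_on h) auto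
  then obtain B where B: "\<And>z. norm z \<le> r \<Longrightarrow> norm (f z) \<le> B"
    unfolding bounded_iff by (metis image_eqI mem_cball_0)
  have "summable (\<lambda>k. B * (norm z / r) ^ k)"
    using z r by (intro summable_mult summable_geometric) (auto simp: field_simps)
  then show "summable (\<lambda>k. norm ((deriv ^^ k) f 0 / fact k * z ^ k))"
  proof (rule summable_comparison_test')
    fix k :: nat
    have "norm ((deriv ^^ k) f 0 / fact k) * norm z ^ k \<le> B / r ^ k * norm z ^ k"
      by (intro mult_right_mono norm_taylor_coeff_le[OF f r B]) auto
    then show "norm (norm ((deriv ^^ k) f 0 / fact k * z ^ k)) \<le> B * (norm z / r) ^ k"
      by (simp add: norm_mult norm_power norm_divide power_divide)
  qed
  show "(\<lambda>k. (deriv ^^ k) f 0 / fact k * z ^ k) sums f z"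
    using holomorphic_power_series[OF f, of z] z r by simp
qed

lemma summable_on_times_nonneg:
  fixes f :: "'a \<Rightarrow> real" and g :: "'b \<Rightarrow> real"
  assumes "f summable_on A" "g summable_on B" "\<And>x. f x \<ge> 0" "\<And>y. g y \<ge> 0"
  shows "(\<lambda>p. f (fst p) * g (snd p)) summable_on A \<times> B"
proof (rule summable_on_SigmaI)
  show "((\<lambda>y. f (fst (x, y)) * g (snd (x, y))) has_sum f x * infsum g B) B" for x
    using has_sum_cmult_right[OF has_sum_infsum[OF assms(2)], of "f x"] by simp
  show "(\<lambda>x. f x * infsum g B) summable_on A"
    by (rule summable_on_cmult_left[OF assms(1)])
qed (use assms in auto)

text \<open>Taylor expansion in one variable at a time: the coefficients \<open>G\<close> of the
  expansion in \<open>a\<close> are holomorphic in \<open>b\<close>, and their coefficients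
  \<open>H\<close> are holomorphic in \<open>c\<close>. Cauchy's estimates bound
  \<open>C i j k\<close> by \<open>M / r ^ (i + j + k)\<close>; this absolute summability merges the
  three iterated series into one unordered sum.\<close>

lemma holomorphic3_power_series:
  assumes F: "holomorphic3 R F" and r: "0 < r" "r < R"
  shows "\<exists>C :: nat \<Rightarrow> nat \<Rightarrow> nat \<Rightarrow> complex. \<forall>a b c. norm a < r \<longrightarrow> norm b < r \<longrightarrow> norm c < r \<longrightarrow>
       ((\<lambda>(i, j, k). C i j k * a ^ i * b ^ j * c ^ k) has_sum F a b c) (UNIV \<times> UNIV \<times> UNIV)"
proof -
  let ?B = "ball (0::complex) R"
  have R: "0 < R" using r by simp
  have cont: "continuous_on (?B \<times> ?B \<times> ?B) (\<lambda>(a, b, c). F a b c)"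
    and h1: "\<And>b c. b \<in> ?B \<Longrightarrow> c \<in> ?B \<Longrightarrow> (\<lambda>a. F a b c) holomorphic_on ?B"
    and h2: "\<And>a c. a \<in> ?B \<Longrightarrow> c \<in> ?B \<Longrightarrow> (\<lambda>b. F a b c) holomorphic_on ?B"
    and h3: "\<And>a b. a \<in> ?B \<Longrightarrow> b \<in> ?B \<Longrightarrow> (\<lambda>c. F a b c) holomorphic_on ?B"
    using F unfolding holomorphic3_def by auto
  define G where "G i b c = (deriv ^^ i) (\<lambda>a. F a b c) 0 / fact i" for i b c
  define H where "H i j c = (deriv ^^ j) (\<lambda>b. G i b c) 0 / fact j" for i j c
  define C where "C i j k = (deriv ^^ k) (\<lambda>c. H i j c) 0 / fact k" for i j k
  have contG: "continuous_on (?B \<times> ?B) (\<lambda>(b, c). G i b c)" for i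
  proof -
    have "continuous_on (?B \<times> ?B \<times> ?B) (\<lambda>(a, x). F a (fst x) (snd x))"
      using cont by (simp add: case_prod_unfold)
    then have "continuous_on (?B \<times> ?B \<times> ?B) (\<lambda>(a, x). (deriv ^^ i) (\<lambda>a. F a (fst x) (snd x)) a)"
      by (rule continuous_on_higher_deriv_param) (use h1 in auto)
    then have "continuous_on (?B \<times> ?B) (\<lambda>x. (\<lambda>(a, x). (deriv ^^ i) (\<lambda>a. F a (fst x) (snd x)) a) (0, x))"
      by (rule continuous_on_compose2) (use R in \<open>auto intro!: continuous_intros\<close>)
    then show ?thesis unfolding G_def by (auto simp: case_prod_unfold intro!: continuous_intros)
  qed
  have hG1: "(\<lambda>b. G i b c) holomorphic_on ?B" if c: "c \<in> ?B" for i c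
  proof -
    have "continuous_on (?B \<times> ?B) (\<lambda>p. (\<lambda>(a, b, c). F a b c) (fst p, snd p, c))"
      by (rule continuous_on_compose2[OF cont]) (use c in \<open>auto intro!: continuous_intros\<close>)
    then have "(\<lambda>b. (deriv ^^ i) (\<lambda>a. F a b c) 0) holomorphic_on ?B"
      by (intro holomorphic_higher_deriv_param) (use h1 h2 c R in \<open>auto simp: case_prod_unfold\<close>)
    then show ?thesis unfolding G_def by (intro holomorphic_intros) auto
  qed
  have hG2: "(\<lambda>c. G i b c) holomorphic_on ?B" if b: "b \<in> ?B" for i b
  proof -
    have "continuous_on (?B \<times> ?B) (\<lambda>p. (\<lambda>(a, b, c). F a b c) (fst p, b, snd p))"
      by (rule continuous_on_compose2[OF cont]) (use b in \<open>auto intro!: continuous_intros\<close>)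
    then have "(\<lambda>c. (deriv ^^ i) (\<lambda>a. F a b c) 0) holomorphic_on ?B"
      by (intro holomorphic_higher_deriv_param) (use h1 h3 b R in \<open>auto simp: case_prod_unfold\<close>)
    then show ?thesis unfolding G_def by (intro holomorphic_intros) auto
  qed
  have hH: "H i j holomorphic_on ?B" for i j
  proof -
    have "(\<lambda>c. (deriv ^^ j) (\<lambda>b. G i b c) 0) holomorphic_on ?B"
      by (intro holomorphic_higher_deriv_param contG) (use hG1 hG2 R in auto)
    then show ?thesis unfolding H_def by (intro holomorphic_intros) auto
  qed
  have "compact ((\<lambda>(a, b, c). F a b c) ` (cball 0 r \<times> cball 0 r \<times> cball 0 r))"
    by (intro compact_continuous_image continuous_on_subset[OF cont] compact_Times compact_cball)
       (use r in auto)
  then have "bounded ((\<lambda>(a, b, c). F a b c) ` (cball 0 r \<times> cball 0 r \<times> cball 0 r))"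
    by (rule compact_imp_bounded)
  then obtain M where M: "\<And>a b c. norm a \<le> r \<Longrightarrow> norm b \<le> r \<Longrightarrow> norm c \<le> r \<Longrightarrow> norm (F a b c) \<le> M"
    by (fastforce simp: bounded_iff)
  have bG: "norm (G i b c) \<le> M / r ^ i" if "norm b \<le> r" "norm c \<le> r" for i b c
    unfolding G_def by (rule norm_taylor_coeff_le[OF h1 r]) (use that r M in auto)
  have bH: "norm (H i j c) \<le> M / r ^ i / r ^ j" if "norm c \<le> r" for i j c
    unfolding H_def by (rule norm_taylor_coeff_le[OF hG1 r]) (use that r bG in auto)
  have bC: "norm (C i j k) \<le> M / r ^ i / r ^ j / r ^ k" for i j k
    unfolding C_def by (rule norm_taylor_coeff_le[OF hH r]) (use bH in auto)
  show ?thesis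
  proof (intro exI allI impI)
    fix a b c :: complex assume abc: "norm a < r" "norm b < r" "norm c < r"
    have bd: "a \<in> ?B" "b \<in> ?B" "c \<in> ?B" using abc r by auto
    have s3: "((\<lambda>k. C i j k * a ^ i * b ^ j * c ^ k) has_sum H i j c * a ^ i * b ^ j) UNIV" for i j
    proof -
      have "((\<lambda>k. C i j k * c ^ k) has_sum H i j c) UNIV"
        unfolding C_def by (rule taylor_has_sum[OF _ r abc(3)]) (rule hH)
      then have "((\<lambda>k. (C i j k * c ^ k) * (a ^ i * b ^ j)) has_sum H i j c * (a ^ i * b ^ j)) UNIV"
        by (rule has_sum_cmult_left)
      then show ?thesis by (simp add: mult_ac)
    qed
    have s2: "((\<lambda>j. H i j c * a ^ i * b ^ j) has_sum G i b c * a ^ i) UNIV" for i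
    proof -
      have "((\<lambda>j. H i j c * b ^ j) has_sum G i b c) UNIV"
        unfolding H_def by (rule taylor_has_sum[where f = "\<lambda>b. G i b c", OF _ r abc(2)]) (rule hG1[OF bd(3)])
      then have "((\<lambda>j. (H i j c * b ^ j) * a ^ i) has_sum G i b c * a ^ i) UNIV"
        by (rule has_sum_cmult_left)
      then show ?thesis by (simp add: mult_ac)
    qed
    have s1: "((\<lambda>i. G i b c * a ^ i) has_sum F a b c) UNIV"
      unfolding G_def by (rule taylor_has_sum[where f = "\<lambda>a. F a b c", OF _ r abc(1)]) (rule h1[OF bd(2,3)])
    have geo: "(\<lambda>i. norm ((norm z / r) ^ i)) summable_on UNIV" if "norm z < r" for z :: complex
      by (intro norm_summable_imp_summable_on) (use that r in \<open>auto simp: norm_power intro!: summable_geometric\<close>)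
    have "(\<lambda>p. norm ((norm a / r) ^ fst p * ((norm b / r) ^ fst (snd p) * (norm c / r) ^ snd (snd p)))) summable_on UNIV \<times> UNIV \<times> UNIV"
    proof -
      have "(\<lambda>p. norm ((norm a / r) ^ fst p) * (norm ((norm b / r) ^ fst (snd p)) * norm ((norm c / r) ^ snd (snd p))))
          summable_on UNIV \<times> (UNIV \<times> UNIV)"
        by (intro summable_on_times_nonneg[of _ _ "\<lambda>q. norm ((norm b / r) ^ fst q) * norm ((norm c / r) ^ snd q)"]
            summable_on_times_nonneg geo abc) auto
      then show ?thesis by (simp only: norm_mult)
    qed
    then have g: "(\<lambda>p. \<bar>M\<bar> * norm ((norm a / r) ^ fst p * ((norm b / r) ^ fst (snd p) * (norm c / r) ^ snd (snd p)))) summable_on UNIV \<times> UNIV \<times> UNIV"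
      by (rule summable_on_cmult_right)
    define f where "f = (\<lambda>(i, j, k). C i j k * a ^ i * b ^ j * c ^ k)"
    have "(\<lambda>p. norm (f p)) summable_on UNIV \<times> UNIV \<times> UNIV"
    proof (rule Infinite_Sum.abs_summable_on_comparison_test'[OF g])
      fix p :: "nat \<times> nat \<times> nat"
      obtain i j k where p: "p = (i, j, k)" by (cases p)
      let ?m = "norm a ^ i * (norm b ^ j * norm c ^ k)"
      have le: "norm (C i j k) * ?m \<le> M / r ^ i / r ^ j / r ^ k * ?m"
        by (intro mult_right_mono bC) auto
      have eq: "M / r ^ i / r ^ j / r ^ k * ?m = M * ((norm a / r) ^ i * ((norm b / r) ^ j * (norm c / r) ^ k))"
        by (simp add: power_divide)
      have "norm (C i j k) * ?m \<le> \<bar>M * ((norm a / r) ^ i * ((norm b / r) ^ j * (norm c / r) ^ k))\<bar>"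
        using le unfolding eq by linarith
      then show "norm (f p) \<le> \<bar>M\<bar> * norm ((norm a / r) ^ fst p * ((norm b / r) ^ fst (snd p) * (norm c / r) ^ snd (snd p)))"
        by (simp add: f_def p norm_mult norm_power mult.assoc abs_mult)
    qed
    then have "f summable_on UNIV \<times> UNIV \<times> UNIV"
      by (rule Infinite_Sum.abs_summable_summable)
    then have summ: "(\<lambda>(i, j, k). C i j k * a ^ i * b ^ j * c ^ k) summable_on UNIV \<times> UNIV \<times> UNIV"
      unfolding f_def .
    have inner: "((\<lambda>p. case (i, p) of (i, j, k) \<Rightarrow> C i j k * a ^ i * b ^ j * c ^ k) has_sum G i b c * a ^ i) (UNIV \<times> UNIV)" for i
    proof (rule has_sum_SigmaI)
      show "((\<lambda>y. case (i, j, y) of (i, j, k) \<Rightarrow> C i j k * a ^ i * b ^ j * c ^ k) has_sum H i j c * a ^ i * b ^ j) UNIV" for j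
        using s3 by simp
      show "((\<lambda>j. H i j c * a ^ i * b ^ j) has_sum G i b c * a ^ i) UNIV" by (rule s2)
      have "(\<lambda>(i, j, k). C i j k * a ^ i * b ^ j * c ^ k) summable_on (Pair i ` (UNIV \<times> UNIV))"
        by (rule summable_on_subset_banach[OF summ]) auto
      then show "(\<lambda>p. case (i, p) of (i, j, k) \<Rightarrow> C i j k * a ^ i * b ^ j * c ^ k) summable_on UNIV \<times> UNIV"
        by (subst (asm) summable_on_reindex) (auto simp: inj_on_def o_def)
    qed
    show "((\<lambda>(i, j, k). C i j k * a ^ i * b ^ j * c ^ k) has_sum F a b c) (UNIV \<times> UNIV \<times> UNIV)"
    proof (rule has_sum_SigmaI)
      show "((\<lambda>p. case (i, p) of (i, j, k) \<Rightarrow> C i j k * a ^ i * b ^ j * c ^ k) has_sum G i b c * a ^ i) (UNIV \<times> UNIV)" for i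
        by (rule inner)
      show "((\<lambda>i. G i b c * a ^ i) has_sum F a b c) UNIV" by (rule s1)
    qed (rule summ)
  qed
qed

lemma Basis_real3: "(Basis :: (real \<times> real \<times> real) set) = {(1, 0, 0), (0, 1, 0), (0, 0, 1)}"
  by (auto simp: Basis_prod_def zero_prod_def)

lemma real_analytic_at_holomorphic3:
  fixes f :: "real \<times> real \<times> real \<Rightarrow> complex \<times> complex"
  assumes F: "holomorphic3 R F" and G: "holomorphic3 R G" and R: "R > 0"
    and eq: "\<And>a b c. \<bar>a\<bar> < R \<Longrightarrow> \<bar>b\<bar> < R \<Longrightarrow> \<bar>c\<bar> < R \<Longrightarrow>
       f (t + a, x + b, y + c) = (F (of_real a) (of_real b) (of_real c), G (of_real a) (of_real b) (of_real c))"
  shows "real_analytic_at f (t, x, y)"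
proof -
  define r where "r = R / 2"
  have r: "0 < r" "r < R" using R by (auto simp: r_def)
  from holomorphic3_power_series[OF F r] obtain C where C: "\<forall>a b c. norm a < r \<longrightarrow> norm b < r \<longrightarrow> norm c < r \<longrightarrow>
       ((\<lambda>(i, j, k). C i j k * a ^ i * b ^ j * c ^ k) has_sum F a b c) (UNIV \<times> UNIV \<times> UNIV)"
    by (rule exE)
  from holomorphic3_power_series[OF G r] obtain D where D: "\<forall>a b c. norm a < r \<longrightarrow> norm b < r \<longrightarrow> norm c < r \<longrightarrow>
       ((\<lambda>(i, j, k). D i j k * a ^ i * b ^ j * c ^ k) has_sum G a b c) (UNIV \<times> UNIV \<times> UNIV)"
    by (rule exE)
  let ?e1 = "(1, 0, 0) :: real \<times> real \<times> real" and ?e2 = "(0, 1, 0) :: real \<times> real \<times> real"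
    and ?e3 = "(0, 0, 1) :: real \<times> real \<times> real"
  define c where "c \<alpha> = (C (\<alpha> ?e1) (\<alpha> ?e2) (\<alpha> ?e3), D (\<alpha> ?e1) (\<alpha> ?e2) (\<alpha> ?e3))"
    for \<alpha> :: "real \<times> real \<times> real \<Rightarrow> nat"
  \<comment> \<open>\<open>j\<close> reads the three exponents off a multi-index and
    \<open>i\<close> is its inverse; the value \<open>undefined\<close> outside \<open>Basis\<close>
    makes \<open>i p\<close> extensional.\<close>
  define j :: "(real \<times> real \<times> real \<Rightarrow> nat) \<Rightarrow> nat \<times> nat \<times> nat"
    where "j \<alpha> = (\<alpha> ?e1, \<alpha> ?e2, \<alpha> ?e3)" for \<alpha>
  define i where "i p = (\<lambda>e. if e = ?e1 then fst p else if e = ?e2 then fst (snd p) else if e = ?e3 then snd (snd p) else undefined)"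
    for p :: "nat \<times> nat \<times> nat"
  have "((\<lambda>\<alpha>. (\<Prod>i\<in>Basis. ((z - (t, x, y)) \<bullet> i) ^ \<alpha> i) *\<^sub>R c \<alpha>) has_sum f z) (Basis \<rightarrow>\<^sub>E UNIV)"
    if z: "z \<in> ball (t, x, y) r" for z
  proof -
    obtain t' x' y' where z': "z = (t', x', y')" by (cases z)
    have d: "dist (t', x', y') (t, x, y) < r" using z z' by (simp add: dist_commute)
    have "\<bar>t' - t\<bar> < r" "\<bar>x' - x\<bar> < r" "\<bar>y' - y\<bar> < r"
      using d dist_fst_le[of "(t', x', y')" "(t, x, y)"] dist_snd_le[of "(t', x', y')" "(t, x, y)"]
        dist_fst_le[of "(x', y')" "(x, y)"] dist_snd_le[of "(x', y')" "(x, y)"]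
      by (auto simp: dist_real_def)
    then have small: "norm (of_real (t' - t) :: complex) < r" "norm (of_real (x' - x) :: complex) < r"
      "norm (of_real (y' - y) :: complex) < r" "\<bar>t' - t\<bar> < R" "\<bar>x' - x\<bar> < R" "\<bar>y' - y\<bar> < R"
      using r by (auto simp del: of_real_diff)
    let ?a = "of_real (t' - t) :: complex" and ?b = "of_real (x' - x) :: complex" and ?c = "of_real (y' - y) :: complex"
    have fz: "f z = (F ?a ?b ?c, 0) + (0, G ?a ?b ?c)"
      using eq[OF small(4-6)] by (simp add: z')
    have bl1: "bounded_linear (\<lambda>w. (w, 0) :: complex \<times> complex)" and bl2: "bounded_linear (\<lambda>w. (0, w) :: complex \<times> complex)"
      by (intro bounded_linear_Pair bounded_linear_ident bounded_linear_zero)+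
    have "((\<lambda>p. ((case p of (i, j, k) \<Rightarrow> C i j k * ?a ^ i * ?b ^ j * ?c ^ k), 0) +
          (0, (case p of (i, j, k) \<Rightarrow> D i j k * ?a ^ i * ?b ^ j * ?c ^ k))) has_sum f z) (UNIV \<times> UNIV \<times> UNIV)"
      unfolding fz
      by (intro has_sum_add has_sum_bounded_linear[OF bl1] has_sum_bounded_linear[OF bl2] C[rule_format] D[rule_format] small)
    moreover have "((\<lambda>\<alpha>. (\<Prod>i\<in>Basis. ((z - (t, x, y)) \<bullet> i) ^ \<alpha> i) *\<^sub>R c \<alpha>) has_sum f z) (Basis \<rightarrow>\<^sub>E UNIV) \<longleftrightarrow>
       ((\<lambda>p. ((case p of (i, j, k) \<Rightarrow> C i j k * ?a ^ i * ?b ^ j * ?c ^ k), 0) +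
          (0, (case p of (i, j, k) \<Rightarrow> D i j k * ?a ^ i * ?b ^ j * ?c ^ k))) has_sum f z) (UNIV \<times> UNIV \<times> UNIV)"
    proof (rule has_sum_reindex_bij_witness[of _ i j])
      show "i (j \<alpha>) = \<alpha>" if "\<alpha> \<in> Basis \<rightarrow>\<^sub>E UNIV" for \<alpha>
        using that by (auto simp: fun_eq_iff i_def j_def Basis_real3 PiE_iff extensional_def)
      show "((case j \<alpha> of (i, j, k) \<Rightarrow> C i j k * ?a ^ i * ?b ^ j * ?c ^ k), 0) +
          (0, (case j \<alpha> of (i, j, k) \<Rightarrow> D i j k * ?a ^ i * ?b ^ j * ?c ^ k)) =
          (\<Prod>i\<in>Basis. ((z - (t, x, y)) \<bullet> i) ^ \<alpha> i) *\<^sub>R c \<alpha>" for \<alpha>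
        by (simp add: Basis_real3 j_def c_def z' scaleR_conv_of_real mult_ac)
      show "i p \<in> Basis \<rightarrow>\<^sub>E UNIV" for p
        unfolding PiE_iff extensional_def Basis_real3 by (simp add: i_def)
      show "j (i p) = p" for p
        by (simp add: i_def j_def)
      show "j \<alpha> \<in> UNIV \<times> UNIV \<times> UNIV" for \<alpha>
        by simp
    qed (rule refl)
    ultimately show ?thesis by simp
  qed
  then show ?thesis
    unfolding real_analytic_at_def using r by blast
qed

section \<open>The time change\<close>

lemma has_real_derivative_Re_of_real:
  assumes "(f has_field_derivative f') (at (of_real u))"
  shows "((\<lambda>u. Re (f (of_real u))) has_real_derivative Re f') (at u)"
proof -
  have "((\<lambda>u. f (of_real u)) has_vector_derivative f') (at u)"
    by (rule has_vector_derivative_real_field[OF assms])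
  then have "((\<lambda>u. Re (f (of_real u))) has_vector_derivative Re f') (at u)"
    by (rule bounded_linear.has_vector_derivative[OF bounded_linear_Re])
  then show ?thesis by (simp add: has_real_derivative_iff_has_vector_derivative)
qed

text \<open>\<open>q j * \<alpha> - p j\<close> is the speed of the phase
  \<open>q j * x - p j * y\<close> along the linear flow. For positions and times with imaginary
  part at most 1 the argument of \<open>g j\<close> has imaginary part at most
  \<open>2 * q j + 1\<close>; the half-width \<open>2 * q j + 2\<close> leaves a unit disc for
  Cauchy's estimate. The powers of 1/4 sum to 1/3, which makes the perturbation of time a
  contraction.\<close>

locale time_change =
  fixes g :: "nat \<Rightarrow> complex \<Rightarrow> complex" and \<alpha> :: real and q p :: "nat \<Rightarrow> int" and \<beta> :: "nat \<Rightarrow> real"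
  assumes g_hol: "g j holomorphic_on UNIV"
    and g_periodic: "g j (z + 1) = g j z"
    and g_real: "g j (of_real x) \<in> \<real>"
    and g_bound: "\<bar>Im z\<bar> \<le> 2 * q j + 2 \<Longrightarrow> norm (g j z) \<le> \<beta> j"
    and q_pos: "q j \<ge> 1" and p_bound: "\<bar>p j\<bar> \<le> q j" and beta_ge: "\<beta> j \<ge> 1"
    and eps_pos': "0 < q j * \<alpha> - p j"
    and eps_beta': "(q j * \<alpha> - p j) * \<beta> j \<le> (1/4) ^ Suc j"
begin

definition \<epsilon> :: "nat \<Rightarrow> real" where "\<epsilon> j = q j * \<alpha> - p j"

lemma eps_pos: "0 < \<epsilon> j" and eps_beta: "\<epsilon> j * \<beta> j \<le> (1/4) ^ Suc j"
  unfolding \<epsilon>_def using eps_pos' eps_beta' by auto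

lemma eps_le: "\<epsilon> j \<le> (1/4) ^ Suc j"
proof -
  have "\<epsilon> j * 1 \<le> \<epsilon> j * \<beta> j" using eps_pos[of j] beta_ge[of j] by (intro mult_left_mono) auto
  then show ?thesis using eps_beta[of j] by simp
qed

lemma eps_le_1: "\<epsilon> j \<le> 1"
  using eps_le[of j] power_le_one[of "1/4 :: real" "Suc j"] by linarith

lemma q_pos_real: "real_of_int (q j) \<ge> 1"
  using q_pos[of j] by linarith

lemma quarter_sums: "(\<lambda>j. (1/4::real) ^ Suc j) sums (1/3)"
  using sums_mult[OF geometric_sums[of "1/4 :: real"], of "1/4"] by simp

lemma quarter_summable: "summable (\<lambda>j. (1/4::real) ^ Suc j)" and quarter_suminf: "(\<Sum>j. (1/4::real) ^ Suc j) = 1/3"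
  using quarter_sums by (auto simp: sums_iff)

definition gd :: "nat \<Rightarrow> nat \<Rightarrow> real \<Rightarrow> real" where
  "gd k j u = Re ((deriv ^^ k) (g j) (of_real u))"

lemma gd_deriv: "(gd k j has_real_derivative gd (Suc k) j u) (at u)"
proof -
  have "((deriv ^^ k) (g j) has_field_derivative deriv ((deriv ^^ k) (g j)) (of_real u)) (at (of_real u))"
    by (rule holomorphic_derivI[OF holomorphic_higher_deriv[OF g_hol]]) auto
  from has_real_derivative_Re_of_real[OF this] show ?thesis
    unfolding gd_def by simp
qed

lemma gd_0: "of_real (gd 0 j u) = g j (of_real u)"
  using g_real[of j u] by (simp add: gd_def of_real_Re)

text \<open>Cauchy's estimate on discs of radius \<open>2 * q j + 2\<close>: each derivative of
  \<open>g j\<close> gains a factor \<open>1 / q j\<close>. This compensates the factor of size at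
  most \<open>q j\<close> that each derivative in \<open>x\<close> or \<open>y\<close> of a function
  of the phase produces.\<close>

lemma gd_bound: "\<bar>gd k j u\<bar> * of_int (q j) ^ k \<le> fact k * \<beta> j"
proof -
  define r where "r = 2 * real_of_int (q j) + 2"
  have r: "r \<ge> q j" "r > 0" using q_pos_real[of j] by (auto simp: r_def)
  have "norm ((deriv ^^ k) (g j) (of_real u)) \<le> fact k * \<beta> j / r ^ k"
  proof (rule Cauchy_inequality)
    show "g j holomorphic_on ball (of_real u) r" by (rule holomorphic_on_subset[OF g_hol]) auto
    show "continuous_on (cball (of_real u) r) (g j)"
      by (rule holomorphic_on_imp_continuous_on[OF holomorphic_on_subset[OF g_hol]]) auto
    show "norm (g j z) \<le> \<beta> j" if "norm (of_real u - z) = r" for z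
      using that abs_Im_le_cmod[of "of_real u - z"] by (intro g_bound) (simp add: r_def)
  qed (use r in auto)
  then have "\<bar>gd k j u\<bar> \<le> fact k * \<beta> j / r ^ k"
    using abs_Re_le_cmod[of "(deriv ^^ k) (g j) (of_real u)"] unfolding gd_def by linarith
  then have 1: "\<bar>gd k j u\<bar> * r ^ k \<le> fact k * \<beta> j" using r by (simp add: field_simps)
  have "\<bar>gd k j u\<bar> * of_int (q j) ^ k \<le> \<bar>gd k j u\<bar> * r ^ k"
    using r q_pos_real[of j] by (intro mult_left_mono power_mono) auto
  with 1 show ?thesis by linarith
qed

lemma gd_periodic: "gd k j (u + of_int n) = gd k j u"
proof -
  have 1: "gd k j (u + 1) = gd k j u" for u
  proof (induction k arbitrary: u)
    case 0
    show ?case using g_periodic[of j "of_real u"] by (simp add: gd_def)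
  next
    case (Suc k)
    have "((\<lambda>v. gd k j (v + 1)) has_real_derivative gd (Suc k) j (u + 1)) (at u)"
      using DERIV_shift[of "gd k j" "gd (Suc k) j (u + 1)" u 1] gd_deriv[of k j "u + 1"] by simp
    then have "(gd k j has_real_derivative gd (Suc k) j (u + 1)) (at u)" by (simp add: Suc)
    then show ?case using gd_deriv DERIV_unique by blast
  qed
  have nat: "gd k j (u + of_nat m) = gd k j u" for m u
  proof (induction m)
    case (Suc m)
    then show ?case using 1[of "u + of_nat m"] by (simp add: add_ac)
  qed simp
  show ?thesis
  proof (cases "n \<ge> 0")
    case True
    then show ?thesis using nat[of u "nat n"] by simp
  next
    case False
    then show ?thesis using nat[of "u + of_int n" "nat (- n)"] by simp
  qed
qed

lemma gd_lipschitz: "\<bar>gd k j u - gd k j u'\<bar> * of_int (q j) ^ Suc k \<le> fact (Suc k) * \<beta> j * \<bar>u - u'\<bar>"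
proof -
  have "norm (gd k j u - gd k j u') \<le> fact (Suc k) * \<beta> j / of_int (q j) ^ Suc k * norm (u - u')"
  proof (rule field_differentiable_bound[of UNIV])
    show "(gd k j has_field_derivative gd (Suc k) j z) (at z within UNIV)" for z
      using gd_deriv by simp
    show "norm (gd (Suc k) j z) \<le> fact (Suc k) * \<beta> j / of_int (q j) ^ Suc k" for z
      using gd_bound[of "Suc k" j z] q_pos_real[of j] by (simp add: pos_le_divide_eq)
  qed auto
  then show ?thesis using q_pos_real[of j] by (simp add: field_simps)
qed

section \<open>The time perturbation at complex positions and times\<close>

definition strip :: "complex set" where "strip = {z. \<bar>Im z\<bar> \<le> 1}"

lemma of_real_strip [simp]: "of_real x \<in> strip" by (simp add: strip_def)

lemma strip_add: "norm b \<le> 1 \<Longrightarrow> of_real x + b \<in> strip"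
  using abs_Im_le_cmod[of b] by (simp add: strip_def)

definition uC :: "nat \<Rightarrow> complex \<Rightarrow> complex \<Rightarrow> complex" where
  "uC j z w = of_int (q j) * z - of_int (p j) * w"

definition termC :: "nat \<Rightarrow> complex \<Rightarrow> complex \<Rightarrow> complex \<Rightarrow> complex" where
  "termC j z w s = g j (uC j z w + s * of_real (\<epsilon> j)) - g j (uC j z w)"

definition psiC :: "complex \<Rightarrow> complex \<Rightarrow> complex \<Rightarrow> complex" where
  "psiC z w s = (\<Sum>j. termC j z w s)"

text \<open>Mean value estimate: Cauchy's estimate on unit discs bounds the derivative of
  \<open>g j\<close> by \<open>\<beta> j\<close>, and the two arguments differ by
  \<open>(s - s') * \<epsilon> j\<close>.\<close>

lemma g_diff_bound:
  assumes "z \<in> strip" "w \<in> strip" "s \<in> strip" "s' \<in> strip"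
  shows "norm (g j (uC j z w + s * of_real (\<epsilon> j)) - g j (uC j z w + s' * of_real (\<epsilon> j)))
    \<le> norm (s - s') * (1/4) ^ Suc j"
proof -
  define S where "S = {\<zeta>. \<bar>Im \<zeta>\<bar> \<le> 2 * real_of_int (q j) + 1}"
  have cv: "convex S"
  proof -
    have "S = {\<zeta>. Im \<zeta> \<le> 2 * real_of_int (q j) + 1} \<inter> {\<zeta>. Im \<zeta> \<ge> - (2 * real_of_int (q j) + 1)}"
      by (auto simp: S_def abs_le_iff)
    then show ?thesis by (simp add: convex_Int convex_halfspace_Im_le convex_halfspace_Im_ge)
  qed
  have inS: "uC j z w + s * of_real (\<epsilon> j) \<in> S" if "s \<in> strip" for s
  proof -
    have "\<bar>real_of_int (q j) * Im z\<bar> \<le> real_of_int (q j) * 1"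
      unfolding abs_mult using assms q_pos_real[of j] by (intro mult_mono) (auto simp: strip_def)
    moreover have "\<bar>real_of_int (p j) * Im w\<bar> \<le> real_of_int (q j) * 1"
      unfolding abs_mult using assms q_pos_real[of j] p_bound[of j] by (intro mult_mono) (auto simp: strip_def)
    moreover have "\<bar>Im s * \<epsilon> j\<bar> \<le> 1 * 1"
      unfolding abs_mult using that eps_le_1[of j] eps_pos[of j] by (intro mult_mono) (auto simp: strip_def)
    ultimately show ?thesis by (simp add: S_def uC_def)
  qed
  have "norm (g j (uC j z w + s * of_real (\<epsilon> j)) - g j (uC j z w + s' * of_real (\<epsilon> j)))
    \<le> \<beta> j * norm ((uC j z w + s * of_real (\<epsilon> j)) - (uC j z w + s' * of_real (\<epsilon> j)))"
  proof (rule field_differentiable_bound[OF cv])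
    show "(g j has_field_derivative deriv (g j) \<zeta>) (at \<zeta> within S)" for \<zeta>
      by (rule has_field_derivative_at_within[OF holomorphic_derivI[OF g_hol]]) auto
    show "norm (deriv (g j) \<zeta>) \<le> \<beta> j" if \<zeta>: "\<zeta> \<in> S" for \<zeta>
    proof -
      have "norm ((deriv ^^ 1) (g j) \<zeta>) \<le> fact 1 * \<beta> j / 1 ^ 1"
      proof (rule Cauchy_inequality)
        show "g j holomorphic_on ball \<zeta> 1" by (rule holomorphic_on_subset[OF g_hol]) auto
        show "continuous_on (cball \<zeta> 1) (g j)"
          by (rule holomorphic_on_imp_continuous_on[OF holomorphic_on_subset[OF g_hol]]) auto
        show "norm (g j x) \<le> \<beta> j" if "norm (\<zeta> - x) = 1" for x
        proof (rule g_bound)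
          have "\<bar>Im x\<bar> \<le> \<bar>Im \<zeta>\<bar> + \<bar>Im (\<zeta> - x)\<bar>" by simp
          also have "\<dots> \<le> \<bar>Im \<zeta>\<bar> + 1" using abs_Im_le_cmod[of "\<zeta> - x"] that by simp
          finally show "\<bar>Im x\<bar> \<le> real_of_int (2 * q j + 2)" using \<zeta> by (simp add: S_def)
        qed
      qed auto
      then show ?thesis by simp
    qed
  qed (use inS assms in auto)
  also have "(uC j z w + s * of_real (\<epsilon> j)) - (uC j z w + s' * of_real (\<epsilon> j)) = (s - s') * of_real (\<epsilon> j)"
    by (simp add: algebra_simps)
  also have "\<beta> j * norm ((s - s') * of_real (\<epsilon> j)) = norm (s - s') * (\<epsilon> j * \<beta> j)"
    using eps_pos[of j] by (simp add: norm_mult)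
  also have "\<dots> \<le> norm (s - s') * (1/4) ^ Suc j"
    by (intro mult_left_mono eps_beta) auto
  finally show ?thesis .
qed

lemma termC_bound:
  assumes "z \<in> strip" "w \<in> strip" "s \<in> strip"
  shows "norm (termC j z w s) \<le> norm s * (1/4) ^ Suc j"
  using g_diff_bound[OF assms, of 0 j] by (simp add: termC_def strip_def)

lemma termC_summable:
  assumes "z \<in> strip" "w \<in> strip" "s \<in> strip"
  shows "summable (\<lambda>j. termC j z w s)"
  by (rule summable_comparison_test'[OF summable_mult[OF quarter_summable]]) (rule termC_bound[OF assms])

text \<open>The factor 1/3 is the sum of the powers of 1/4. Being below 1, it makes the identity
  plus this perturbation invertible and the fixed-point iteration for the inverse
  convergent.\<close>

lemma psiC_lipschitz:
  assumes "z \<in> strip" "w \<in> strip" "s \<in> strip" "s' \<in> strip"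
  shows "norm (psiC z w s - psiC z w s') \<le> norm (s - s') / 3"
proof -
  have sm: "summable (\<lambda>j. norm (s - s') * (1/4) ^ Suc j)" by (rule summable_mult[OF quarter_summable])
  have bd: "norm (termC j z w s - termC j z w s') \<le> norm (s - s') * (1/4) ^ Suc j" for j
    using g_diff_bound[OF assms, of j] by (simp add: termC_def)
  have "psiC z w s - psiC z w s' = (\<Sum>j. termC j z w s - termC j z w s')"
    unfolding psiC_def by (intro suminf_diff termC_summable assms)
  also have "norm \<dots> \<le> (\<Sum>j. norm (s - s') * (1/4) ^ Suc j)"
    by (rule norm_suminf_le[OF bd sm])
  also have "\<dots> = norm (s - s') / 3"
    using suminf_mult[OF quarter_summable, of "norm (s - s')"] quarter_suminf by simp
  finally show ?thesis .
qed

lemma psiC_uniform_limit: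
  assumes "\<And>x. x \<in> X \<Longrightarrow> Z x \<in> strip" "\<And>x. x \<in> X \<Longrightarrow> W x \<in> strip" "\<And>x. x \<in> X \<Longrightarrow> S x \<in> strip"
    and "\<And>x. x \<in> X \<Longrightarrow> norm (S x) \<le> K"
  shows "uniform_limit X (\<lambda>n x. \<Sum>j<n. termC j (Z x) (W x) (S x)) (\<lambda>x. psiC (Z x) (W x) (S x)) sequentially"
  unfolding psiC_def
proof (rule Weierstrass_m_test)
  show "summable (\<lambda>j. K * (1/4) ^ Suc j)" by (rule summable_mult[OF quarter_summable])
  fix j x assume x: "x \<in> X"
  have "norm (termC j (Z x) (W x) (S x)) \<le> norm (S x) * (1/4) ^ Suc j"
    using assms x by (intro termC_bound) auto
  also have "\<dots> \<le> K * (1/4) ^ Suc j" using assms x by (intro mult_right_mono) auto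
  finally show "norm (termC j (Z x) (W x) (S x)) \<le> K * (1/4) ^ Suc j" .
qed

lemma g_continuous_compose:
  assumes "continuous_on X f"
  shows "continuous_on X (\<lambda>x. g j (f x))"
  using continuous_on_compose2[OF holomorphic_on_imp_continuous_on[OF g_hol] assms] by simp

lemma psiC_continuous:
  assumes "\<And>x. x \<in> X \<Longrightarrow> Z x \<in> strip" "\<And>x. x \<in> X \<Longrightarrow> W x \<in> strip" "\<And>x. x \<in> X \<Longrightarrow> S x \<in> strip"
    and "\<And>x. x \<in> X \<Longrightarrow> norm (S x) \<le> K"
    and "continuous_on X Z" "continuous_on X W" "continuous_on X S"
  shows "continuous_on X (\<lambda>x. psiC (Z x) (W x) (S x))"
proof (rule uniform_limit_theorem[OF _ psiC_uniform_limit[OF assms(1-4)]])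
  have "continuous_on X (\<lambda>x. \<Sum>j<n. termC j (Z x) (W x) (S x))" for n
    unfolding termC_def uC_def using assms(5-7)
    by (intro continuous_on_sum continuous_on_diff g_continuous_compose continuous_on_add continuous_on_mult continuous_on_const)
  then show "\<forall>\<^sub>F n in sequentially. continuous_on X (\<lambda>x. \<Sum>j<n. termC j (Z x) (W x) (S x))" by simp
qed auto

lemma psiC_holomorphic:
  assumes "\<And>x. x \<in> X \<Longrightarrow> Z x \<in> strip" "\<And>x. x \<in> X \<Longrightarrow> W x \<in> strip" "\<And>x. x \<in> X \<Longrightarrow> S x \<in> strip"
    and "\<And>x. x \<in> X \<Longrightarrow> norm (S x) \<le> K" and X: "open X"
    and Z: "Z holomorphic_on X" and W: "W holomorphic_on X" and S: "S holomorphic_on X"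
  shows "(\<lambda>x. psiC (Z x) (W x) (S x)) holomorphic_on X"
proof (rule holomorphic_uniform_sequence[OF X])
  have gc: "(\<lambda>x. g j (f x)) holomorphic_on X" if "f holomorphic_on X" for f j
  proof -
    have "(g j \<circ> f) holomorphic_on X" by (rule holomorphic_on_compose_gen[OF that g_hol]) simp
    then show ?thesis by (simp add: o_def)
  qed
  show "(\<lambda>x. \<Sum>j<n. termC j (Z x) (W x) (S x)) holomorphic_on X" for n
    unfolding termC_def uC_def
    by (intro holomorphic_on_sum holomorphic_on_diff gc holomorphic_on_add holomorphic_on_mult holomorphic_on_const Z W S)
  fix x assume "x \<in> X"
  then obtain d where "d > 0" "cball x d \<subseteq> X" using X open_contains_cball by blast
  then show "\<exists>d>0. cball x d \<subseteq> X \<and> uniform_limit (cball x d) (\<lambda>n x. \<Sum>j<n. termC j (Z x) (W x) (S x))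
       (\<lambda>x. psiC (Z x) (W x) (S x)) sequentially"
    by (intro exI[of _ d] conjI uniform_limit_on_subset[OF psiC_uniform_limit[OF assms(1-4)]])
qed

section \<open>The real time change and its inverse\<close>

definition ur :: "nat \<Rightarrow> real \<Rightarrow> real \<Rightarrow> real" where
  "ur j x y = of_int (q j) * x - of_int (p j) * y"

definition psi :: "real \<Rightarrow> real \<Rightarrow> real \<Rightarrow> real" where
  "psi x y s = (\<Sum>j. gd 0 j (ur j x y + s * \<epsilon> j) - gd 0 j (ur j x y))"

definition tau :: "real \<Rightarrow> real \<Rightarrow> real \<Rightarrow> real" where
  "tau x y s = s + psi x y s"

definition sigma :: "real \<Rightarrow> real \<Rightarrow> real \<Rightarrow> real" where
  "sigma t x y = (THE s. tau x y s = t)"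

lemma ur_flow: "ur j (x + \<alpha> * s) (y + s) = ur j x y + s * \<epsilon> j"
  by (simp add: ur_def \<epsilon>_def algebra_simps)

lemma ur_shift: "ur j (x + of_int m) (y + of_int n) = ur j x y + of_int (q j * m - p j * n)"
  by (simp add: ur_def algebra_simps)

lemma termC_of_real: "termC j (of_real x) (of_real y) (of_real s) =
    of_real (gd 0 j (ur j x y + s * \<epsilon> j) - gd 0 j (ur j x y))"
  by (simp add: termC_def uC_def ur_def gd_0)

lemma psi_term_bound: "\<bar>gd 0 j (ur j x y + s * \<epsilon> j) - gd 0 j (ur j x y)\<bar> \<le> \<bar>s\<bar> * (1/4) ^ Suc j"
  using termC_bound[of "of_real x" "of_real y" "of_real s" j]
  unfolding termC_of_real by (simp only: norm_of_real of_real_strip simp_thms)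

lemma psi_summable: "summable (\<lambda>j. gd 0 j (ur j x y + s * \<epsilon> j) - gd 0 j (ur j x y))"
  by (rule summable_comparison_test'[OF summable_mult[OF quarter_summable, of "\<bar>s\<bar>"]])
     (simp only: real_norm_def psi_term_bound)

lemma psiC_of_real: "psiC (of_real x) (of_real y) (of_real s) = of_real (psi x y s)"
  unfolding psiC_def termC_of_real psi_def by (rule suminf_of_real[OF psi_summable, symmetric])

lemma psi_lipschitz: "\<bar>psi x y s - psi x y s'\<bar> \<le> \<bar>s - s'\<bar> / 3"
  using psiC_lipschitz[of "of_real x" "of_real y" "of_real s" "of_real s'"]
  unfolding psiC_of_real of_real_diff[symmetric] norm_of_real by simp

lemma psi_0 [simp]: "psi x y 0 = 0" by (simp add: psi_def)

lemma psi_bound: "\<bar>psi x y s\<bar> \<le> \<bar>s\<bar> / 3"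
  using psi_lipschitz[of x y s 0] by simp

lemma tau_0 [simp]: "tau x y 0 = 0" by (simp add: tau_def)

lemma tau_diff_ge: "\<bar>tau x y s - tau x y s'\<bar> \<ge> 2 / 3 * \<bar>s - s'\<bar>"
proof -
  have "s - s' = (tau x y s - tau x y s') - (psi x y s - psi x y s')" by (simp add: tau_def)
  then have "\<bar>s - s'\<bar> \<le> \<bar>tau x y s - tau x y s'\<bar> + \<bar>psi x y s - psi x y s'\<bar>"
    by (metis abs_triangle_ineq4)
  moreover have "2 / 3 * a \<le> b" if "a \<le> b + c" "c \<le> a / 3" for a b c :: real
    using that by linarith
  ultimately show ?thesis using psi_lipschitz[of x y s s'] by blast
qed

lemma tau_inj: "tau x y s = tau x y s' \<Longrightarrow> s = s'"
  using tau_diff_ge[of s s' x y] by simp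

lemma tau_continuous: "continuous_on UNIV (tau x y)"
proof -
  have "(1/3)-lipschitz_on UNIV (psi x y)"
    by (rule lipschitz_onI) (use psi_lipschitz in \<open>auto simp: dist_real_def\<close>)
  then have "continuous_on UNIV (psi x y)" by (rule lipschitz_on_continuous_on)
  then show ?thesis unfolding tau_def by (intro continuous_intros)
qed

lemma tau_surj: "\<exists>s. tau x y s = t"
proof -
  \<comment> \<open>The perturbation takes off at most a third, so \<open>tau\<close> is at least
    \<open>2 / 3 * K = \<bar>t\<bar>\<close> at \<open>K\<close> and at most
    \<open>- \<bar>t\<bar>\<close> at \<open>- K\<close>.\<close>
  define K where "K = 3 / 2 * \<bar>t\<bar>"
  have K: "K \<ge> 0" by (simp add: K_def)
  have "tau x y K \<ge> t" "tau x y (- K) \<le> t"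
    using psi_bound[of x y K] psi_bound[of x y "- K"] unfolding tau_def K_def by auto
  then have "\<exists>s\<ge>-K. s \<le> K \<and> tau x y s = t"
    using K by (intro IVT') (auto intro: continuous_on_subset[OF tau_continuous])
  then show ?thesis by blast
qed

lemma tau_sigma [simp]: "tau x y (sigma t x y) = t"
proof -
  have "\<exists>!s. tau x y s = t"
  proof (rule ex_ex1I[OF tau_surj])
    show "s = s'" if "tau x y s = t" "tau x y s' = t" for s s'
      using tau_inj[of x y s s'] that by simp
  qed
  then show ?thesis unfolding sigma_def by (rule theI')
qed

lemma sigma_unique: "tau x y s = t \<Longrightarrow> sigma t x y = s"
  using tau_inj tau_sigma by blast

lemma sigma_0 [simp]: "sigma 0 x y = 0"
  by (rule sigma_unique) simp

lemma sigma_bound: "\<bar>sigma t x y\<bar> \<le> 3 / 2 * \<bar>t\<bar>"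
  using tau_diff_ge[of "sigma t x y" 0 x y] by simp

text \<open>Along the linear flow the phase at scale \<open>j\<close> advances by
  \<open>s * \<epsilon> j\<close>, so the summands telescope. Inverted, this cocycle identity is the
  flow property of \<open>sigma\<close>.\<close>

lemma tau_cocycle: "tau x y (s + s') = tau x y s + tau (x + \<alpha> * s) (y + s) s'"
proof -
  have "psi x y (s + s') = psi x y s + psi (x + \<alpha> * s) (y + s) s'"
  proof -
    have "psi x y s + psi (x + \<alpha> * s) (y + s) s' = (\<Sum>j. (gd 0 j (ur j x y + s * \<epsilon> j) - gd 0 j (ur j x y)) +
        (gd 0 j (ur j (x + \<alpha> * s) (y + s) + s' * \<epsilon> j) - gd 0 j (ur j (x + \<alpha> * s) (y + s))))"
      unfolding psi_def by (rule suminf_add[OF psi_summable psi_summable])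
    also have "\<dots> = psi x y (s + s')"
      unfolding psi_def ur_flow by (simp add: algebra_simps)
    finally show ?thesis by simp
  qed
  then show ?thesis by (simp add: tau_def)
qed

lemma sigma_add: "sigma (t + t') x y = sigma t x y + sigma t' (x + \<alpha> * sigma t x y) (y + sigma t x y)"
  by (rule sigma_unique) (simp add: tau_cocycle)

lemma psi_periodic: "psi (x + of_int m) (y + of_int n) s = psi x y s"
proof -
  have eq: "gd 0 j (ur j x y + of_int k + s * \<epsilon> j) = gd 0 j (ur j x y + s * \<epsilon> j)" for j k
    using gd_periodic[of 0 j "ur j x y + s * \<epsilon> j" k] by (simp add: add_ac)
  show ?thesis unfolding psi_def ur_shift gd_periodic eq ..
qed

lemma sigma_periodic: "sigma t (x + of_int m) (y + of_int n) = sigma t x y"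
  unfolding sigma_def tau_def psi_periodic ..

text \<open>An implicit function theorem by Picard iteration for \<open>s = t - psiC z w s\<close>:
  the iterates are holomorphic in each parameter, contract by 1/3 and converge uniformly, so the
  limit is holomorphic; at real parameters it is the unique real solution.\<close>

lemma local_holomorphic_sigma:
  obtains R S where "R > 0" "R \<le> 1" "holomorphic3 R S"
    "\<And>a b c. \<bar>a\<bar> < R \<Longrightarrow> \<bar>b\<bar> < R \<Longrightarrow> \<bar>c\<bar> < R \<Longrightarrow>
       S (of_real a) (of_real b) (of_real c) = of_real (sigma (t0 + a) (x0 + b) (y0 + c))"
proof -
  define s0 where "s0 = sigma t0 x0 y0"
  have s0: "s0 + psi x0 y0 s0 = t0" using tau_sigma[of x0 y0 t0] by (simp add: tau_def s0_def)
  have "continuous_on (ball 0 1 \<times> ball 0 1) (\<lambda>p. psiC (of_real x0 + fst p) (of_real y0 + snd p) (of_real s0))"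
    by (rule psiC_continuous[where K = "\<bar>s0\<bar>"])
       (auto simp: strip_add intro!: continuous_intros)
  then have "isCont (\<lambda>p. psiC (of_real x0 + fst p) (of_real y0 + snd p) (of_real s0)) (0, 0)"
    by (rule continuous_on_interior) (auto simp: interior_open open_Times)
  then obtain d where d: "d > 0" "\<And>p. dist p (0, 0) < d \<Longrightarrow>
      dist (psiC (of_real x0 + fst p) (of_real y0 + snd p) (of_real s0)) (psiC (of_real x0) (of_real y0) (of_real s0)) < 1/4"
    unfolding continuous_at_eps_delta by (drule_tac x = "1/4" in spec) auto
  \<comment> \<open>With \<open>R \<le> 1/4\<close> and the variation of \<open>psiC\<close> at
    \<open>s0\<close> at most 1/4, an iterate within 1 of \<open>s0\<close> is followed by one
    within \<open>1/4 + 1/3 + 1/4 < 1\<close>; so the iterates never leave the strip.\<close>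
  define R where "R = min (1/4) (d / 2)"
  have R: "R > 0" "R \<le> 1/4" "R \<le> d / 2" using d by (auto simp: R_def)
  let ?B = "ball (0::complex) R"
  define X where "X = rec_nat (\<lambda>a b c. of_real s0) (\<lambda>n f a b c. of_real t0 + a - psiC (of_real x0 + b) (of_real y0 + c) (f a b c))"
  have X0: "X 0 a b c = of_real s0" and XS: "X (Suc n) a b c = of_real t0 + a - psiC (of_real x0 + b) (of_real y0 + c) (X n a b c)" for n a b c
    by (simp_all add: X_def)
  have strip1: "of_real x + b \<in> strip" if "b \<in> ?B" for b x
    using that R abs_Im_le_cmod[of b] by (auto simp: strip_def)
  have stripX: "z \<in> strip" if "norm (z - of_real s0) \<le> 1" for z
    using that abs_Im_le_cmod[of "z - of_real s0"] by (auto simp: strip_def)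
  have base: "norm (psiC (of_real x0 + b) (of_real y0 + c) (of_real s0) - psiC (of_real x0) (of_real y0) (of_real s0)) \<le> 1/4"
    if "b \<in> ?B" "c \<in> ?B" for b c
  proof -
    have "dist (b, c) (0, 0) \<le> norm b + norm c" by (simp add: dist_norm norm_Pair sqrt_sum_squares_le_sum)
    also have "\<dots> < d" using that R by simp
    finally show ?thesis using d(2)[of "(b, c)"] by (simp add: dist_norm)
  qed
  have near: "norm (X n a b c - of_real s0) \<le> 1" if abc: "a \<in> ?B" "b \<in> ?B" "c \<in> ?B" for n a b c
  proof (induction n)
    case (Suc n)
    have "X (Suc n) a b c - of_real s0 = a - (psiC (of_real x0 + b) (of_real y0 + c) (X n a b c) - psiC (of_real x0 + b) (of_real y0 + c) (of_real s0))
        - (psiC (of_real x0 + b) (of_real y0 + c) (of_real s0) - psiC (of_real x0) (of_real y0) (of_real s0))"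
      unfolding XS s0[symmetric] by (simp add: psiC_of_real)
    also have "norm \<dots> \<le> norm a + norm (psiC (of_real x0 + b) (of_real y0 + c) (X n a b c) - psiC (of_real x0 + b) (of_real y0 + c) (of_real s0))
       + norm (psiC (of_real x0 + b) (of_real y0 + c) (of_real s0) - psiC (of_real x0) (of_real y0) (of_real s0))"
      using order.trans[OF norm_triangle_ineq4 add_right_mono[OF norm_triangle_ineq4]] .
    finally have "norm (X (Suc n) a b c - of_real s0) \<le> norm a + norm (X n a b c - of_real s0) / 3 + 1/4"
      using base[OF abc(2,3)] psiC_lipschitz[OF strip1[OF abc(2), of x0] strip1[OF abc(3), of y0] stripX[OF Suc] of_real_strip[of s0]]
      by linarith
    then show ?case using Suc R abc by simp
  qed (simp add: X0)
  have inX: "X n a b c \<in> strip" "norm (X n a b c) \<le> \<bar>s0\<bar> + 1" if abc: "a \<in> ?B" "b \<in> ?B" "c \<in> ?B" for n a b c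
    using stripX[OF near[OF abc]] near[OF abc, of n] norm_triangle_ineq2[of "X n a b c" "of_real s0"] by auto
  have step: "norm (X (Suc n) a b c - X n a b c) \<le> (1/3) ^ n" if abc: "a \<in> ?B" "b \<in> ?B" "c \<in> ?B" for n a b c
  proof (induction n)
    case 0
    then show ?case using near[OF abc, of 1] by (simp add: X0)
  next
    case (Suc n)
    have "norm (X (Suc (Suc n)) a b c - X (Suc n) a b c) =
       norm (psiC (of_real x0 + b) (of_real y0 + c) (X (Suc n) a b c) - psiC (of_real x0 + b) (of_real y0 + c) (X n a b c))"
      unfolding XS[of "Suc n"] XS[of n a b c] by (simp add: norm_minus_commute)
    also have "\<dots> \<le> norm (X (Suc n) a b c - X n a b c) / 3"
      by (intro psiC_lipschitz strip1 inX abc)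
    finally show ?case using Suc by simp
  qed
  define S where "S a b c = of_real s0 + (\<Sum>n. X (Suc n) a b c - X n a b c)" for a b c
  have "uniform_limit (?B \<times> ?B \<times> ?B) (\<lambda>n p. \<Sum>i<n. X (Suc i) (fst p) (fst (snd p)) (snd (snd p)) - X i (fst p) (fst (snd p)) (snd (snd p)))
      (\<lambda>p. \<Sum>i. X (Suc i) (fst p) (fst (snd p)) (snd (snd p)) - X i (fst p) (fst (snd p)) (snd (snd p))) sequentially"
    by (rule Weierstrass_m_test[where M = "\<lambda>n. (1/3) ^ n"]) (use step in \<open>auto intro: summable_geometric\<close>)
  then have "uniform_limit (?B \<times> ?B \<times> ?B) (\<lambda>n p. of_real s0 + (\<Sum>i<n. X (Suc i) (fst p) (fst (snd p)) (snd (snd p)) - X i (fst p) (fst (snd p)) (snd (snd p))))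
      (\<lambda>p. of_real s0 + (\<Sum>i. X (Suc i) (fst p) (fst (snd p)) (snd (snd p)) - X i (fst p) (fst (snd p)) (snd (snd p)))) sequentially"
    by (intro uniform_limit_add uniform_limit_const)
  moreover have "(\<Sum>i<n. X (Suc i) a b c - X i a b c) = X n a b c - of_real s0" for n a b c
    using sum_lessThan_telescope[of "\<lambda>i. X i a b c" n] by (simp add: X0)
  ultimately have ul: "uniform_limit (?B \<times> ?B \<times> ?B) (\<lambda>n (a, b, c). X n a b c) (\<lambda>(a, b, c). S a b c) sequentially"
    by (simp add: S_def case_prod_unfold)
  have Xh: "continuous_on (?B \<times> ?B \<times> ?B) (\<lambda>(a, b, c). X n a b c) \<and>
     (\<forall>b\<in>?B. \<forall>c\<in>?B. (\<lambda>a. X n a b c) holomorphic_on ?B) \<and>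
     (\<forall>a\<in>?B. \<forall>c\<in>?B. (\<lambda>b. X n a b c) holomorphic_on ?B) \<and>
     (\<forall>a\<in>?B. \<forall>b\<in>?B. (\<lambda>c. X n a b c) holomorphic_on ?B)" for n
  proof (induction n)
    case (Suc n)
    have cX: "continuous_on (?B \<times> ?B \<times> ?B) (\<lambda>p. X n (fst p) (fst (snd p)) (snd (snd p)))"
      using Suc by (simp add: case_prod_unfold)
    have "continuous_on (?B \<times> ?B \<times> ?B) (\<lambda>p. of_real t0 + fst p - psiC (of_real x0 + fst (snd p)) (of_real y0 + snd (snd p)) (X n (fst p) (fst (snd p)) (snd (snd p))))"
      by (intro continuous_on_diff continuous_on_add continuous_on_const continuous_on_fst continuous_on_snd continuous_on_id
          psiC_continuous[where K = "\<bar>s0\<bar> + 1"] cX) (use strip1 inX in auto)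
    moreover have "(\<lambda>a. of_real t0 + a - psiC (of_real x0 + b) (of_real y0 + c) (X n a b c)) holomorphic_on ?B" if "b \<in> ?B" "c \<in> ?B" for b c
      by (intro holomorphic_on_diff holomorphic_on_add holomorphic_on_const holomorphic_on_ident
          psiC_holomorphic[where K = "\<bar>s0\<bar> + 1"]) (use strip1 inX that Suc in auto)
    moreover have "(\<lambda>b. of_real t0 + a - psiC (of_real x0 + b) (of_real y0 + c) (X n a b c)) holomorphic_on ?B" if "a \<in> ?B" "c \<in> ?B" for a c
      by (intro holomorphic_on_diff holomorphic_on_add holomorphic_on_const holomorphic_on_ident
          psiC_holomorphic[where K = "\<bar>s0\<bar> + 1"]) (use strip1 inX that Suc in auto)
    moreover have "(\<lambda>c. of_real t0 + a - psiC (of_real x0 + b) (of_real y0 + c) (X n a b c)) holomorphic_on ?B" if "a \<in> ?B" "b \<in> ?B" for a b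
      by (intro holomorphic_on_diff holomorphic_on_add holomorphic_on_const holomorphic_on_ident
          psiC_holomorphic[where K = "\<bar>s0\<bar> + 1"]) (use strip1 inX that Suc in auto)
    ultimately show ?case unfolding XS by (simp add: case_prod_unfold)
  qed (simp add: X0)
  have Slim: "(\<lambda>n. X n a b c) \<longlonglongrightarrow> S a b c" if "a \<in> ?B" "b \<in> ?B" "c \<in> ?B" for a b c
    using tendsto_uniform_limitI[OF ul, of "(a, b, c)"] that by simp
  have hol_lim: "f holomorphic_on ?B" if "\<And>n. F n holomorphic_on ?B" "uniform_limit ?B F f sequentially" for f F
  proof (rule holomorphic_uniform_sequence[of _ F])
    fix x :: complex assume "x \<in> ?B"
    then obtain d where "d > 0" "cball x d \<subseteq> ?B" using open_contains_cball open_ball by blast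
    then show "\<exists>d>0. cball x d \<subseteq> ?B \<and> uniform_limit (cball x d) F f sequentially"
      using uniform_limit_on_subset[OF that(2)] by blast
  qed (use that in auto)
  have hX: "b \<in> ?B \<Longrightarrow> c \<in> ?B \<Longrightarrow> (\<lambda>a. X n a b c) holomorphic_on ?B"
    "a \<in> ?B \<Longrightarrow> c \<in> ?B \<Longrightarrow> (\<lambda>b. X n a b c) holomorphic_on ?B"
    "a \<in> ?B \<Longrightarrow> b \<in> ?B \<Longrightarrow> (\<lambda>c. X n a b c) holomorphic_on ?B" for n a b c
    using Xh[of n] by blast+
  have h3: "holomorphic3 R S"
    unfolding holomorphic3_def
  proof (intro conjI ballI)
    show "continuous_on (?B \<times> ?B \<times> ?B) (\<lambda>(a, b, c). S a b c)"
      by (rule uniform_limit_theorem[OF _ ul]) (use Xh in auto)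
    fix a b assume ab: "a \<in> ?B" "b \<in> ?B"
    have "uniform_limit ?B (\<lambda>n c. X n c a b) (\<lambda>c. S c a b) sequentially"
      using uniform_limit_compose'[OF ul, of "\<lambda>c. (c, a, b)" ?B] ab by auto
    then show "(\<lambda>c. S c a b) holomorphic_on ?B"
      by (rule hol_lim[rotated]) (rule hX(1)[OF ab])
    have "uniform_limit ?B (\<lambda>n c. X n a c b) (\<lambda>c. S a c b) sequentially"
      using uniform_limit_compose'[OF ul, of "\<lambda>c. (a, c, b)" ?B] ab by auto
    then show "(\<lambda>c. S a c b) holomorphic_on ?B"
      by (rule hol_lim[rotated]) (rule hX(2)[OF ab])
    have "uniform_limit ?B (\<lambda>n c. X n a b c) (\<lambda>c. S a b c) sequentially"
      using uniform_limit_compose'[OF ul, of "\<lambda>c. (a, b, c)" ?B] ab by auto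
    then show "(\<lambda>c. S a b c) holomorphic_on ?B"
      by (rule hol_lim[rotated]) (rule hX(3)[OF ab])
  qed
  have Sreal: "S (of_real a) (of_real b) (of_real c) = of_real (sigma (t0 + a) (x0 + b) (y0 + c))"
    if abc: "\<bar>a\<bar> < R" "\<bar>b\<bar> < R" "\<bar>c\<bar> < R" for a b c
  proof -
    have B: "of_real a \<in> ?B" "of_real b \<in> ?B" "of_real c \<in> ?B" using abc by auto
    define \<sigma> where "\<sigma> = sigma (t0 + a) (x0 + b) (y0 + c)"
    have \<sigma>: "\<sigma> = t0 + a - psi (x0 + b) (y0 + c) \<sigma>"
      using tau_sigma[of "x0 + b" "y0 + c" "t0 + a"] by (simp add: tau_def \<sigma>_def)
    have con: "norm (X (Suc n) (of_real a) (of_real b) (of_real c) - of_real \<sigma>) \<le> norm (X n (of_real a) (of_real b) (of_real c) - of_real \<sigma>) / 3" for n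
    proof -
      have "of_real \<sigma> = (of_real t0 + of_real a - psiC (of_real x0 + of_real b) (of_real y0 + of_real c) (of_real \<sigma>) :: complex)"
        using \<sigma> psiC_of_real[of "x0 + b" "y0 + c" \<sigma>] by (metis of_real_add of_real_diff)
      then have "X (Suc n) (of_real a) (of_real b) (of_real c) - of_real \<sigma> =
        - (psiC (of_real x0 + of_real b) (of_real y0 + of_real c) (X n (of_real a) (of_real b) (of_real c)) -
         psiC (of_real x0 + of_real b) (of_real y0 + of_real c) (of_real \<sigma>))"
        unfolding XS by (simp add: algebra_simps)
      then show ?thesis
        using psiC_lipschitz[OF strip1[OF B(2)] strip1[OF B(3)] inX(1)[OF B] of_real_strip] by (simp add: norm_minus_commute)
    qed
    have lim: "(\<lambda>n. norm (X n (of_real a) (of_real b) (of_real c) - of_real \<sigma>)) \<longlonglongrightarrow> norm (S (of_real a) (of_real b) (of_real c) - of_real \<sigma>)"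
      by (intro tendsto_norm tendsto_diff Slim B tendsto_const)
    \<comment> \<open>In the limit the distance is at most a third of itself, hence 0.\<close>
    have "norm (S (of_real a) (of_real b) (of_real c) - of_real \<sigma>) \<le> norm (S (of_real a) (of_real b) (of_real c) - of_real \<sigma>) / 3"
      by (rule tendsto_le[OF _ tendsto_divide[OF lim tendsto_const] LIMSEQ_Suc[OF lim]]) (use con in auto)
    then show ?thesis by (simp add: \<sigma>_def)
  qed
  show thesis
    by (rule that[OF R(1) _ h3 Sreal]) (use R in auto)
qed

end

section \<open>The flow on the torus\<close>

lemma cis_2pi_shift: "cis (2 * pi * (x + of_int m)) = cis (2 * pi * x)"
  by (simp add: distrib_left cis_mult[symmetric] cis_multiple_2pi)

lemma Arg2pi_cis: "Arg2pi (cis (2 * pi * x)) / (2 * pi) = frac x"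
proof -
  have "cis (2 * pi * x) = cis (2 * pi * frac x)"
    using cis_2pi_shift[of "frac x" "\<lfloor>x\<rfloor>"] by (simp add: frac_def)
  moreover have "Arg2pi (cis (2 * pi * frac x)) = 2 * pi * frac x"
    by (rule Arg2pi_unique[of 1]) (auto simp: cis_conv_exp frac_lt_1)
  ultimately show ?thesis by simp
qed

lemma torus_proj_in_torus [simp]: "torus_proj p \<in> torus"
  by (simp add: torus_proj_def torus_def)

lemma torus_proj_shift: "torus_proj (x + of_int m, y + of_int n) = torus_proj (x, y)"
  by (simp only: torus_proj_def fst_conv snd_conv cis_2pi_shift)

text \<open>The inverse of \<open>torus_proj\<close> with values in the fundamental domain. It jumps
  across the two seams, so that only periodic functions of it can be expected to be continuous on
  the torus.\<close>

definition torus_coord :: "complex \<times> complex \<Rightarrow> real \<times> real" where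
  "torus_coord z = (Arg2pi (fst z) / (2 * pi), Arg2pi (snd z) / (2 * pi))"

lemma torus_coord_proj: "torus_coord (torus_proj (x, y)) = (frac x, frac y)"
  by (simp add: torus_coord_def torus_proj_def Arg2pi_cis)

lemma torus_proj_coord: "z \<in> torus \<Longrightarrow> torus_proj (torus_coord z) = z"
proof -
  have "cis (Arg2pi w) = w" if "norm w = 1" for w
    using Arg2pi_eq[of w] that by (simp add: cis_conv_exp)
  then show "z \<in> torus \<Longrightarrow> torus_proj (torus_coord z) = z"
    by (cases z) (simp add: torus_coord_def torus_proj_def torus_def)
qed

context time_change
begin

section \<open>Smooth density and analytic flow\<close>

lemma gd_le: "\<bar>gd k j u\<bar> \<le> fact k * \<beta> j"
proof -
  have "\<bar>gd k j u\<bar> * 1 \<le> \<bar>gd k j u\<bar> * of_int (q j) ^ k"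
    using q_pos_real[of j] by (intro mult_left_mono one_le_power) auto
  then show ?thesis using gd_bound[of k j u] by simp
qed

text \<open>The derivative of order \<open>a\<close> in \<open>x\<close> and \<open>b\<close> in
  \<open>y\<close> of the sum over \<open>j\<close> of \<open>\<epsilon> j\<close> times the
  derivative of \<open>g j\<close> at the phase. The whole family is closed under differentiation,
  so \<open>C_k\<close> follows for all members at once by induction on \<open>k\<close>.\<close>

definition density_deriv :: "nat \<Rightarrow> nat \<Rightarrow> real \<Rightarrow> real \<Rightarrow> real" where
  "density_deriv a b x y = (\<Sum>j. \<epsilon> j * (of_int (q j) ^ a * (- of_int (p j)) ^ b) * gd (Suc (a + b)) j (ur j x y))"

text \<open>The rate of flow time per unit of linear time, that is, the derivative of
  \<open>tau\<close> along orbits. The linear flow preserves area, so its time change preserves the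
  measure with this density.\<close>

definition v :: "real \<Rightarrow> real \<Rightarrow> real" where "v x y = 1 + density_deriv 0 0 x y"

text \<open>As \<open>\<bar>p j\<bar> \<le> q j\<close>, the integer coefficient is at most
  \<open>q j ^ (a + b)\<close> in absolute value, which the gain in \<open>gd_bound\<close> absorbs;
  the factor \<open>\<epsilon> j * \<beta> j\<close> leaves a geometric series at every
  order.\<close>

lemma density_deriv_term_bound:
  "\<bar>\<epsilon> j * (of_int (q j) ^ a * (- of_int (p j)) ^ b) * gd (Suc (a + b)) j u\<bar> \<le> fact (Suc (a + b)) * (1/4) ^ Suc j"
proof -
  have q1: "real_of_int (q j) \<ge> 1" by (rule q_pos_real)
  have "\<bar>- real_of_int (p j)\<bar> \<le> real_of_int (q j)" using p_bound[of j] by simp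
  then have "\<bar>- real_of_int (p j)\<bar> ^ b \<le> real_of_int (q j) ^ b" by (intro power_mono) auto
  then have "real_of_int (q j) ^ a * \<bar>- real_of_int (p j)\<bar> ^ b \<le> real_of_int (q j) ^ a * real_of_int (q j) ^ b"
    using q1 by (intro mult_left_mono) auto
  also have "\<dots> \<le> real_of_int (q j) ^ Suc (a + b)"
    unfolding power_add[symmetric] using q1 by (intro power_increasing) auto
  finally have 1: "real_of_int (q j) ^ a * \<bar>- real_of_int (p j)\<bar> ^ b \<le> real_of_int (q j) ^ Suc (a + b)" .
  have "\<bar>\<epsilon> j * (of_int (q j) ^ a * (- of_int (p j)) ^ b) * gd (Suc (a + b)) j u\<bar> =
     \<epsilon> j * ((real_of_int (q j) ^ a * \<bar>- real_of_int (p j)\<bar> ^ b) * \<bar>gd (Suc (a + b)) j u\<bar>)"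
    using eps_pos[of j] q1 by (simp add: abs_mult power_abs)
  also have "\<dots> \<le> \<epsilon> j * (real_of_int (q j) ^ Suc (a + b) * \<bar>gd (Suc (a + b)) j u\<bar>)"
    using 1 eps_pos[of j] by (intro mult_left_mono mult_right_mono) auto
  also have "\<dots> \<le> \<epsilon> j * (fact (Suc (a + b)) * \<beta> j)"
    using gd_bound[of "Suc (a + b)" j u] eps_pos[of j] by (intro mult_left_mono) (auto simp: mult.commute)
  also have "\<dots> = fact (Suc (a + b)) * (\<epsilon> j * \<beta> j)" by simp
  also have "\<dots> \<le> fact (Suc (a + b)) * (1/4) ^ Suc j" by (intro mult_left_mono eps_beta) auto
  finally show ?thesis .
qed

lemma density_deriv_uniform_limit:
  "uniform_limit UNIV (\<lambda>n w. \<Sum>j<n. \<epsilon> j * (of_int (q j) ^ a * (- of_int (p j)) ^ b) * gd (Suc (a + b)) j (ur j (fst w) (snd w)))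
     (\<lambda>w. density_deriv a b (fst w) (snd w)) sequentially"
  unfolding density_deriv_def
  by (rule Weierstrass_m_test[OF _ summable_mult[OF quarter_summable, of "fact (Suc (a + b))"]])
     (simp only: real_norm_def density_deriv_term_bound)

lemma density_deriv_summable:
  "summable (\<lambda>j. \<epsilon> j * (of_int (q j) ^ a * (- of_int (p j)) ^ b) * gd (Suc (a + b)) j (ur j x y))"
  by (rule summable_comparison_test'[OF summable_mult[OF quarter_summable, of "fact (Suc (a + b))"]])
     (simp only: real_norm_def density_deriv_term_bound)

lemma density_deriv_has_derivative:
  "((\<lambda>w. density_deriv a b (fst w) (snd w)) has_derivative
     (\<lambda>h. fst h * density_deriv (Suc a) b (fst w) (snd w) + snd h * density_deriv a (Suc b) (fst w) (snd w))) (at w)"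
proof -
  define f where "f j w = \<epsilon> j * (of_int (q j) ^ a * (- of_int (p j)) ^ b) * gd (Suc (a + b)) j (ur j (fst w) (snd w))" for j w
  define A where "A j w = \<epsilon> j * (of_int (q j) ^ Suc a * (- of_int (p j)) ^ b) * gd (Suc (Suc a + b)) j (ur j (fst w) (snd w))" for j w
  define B where "B j w = \<epsilon> j * (of_int (q j) ^ a * (- of_int (p j)) ^ Suc b) * gd (Suc (a + Suc b)) j (ur j (fst w) (snd w))" for j w
  have ulA: "uniform_limit UNIV (\<lambda>n w. \<Sum>j<n. A j w) (\<lambda>w. density_deriv (Suc a) b (fst w) (snd w)) sequentially"
    unfolding A_def by (rule density_deriv_uniform_limit)
  have ulB: "uniform_limit UNIV (\<lambda>n w. \<Sum>j<n. B j w) (\<lambda>w. density_deriv a (Suc b) (fst w) (snd w)) sequentially"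
    unfolding B_def by (rule density_deriv_uniform_limit)
  have der: "(f j has_derivative (\<lambda>h. fst h * A j w + snd h * B j w)) (at w within UNIV)" for j w
  proof -
    have u: "((\<lambda>w. ur j (fst w) (snd w)) has_derivative (\<lambda>h. of_int (q j) * fst h - of_int (p j) * snd h)) (at w)"
      unfolding ur_def by (auto intro!: derivative_eq_intros)
    have "((\<lambda>w. gd (Suc (a + b)) j (ur j (fst w) (snd w))) has_derivative
       (\<lambda>h. (of_int (q j) * fst h - of_int (p j) * snd h) * gd (Suc (Suc (a + b))) j (ur j (fst w) (snd w)))) (at w)"
      using has_derivative_compose[OF u gd_deriv[unfolded has_field_derivative_def]] by (simp add: mult.commute)
    then have "(f j has_derivative (\<lambda>h. \<epsilon> j * (of_int (q j) ^ a * (- of_int (p j)) ^ b) *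
       ((of_int (q j) * fst h - of_int (p j) * snd h) * gd (Suc (Suc (a + b))) j (ur j (fst w) (snd w))))) (at w)"
      unfolding f_def by (rule has_derivative_mult_right)
    then show ?thesis by (simp add: A_def B_def algebra_simps)
  qed
  have "\<exists>F. \<forall>w\<in>UNIV. (\<lambda>j. f j w) sums F w \<and> (F has_derivative
     (\<lambda>h. fst h * density_deriv (Suc a) b (fst w) (snd w) + snd h * density_deriv a (Suc b) (fst w) (snd w))) (at w within UNIV)"
  proof (rule has_derivative_series[OF _ der])
    show "(\<lambda>j. f j (0, 0)) sums density_deriv a b 0 0"
      using summable_sums[OF density_deriv_summable[of a b 0 0]] by (simp add: f_def density_deriv_def)
    fix e :: real assume e: "e > 0"
    have "\<forall>\<^sub>F n in sequentially. \<forall>w\<in>UNIV. dist (\<Sum>j<n. A j w) (density_deriv (Suc a) b (fst w) (snd w)) < e / 2"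
      using uniform_limitD[OF ulA, of "e / 2"] e by simp
    moreover have "\<forall>\<^sub>F n in sequentially. \<forall>w\<in>UNIV. dist (\<Sum>j<n. B j w) (density_deriv a (Suc b) (fst w) (snd w)) < e / 2"
      using uniform_limitD[OF ulB, of "e / 2"] e by simp
    ultimately show "\<forall>\<^sub>F n in sequentially. \<forall>w\<in>UNIV. \<forall>h. norm ((\<Sum>j<n. fst h * A j w + snd h * B j w) -
        (fst h * density_deriv (Suc a) b (fst w) (snd w) + snd h * density_deriv a (Suc b) (fst w) (snd w))) \<le> e * norm h"
    proof eventually_elim
      case (elim n)
      show ?case
      proof (intro ballI allI)
        fix w h :: "real \<times> real"
        let ?a = "(\<Sum>j<n. A j w) - density_deriv (Suc a) b (fst w) (snd w)"
        let ?b = "(\<Sum>j<n. B j w) - density_deriv a (Suc b) (fst w) (snd w)"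
        have "norm ((\<Sum>j<n. fst h * A j w + snd h * B j w) -
          (fst h * density_deriv (Suc a) b (fst w) (snd w) + snd h * density_deriv a (Suc b) (fst w) (snd w)))
          = \<bar>fst h * ?a + snd h * ?b\<bar>"
          by (simp add: sum.distrib sum_distrib_left[symmetric] algebra_simps)
        also have "\<dots> \<le> \<bar>fst h\<bar> * \<bar>?a\<bar> + \<bar>snd h\<bar> * \<bar>?b\<bar>"
          using abs_triangle_ineq[of "fst h * ?a" "snd h * ?b"] by (simp only: abs_mult)
        also have "\<dots> \<le> norm h * (e / 2) + norm h * (e / 2)"
          using elim[rule_format, of w] norm_fst_le[of "fst h" "snd h"] norm_snd_le[of "snd h" "fst h"] e
          by (intro add_mono mult_mono) (auto simp: dist_real_def intro: less_imp_le)
        finally show "norm ((\<Sum>j<n. fst h * A j w + snd h * B j w) -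
          (fst h * density_deriv (Suc a) b (fst w) (snd w) + snd h * density_deriv a (Suc b) (fst w) (snd w))) \<le> e * norm h"
          by (simp add: mult.commute)
      qed
    qed
  qed auto
  then obtain F where "\<forall>w\<in>UNIV. (\<lambda>j. f j w) sums F w \<and> (F has_derivative
     (\<lambda>h. fst h * density_deriv (Suc a) b (fst w) (snd w) + snd h * density_deriv a (Suc b) (fst w) (snd w))) (at w within UNIV)"
    by (rule exE)
  then have F: "(\<lambda>j. f j w) sums F w" "(F has_derivative
     (\<lambda>h. fst h * density_deriv (Suc a) b (fst w) (snd w) + snd h * density_deriv a (Suc b) (fst w) (snd w))) (at w)" for w
    by (simp_all only: UNIV_I simp_thms Ball_def)
  have "F = (\<lambda>w. density_deriv a b (fst w) (snd w))"
    using sums_unique[OF F(1)] by (simp add: fun_eq_iff f_def density_deriv_def)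
  then show ?thesis using F(2) by simp
qed

lemma C_k_density_deriv: "C_k k (\<lambda>w. c + density_deriv a b (fst w) (snd w))"
proof (induction k arbitrary: a b c)
  case 0
  have "continuous_on UNIV (\<lambda>w. density_deriv a b (fst w) (snd w))"
    using has_derivative_continuous[OF density_deriv_has_derivative] by (simp add: continuous_on_eq_continuous_at)
  then show ?case by (simp add: continuous_on_add)
next
  case (Suc k)
  have d: "((\<lambda>w. c + density_deriv a b (fst w) (snd w)) has_derivative
     (\<lambda>h. fst h * density_deriv (Suc a) b (fst w) (snd w) + snd h * density_deriv a (Suc b) (fst w) (snd w))) (at w)" for w
    using has_derivative_add[OF has_derivative_const density_deriv_has_derivative, of c] by simp
  have fd: "frechet_derivative (\<lambda>w. c + density_deriv a b (fst w) (snd w)) (at w) =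
     (\<lambda>h. fst h * density_deriv (Suc a) b (fst w) (snd w) + snd h * density_deriv a (Suc b) (fst w) (snd w))" for w
    using frechet_derivative_at[OF d] by simp
  have B: "(Basis :: (real \<times> real) set) = {(1, 0), (0, 1)}"
    by (auto simp: Basis_prod_def)
  show ?case
    using Suc[of 0 "Suc a" b] Suc[of 0 a "Suc b"] d
    unfolding C_k.simps fd B by (auto simp: differentiable_def)
qed

lemma v_bounds: "2/3 \<le> v x y" "v x y \<le> 4/3"
proof -
  have "norm (density_deriv 0 0 x y) \<le> (\<Sum>j. fact (Suc (0 + 0)) * (1/4) ^ Suc j)"
    unfolding density_deriv_def
    by (rule norm_suminf_le[OF _ summable_mult[OF quarter_summable]]) (simp only: real_norm_def density_deriv_term_bound)
  also have "\<dots> = 1/3" using quarter_suminf by simp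
  finally show "2/3 \<le> v x y" "v x y \<le> 4/3" unfolding v_def by (simp_all add: abs_le_iff)
qed

lemma v_pos: "v x y > 0" using v_bounds[of x y] by linarith

lemma v_continuous: "continuous_on UNIV (\<lambda>w. v (fst w) (snd w))"
  using C_k_density_deriv[of 0 1 0 0] by (simp add: v_def)

lemma v_periodic: "v (x + of_int m) (y + of_int n) = v x y"
  unfolding v_def density_deriv_def ur_shift gd_periodic ..

lemma tau_has_derivative: "(tau x y has_real_derivative v (x + \<alpha> * s) (y + s)) (at s)"
proof -
  have "((\<lambda>s. \<Sum>j. gd 0 j (ur j x y + s * \<epsilon> j) - gd 0 j (ur j x y)) has_field_derivative
      (\<Sum>j. gd 1 j (ur j x y + s * \<epsilon> j) * \<epsilon> j)) (at s)"
  proof (rule has_field_derivative_series'[of UNIV])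
    show "((\<lambda>s. gd 0 j (ur j x y + s * \<epsilon> j) - gd 0 j (ur j x y)) has_field_derivative gd 1 j (ur j x y + s * \<epsilon> j) * \<epsilon> j) (at s within UNIV)" for j s
    proof -
      have "((\<lambda>s. ur j x y + s * \<epsilon> j) has_real_derivative \<epsilon> j) (at s)" by (auto intro!: derivative_eq_intros)
      from DERIV_chain2[where f = "gd 0 j" and g = "\<lambda>s. ur j x y + s * \<epsilon> j", OF gd_deriv this]
      show ?thesis using DERIV_diff[OF _ DERIV_const] by fastforce
    qed
    show "uniformly_convergent_on UNIV (\<lambda>n s. \<Sum>i<n. gd 1 i (ur i x y + s * \<epsilon> i) * \<epsilon> i)"
    proof (rule Weierstrass_m_test'[OF _ quarter_summable])
      fix j s
      have "\<bar>gd 1 j (ur j x y + s * \<epsilon> j)\<bar> * \<epsilon> j \<le> \<beta> j * \<epsilon> j"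
        using gd_le[of 1 j] eps_pos[of j] by (intro mult_right_mono) auto
      then have "\<bar>gd 1 j (ur j x y + s * \<epsilon> j)\<bar> * \<epsilon> j \<le> (1/4) ^ Suc j"
        using eps_beta[of j] mult.commute[of "\<beta> j" "\<epsilon> j"] by linarith
      then show "norm (gd 1 j (ur j x y + s * \<epsilon> j) * \<epsilon> j) \<le> (1/4) ^ Suc j"
        unfolding real_norm_def abs_mult abs_of_pos[OF eps_pos] .
    qed
    show "summable (\<lambda>j. gd 0 j (ur j x y + 0 * \<epsilon> j) - gd 0 j (ur j x y))" by simp
  qed auto
  then have "(psi x y has_field_derivative (\<Sum>j. gd 1 j (ur j x y + s * \<epsilon> j) * \<epsilon> j)) (at s)"
    by (simp add: psi_def[abs_def])
  then have "(tau x y has_field_derivative 1 + (\<Sum>j. gd 1 j (ur j x y + s * \<epsilon> j) * \<epsilon> j)) (at s)"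
    unfolding tau_def[abs_def] by (intro DERIV_add DERIV_ident)
  moreover have "1 + (\<Sum>j. gd 1 j (ur j x y + s * \<epsilon> j) * \<epsilon> j) = v (x + \<alpha> * s) (y + s)"
    unfolding v_def density_deriv_def ur_flow by (simp add: mult.commute)
  ultimately show ?thesis by simp
qed

lemma sigma_isCont: "isCont (\<lambda>(t, x, y). sigma t x y) (t0, x0, y0)"
proof -
  obtain R S where R: "R > 0" "R \<le> 1" and S: "holomorphic3 R S" and eq:
    "\<And>a b c. \<bar>a\<bar> < R \<Longrightarrow> \<bar>b\<bar> < R \<Longrightarrow> \<bar>c\<bar> < R \<Longrightarrow>
       S (of_real a) (of_real b) (of_real c) = of_real (sigma (t0 + a) (x0 + b) (y0 + c))"
    by (rule local_holomorphic_sigma[of t0 x0 y0]) (rule that)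
  define U where "U = ball t0 R \<times> ball x0 R \<times> ball y0 R"
  have cS: "continuous_on (ball 0 R \<times> ball 0 R \<times> ball 0 R) (\<lambda>(a, b, c). S a b c)"
    using S by (simp add: holomorphic3_def)
  have cm: "continuous_on U (\<lambda>p. (of_real (fst p - t0) :: complex, of_real (fst (snd p) - x0) :: complex, of_real (snd (snd p) - y0) :: complex))"
    by (intro continuous_intros)
  have "continuous_on U (\<lambda>p. (\<lambda>(a, b, c). S a b c) (of_real (fst p - t0), of_real (fst (snd p) - x0), of_real (snd (snd p) - y0)))"
    by (rule continuous_on_compose2[OF cS cm])
       (auto simp: U_def dist_real_def abs_minus_commute simp flip: of_real_diff)
  then have "continuous_on U (\<lambda>p. Re ((\<lambda>(a, b, c). S a b c) (of_real (fst p - t0), of_real (fst (snd p) - x0), of_real (snd (snd p) - y0))))"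
    by (rule continuous_on_Re)
  moreover have "Re ((\<lambda>(a, b, c). S a b c) (of_real (fst p - t0), of_real (fst (snd p) - x0), of_real (snd (snd p) - y0))) = (\<lambda>(t, x, y). sigma t x y) p"
    if "p \<in> U" for p
    using eq[of "fst p - t0" "fst (snd p) - x0" "snd (snd p) - y0"] that
    by (auto simp: U_def dist_real_def case_prod_unfold simp flip: of_real_diff)
  ultimately have "continuous_on U (\<lambda>(t, x, y). sigma t x y)"
    by (rule continuous_on_eq)
  then show ?thesis
    by (rule continuous_on_interior) (use R in \<open>auto simp: U_def interior_open open_Times\<close>)
qed

lemma sigma_continuous: "continuous_on UNIV (\<lambda>(t, x, y). sigma t x y)"
  using sigma_isCont by (auto simp: continuous_on_eq_continuous_at)

definition flow :: "real \<Rightarrow> complex \<times> complex \<Rightarrow> complex \<times> complex" where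
  "flow t z = (let (x, y) = torus_coord z; s = sigma t x y in torus_proj (x + \<alpha> * s, y + s))"

text \<open>Both \<open>sigma\<close> and \<open>torus_proj\<close> ignore integer translations, so
  the representative chosen in \<open>flow\<close> is immaterial. This moves computations with the
  flow to the plane.\<close>

lemma flow_proj: "flow t (torus_proj (x, y)) = torus_proj (x + \<alpha> * sigma t x y, y + sigma t x y)"
proof -
  have fx: "frac x = x + of_int (- \<lfloor>x\<rfloor>)" for x :: real by (simp add: frac_def)
  have s: "sigma t (frac x) (frac y) = sigma t x y"
    unfolding fx by (rule sigma_periodic)
  have "torus_proj (frac x + \<alpha> * sigma t x y, frac y + sigma t x y) = torus_proj (x + \<alpha> * sigma t x y + of_int (- \<lfloor>x\<rfloor>), y + sigma t x y + of_int (- \<lfloor>y\<rfloor>))"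
    by (simp add: frac_def algebra_simps)
  also have "\<dots> = torus_proj (x + \<alpha> * sigma t x y, y + sigma t x y)" by (rule torus_proj_shift)
  finally show ?thesis by (simp add: flow_def torus_coord_proj s Let_def)
qed

lemma torus_cases:
  assumes "z \<in> torus"
  obtains x y where "z = torus_proj (x, y)"
  using torus_proj_coord[OF assms] that[of "fst (torus_coord z)" "snd (torus_coord z)"] by simp

text \<open>The flow property is the cocycle identity for \<open>sigma\<close>. For analyticity, the
  two circle coordinates of the image are exponentials of the local holomorphic extension of
  \<open>sigma\<close>, hence power series in time and position.\<close>

lemma real_analytic_torus_flow_flow: "real_analytic_torus_flow flow"
  unfolding real_analytic_torus_flow_def
proof (intro conjI allI ballI)
  show "flow t ` torus \<subseteq> torus" for t by (auto simp: flow_def Let_def case_prod_unfold)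
  show "flow 0 z = z" if "z \<in> torus" for z
    using that by (elim torus_cases) (simp add: flow_proj)
  show "flow (s + t) z = flow s (flow t z)" if zt: "z \<in> torus" for s t z
  proof -
    obtain x y where z: "z = torus_proj (x, y)" by (rule torus_cases[OF zt]) (rule that)
    have "sigma (s + t) x y = sigma t x y + sigma s (x + \<alpha> * sigma t x y) (y + sigma t x y)"
      using sigma_add[of t s x y] by (simp only: add.commute)
    then show ?thesis by (simp only: z flow_proj distrib_left add.assoc)
  qed
  show "real_analytic (\<lambda>(t, p). flow t (torus_proj p))"
    unfolding real_analytic_def
  proof
    fix P :: "real \<times> real \<times> real"
    obtain t0 x0 y0 where P: "P = (t0, x0, y0)" by (cases P)
    obtain R S where R: "R > 0" "R \<le> 1" and S: "holomorphic3 R S" and eq: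
      "\<And>a b c. \<bar>a\<bar> < R \<Longrightarrow> \<bar>b\<bar> < R \<Longrightarrow> \<bar>c\<bar> < R \<Longrightarrow>
         S (of_real a) (of_real b) (of_real c) = of_real (sigma (t0 + a) (x0 + b) (y0 + c))"
      by (rule local_holomorphic_sigma[of t0 x0 y0]) (rule that)
    have cS: "continuous_on (ball 0 R \<times> ball 0 R \<times> ball 0 R) (\<lambda>p. S (fst p) (fst (snd p)) (snd (snd p)))"
      using S by (simp add: holomorphic3_def case_prod_unfold)
    have hS: "b \<in> ball 0 R \<Longrightarrow> c \<in> ball 0 R \<Longrightarrow> (\<lambda>a. S a b c) holomorphic_on ball 0 R"
      "a \<in> ball 0 R \<Longrightarrow> c \<in> ball 0 R \<Longrightarrow> (\<lambda>b. S a b c) holomorphic_on ball 0 R"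
      "a \<in> ball 0 R \<Longrightarrow> b \<in> ball 0 R \<Longrightarrow> (\<lambda>c. S a b c) holomorphic_on ball 0 R" for a b c
      using S by (auto simp: holomorphic3_def)
    define F where "F a b c = exp (\<i> * (2 * of_real pi * (of_real x0 + b + of_real \<alpha> * S a b c)))" for a b c
    define G where "G a b c = exp (\<i> * (2 * of_real pi * (of_real y0 + c + S a b c)))" for a b c
    have F: "holomorphic3 R F"
      unfolding holomorphic3_def case_prod_unfold F_def
      by (intro conjI ballI continuous_on_exp continuous_on_mult continuous_on_add continuous_on_const cS
          continuous_on_fst continuous_on_snd continuous_on_id holomorphic_on_exp' holomorphic_on_mult holomorphic_on_add
          holomorphic_on_const holomorphic_on_ident hS)
    have G: "holomorphic3 R G"
      unfolding holomorphic3_def case_prod_unfold G_def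
      by (intro conjI ballI continuous_on_exp continuous_on_mult continuous_on_add continuous_on_const cS
          continuous_on_fst continuous_on_snd continuous_on_id holomorphic_on_exp' holomorphic_on_mult holomorphic_on_add
          holomorphic_on_const holomorphic_on_ident hS)
    show "real_analytic_at (\<lambda>(t, p). flow t (torus_proj p)) P"
      unfolding P
    proof (rule real_analytic_at_holomorphic3[OF F G R(1)])
      fix a b c :: real assume "\<bar>a\<bar> < R" "\<bar>b\<bar> < R" "\<bar>c\<bar> < R"
      then show "(case (t0 + a, x0 + b, y0 + c) of (t, p) \<Rightarrow> flow t (torus_proj p)) =
          (F (of_real a) (of_real b) (of_real c), G (of_real a) (of_real b) (of_real c))"
        by (simp only: prod.case flow_proj) (simp add: F_def G_def eq torus_proj_def cis_conv_exp)
    qed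
  qed
qed

end

section \<open>The invariant measure\<close>

lemma nn_integral_periodic_shift:
  fixes f :: "real \<Rightarrow> ennreal"
  assumes f [measurable]: "f \<in> borel_measurable borel" and per: "\<And>x. f (x + 1) = f x"
  shows "(\<integral>\<^sup>+x. f (x + a) * indicator {0..<1} x \<partial>lborel) = (\<integral>\<^sup>+x. f x * indicator {0..<1} x \<partial>lborel)"
proof -
  have shift: "(\<integral>\<^sup>+x. h (x + c) \<partial>lborel) = (\<integral>\<^sup>+x. h x \<partial>lborel)" if [measurable]: "h \<in> borel_measurable borel" for h :: "real \<Rightarrow> ennreal" and c
    using nn_integral_real_affine[OF that, of 1 c] by (simp add: add.commute)
  have per_nat: "f (x + of_nat n) = f x" for x n
  proof (induction n)
    case (Suc n)
    then show ?case using per[of "x + of_nat n"] by (simp add: add_ac)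
  qed simp
  have per_int: "f (x + of_int n) = f x" for x n
  proof (cases "n \<ge> 0")
    case True
    then show ?thesis using per_nat[of x "nat n"] by simp
  next
    case False
    then show ?thesis using per_nat[of "x + of_int n" "nat (- n)"] by simp
  qed
  define r where "r = frac a"
  have r: "0 \<le> r" "r < 1" by (auto simp: r_def frac_lt_1)
  have "(\<integral>\<^sup>+x. f (x + a) * indicator {0..<1} x \<partial>lborel) = (\<integral>\<^sup>+x. f (x + r) * indicator {0..<1} x \<partial>lborel)"
    using per_int[of "_ + r" "\<lfloor>a\<rfloor>"] by (simp add: r_def frac_def)
  also have "\<dots> = (\<integral>\<^sup>+x. f (x + r) * indicator {r..<1 + r} (x + r) \<partial>lborel)"
    by (rule nn_integral_cong) (auto simp: indicator_def)
  also have "\<dots> = (\<integral>\<^sup>+x. f x * indicator {r..<1 + r} x \<partial>lborel)"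
    by (rule shift[of "\<lambda>x. f x * indicator {r..<1 + r} x" r]) measurable
  also have "\<dots> = (\<integral>\<^sup>+x. f x * indicator {r..<1} x + f x * indicator {1..<1 + r} x \<partial>lborel)"
    using r by (intro nn_integral_cong) (auto simp: indicator_def)
  also have "\<dots> = (\<integral>\<^sup>+x. f x * indicator {r..<1} x \<partial>lborel) + (\<integral>\<^sup>+x. f x * indicator {1..<1 + r} x \<partial>lborel)"
    by (rule nn_integral_add) auto
  also have "(\<integral>\<^sup>+x. f x * indicator {1..<1 + r} x \<partial>lborel) = (\<integral>\<^sup>+x. f (x + 1) * indicator {1..<1 + r} (x + 1) \<partial>lborel)"
    by (rule shift[of "\<lambda>x. f x * indicator {1..<1 + r} x" 1, symmetric]) measurable
  also have "\<dots> = (\<integral>\<^sup>+x. f x * indicator {0..<r} x \<partial>lborel)"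
    unfolding per by (rule nn_integral_cong) (auto simp: indicator_def)
  also have "(\<integral>\<^sup>+x. f x * indicator {r..<1} x \<partial>lborel) + \<dots> = (\<integral>\<^sup>+x. f x * indicator {r..<1} x + f x * indicator {0..<r} x \<partial>lborel)"
    by (rule nn_integral_add[symmetric]) auto
  also have "\<dots> = (\<integral>\<^sup>+x. f x * indicator {0..<1} x \<partial>lborel)"
    using r by (intro nn_integral_cong) (auto simp: indicator_def)
  finally show ?thesis .
qed

lemma nn_integral_periodic_multiple:
  fixes f :: "real \<Rightarrow> ennreal"
  assumes f [measurable]: "f \<in> borel_measurable borel" and per: "\<And>x. f (x + 1) = f x"
  shows "(\<integral>\<^sup>+x. f x * indicator {0..<real N} x \<partial>lborel) = of_nat N * (\<integral>\<^sup>+x. f x * indicator {0..<1} x \<partial>lborel)"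
proof (induction N)
  case (Suc N)
  have "(\<integral>\<^sup>+x. f x * indicator {0..<real (Suc N)} x \<partial>lborel) =
     (\<integral>\<^sup>+x. f x * indicator {0..<real N} x + f x * indicator {real N..<real N + 1} x \<partial>lborel)"
    by (intro nn_integral_cong) (auto simp: indicator_def)
  also have "\<dots> = (\<integral>\<^sup>+x. f x * indicator {0..<real N} x \<partial>lborel) + (\<integral>\<^sup>+x. f x * indicator {real N..<real N + 1} x \<partial>lborel)"
    by (rule nn_integral_add) auto
  also have "(\<integral>\<^sup>+x. f x * indicator {real N..<real N + 1} x \<partial>lborel) =
      (\<integral>\<^sup>+x. f (x + real N) * indicator {real N..<real N + 1} (x + real N) \<partial>lborel)"
    using nn_integral_real_affine[of "\<lambda>x. f x * indicator {real N..<real N + 1} x" 1 "real N"] by (simp add: add.commute)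
  also have "\<dots> = (\<integral>\<^sup>+x. f (x + real N) * indicator {0..<1} x \<partial>lborel)"
    by (rule nn_integral_cong) (auto simp: indicator_def)
  also have "\<dots> = (\<integral>\<^sup>+x. f x * indicator {0..<1} x \<partial>lborel)"
    by (rule nn_integral_periodic_shift[OF f per])
  finally show ?case using Suc by (simp add: algebra_simps)
qed simp

lemma nn_integral_periodic_dilation:
  fixes f :: "real \<Rightarrow> ennreal"
  assumes f [measurable]: "f \<in> borel_measurable borel" and per: "\<And>x. f (x + 1) = f x" and N: "N > 0"
  shows "(\<integral>\<^sup>+x. f (real N * x + c) * indicator {0..<1} x \<partial>lborel) = (\<integral>\<^sup>+x. f x * indicator {0..<1} x \<partial>lborel)"
proof -
  let ?h = "\<lambda>x. f (x + c)"
  have "(\<integral>\<^sup>+x. ?h x * indicator {0..<real N} x \<partial>lborel) =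
     of_nat N * (\<integral>\<^sup>+x. ?h (real N * x) * indicator {0..<real N} (real N * x) \<partial>lborel)"
    using nn_integral_real_affine[of "\<lambda>x. ?h x * indicator {0..<real N} x" "real N" 0] N
    by (simp add: ennreal_of_nat_eq_real_of_nat)
  also have "(\<integral>\<^sup>+x. ?h (real N * x) * indicator {0..<real N} (real N * x) \<partial>lborel) = (\<integral>\<^sup>+x. f (real N * x + c) * indicator {0..<1} x \<partial>lborel)"
    using N by (intro nn_integral_cong) (auto simp: indicator_def zero_le_mult_iff)
  finally have "of_nat N * (\<integral>\<^sup>+x. f (real N * x + c) * indicator {0..<1} x \<partial>lborel) = of_nat N * (\<integral>\<^sup>+x. f x * indicator {0..<1} x \<partial>lborel)"
    using nn_integral_periodic_multiple[of ?h N] nn_integral_periodic_shift[OF f per, of c] per[of "_ + c"]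
    by (simp add: add_ac)
  then show ?thesis using N by (simp add: ennreal_mult_cancel_left ennreal_of_nat_eq_real_of_nat)
qed

lemma Arg2pi_measurable [measurable]: "Arg2pi \<in> borel_measurable borel"
proof -
  have "(\<lambda>z. indicator (- \<real>\<^sub>\<ge>\<^sub>0) z *\<^sub>R Arg2pi z) \<in> borel_measurable borel"
    by (intro borel_measurable_continuous_on_indicator continuous_at_imp_continuous_on ballI continuous_at_Arg2pi)
       (auto intro: borel_open)
  \<comment> \<open>\<open>Arg2pi\<close> vanishes on the excluded half-line, the nonnegative reals,
    so cutting it out changes no value.\<close>
  moreover have "indicator (- \<real>\<^sub>\<ge>\<^sub>0) z *\<^sub>R Arg2pi z = Arg2pi z" for z
    by (auto simp: indicator_def Arg2pi_eq_0 complex_nonneg_Reals_iff complex_is_Real_iff)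
  ultimately show ?thesis by (simp only:)
qed

abbreviation torus_borel :: "(complex \<times> complex) measure" where
  "torus_borel \<equiv> restrict_space borel torus"

lemma space_torus_borel [simp]: "space torus_borel = torus"
  by (simp add: space_restrict_space)

lemma torus_proj_measurable [measurable]: "torus_proj \<in> measurable borel torus_borel"
proof (rule measurable_restrict_space2)
  show "torus_proj \<in> borel_measurable borel"
    unfolding torus_proj_def by (intro borel_measurable_continuous_onI continuous_intros)
qed simp

lemma torus_coord_measurable [measurable]: "torus_coord \<in> measurable torus_borel borel"
proof (rule measurable_restrict_space1)
  show "torus_coord \<in> borel_measurable borel"
    unfolding torus_coord_def borel_prod[symmetric] by measurable
qed

lemma sets_torus_lebesgue [simp]: "sets torus_lebesgue = sets torus_borel"
  and space_torus_lebesgue [simp]: "space torus_lebesgue = torus"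
  by (simp_all add: torus_lebesgue_def)

lemma nn_integral_torus_lebesgue:
  assumes [measurable]: "F \<in> borel_measurable torus_borel"
  shows "(\<integral>\<^sup>+z. F z \<partial>torus_lebesgue) =
    (\<integral>\<^sup>+y. (\<integral>\<^sup>+x. F (torus_proj (x, y)) * indicator {0..<1} x \<partial>lborel) * indicator {0..<1} y \<partial>lborel)"
proof -
  let ?I = "{0..<1} \<times> {0..<1} :: (real \<times> real) set"
  have I: "?I \<in> sets borel" by (intro borel_Times) auto
  have "(\<integral>\<^sup>+z. F z \<partial>torus_lebesgue) = (\<integral>\<^sup>+p. F (torus_proj p) \<partial>restrict_space lborel ?I)"
    unfolding torus_lebesgue_def
    by (intro nn_integral_distr measurable_restrict_space1) (auto simp: measurable_lborel1)
  also have "\<dots> = (\<integral>\<^sup>+p. F (torus_proj p) * indicator ?I p \<partial>lborel)"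
    using I by (intro nn_integral_restrict_space) simp
  also have "\<dots> = (\<integral>\<^sup>+p. F (torus_proj p) * indicator ?I p \<partial>(lborel \<Otimes>\<^sub>M lborel))"
    by (simp add: lborel_prod)
  also have "\<dots> = (\<integral>\<^sup>+y. \<integral>\<^sup>+x. F (torus_proj (x, y)) * indicator ?I (x, y) \<partial>lborel \<partial>lborel)"
  proof (rule lborel_pair.nn_integral_snd[symmetric])
    have "(\<lambda>p. F (torus_proj p) * indicator ?I p) \<in> borel_measurable borel"
      using I by measurable
    then show "(\<lambda>p. F (torus_proj p) * indicator ?I p) \<in> borel_measurable (lborel \<Otimes>\<^sub>M lborel)"
      by (simp add: lborel_prod)
  qed
  also have "\<dots> = (\<integral>\<^sup>+y. (\<integral>\<^sup>+x. F (torus_proj (x, y)) * indicator {0..<1} x \<partial>lborel) * indicator {0..<1} y \<partial>lborel)"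
    by (intro nn_integral_cong) (auto simp: indicator_def)
  finally show ?thesis .
qed

context time_change
begin

definition \<mu> :: "(complex \<times> complex) measure" where
  "\<mu> = density torus_lebesgue (\<lambda>z. ennreal (v (fst (torus_coord z)) (snd (torus_coord z))))"

lemma sets_mu [simp, measurable_cong]: "sets \<mu> = sets torus_borel"
  and space_mu [simp]: "space \<mu> = torus"
  by (simp_all add: \<mu>_def)

lemma v_frac: "v (frac x) (frac y) = v x y"
  using v_periodic[of x "- \<lfloor>x\<rfloor>" y "- \<lfloor>y\<rfloor>"] by (simp add: frac_def)

lemma v_measurable [measurable]: "(\<lambda>p. v (fst p) (snd p)) \<in> borel_measurable borel"
  by (rule borel_measurable_continuous_onI[OF v_continuous])

lemma nn_integral_mu:
  assumes [measurable]: "F \<in> borel_measurable torus_borel"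
  shows "(\<integral>\<^sup>+z. F z \<partial>\<mu>) =
    (\<integral>\<^sup>+y. (\<integral>\<^sup>+x. ennreal (v x y) * F (torus_proj (x, y)) * indicator {0..<1} x \<partial>lborel) * indicator {0..<1} y \<partial>lborel)"
proof -
  have vm: "(\<lambda>z. ennreal (v (fst (torus_coord z)) (snd (torus_coord z)))) \<in> borel_measurable torus_borel"
    using measurable_compose[OF torus_coord_measurable v_measurable] by measurable
  have "(\<integral>\<^sup>+z. F z \<partial>\<mu>) = (\<integral>\<^sup>+z. ennreal (v (fst (torus_coord z)) (snd (torus_coord z))) * F z \<partial>torus_lebesgue)"
    unfolding \<mu>_def using vm by (intro nn_integral_density) (auto simp: measurable_cong_sets[OF sets_torus_lebesgue refl])
  then show ?thesis
    using nn_integral_torus_lebesgue[of "\<lambda>z. ennreal (v (fst (torus_coord z)) (snd (torus_coord z))) * F z"] vm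
    by (simp add: torus_coord_proj v_frac)
qed

lemma nn_integral_Icc_Ico:
  "(\<integral>\<^sup>+x. f x * indicator {a..<b::real} x \<partial>lborel) = (\<integral>\<^sup>+x. f x * indicator {a..b} x \<partial>lborel)"
proof (rule nn_integral_cong_AE)
  show "AE x in lborel. f x * indicator {a..<b} x = f x * indicator {a..b} x"
    using AE_lborel_singleton[of b] by eventually_elim (auto simp: indicator_def)
qed

text \<open>\<open>v\<close> is the \<open>x\<close>-derivative of \<open>X\<close>, the identity
  plus a series that is periodic in \<open>x\<close>, so the integral over a period is
  \<open>X 1 - X 0 = 1\<close>. All horizontal circles thus carry the same mass: the total is 1, and
  under \<open>\<mu>\<close> the coordinate \<open>y\<close> is uniformly distributed.\<close>

lemma nn_integral_v: "(\<integral>\<^sup>+x. ennreal (v x y) * indicator {0..<1} x \<partial>lborel) = 1"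
proof -
  define X where "X x = x + (\<Sum>j. \<epsilon> j / of_int (q j) * gd 0 j (ur j x y))" for x
  have q1: "real_of_int (q j) \<ge> 1" for j by (rule q_pos_real)
  have bd: "\<bar>\<epsilon> j / of_int (q j) * gd 0 j u\<bar> \<le> (1/4) ^ Suc j" for j u
  proof -
    have "\<epsilon> j / of_int (q j) \<le> \<epsilon> j / 1" using q1[of j] eps_pos[of j] by (intro divide_left_mono) auto
    then have "\<epsilon> j / of_int (q j) * \<bar>gd 0 j u\<bar> \<le> \<epsilon> j * \<beta> j"
      using gd_le[of 0 j u] eps_pos[of j] by (intro mult_mono) auto
    moreover have "\<bar>\<epsilon> j / of_int (q j) * gd 0 j u\<bar> = \<epsilon> j / of_int (q j) * \<bar>gd 0 j u\<bar>"
      using eps_pos[of j] q1[of j] by (simp add: abs_mult)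
    ultimately show ?thesis using eps_beta[of j] by linarith
  qed
  have "((\<lambda>x. \<Sum>j. \<epsilon> j / of_int (q j) * gd 0 j (ur j x y)) has_field_derivative density_deriv 0 0 x y) (at x)" for x
    unfolding density_deriv_def
  proof (rule has_field_derivative_series'[of UNIV])
    fix j x
    have "((\<lambda>x. ur j x y) has_real_derivative of_int (q j)) (at x)"
      unfolding ur_def by (auto intro!: derivative_eq_intros)
    from DERIV_cmult[OF DERIV_chain2[where f = "gd 0 j" and g = "\<lambda>x. ur j x y", OF gd_deriv this], of "\<epsilon> j / of_int (q j)"]
    show "((\<lambda>x. \<epsilon> j / of_int (q j) * gd 0 j (ur j x y)) has_field_derivative
        \<epsilon> j * (of_int (q j) ^ 0 * (- of_int (p j)) ^ 0) * gd (Suc (0 + 0)) j (ur j x y)) (at x within UNIV)"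
      using q1[of j] by simp
  next
    show "uniformly_convergent_on UNIV (\<lambda>n x. \<Sum>j<n. \<epsilon> j * (of_int (q j) ^ 0 * (- of_int (p j)) ^ 0) * gd (Suc (0 + 0)) j (ur j x y))"
      by (rule Weierstrass_m_test'[OF _ summable_mult[OF quarter_summable, of "fact (Suc (0 + 0))"]])
         (simp only: real_norm_def density_deriv_term_bound)
    show "summable (\<lambda>j. \<epsilon> j / of_int (q j) * gd 0 j (ur j 0 y))"
      by (rule summable_comparison_test'[OF quarter_summable]) (simp only: real_norm_def bd)
  qed auto
  then have dX: "(X has_real_derivative v x y) (at x)" for x
    unfolding X_def[abs_def] v_def by (intro DERIV_add DERIV_ident)
  have "ur j 1 y = ur j 0 y + of_int (q j)" for j by (simp add: ur_def)
  then have X1: "X 1 = X 0 + 1" by (simp add: X_def gd_periodic)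
  have "(\<integral>\<^sup>+x. ennreal (v x y) * indicator {0..<1} x \<partial>lborel) = (\<integral>\<^sup>+x. ennreal (v x y) * indicator {0..1} x \<partial>lborel)"
    by (rule nn_integral_Icc_Ico)
  also have "\<dots> = ennreal (X 1 - X 0)"
  proof (rule nn_integral_FTC_Icc)
    have "continuous_on UNIV (\<lambda>x. (\<lambda>p. v (fst p) (snd p)) (x, y))"
      by (rule continuous_on_compose2[OF v_continuous]) (auto intro!: continuous_intros)
    then show "(\<lambda>x. v x y) \<in> borel_measurable borel" by (intro borel_measurable_continuous_onI) simp
  qed (use dX v_pos in \<open>auto intro: less_imp_le has_vector_derivative_at_within simp: has_real_derivative_iff_has_vector_derivative[symmetric]\<close>)
  finally show ?thesis by (simp add: X1)
qed

lemma prob_space_mu: "prob_space \<mu>"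
proof
  have "emeasure \<mu> (space \<mu>) = (\<integral>\<^sup>+z. 1 \<partial>\<mu>)" by simp
  also have "\<dots> = 1"
    using nn_integral_mu[of "\<lambda>_. 1"] nn_integral_v by simp
  finally show "emeasure \<mu> (space \<mu>) = 1" .
qed

lemma smooth_torus_measure_mu: "smooth_torus_measure \<mu>"
  unfolding smooth_torus_measure_def
proof (intro exI[of _ "\<lambda>z. v (fst (torus_coord z)) (snd (torus_coord z))"] conjI ballI)
  have "(\<lambda>z. v (fst (torus_coord z)) (snd (torus_coord z))) \<circ> torus_proj = (\<lambda>w. 1 + density_deriv 0 0 (fst w) (snd w))"
    using v_frac by (auto simp: fun_eq_iff torus_coord_proj v_def)
  then show "smooth ((\<lambda>z. v (fst (torus_coord z)) (snd (torus_coord z))) \<circ> torus_proj)"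
    unfolding smooth_def using C_k_density_deriv by simp
qed (simp_all add: v_pos \<mu>_def)

lemma sigma_tau [simp]: "sigma (tau x y s) x y = s"
  by (rule sigma_unique) simp

lemma tau_mono: "s \<le> s' \<Longrightarrow> tau x y s \<le> tau x y s'"
proof (rule DERIV_nonneg_imp_nondecreasing[where f = "tau x y"])
  show "\<exists>d. (tau x y has_real_derivative d) (at r) \<and> 0 \<le> d" for r
    by (intro exI[of _ "v (x + \<alpha> * r) (y + r)"] conjI tau_has_derivative less_imp_le[OF v_pos])
qed

section \<open>Invariance of the measure in orbit coordinates\<close>

definition mass :: "(real \<times> real \<Rightarrow> real) \<Rightarrow> ennreal" where
  "mass f = (\<integral>\<^sup>+y. (\<integral>\<^sup>+x. ennreal (v x y * f (x, y)) * indicator {0..<1} x \<partial>lborel) * indicator {0..<1} y \<partial>lborel)"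

text \<open>In the coordinates \<open>(x, c)\<close> of the point reached from \<open>(x, 0)\<close>
  after flow time \<open>c\<close>, the flow only translates \<open>c\<close>. They arise from a
  shear along the linear flow, allowed by periodicity, and the substitution
  \<open>c = tau x 0 y\<close>, whose Jacobian is the density \<open>v\<close>. Stacking
  \<open>N\<close> unit squares makes the range of \<open>c\<close> long compared with any fixed
  time.\<close>

lemma mass_orbit:
  assumes f [measurable]: "f \<in> borel_measurable borel" and f0: "\<And>w. 0 \<le> f w"
    and per: "\<And>x y m n. f (x + of_int m, y + of_int n) = f (x, y)"
  shows "of_nat N * mass f = (\<integral>\<^sup>+x. (\<integral>\<^sup>+c. ennreal (f (x + \<alpha> * sigma c x 0, sigma c x 0)) * indicator {0..tau x 0 N} c \<partial>lborel) * indicator {0..<1} x \<partial>lborel)"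
proof -
  define h where "h w = v (fst w) (snd w) * f w" for w
  have h [measurable]: "h \<in> borel_measurable borel" unfolding h_def by measurable
  have h_per: "h (x + of_int m, y + of_int n) = h (x, y)" for x y m n
    by (simp add: h_def per v_periodic)
  have shear: "(\<lambda>w. h (fst w + \<alpha> * snd w, snd w)) \<in> borel_measurable borel"
    by (rule measurable_compose[OF _ h]) (intro borel_measurable_continuous_onI continuous_intros)
  have hx: "(\<lambda>x. h (x, y)) \<in> borel_measurable borel" for y
    by (rule measurable_compose[OF _ h]) (intro borel_measurable_continuous_onI continuous_intros)
  define inner where "inner y = (\<integral>\<^sup>+x. ennreal (h (x, y)) * indicator {0..<1} x \<partial>lborel)" for y
  have inner: "inner y = (\<integral>\<^sup>+x. ennreal (h (x + \<alpha> * y, y)) * indicator {0..<1} x \<partial>lborel)" for y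
    unfolding inner_def using h_per[of _ 1 y 0] hx[of y]
    by (intro nn_integral_periodic_shift[symmetric, of "\<lambda>x. ennreal (h (x, y))"]) auto
  have h_prod: "h \<in> borel_measurable (lborel \<Otimes>\<^sub>M lborel)" and shear_prod: "(\<lambda>w. h (fst w + \<alpha> * snd w, snd w)) \<in> borel_measurable (lborel \<Otimes>\<^sub>M lborel)"
    using h shear by (simp_all add: lborel_prod)
  have inner_meas: "inner \<in> borel_measurable borel"
  proof -
    have "(\<lambda>w. h (snd w, fst w)) \<in> borel_measurable borel"
      by (rule measurable_compose[OF _ h]) (intro borel_measurable_continuous_onI continuous_intros)
    then have "(\<lambda>w. h (snd w, fst w)) \<in> borel_measurable (lborel \<Otimes>\<^sub>M lborel)" by (simp add: lborel_prod)
    then have "(\<lambda>(y, x). ennreal (h (x, y)) * indicator {0..<1} x) \<in> borel_measurable (lborel \<Otimes>\<^sub>M lborel)"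
      unfolding case_prod_unfold by measurable
    from lborel.borel_measurable_nn_integral[OF this] show ?thesis
      unfolding inner_def[abs_def] by simp
  qed
  have "of_nat N * mass f = of_nat N * (\<integral>\<^sup>+y. inner y * indicator {0..<1} y \<partial>lborel)"
    by (simp add: mass_def inner_def h_def)
  also have "\<dots> = (\<integral>\<^sup>+y. inner y * indicator {0..<real N} y \<partial>lborel)"
    using h_per[of _ 0 _ 1] by (intro nn_integral_periodic_multiple[symmetric] inner_meas) (simp add: inner_def)
  also have "\<dots> = (\<integral>\<^sup>+y. \<integral>\<^sup>+x. ennreal (h (x + \<alpha> * y, y)) * indicator {0..<1} x * indicator {0..<real N} y \<partial>lborel \<partial>lborel)"
  proof (rule nn_integral_cong)
    fix y :: real
    have "(\<lambda>x. h (x + \<alpha> * y, y)) \<in> borel_measurable borel"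
      by (rule measurable_compose[OF _ h]) (intro borel_measurable_continuous_onI continuous_intros)
    then show "inner y * indicator {0..<real N} y = (\<integral>\<^sup>+x. ennreal (h (x + \<alpha> * y, y)) * indicator {0..<1} x * indicator {0..<real N} y \<partial>lborel)"
      unfolding inner by (intro nn_integral_multc[symmetric]) measurable
  qed
  also have "\<dots> = (\<integral>\<^sup>+x. \<integral>\<^sup>+y. ennreal (h (x + \<alpha> * y, y)) * indicator {0..<1} x * indicator {0..<real N} y \<partial>lborel \<partial>lborel)"
  proof (rule lborel_pair.Fubini')
    show "(\<lambda>(x, y). ennreal (h (x + \<alpha> * y, y)) * indicator {0..<1} x * indicator {0..<real N} y) \<in> borel_measurable (lborel \<Otimes>\<^sub>M lborel)"
      using shear_prod unfolding case_prod_unfold by measurable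
  qed
  also have "\<dots> = (\<integral>\<^sup>+x. (\<integral>\<^sup>+c. ennreal (f (x + \<alpha> * sigma c x 0, sigma c x 0)) * indicator {0..tau x 0 N} c \<partial>lborel) * indicator {0..<1} x \<partial>lborel)"
  proof (rule nn_integral_cong)
    fix x :: real
    define F where "F c = f (x + \<alpha> * sigma c x 0, sigma c x 0)" for c
    have Fm: "F \<in> borel_measurable borel"
    proof -
      have "continuous_on UNIV (\<lambda>c. (\<lambda>(t, x, y). sigma t x y) (c, x, 0))"
        by (rule continuous_on_compose2[OF sigma_continuous]) (auto intro!: continuous_intros)
      then have "continuous_on UNIV (\<lambda>c. (x + \<alpha> * sigma c x 0, sigma c x 0))"
        by (auto intro!: continuous_intros)
      from measurable_compose[OF borel_measurable_continuous_onI[OF this] f] show ?thesis by (simp add: F_def[abs_def])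
    qed
    have hm: "(\<lambda>y. h (x + \<alpha> * y, y)) \<in> borel_measurable borel"
      by (rule measurable_compose[OF _ h]) (intro borel_measurable_continuous_onI continuous_intros)
    have "(\<integral>\<^sup>+c. ennreal (F c) * indicator {0..tau x 0 N} c \<partial>lborel) = (\<integral>\<^sup>+c. ennreal (F c * indicator {tau x 0 0..tau x 0 N} c) \<partial>lborel)"
      by (intro nn_integral_cong) (auto simp: indicator_def)
    also have "\<dots> = (\<integral>\<^sup>+y. ennreal (F (tau x 0 y) * v (x + \<alpha> * y) (0 + y) * indicator {0..real N} y) \<partial>lborel)"
    proof (rule nn_integral_substitution)
      show "set_borel_measurable borel {tau x 0 0..tau x 0 (real N)} F"
        unfolding set_borel_measurable_def using Fm by measurable
      have "continuous_on UNIV (\<lambda>y. (\<lambda>p. v (fst p) (snd p)) (x + \<alpha> * y, 0 + y))"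
        by (rule continuous_on_compose2[OF v_continuous]) (auto intro!: continuous_intros)
      then have "continuous_on UNIV (\<lambda>y. v (x + \<alpha> * y) (0 + y))" by simp
      then show "continuous_on {0..real N} (\<lambda>y. v (x + \<alpha> * y) (0 + y))"
        by (rule continuous_on_subset) simp
      show "(tau x 0 has_real_derivative v (x + \<alpha> * y) (0 + y)) (at y)" for y by (rule tau_has_derivative)
      show "0 \<le> v (x + \<alpha> * y) (0 + y)" for y by (rule less_imp_le[OF v_pos])
    qed simp
    also have "\<dots> = (\<integral>\<^sup>+y. ennreal (h (x + \<alpha> * y, y)) * indicator {0..real N} y \<partial>lborel)"
      by (intro nn_integral_cong) (auto simp: indicator_def F_def h_def mult.commute)
    also have "\<dots> = (\<integral>\<^sup>+y. ennreal (h (x + \<alpha> * y, y)) * indicator {0..<real N} y \<partial>lborel)"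
      by (rule nn_integral_Icc_Ico[symmetric])
    finally have eq: "(\<integral>\<^sup>+c. ennreal (F c) * indicator {0..tau x 0 N} c \<partial>lborel) = \<dots>" .
    have "(\<integral>\<^sup>+y. ennreal (h (x + \<alpha> * y, y)) * indicator {0..<1} x * indicator {0..<real N} y \<partial>lborel)
        = (\<integral>\<^sup>+y. ennreal (h (x + \<alpha> * y, y)) * indicator {0..<real N} y * indicator {0..<1} x \<partial>lborel)"
      by (simp add: mult_ac)
    also have "\<dots> = (\<integral>\<^sup>+y. ennreal (h (x + \<alpha> * y, y)) * indicator {0..<real N} y \<partial>lborel) * indicator {0..<1} x"
      using hm by (intro nn_integral_multc) measurable
    finally show "(\<integral>\<^sup>+y. ennreal (h (x + \<alpha> * y, y)) * indicator {0..<1} x * indicator {0..<real N} y \<partial>lborel)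
        = (\<integral>\<^sup>+c. ennreal (f (x + \<alpha> * sigma c x 0, sigma c x 0)) * indicator {0..tau x 0 N} c \<partial>lborel) * indicator {0..<1} x"
      unfolding eq[symmetric] F_def .
  qed
  finally show ?thesis .
qed

lemma flow_measurable_pair: "(\<lambda>(t, z). flow t z) \<in> measurable (borel \<Otimes>\<^sub>M \<mu>) \<mu>"
proof -
  have c: "continuous_on UNIV (\<lambda>(t, x, y). (x + \<alpha> * sigma t x y, y + sigma t x y))"
    using sigma_continuous unfolding case_prod_unfold by (intro continuous_intros)
  have m1: "(\<lambda>w. (fst w, torus_coord (snd w))) \<in> measurable (borel \<Otimes>\<^sub>M torus_borel) (borel :: (real \<times> real \<times> real) measure)"
    unfolding borel_prod[symmetric, where 'a = real and 'b = "real \<times> real"] by measurable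
  have "(\<lambda>w. torus_proj ((\<lambda>(t, x, y). (x + \<alpha> * sigma t x y, y + sigma t x y)) (fst w, torus_coord (snd w))))
     \<in> measurable (borel \<Otimes>\<^sub>M torus_borel) torus_borel"
    by (rule measurable_compose[OF measurable_compose[OF m1 borel_measurable_continuous_onI[OF c]] torus_proj_measurable])
  then show ?thesis
    by (simp add: flow_def[abs_def] case_prod_unfold Let_def cong: measurable_cong_sets)
qed

lemma flow_measurable: "flow t \<in> measurable \<mu> \<mu>"
proof -
  have "(\<lambda>z. (t, z)) \<in> measurable \<mu> (borel \<Otimes>\<^sub>M \<mu>)" by measurable
  from measurable_compose[OF this flow_measurable_pair] show ?thesis by simp
qed

lemma flow_0: "z \<in> torus \<Longrightarrow> flow 0 z = z"
  and flow_add: "z \<in> torus \<Longrightarrow> flow (s + t) z = flow s (flow t z)"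
  and flow_in_torus: "flow t z \<in> torus"
  using real_analytic_torus_flow_flow by (auto simp: real_analytic_torus_flow_def flow_def Let_def case_prod_unfold)

lemma emeasure_mu_mass:
  assumes A: "A \<in> sets torus_borel"
  shows "emeasure \<mu> A = mass (\<lambda>w. indicator A (torus_proj w))"
proof -
  have "emeasure \<mu> A = (\<integral>\<^sup>+z. indicator A z \<partial>\<mu>)" using A by (intro nn_integral_indicator[symmetric]) simp
  also have "\<dots> = (\<integral>\<^sup>+y. (\<integral>\<^sup>+x. ennreal (v x y) * indicator A (torus_proj (x, y)) * indicator {0..<1} x \<partial>lborel) * indicator {0..<1} y \<partial>lborel)"
    using A by (intro nn_integral_mu) simp
  also have "\<dots> = mass (\<lambda>w. indicator A (torus_proj w))"
    unfolding mass_def by (intro nn_integral_cong arg_cong2[of _ _ _ _ "(*)"]) (auto simp: indicator_def)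
  finally show ?thesis .
qed

text \<open>In orbit coordinates, passing to the preimage under time \<open>t\<close> shifts the
  integrand by \<open>t\<close>. The intervals \<open>{0..b}\<close> and \<open>{t..t + b}\<close>
  differ only near their ends, and the error \<open>\<bar>t\<bar>\<close> does not grow with
  \<open>N\<close>.\<close>

lemma flow_almost_preserves:
  assumes A: "A \<in> sets torus_borel"
  shows "of_nat N * emeasure \<mu> (flow t -` A \<inter> torus) \<le> of_nat N * emeasure \<mu> A + ennreal \<bar>t\<bar>"
proof -
  define f :: "real \<times> real \<Rightarrow> real" where "f w = indicator A (torus_proj w)" for w
  define f' :: "real \<times> real \<Rightarrow> real" where "f' w = indicator (flow t -` A \<inter> torus) (torus_proj w)" for w
  have A': "flow t -` A \<inter> torus \<in> sets torus_borel"
    using measurable_sets[OF flow_measurable, of A t] A by simp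
  have f: "f \<in> borel_measurable borel" and f': "f' \<in> borel_measurable borel"
    using measurable_compose[OF torus_proj_measurable borel_measurable_indicator[OF A]]
      measurable_compose[OF torus_proj_measurable borel_measurable_indicator[OF A']]
    unfolding f_def[abs_def] f'_def[abs_def] by auto
  have ff': "f' (x + \<alpha> * sigma c x 0, sigma c x 0) = f (x + \<alpha> * sigma (c + t) x 0, sigma (c + t) x 0)" for c x
    using sigma_add[of c t x 0] by (simp add: f_def f'_def flow_proj indicator_def algebra_simps)
  have int_le: "(\<integral>\<^sup>+c. ennreal (f' (x + \<alpha> * sigma c x 0, sigma c x 0)) * indicator {0..b} c \<partial>lborel)
     \<le> (\<integral>\<^sup>+c. ennreal (f (x + \<alpha> * sigma c x 0, sigma c x 0)) * indicator {0..b} c \<partial>lborel) + ennreal \<bar>t\<bar>" if b: "b \<ge> 0" for x b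
  proof -
    define F where "F c = ennreal (f (x + \<alpha> * sigma c x 0, sigma c x 0))" for c
    have [measurable]: "F \<in> borel_measurable borel"
    proof -
      have "continuous_on UNIV (\<lambda>c. (\<lambda>(t, x, y). sigma t x y) (c, x, 0))"
        by (rule continuous_on_compose2[OF sigma_continuous]) (auto intro!: continuous_intros)
      then have "continuous_on UNIV (\<lambda>c. (x + \<alpha> * sigma c x 0, sigma c x 0))"
        by (auto intro!: continuous_intros)
      from measurable_compose[OF borel_measurable_continuous_onI[OF this] f] show ?thesis unfolding F_def[abs_def] by simp
    qed
    have F1: "F c \<le> 1" for c by (simp add: F_def f_def indicator_def)
    have "(\<integral>\<^sup>+c. F (c + t) * indicator {0..b} c \<partial>lborel) = (\<integral>\<^sup>+c. F (t + 1 * c) * indicator {t..t + b} (t + 1 * c) \<partial>lborel)"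
      by (intro nn_integral_cong) (auto simp: indicator_def add.commute)
    also have "\<dots> = (\<integral>\<^sup>+c. F c * indicator {t..t + b} c \<partial>lborel)"
      using nn_integral_real_affine[of "\<lambda>c. F c * indicator {t..t + b} c" 1 t] by simp
    also have "\<dots> \<le> (\<integral>\<^sup>+c. F c * indicator {0..b} c + indicator (if t \<ge> 0 then {b..b + t} else {t..0}) c \<partial>lborel)"
    proof (rule nn_integral_mono)
      fix c
      show "F c * indicator {t..t + b} c \<le> F c * indicator {0..b} c + indicator (if t \<ge> 0 then {b..b + t} else {t..0}) c"
        using F1[of c] by (cases "0 \<le> t") (auto simp: indicator_def)
    qed
    also have "\<dots> = (\<integral>\<^sup>+c. F c * indicator {0..b} c \<partial>lborel) + (\<integral>\<^sup>+c. indicator (if t \<ge> 0 then {b..b + t} else {t..0}) c \<partial>lborel)"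
      by (intro nn_integral_add) auto
    also have "(\<integral>\<^sup>+c. indicator (if t \<ge> 0 then {b..b + t} else {t..0}) c \<partial>lborel) = ennreal \<bar>t\<bar>"
      by auto
    finally show ?thesis by (simp add: ff' F_def)
  qed
  have per: "f (x + of_int m, y + of_int n) = f (x, y)" "f' (x + of_int m, y + of_int n) = f' (x, y)" for x y m n
    by (simp_all add: f_def f'_def torus_proj_shift)
  have "of_nat N * emeasure \<mu> (flow t -` A \<inter> torus) = of_nat N * mass f'"
    using emeasure_mu_mass[OF A'] by (simp add: f'_def[abs_def])
  also have "\<dots> = (\<integral>\<^sup>+x. (\<integral>\<^sup>+c. ennreal (f' (x + \<alpha> * sigma c x 0, sigma c x 0)) * indicator {0..tau x 0 N} c \<partial>lborel) * indicator {0..<1} x \<partial>lborel)"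
    by (rule mass_orbit[OF f' _ per(2)]) (simp add: f'_def)
  also have "\<dots> \<le> (\<integral>\<^sup>+x. ((\<integral>\<^sup>+c. ennreal (f (x + \<alpha> * sigma c x 0, sigma c x 0)) * indicator {0..tau x 0 N} c \<partial>lborel) * indicator {0..<1} x) +
       ennreal \<bar>t\<bar> * indicator {0..<1} x \<partial>lborel)"
  proof (rule nn_integral_mono)
    fix x
    have "0 \<le> tau x 0 (real N)" using tau_mono[of 0 "real N" x 0] by simp
    from mult_right_mono[OF int_le[OF this, of x], of "indicator {0..<1} x"]
    show "(\<integral>\<^sup>+c. ennreal (f' (x + \<alpha> * sigma c x 0, sigma c x 0)) * indicator {0..tau x 0 N} c \<partial>lborel) * indicator {0..<1} x \<le>
     ((\<integral>\<^sup>+c. ennreal (f (x + \<alpha> * sigma c x 0, sigma c x 0)) * indicator {0..tau x 0 N} c \<partial>lborel) * indicator {0..<1} x) +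
       ennreal \<bar>t\<bar> * indicator {0..<1} x"
      by (simp add: distrib_right)
  qed
  also have "\<dots> = (\<integral>\<^sup>+x. ((\<integral>\<^sup>+c. ennreal (f (x + \<alpha> * sigma c x 0, sigma c x 0)) * indicator {0..tau x 0 N} c \<partial>lborel) * indicator {0..<1} x) \<partial>lborel) +
      (\<integral>\<^sup>+x. ennreal \<bar>t\<bar> * indicator {0..<1} (x::real) \<partial>lborel)"
  proof (rule nn_integral_add)
    have "continuous_on UNIV (\<lambda>w. (\<lambda>(t, x, y). sigma t x y) (snd w, fst w, 0))"
      by (rule continuous_on_compose2[OF sigma_continuous]) (auto intro!: continuous_intros)
    then have "continuous_on UNIV (\<lambda>w. (fst w + \<alpha> * sigma (snd w) (fst w) 0, sigma (snd w) (fst w) 0))"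
      by (auto intro!: continuous_intros)
    from measurable_compose[OF borel_measurable_continuous_onI[OF this] f]
    have m1: "(\<lambda>w. f (fst w + \<alpha> * sigma (snd w) (fst w) 0, sigma (snd w) (fst w) 0)) \<in> borel_measurable (lborel \<Otimes>\<^sub>M lborel)"
      by (simp add: lborel_prod)
    have "continuous_on UNIV (\<lambda>x. psi x 0 (real N))"
    proof -
      have "continuous_on UNIV (\<lambda>x. psiC (of_real x) (of_real 0) (of_real (real N)))"
        by (rule psiC_continuous[where K = "real N"]) (auto simp: strip_def intro!: continuous_intros)
      then have "continuous_on UNIV (\<lambda>x. Re (of_real (psi x 0 (real N)) :: complex))"
        unfolding psiC_of_real by (rule continuous_on_Re)
      then show ?thesis by simp
    qed
    then have m2: "(\<lambda>x. tau x 0 (real N)) \<in> borel_measurable borel"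
      unfolding tau_def by (intro borel_measurable_continuous_onI continuous_intros)
    have "{w \<in> space (lborel \<Otimes>\<^sub>M lborel). 0 \<le> snd w \<and> snd w \<le> tau (fst w) 0 (real N)} \<in> sets (lborel \<Otimes>\<^sub>M lborel)"
      using m2 by measurable
    then have "(indicator {w. 0 \<le> snd w \<and> snd w \<le> tau (fst w) 0 (real N)} :: real \<times> real \<Rightarrow> ennreal) \<in> borel_measurable (lborel \<Otimes>\<^sub>M lborel)"
      by (intro borel_measurable_indicator) (simp add: space_pair_measure)
    moreover have "(\<lambda>w. indicator {0..tau (fst w) 0 (real N)} (snd w) :: ennreal) = indicator {w. 0 \<le> snd w \<and> snd w \<le> tau (fst w) 0 (real N)}"
      by (auto simp: fun_eq_iff indicator_def)
    ultimately have m3: "(\<lambda>w. indicator {0..tau (fst w) 0 (real N)} (snd w) :: ennreal) \<in> borel_measurable (lborel \<Otimes>\<^sub>M lborel)"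
      by simp
    have "(\<lambda>(x, c). ennreal (f (x + \<alpha> * sigma c x 0, sigma c x 0)) * indicator {0..tau x 0 N} c) \<in> borel_measurable (lborel \<Otimes>\<^sub>M lborel)"
      unfolding case_prod_unfold using m1 m3 by measurable
    from lborel.borel_measurable_nn_integral[OF this]
    show "(\<lambda>x. (\<integral>\<^sup>+c. ennreal (f (x + \<alpha> * sigma c x 0, sigma c x 0)) * indicator {0..tau x 0 N} c \<partial>lborel) * indicator {0..<1} x) \<in> borel_measurable lborel"
      by measurable
  qed auto
  also have "(\<integral>\<^sup>+x. (\<integral>\<^sup>+c. ennreal (f (x + \<alpha> * sigma c x 0, sigma c x 0)) * indicator {0..tau x 0 N} c \<partial>lborel) * indicator {0..<1} x \<partial>lborel) = of_nat N * mass f"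
    by (rule mass_orbit[OF f _ per(1), symmetric]) (simp add: f_def)
  also have "mass f = emeasure \<mu> A" using emeasure_mu_mass[OF A] by (simp add: f_def[abs_def])
  also have "(\<integral>\<^sup>+x. ennreal \<bar>t\<bar> * indicator {0..<1::real} x \<partial>lborel) = ennreal \<bar>t\<bar>"
    by (simp add: nn_integral_cmult)
  finally show ?thesis .
qed

text \<open>Dividing the preceding estimate by \<open>N\<close> and letting \<open>N\<close> grow
  gives one inequality; applied to the preimage of \<open>A\<close> and the time \<open>- t\<close>
  it gives the other.\<close>

lemma flow_preserves_measure:
  assumes A: "A \<in> sets torus_borel"
  shows "emeasure \<mu> (flow t -` A \<inter> torus) = emeasure \<mu> A"
proof -
  interpret prob_space \<mu> by (rule prob_space_mu)
  have le: "measure \<mu> (flow t -` A \<inter> torus) \<le> measure \<mu> A" if A: "A \<in> sets torus_borel" for A t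
  proof (rule field_le_epsilon)
    fix e :: real assume e: "e > 0"
    obtain N :: nat where N: "\<bar>t\<bar> / e < N" using reals_Archimedean2 by blast
    have "0 \<le> \<bar>t\<bar> / e" using e by simp
    with N have N0: "real N > 0" by linarith
    have eq: "of_nat N * emeasure \<mu> B = ennreal (real N * measure \<mu> B)" for B
      by (simp add: emeasure_eq_measure ennreal_of_nat_eq_real_of_nat ennreal_mult)
    have "ennreal (real N * measure \<mu> (flow t -` A \<inter> torus)) \<le> ennreal (real N * measure \<mu> A) + ennreal \<bar>t\<bar>"
      using flow_almost_preserves[OF A, of N t] unfolding eq .
    also have "\<dots> = ennreal (real N * measure \<mu> A + \<bar>t\<bar>)"
      by (rule ennreal_plus[symmetric]) auto
    finally have "ennreal (real N * measure \<mu> (flow t -` A \<inter> torus)) \<le> ennreal (real N * measure \<mu> A + \<bar>t\<bar>)" .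
    then have "real N * measure \<mu> (flow t -` A \<inter> torus) \<le> real N * measure \<mu> A + \<bar>t\<bar>"
      by (subst (asm) ennreal_le_iff) auto
    also have "\<dots> \<le> real N * measure \<mu> A + real N * e" using N e by (simp add: field_simps)
    finally have "real N * measure \<mu> (flow t -` A \<inter> torus) \<le> real N * (measure \<mu> A + e)" by (simp add: distrib_left)
    then show "measure \<mu> (flow t -` A \<inter> torus) \<le> measure \<mu> A + e" using N0 by (rule mult_left_le_imp_le)
  qed
  have A': "flow t -` A \<inter> torus \<in> sets torus_borel"
    using measurable_sets[OF flow_measurable, of A t] A by simp
  have "flow (- t) -` (flow t -` A \<inter> torus) \<inter> torus = A"
  proof (rule set_eqI)
    fix z
    have "flow t (flow (- t) z) = z" if "z \<in> torus"
      using flow_add[OF that, of t "- t"] flow_0[OF that] by simp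
    then show "z \<in> flow (- t) -` (flow t -` A \<inter> torus) \<inter> torus \<longleftrightarrow> z \<in> A"
      using sets.sets_into_space[OF A] by (cases "z \<in> torus") (auto simp: flow_in_torus simp del: split_paired_All)
  qed
  with le[OF A', of "- t"] le[OF A, of t] show ?thesis by (simp add: emeasure_eq_measure)
qed

lemma measure_preserving_flow_flow: "measure_preserving_flow \<mu> flow"
  unfolding measure_preserving_flow_def measure_preserving_def
proof (intro conjI allI ballI flow_measurable flow_measurable_pair)
  show "distr \<mu> \<mu> (flow t) = \<mu>" for t
  proof (rule measure_eqI)
    fix A assume "A \<in> sets (distr \<mu> \<mu> (flow t))"
    then show "emeasure (distr \<mu> \<mu> (flow t)) A = emeasure \<mu> A"
      using flow_preserves_measure[of A t] by (simp add: emeasure_distr[OF flow_measurable])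
  qed simp
qed (simp_all add: flow_0 flow_add)

end

section \<open>Estimates at one scale\<close>

text \<open>\<open>eps_tail'\<close> makes all finer scales together negligible against
  \<open>\<epsilon> n\<close>. \<open>beta_head\<close> compares the coarser scales with
  \<open>q n\<close>, the factor that an \<open>x\<close>-derivative of the \<open>n\<close>-th
  summand carries; the extra \<open>1 / Suc n\<close> makes their effect disappear in the limit at
  multiples of \<open>q n\<close>. \<open>beta_q\<close> makes \<open>q n * \<epsilon> n\<close>
  tend to 0.\<close>

locale mixing_flow = time_change g \<alpha> q p \<beta>
  for g :: "nat \<Rightarrow> complex \<Rightarrow> complex" and \<alpha> :: real and q p :: "nat \<Rightarrow> int" and \<beta> :: "nat \<Rightarrow> real" +
  assumes eps_tail': "n < j \<Longrightarrow> (q j * \<alpha> - p j) * \<beta> j \<le> (1/4) ^ Suc j * (q n * \<alpha> - p n)"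
    and beta_head: "(\<Sum>j<n. \<beta> j) \<le> q n / real (Suc n)"
    and beta_q: "q n \<le> \<beta> n"
begin

lemma eps_tail: "n < j \<Longrightarrow> \<epsilon> j * \<beta> j \<le> (1/4) ^ Suc j * \<epsilon> n"
  unfolding \<epsilon>_def by (rule eps_tail')

lemma summable_quarter_bound:
  fixes a :: "nat \<Rightarrow> real"
  assumes "\<And>j. \<bar>a j\<bar> \<le> K * (1/4) ^ Suc j"
  shows "summable a"
  by (rule summable_comparison_test'[OF summable_mult[OF quarter_summable, of K]]) (simp only: real_norm_def assms)

lemma suminf_quarter_bound:
  fixes a :: "nat \<Rightarrow> real"
  assumes "\<And>j. \<bar>a j\<bar> \<le> K * (1/4) ^ Suc j"
  shows "\<bar>suminf a\<bar> \<le> K / 3"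
proof -
  have "norm (suminf a) \<le> (\<Sum>j. K * (1/4) ^ Suc j)"
    by (rule norm_suminf_le[OF _ summable_mult[OF quarter_summable]]) (simp only: real_norm_def assms)
  also have "(\<Sum>j. K * (1/4) ^ Suc j) = K * (1/3)"
    unfolding suminf_mult[OF quarter_summable] quarter_suminf ..
  finally show ?thesis by simp
qed

text \<open>The scale \<open>n\<close> dominates: coarser scales are controlled by the growth of \<open>q n\<close>, finer ones
  by the smallness of \<open>\<epsilon> j\<close>.\<close>

lemma suminf_dominant_scale:
  fixes a :: "nat \<Rightarrow> real"
  assumes sm: "summable a" and head: "\<And>j. j < n \<Longrightarrow> \<bar>a j\<bar> \<le> L * \<beta> j"
    and tail: "\<And>j. n < j \<Longrightarrow> \<bar>a j\<bar> \<le> K * \<epsilon> j * \<beta> j" and L: "L \<ge> 0" and K: "K \<ge> 0"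
  shows "\<bar>suminf a - a n\<bar> \<le> L * (q n / real (Suc n)) + K * \<epsilon> n"
proof -
  have "suminf a = (\<Sum>j. a (j + Suc n)) + (\<Sum>j<Suc n. a j)"
    by (rule suminf_split_initial_segment[OF sm])
  then have eq: "suminf a - a n = (\<Sum>j. a (j + Suc n)) + (\<Sum>j<n. a j)" by simp
  have "\<bar>\<Sum>j<n. a j\<bar> \<le> (\<Sum>j<n. L * \<beta> j)"
    by (rule order.trans[OF sum_abs]) (auto intro!: sum_mono head)
  also have "\<dots> \<le> L * (q n / real (Suc n))"
    unfolding sum_distrib_left[symmetric] using beta_head[of n] L by (rule mult_left_mono)
  finally have 1: "\<bar>\<Sum>j<n. a j\<bar> \<le> L * (q n / real (Suc n))" .
  have "\<bar>a (j + Suc n)\<bar> \<le> (K * \<epsilon> n) * (1/4) ^ Suc j" for j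
  proof -
    have "\<bar>a (j + Suc n)\<bar> \<le> K * (\<epsilon> (j + Suc n) * \<beta> (j + Suc n))"
      using tail[of "j + Suc n"] by (simp add: mult.assoc)
    also have "\<dots> \<le> K * ((1/4) ^ Suc (j + Suc n) * \<epsilon> n)"
      using eps_tail[of n "j + Suc n"] K by (intro mult_left_mono) auto
    also have "\<dots> = (K * \<epsilon> n) * (1/4) ^ Suc (j + Suc n)" by simp
    also have "\<dots> \<le> (K * \<epsilon> n) * (1/4) ^ Suc j"
      using K eps_pos[of n] by (intro mult_left_mono power_decreasing) auto
    finally show ?thesis .
  qed
  then have "\<bar>\<Sum>j. a (j + Suc n)\<bar> \<le> K * \<epsilon> n / 3" by (rule suminf_quarter_bound)
  moreover have "0 \<le> K * \<epsilon> n" using K eps_pos[of n] by simp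
  ultimately show ?thesis using 1 unfolding eq by linarith
qed

lemma q_power_gd_diff:
  "\<bar>of_int (q j) ^ k * (gd k j (u + h) - gd k j u)\<bar> \<le> 2 * fact k * \<beta> j"
  "\<bar>of_int (q j) ^ k * (gd k j (u + h) - gd k j u)\<bar> \<le> fact (Suc k) * \<beta> j * \<bar>h\<bar>"
proof -
  have q1: "real_of_int (q j) \<ge> 1" by (rule q_pos_real)
  have eq: "\<bar>of_int (q j) ^ k * (gd k j (u + h) - gd k j u)\<bar> = \<bar>gd k j (u + h) - gd k j u\<bar> * of_int (q j) ^ k"
    using q1 by (simp add: abs_mult)
  have "\<bar>gd k j (u + h) - gd k j u\<bar> * of_int (q j) ^ k \<le> (\<bar>gd k j (u + h)\<bar> + \<bar>gd k j u\<bar>) * of_int (q j) ^ k"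
    using q1 by (intro mult_right_mono abs_triangle_ineq4) auto
  also have "\<dots> \<le> 2 * fact k * \<beta> j"
    using gd_bound[of k j u] gd_bound[of k j "u + h"] by (simp add: distrib_right)
  finally show "\<bar>of_int (q j) ^ k * (gd k j (u + h) - gd k j u)\<bar> \<le> 2 * fact k * \<beta> j"
    unfolding eq .
  have "\<bar>gd k j (u + h) - gd k j u\<bar> * of_int (q j) ^ k \<le> \<bar>gd k j (u + h) - gd k j u\<bar> * of_int (q j) ^ Suc k"
    using q1 by (intro mult_left_mono power_increasing) auto
  also have "\<dots> \<le> fact (Suc k) * \<beta> j * \<bar>h\<bar>"
    using gd_lipschitz[of k j "u + h" u] by simp
  finally show "\<bar>of_int (q j) ^ k * (gd k j (u + h) - gd k j u)\<bar> \<le> fact (Suc k) * \<beta> j * \<bar>h\<bar>"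
    unfolding eq .
qed

section \<open>Derivatives of the time change in the horizontal direction\<close>

text \<open>\<open>Wk k\<close> is the \<open>k\<close>-th derivative of \<open>psi\<close> in
  \<open>x\<close> at fixed time, and \<open>Vk k\<close> is the derivative of \<open>Wk k\<close>
  in the time; the chain rule needs both once the time depends on \<open>x\<close>.\<close>

definition Wk :: "nat \<Rightarrow> real \<Rightarrow> real \<Rightarrow> real \<Rightarrow> real" where
  "Wk k x y s = (\<Sum>j. of_int (q j) ^ k * (gd k j (ur j x y + s * \<epsilon> j) - gd k j (ur j x y)))"

definition Vk :: "nat \<Rightarrow> real \<Rightarrow> real \<Rightarrow> real \<Rightarrow> real" where
  "Vk k x y s = (\<Sum>j. of_int (q j) ^ k * \<epsilon> j * gd (Suc k) j (ur j x y + s * \<epsilon> j))"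

lemma Wk_term_bound:
  "\<bar>of_int (q j) ^ k * (gd k j (ur j x y + s * \<epsilon> j) - gd k j (ur j x y))\<bar> \<le> (fact (Suc k) * \<bar>s\<bar>) * (1/4) ^ Suc j"
proof -
  have "\<bar>of_int (q j) ^ k * (gd k j (ur j x y + s * \<epsilon> j) - gd k j (ur j x y))\<bar> \<le> fact (Suc k) * \<beta> j * \<bar>s * \<epsilon> j\<bar>"
    by (rule q_power_gd_diff(2))
  also have "\<dots> = (fact (Suc k) * \<bar>s\<bar>) * (\<epsilon> j * \<beta> j)" using eps_pos[of j] by (simp add: abs_mult)
  also have "\<dots> \<le> (fact (Suc k) * \<bar>s\<bar>) * (1/4) ^ Suc j" by (intro mult_left_mono eps_beta) auto
  finally show ?thesis .
qed

lemma Vk_term_bound: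
  "\<bar>of_int (q j) ^ k * \<epsilon> j * gd (Suc k) j u\<bar> \<le> fact (Suc k) * (1/4) ^ Suc j"
proof -
  have q1: "real_of_int (q j) \<ge> 1" by (rule q_pos_real)
  have "\<bar>of_int (q j) ^ k * \<epsilon> j * gd (Suc k) j u\<bar> = \<epsilon> j * (\<bar>gd (Suc k) j u\<bar> * of_int (q j) ^ k)"
    using q1 eps_pos[of j] by (simp add: abs_mult)
  also have "\<dots> \<le> \<epsilon> j * (\<bar>gd (Suc k) j u\<bar> * of_int (q j) ^ Suc k)"
    using q1 eps_pos[of j] by (intro mult_left_mono power_increasing) auto
  also have "\<dots> \<le> \<epsilon> j * (fact (Suc k) * \<beta> j)"
    using gd_bound[of "Suc k" j u] eps_pos[of j] by (intro mult_left_mono) auto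
  also have "\<dots> = fact (Suc k) * (\<epsilon> j * \<beta> j)" by simp
  also have "\<dots> \<le> fact (Suc k) * (1/4) ^ Suc j" by (intro mult_left_mono eps_beta) auto
  finally show ?thesis .
qed

lemma Wk_0: "Wk 0 x y s = psi x y s" by (simp add: Wk_def psi_def)

lemma Vk_0: "1 + Vk 0 x y s = v (x + \<alpha> * s) (y + s)"
  unfolding Vk_def v_def density_deriv_def ur_flow by simp

text \<open>Chain rule along the graph of \<open>s\<close>, carried out termwise; the uniform bound
  \<open>A\<close> on \<open>s\<close> and \<open>s'\<close> supplies a geometric majorant for the
  series of derivatives.\<close>

lemma Wk_along:
  assumes s: "\<And>x. (s has_real_derivative s' x) (at x)" and b: "\<And>x. \<bar>s x\<bar> \<le> A" "\<And>x. \<bar>s' x\<bar> \<le> A"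
  shows "((\<lambda>x. Wk k x y (s x)) has_real_derivative Wk (Suc k) x y (s x) + s' x * Vk k x y (s x)) (at x)"
proof -
  define f' where "f' j x = of_int (q j) ^ Suc k * (gd (Suc k) j (ur j x y + s x * \<epsilon> j) - gd (Suc k) j (ur j x y))
      + s' x * (of_int (q j) ^ k * \<epsilon> j * gd (Suc k) j (ur j x y + s x * \<epsilon> j))" for j x
  have A: "0 \<le> A" using b(1)[of 0] by linarith
  have sm1: "summable (\<lambda>j. of_int (q j) ^ Suc k * (gd (Suc k) j (ur j x y + s x * \<epsilon> j) - gd (Suc k) j (ur j x y)))" for x
    by (rule summable_quarter_bound[OF Wk_term_bound])
  have sm2: "summable (\<lambda>j. of_int (q j) ^ k * \<epsilon> j * gd (Suc k) j (ur j x y + s x * \<epsilon> j))" for x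
    by (rule summable_quarter_bound[OF Vk_term_bound])
  have "((\<lambda>x. \<Sum>j. of_int (q j) ^ k * (gd k j (ur j x y + s x * \<epsilon> j) - gd k j (ur j x y))) has_field_derivative (\<Sum>j. f' j x)) (at x)"
  proof (rule has_field_derivative_series'[of UNIV])
    fix j x
    have u: "((\<lambda>x. ur j x y) has_real_derivative of_int (q j)) (at x)"
      unfolding ur_def by (auto intro!: derivative_eq_intros)
    have us: "((\<lambda>x. ur j x y + s x * \<epsilon> j) has_real_derivative of_int (q j) + s' x * \<epsilon> j) (at x)"
      by (intro DERIV_add u DERIV_cmult_right s)
    note d1 = DERIV_chain2[where f = "gd k j" and g = "\<lambda>x. ur j x y + s x * \<epsilon> j", OF gd_deriv us]
    note d2 = DERIV_chain2[where f = "gd k j" and g = "\<lambda>x. ur j x y", OF gd_deriv u]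
    have "((\<lambda>x. of_int (q j) ^ k * (gd k j (ur j x y + s x * \<epsilon> j) - gd k j (ur j x y))) has_field_derivative
      of_int (q j) ^ k * (gd (Suc k) j (ur j x y + s x * \<epsilon> j) * (of_int (q j) + s' x * \<epsilon> j) - gd (Suc k) j (ur j x y) * of_int (q j))) (at x)"
      by (intro DERIV_cmult DERIV_diff d1 d2)
    moreover have "of_int (q j) ^ k * (gd (Suc k) j (ur j x y + s x * \<epsilon> j) * (of_int (q j) + s' x * \<epsilon> j) - gd (Suc k) j (ur j x y) * of_int (q j)) = f' j x"
      unfolding f'_def by (simp add: algebra_simps)
    ultimately show "((\<lambda>x. of_int (q j) ^ k * (gd k j (ur j x y + s x * \<epsilon> j) - gd k j (ur j x y))) has_field_derivative f' j x) (at x within UNIV)"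
      by simp
  next
    show "uniformly_convergent_on UNIV (\<lambda>n x. \<Sum>j<n. f' j x)"
    proof (rule Weierstrass_m_test'[OF _ summable_mult[OF quarter_summable, of "fact (Suc (Suc k)) * A + A * fact (Suc k)"]])
      fix j x
      have "\<bar>f' j x\<bar> \<le> (fact (Suc (Suc k)) * \<bar>s x\<bar>) * (1/4) ^ Suc j + \<bar>s' x\<bar> * (fact (Suc k) * (1/4) ^ Suc j)"
        unfolding f'_def
        using Wk_term_bound[of j "Suc k" x y "s x"] mult_left_mono[OF Vk_term_bound[of j k "ur j x y + s x * \<epsilon> j"], of "\<bar>s' x\<bar>"]
        by (intro order.trans[OF abs_triangle_ineq] add_mono) (auto simp: abs_mult)
      also have "\<dots> \<le> (fact (Suc (Suc k)) * A) * (1/4) ^ Suc j + A * (fact (Suc k) * (1/4) ^ Suc j)"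
        using b by (intro add_mono mult_right_mono mult_left_mono) auto
      finally show "norm (f' j x) \<le> (fact (Suc (Suc k)) * A + A * fact (Suc k)) * (1/4) ^ Suc j"
        by (simp only: real_norm_def distrib_right mult.assoc)
    qed
    show "summable (\<lambda>j. of_int (q j) ^ k * (gd k j (ur j 0 y + s 0 * \<epsilon> j) - gd k j (ur j 0 y)))"
      by (rule summable_quarter_bound[OF Wk_term_bound])
  qed auto
  moreover have "(\<Sum>j. f' j x) = Wk (Suc k) x y (s x) + s' x * Vk k x y (s x)"
    unfolding f'_def Wk_def Vk_def
    using suminf_add[OF sm1[of x] summable_mult[OF sm2[of x], of "s' x"]] suminf_mult[OF sm2[of x], of "s' x"] by simp
  ultimately show ?thesis unfolding Wk_def[abs_def] by simp
qed

lemma Wk_bound: "\<bar>Wk k x y s\<bar> \<le> fact (Suc k) * \<bar>s\<bar> / 3"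
  unfolding Wk_def by (rule suminf_quarter_bound[OF Wk_term_bound])

lemma Vk_bound: "\<bar>Vk k x y s\<bar> \<le> fact (Suc k) / 3"
  unfolding Vk_def by (rule suminf_quarter_bound[OF Vk_term_bound])

lemma psi_lipschitz_x: "\<bar>psi x y s - psi x' y s\<bar> \<le> \<bar>s\<bar> * \<bar>x - x'\<bar>"
proof -
  have "norm (psi x y s - psi x' y s) \<le> \<bar>s\<bar> * norm (x - x')"
  proof (rule field_differentiable_bound[of UNIV])
    fix z
    show "((\<lambda>x. psi x y s) has_field_derivative Wk 1 z y s) (at z within UNIV)"
      using Wk_along[of "\<lambda>_. s" "\<lambda>_. 0" "\<bar>s\<bar>" 0 y z] by (simp add: Wk_0)
    show "norm (Wk 1 z y s) \<le> \<bar>s\<bar>" using Wk_bound[of 1 z y s] by simp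
  qed auto
  then show ?thesis by simp
qed

lemma sigma_lipschitz_x: "\<bar>sigma t x y - sigma t x' y\<bar> \<le> 9/4 * \<bar>t\<bar> * \<bar>x - x'\<bar>"
proof -
  let ?s = "sigma t x y" and ?s' = "sigma t x' y"
  have "tau x y ?s = tau x' y ?s'" by simp
  then have "tau x y ?s - tau x y ?s' = psi x' y ?s' - psi x y ?s'" by (simp add: tau_def)
  then have "2/3 * \<bar>?s - ?s'\<bar> \<le> \<bar>psi x' y ?s' - psi x y ?s'\<bar>" using tau_diff_ge[of ?s ?s' x y] by simp
  also have "\<dots> \<le> \<bar>?s'\<bar> * \<bar>x' - x\<bar>" by (rule psi_lipschitz_x)
  also have "\<dots> \<le> (3/2 * \<bar>t\<bar>) * \<bar>x' - x\<bar>" by (intro mult_right_mono sigma_bound) auto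
  finally show ?thesis by (simp add: abs_minus_commute)
qed

lemma sigma_differentiable_x: "\<exists>d. ((\<lambda>x. sigma t x y) has_real_derivative d) (at x)"
proof -
  obtain R S where R: "R > 0" "R \<le> 1" and S: "holomorphic3 R S" and eq:
    "\<And>a b c. \<bar>a\<bar> < R \<Longrightarrow> \<bar>b\<bar> < R \<Longrightarrow> \<bar>c\<bar> < R \<Longrightarrow>
       S (of_real a) (of_real b) (of_real c) = of_real (sigma (t + a) (x + b) (y + c))"
    by (rule local_holomorphic_sigma[of t x y]) (rule that)
  have "(\<lambda>b. S 0 b 0) holomorphic_on ball 0 R" using S R by (simp add: holomorphic3_def)
  then have "((\<lambda>b. S 0 b 0) has_field_derivative deriv (\<lambda>b. S 0 b 0) 0) (at (of_real 0))"
    using R by (simp add: holomorphic_derivI[where S = "ball 0 R"])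
  from has_real_derivative_Re_of_real[OF this]
  have "((\<lambda>b. Re (S 0 (of_real b) 0)) has_real_derivative Re (deriv (\<lambda>b. S 0 b 0) 0)) (at 0)" .
  then have "((\<lambda>b. sigma t (x + b) y) has_real_derivative Re (deriv (\<lambda>b. S 0 b 0) 0)) (at 0)"
  proof (rule DERIV_cong_ev[OF refl _ refl, THEN iffD1, rotated])
    have "eventually (\<lambda>b. b \<in> ball 0 R) (nhds (0::real))" using R by (intro eventually_nhds_in_open) auto
    then show "eventually (\<lambda>b. Re (S 0 (of_real b) 0) = sigma t (x + b) y) (nhds 0)"
    proof eventually_elim
      case (elim b)
      then show ?case using eq[of 0 b 0] R by simp
    qed
  qed
  then show ?thesis using DERIV_shift[of "\<lambda>x. sigma t x y" _ 0 x] by (auto simp: add.commute)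
qed

text \<open>Implicit differentiation of \<open>tau x y (sigma t x y) = t\<close>. Differentiability
  comes from the local holomorphic extension, and the Lipschitz bound supplies the bound on the
  derivative that \<open>Wk_along\<close> requires.\<close>

lemma sigma_has_derivative_x:
  "((\<lambda>x. sigma t x y) has_real_derivative
     - Wk 1 x y (sigma t x y) / v (x + \<alpha> * sigma t x y) (y + sigma t x y)) (at x)"
proof -
  obtain s' where s': "\<And>x. ((\<lambda>x. sigma t x y) has_real_derivative s' x) (at x)"
    using sigma_differentiable_x[of t y] by metis
  have s'b: "\<bar>s' x\<bar> \<le> 9/4 * \<bar>t\<bar>" for x
  proof -
    have "((\<lambda>h. (sigma t (x + h) y - sigma t x y) / h) \<longlongrightarrow> s' x) (at 0)"
      using s'[of x] by (simp add: DERIV_def)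
    then have "((\<lambda>h. \<bar>(sigma t (x + h) y - sigma t x y) / h\<bar>) \<longlongrightarrow> \<bar>s' x\<bar>) (at 0)"
      by (rule tendsto_rabs)
    then show ?thesis
    proof (rule tendsto_upperbound)
      show "eventually (\<lambda>h. \<bar>(sigma t (x + h) y - sigma t x y) / h\<bar> \<le> 9/4 * \<bar>t\<bar>) (at 0)"
      proof (rule eventually_mono[OF eventually_at_ball'[of 1 0 UNIV]])
        fix h :: real assume "h \<in> ball 0 1 \<and> h \<noteq> 0 \<and> h \<in> UNIV"
        then show "\<bar>(sigma t (x + h) y - sigma t x y) / h\<bar> \<le> 9/4 * \<bar>t\<bar>"
          using sigma_lipschitz_x[of t "x + h" y x] by (simp add: abs_divide pos_divide_le_eq)
      qed simp
    qed simp
  qed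
  have "((\<lambda>x. Wk 0 x y (sigma t x y)) has_real_derivative Wk (Suc 0) x y (sigma t x y) + s' x * Vk 0 x y (sigma t x y)) (at x)"
  proof (rule Wk_along[OF s'])
    show "\<bar>sigma t x y\<bar> \<le> 9/4 * \<bar>t\<bar>" for x using sigma_bound[of t x y] by simp
  qed (rule s'b)
  from DERIV_add[OF s'[of x] this]
  have "((\<lambda>x. t) has_real_derivative s' x + (Wk 1 x y (sigma t x y) + s' x * Vk 0 x y (sigma t x y))) (at x)"
    using tau_sigma[of _ y t] by (simp add: Wk_0 tau_def)
  then have "s' x + (Wk 1 x y (sigma t x y) + s' x * Vk 0 x y (sigma t x y)) = 0"
    using DERIV_const DERIV_unique by blast
  then have "s' x * v (x + \<alpha> * sigma t x y) (y + sigma t x y) = - Wk 1 x y (sigma t x y)"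
    unfolding Vk_0[symmetric] by (simp add: algebra_simps)
  then have "s' x = - Wk 1 x y (sigma t x y) / v (x + \<alpha> * sigma t x y) (y + sigma t x y)"
    using v_pos[of "x + \<alpha> * sigma t x y" "y + sigma t x y"] by (simp add: field_simps)
  then show ?thesis using s'[of x] by simp
qed

lemma W1_has_derivative_x:
  "((\<lambda>x. Wk 1 x y (sigma t x y)) has_real_derivative
     Wk 2 x y (sigma t x y) - Wk 1 x y (sigma t x y) / v (x + \<alpha> * sigma t x y) (y + sigma t x y) * Vk 1 x y (sigma t x y)) (at x)"
proof -
  have "((\<lambda>x. Wk 1 x y (sigma t x y)) has_real_derivative
     Wk (Suc 1) x y (sigma t x y) + (- Wk 1 x y (sigma t x y) / v (x + \<alpha> * sigma t x y) (y + sigma t x y)) * Vk 1 x y (sigma t x y)) (at x)"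
  proof (rule Wk_along[OF sigma_has_derivative_x])
    show "\<bar>sigma t x y\<bar> \<le> 3/2 * \<bar>t\<bar>" for x by (rule sigma_bound)
    show "\<bar>- Wk 1 x y (sigma t x y) / v (x + \<alpha> * sigma t x y) (y + sigma t x y)\<bar> \<le> 3/2 * \<bar>t\<bar>" for x
    proof -
      have "\<bar>Wk 1 x y (sigma t x y)\<bar> \<le> 2/3 * \<bar>sigma t x y\<bar>" using Wk_bound[of 1 x y "sigma t x y"] by simp
      also have "\<dots> \<le> \<bar>t\<bar>" using sigma_bound[of t x y] by linarith
      finally have 1: "\<bar>Wk 1 x y (sigma t x y)\<bar> \<le> \<bar>t\<bar>" .
      have "\<bar>Wk 1 x y (sigma t x y)\<bar> / v (x + \<alpha> * sigma t x y) (y + sigma t x y) \<le> \<bar>t\<bar> / (2/3)"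
        using 1 v_bounds(1)[of "x + \<alpha> * sigma t x y" "y + sigma t x y"] by (intro frac_le) auto
      then show ?thesis using v_pos[of "x + \<alpha> * sigma t x y" "y + sigma t x y"] by (simp add: abs_divide)
    qed
  qed
  then show ?thesis by (simp add: numeral_2_eq_2)
qed

text \<open>For \<open>k \<ge> 1\<close> and bounded \<open>s * \<epsilon> n\<close> the error is at
  most of order \<open>q n\<close>, while the retained term is \<open>q n ^ k\<close> times a
  difference that is large where there is shear.\<close>

lemma Wk_estimate:
  "\<bar>Wk k x y s - of_int (q n) ^ k * (gd k n (ur n x y + s * \<epsilon> n) - gd k n (ur n x y))\<bar>
     \<le> 2 * fact k * (q n / real (Suc n)) + fact (Suc k) * \<bar>s\<bar> * \<epsilon> n"
  unfolding Wk_def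
proof (rule suminf_dominant_scale)
  show "summable (\<lambda>j. of_int (q j) ^ k * (gd k j (ur j x y + s * \<epsilon> j) - gd k j (ur j x y)))"
    by (rule summable_quarter_bound[OF Wk_term_bound])
  show "\<bar>of_int (q j) ^ k * (gd k j (ur j x y + s * \<epsilon> j) - gd k j (ur j x y))\<bar> \<le> 2 * fact k * \<beta> j" for j
    by (rule q_power_gd_diff(1))
  show "\<bar>of_int (q j) ^ k * (gd k j (ur j x y + s * \<epsilon> j) - gd k j (ur j x y))\<bar> \<le> fact (Suc k) * \<bar>s\<bar> * \<epsilon> j * \<beta> j" for j
    using q_power_gd_diff(2)[of j k "ur j x y" "s * \<epsilon> j"] eps_pos[of j] by (simp add: abs_mult mult_ac)
qed auto

section \<open>Oscillatory integrals\<close>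

lemma Wk_periodic: "Wk k (x + of_int a) (y + of_int b) s = Wk k x y s"
proof -
  have eq: "gd k j (ur j x y + of_int i + s * \<epsilon> j) = gd k j (ur j x y + s * \<epsilon> j)" for j i
    using gd_periodic[of k j "ur j x y + s * \<epsilon> j" i] by (simp add: add_ac)
  show ?thesis unfolding Wk_def ur_shift gd_periodic eq ..
qed

lemma v_has_derivative_x: "((\<lambda>x. v x y) has_real_derivative density_deriv 1 0 x y) (at x)"
proof -
  have "((\<lambda>x. (x, y)) has_derivative (\<lambda>h. (h, 0))) (at x)"
    by (auto intro!: derivative_eq_intros)
  from has_derivative_compose[OF this density_deriv_has_derivative[of 0 0 "(x, y)"]]
  have "((\<lambda>x. density_deriv 0 0 x y) has_derivative (\<lambda>h. h * density_deriv 1 0 x y)) (at x)" by simp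
  then have "((\<lambda>x. density_deriv 0 0 x y) has_real_derivative density_deriv 1 0 x y) (at x)"
    by (simp add: has_field_derivative_def mult_commute_abs)
  then show ?thesis unfolding v_def[abs_def] using DERIV_add[OF DERIV_const] by fastforce
qed

lemma density_deriv_10_bound: "\<bar>density_deriv 1 0 x y\<bar> \<le> 2/3"
proof -
  have "\<bar>density_deriv 1 0 x y\<bar> \<le> fact (Suc (1 + 0)) / 3"
    unfolding density_deriv_def by (rule suminf_quarter_bound) (rule density_deriv_term_bound)
  then show ?thesis by simp
qed

text \<open>Writing \<open>\<Phi>\<close> for the phase of a character along the time-\<open>m\<close> map, \<open>\<Phi>' = 2 pi (k - \<kappa> W / vT)\<close>, so
  \<open>cis \<Phi> / vT\<close> is, up to a multiple of \<open>cis \<Phi> / W\<close>, the \<open>x\<close>-derivative of \<open>cis \<Phi>\<close> divided by \<open>W\<close>;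
  integrate by parts.\<close>

lemma oscillatory_integral_bound:
  fixes k l :: int and m y :: real and n :: nat and a ax :: "real \<Rightarrow> real \<Rightarrow> real" and \<omega> \<omega>' :: "real \<Rightarrow> real"
  defines "\<kappa> \<equiv> k * \<alpha> + l"
  defines "s \<equiv> \<lambda>x. sigma m x y"
  defines "vT \<equiv> \<lambda>x. v (x + \<alpha> * s x) (y + s x)"
  defines "\<Phi> \<equiv> \<lambda>x :: real. 2 * pi * (of_int k * x + of_int l * y + \<kappa> * s x)"
  defines "W \<equiv> \<lambda>x. Wk 1 x y (s x)"
  defines "W' \<equiv> \<lambda>x. Wk 2 x y (s x) - W x / vT x * Vk 1 x y (s x)"
  assumes \<kappa>: "\<kappa> \<noteq> 0"
    and d\<omega>: "\<And>u. (\<omega> has_real_derivative \<omega>' u) (at u)" and per\<omega>: "\<And>u i. \<omega> (u + of_int i) = \<omega> u"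
    and K: "closed K" and off: "\<And>u. u \<notin> K \<Longrightarrow> \<omega> u = 0"
    and da: "\<And>x. ((\<lambda>x. a x y) has_real_derivative ax x y) (at x)" and pera: "a 1 y = a 0 y"
    and W0: "\<And>x. ur n x y \<in> K \<Longrightarrow> W x \<noteq> 0"
    and b1: "\<And>x. ur n x y \<in> K \<Longrightarrow> \<bar>\<omega> (ur n x y) * a x y * v x y / W x\<bar> \<le> \<delta>1"
    and b2: "\<And>x. ur n x y \<in> K \<Longrightarrow> \<bar>(\<omega>' (ur n x y) * q n * a x y * v x y +
        \<omega> (ur n x y) * (ax x y * v x y + a x y * density_deriv 1 0 x y)) / W x
        - \<omega> (ur n x y) * a x y * v x y * W' x / (W x)\<^sup>2\<bar> \<le> \<delta>2"
    and \<delta>: "\<delta>1 \<ge> 0" "\<delta>2 \<ge> 0"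
  shows "norm (integral {0..1} (\<lambda>x. of_real (\<omega> (ur n x y) * a x y * v x y / vT x) * cis (\<Phi> x)))
    \<le> \<bar>real_of_int k\<bar> / \<bar>\<kappa>\<bar> * \<delta>1 + \<delta>2 / (2 * pi * \<bar>\<kappa>\<bar>)"
proof -
  define u where "u x = ur n x y" for x
  define b where "b x = \<omega> (u x) * a x y * v x y" for x
  define b' where "b' x = \<omega>' (u x) * q n * a x y * v x y + \<omega> (u x) * (ax x y * v x y + a x y * density_deriv 1 0 x y)" for x
  define Y where "Y x = b x / W x" for x
  \<comment> \<open>Defined by cases because \<open>W\<close> may vanish at phases outside
    \<open>K\<close>. There \<open>\<omega>\<close>, and with it \<open>Y\<close>, vanishes in a
    neighbourhood, since \<open>K\<close> is closed.\<close>
  define Y' where "Y' x = (if u x \<in> K then b' x / W x - b x * W' x / (W x)\<^sup>2 else 0)" for x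
  have vT0: "vT x > 0" for x unfolding vT_def by (rule v_pos)
  have du: "(u has_real_derivative q n) (at x)" for x
    unfolding u_def[abs_def] ur_def by (auto intro!: derivative_eq_intros)
  have ds: "(s has_real_derivative - W x / vT x) (at x)" for x
    unfolding s_def W_def vT_def by (rule sigma_has_derivative_x)
  have dW: "(W has_real_derivative W' x) (at x)" for x
    unfolding W'_def vT_def W_def s_def by (rule W1_has_derivative_x)
  have db: "(b has_real_derivative b' x) (at x)" for x
  proof -
    have "((\<lambda>x. \<omega> (u x)) has_real_derivative \<omega>' (u x) * q n) (at x)"
      by (rule DERIV_chain2[where f = \<omega> and g = u, OF d\<omega> du])
    from DERIV_mult[OF DERIV_mult[OF this da] v_has_derivative_x]
    show ?thesis unfolding b_def[abs_def] b'_def by (rule DERIV_cong) (simp add: algebra_simps)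
  qed
  have dY: "(Y has_real_derivative Y' x) (at x)" for x
  proof (cases "u x \<in> K")
    case True
    have "(Y has_real_derivative (b' x * W x - b x * W' x) / (W x * W x)) (at x)"
      unfolding Y_def[abs_def] using W0 True by (intro DERIV_divide db dW) (simp add: u_def)
    moreover have "(b' x * W x - b x * W' x) / (W x * W x) = Y' x"
      using W0[of x] True by (simp add: Y'_def u_def power2_eq_square diff_divide_distrib)
    ultimately show ?thesis by simp
  next
    case False
    have "open (u -` (- K))"
      using K du by (intro continuous_open_vimage) (auto intro: DERIV_isCont)
    moreover have "x \<in> u -` (- K)" using False by simp
    ultimately have "((\<lambda>_. 0) has_real_derivative 0) (at x) \<longleftrightarrow> (Y has_real_derivative 0) (at x)"
      using off by (intro DERIV_cong_ev refl) (auto simp: eventually_nhds Y_def b_def intro!: exI[of _ "u -` (- K)"])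
    then show ?thesis using False by (simp add: Y'_def)
  qed
  define \<Phi>' where "\<Phi>' x = 2 * pi * (k - \<kappa> * W x / vT x)" for x
  have d\<Phi>: "(\<Phi> has_real_derivative \<Phi>' x) (at x)" for x
    unfolding \<Phi>_def \<Phi>'_def by (rule derivative_eq_intros ds refl | simp)+
  have dc: "((\<lambda>x. cis (\<Phi> x)) has_vector_derivative \<Phi>' x *\<^sub>R (\<i> * cis (\<Phi> x))) (at x)" for x
  proof -
    have 1: "(cis has_vector_derivative \<i> * cis t) (at t)" for t
    proof -
      have "((\<lambda>t. exp (\<i> * of_real t)) has_vector_derivative \<i> * exp (\<i> * of_real t)) (at t)"
        by (intro has_vector_derivative_real_field) (auto intro!: derivative_eq_intros)
      then show ?thesis by (simp add: cis_conv_exp[abs_def])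
    qed
    have 2: "(\<Phi> has_vector_derivative \<Phi>' x) (at x)"
      using d\<Phi> by (simp add: has_real_derivative_iff_has_vector_derivative)
    from vector_diff_chain_at[OF 2 1] show ?thesis by (simp add: o_def)
  qed
  have dYc: "((\<lambda>x. of_real (Y x) * cis (\<Phi> x)) has_vector_derivative
     of_real (Y x) * (of_real (\<Phi>' x) * (\<i> * cis (\<Phi> x))) + of_real (Y' x) * cis (\<Phi> x)) (at x)" for x
  proof -
    have "((\<lambda>x. of_real (Y x) :: complex) has_vector_derivative of_real (Y' x)) (at x)"
      using dY[of x] by (intro has_vector_derivative_of_real) (simp add: has_real_derivative_iff_has_vector_derivative)
    from has_vector_derivative_mult[OF this dc] show ?thesis by (simp add: scaleR_conv_of_real)
  qed
  have "((\<lambda>x. of_real (Y x) * (of_real (\<Phi>' x) * (\<i> * cis (\<Phi> x))) + of_real (Y' x) * cis (\<Phi> x))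
      has_integral (of_real (Y 1) * cis (\<Phi> 1) - of_real (Y 0) * cis (\<Phi> 0))) {0..1}"
    by (rule fundamental_theorem_of_calculus) (auto intro: has_vector_derivative_at_within[OF dYc])
  \<comment> \<open>Periodicity in \<open>x\<close> removes the boundary term of the integration by
    parts.\<close>
  moreover have "Y 1 = Y 0" "cis (\<Phi> 1) = cis (\<Phi> 0)"
  proof -
    have s1: "s 1 = s 0" using sigma_periodic[of m 0 1 y 0] by (simp add: s_def)
    have "u 1 = u 0 + of_int (q n)" by (simp add: u_def ur_def)
    then have "\<omega> (u 1) = \<omega> (u 0)" using per\<omega> by simp
    moreover have "v 1 y = v 0 y" using v_periodic[of 0 1 y 0] by simp
    moreover have "W 1 = W 0" using Wk_periodic[of 1 0 1 y 0] s1 by (simp add: W_def)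
    ultimately show "Y 1 = Y 0" by (simp add: Y_def b_def pera)
    have "\<Phi> 1 = 2 * pi * ((l * y + \<kappa> * s 0) + of_int k)" by (simp add: \<Phi>_def s1 algebra_simps)
    then show "cis (\<Phi> 1) = cis (\<Phi> 0)"
      unfolding \<Phi>_def by (simp only: cis_2pi_shift) (simp add: algebra_simps)
  qed
  ultimately have I0: "((\<lambda>x. of_real (Y x) * (of_real (\<Phi>' x) * (\<i> * cis (\<Phi> x))) + of_real (Y' x) * cis (\<Phi> x)) has_integral 0) {0..1}"
    by simp
  define G where "G x = of_real (b x / vT x) * cis (\<Phi> x)" for x
  define H where "H x = of_real (k / \<kappa> * Y x) * cis (\<Phi> x) - \<i> * of_real (Y' x / (2 * pi * \<kappa>)) * cis (\<Phi> x)" for x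
  \<comment> \<open>\<open>\<Phi>'\<close> contains the summand
    \<open>- 2 * pi * \<kappa> * W / vT\<close>. Divided by \<open>2 * pi * \<kappa>\<close> and
    multiplied by \<open>Y = b / W\<close> it cancels \<open>b / vT\<close>; only terms in
    \<open>Y\<close> and \<open>Y'\<close> remain, and these are bounded by \<delta>1 and
    \<delta>2.\<close>
  have GH: "G x - (\<i> / (2 * pi * \<kappa>)) * (of_real (Y x) * (of_real (\<Phi>' x) * (\<i> * cis (\<Phi> x))) + of_real (Y' x) * cis (\<Phi> x)) = H x" for x
  proof -
    have "b x / vT x + Y x * \<Phi>' x / (2 * pi * \<kappa>) = k / \<kappa> * Y x"
    proof (cases "u x \<in> K")
      case True
      then have "W x \<noteq> 0" using W0 by (simp add: u_def)
      then show ?thesis using \<kappa> vT0[of x] by (simp add: Y_def \<Phi>'_def field_simps)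
    next
      case False
      then show ?thesis using off by (simp add: b_def Y_def)
    qed
    then have e: "of_real (k / \<kappa> * Y x) = (of_real (b x / vT x) + of_real (Y x * \<Phi>' x / (2 * pi * \<kappa>)) :: complex)"
      by (metis of_real_add)
    show ?thesis unfolding G_def H_def e using \<kappa> by (simp add: field_simps)
  qed
  have Gc: "continuous_on {0..1} G"
  proof -
    have "continuous_on {0..1} vT"
    proof -
      have "continuous_on UNIV s" using ds by (intro continuous_at_imp_continuous_on ballI) (auto intro: DERIV_isCont)
      then have "continuous_on UNIV (\<lambda>x. (\<lambda>w. v (fst w) (snd w)) (x + \<alpha> * s x, y + s x))"
        by (intro continuous_on_compose2[OF v_continuous]) (auto intro!: continuous_intros)
      then show ?thesis unfolding vT_def by (auto intro: continuous_on_subset)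
    qed
    moreover have "continuous_on {0..1} b" "continuous_on {0..1} \<Phi>"
      using db d\<Phi> by (auto intro!: continuous_at_imp_continuous_on DERIV_isCont)
    ultimately show ?thesis
      unfolding G_def[abs_def] using vT0 by (intro continuous_intros) (auto simp: less_imp_neq[symmetric])
  qed
  then have GI: "G integrable_on {0..1}" by (rule integrable_continuous_real)
  have "(H has_integral integral {0..1} G - (\<i> / (2 * pi * \<kappa>)) * 0) {0..1}"
    using has_integral_diff[OF integrable_integral[OF GI] has_integral_mult_right[OF I0, of "\<i> / (2 * pi * \<kappa>)"]]
    unfolding GH .
  then have HI: "(H has_integral integral {0..1} G) (cbox 0 1)" by simp
  have bd: "norm (H x) \<le> \<bar>real_of_int k\<bar> / \<bar>\<kappa>\<bar> * \<delta>1 + \<delta>2 / (2 * pi * \<bar>\<kappa>\<bar>)" for x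
  proof -
    have Y: "\<bar>Y x\<bar> \<le> \<delta>1"
      using b1[of x] off[of "u x"] \<delta> by (cases "u x \<in> K") (auto simp: Y_def b_def u_def)
    have Y': "\<bar>Y' x\<bar> \<le> \<delta>2"
      using b2[of x] \<delta> by (cases "u x \<in> K") (auto simp: Y'_def b'_def b_def u_def)
    have "norm (H x) \<le> norm (of_real (k / \<kappa> * Y x) * cis (\<Phi> x)) + norm (\<i> * of_real (Y' x / (2 * pi * \<kappa>)) * cis (\<Phi> x))"
      unfolding H_def by (rule norm_triangle_ineq4)
    also have "\<dots> = \<bar>real_of_int k\<bar> / \<bar>\<kappa>\<bar> * \<bar>Y x\<bar> + \<bar>Y' x\<bar> / (2 * pi * \<bar>\<kappa>\<bar>)"
      by (simp add: norm_mult abs_mult abs_divide norm_divide)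
    also have "\<dots> \<le> \<bar>real_of_int k\<bar> / \<bar>\<kappa>\<bar> * \<delta>1 + \<delta>2 / (2 * pi * \<bar>\<kappa>\<bar>)"
      using Y Y' \<kappa> by (intro add_mono mult_left_mono divide_right_mono) auto
    finally show ?thesis .
  qed
  have "norm (integral {0..1} G) \<le> (\<bar>real_of_int k\<bar> / \<bar>\<kappa>\<bar> * \<delta>1 + \<delta>2 / (2 * pi * \<bar>\<kappa>\<bar>)) * measure lborel (cbox 0 (1::real))"
  proof (rule has_integral_bound[OF _ HI])
    show "norm (H x) \<le> \<bar>real_of_int k\<bar> / \<bar>\<kappa>\<bar> * \<delta>1 + \<delta>2 / (2 * pi * \<bar>\<kappa>\<bar>)" for x by (rule bd)
    show "0 \<le> \<bar>real_of_int k\<bar> / \<bar>\<kappa>\<bar> * \<delta>1 + \<delta>2 / (2 * pi * \<bar>\<kappa>\<bar>)"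
      using \<delta> by (intro add_nonneg_nonneg mult_nonneg_nonneg divide_nonneg_nonneg) auto
  qed
  then show ?thesis unfolding G_def b_def u_def by simp
qed

text \<open>Linear time and flow time differ by \<open>psi\<close>, which is of order
  \<open>\<beta> n\<close> plus a bounded term, and \<open>\<epsilon> n * \<beta> n\<close> tends to
  0. So the phase shift at scale \<open>n\<close> is asymptotically the same at all points.\<close>

lemma sigma_scaled_limit:
  assumes m: "(\<lambda>n. m n * \<epsilon> n) \<longlonglongrightarrow> \<theta>" and \<eta>: "\<eta> > 0"
  shows "eventually (\<lambda>n. \<forall>x y. \<bar>sigma (m n) x y * \<epsilon> n - \<theta>\<bar> < \<eta>) sequentially"
proof -
  have q4: "(\<lambda>n. (1/4::real) ^ Suc n) \<longlonglongrightarrow> 0"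
    using summable_LIMSEQ_zero[OF quarter_summable] .
  have L0: "(\<lambda>n. (4 + 3/2 * (\<bar>\<theta>\<bar> + 1)) * (1/4) ^ Suc n) \<longlonglongrightarrow> 0"
    using tendsto_mult_right_zero[OF q4] .
  have e1: "eventually (\<lambda>n. (4 + 3/2 * (\<bar>\<theta>\<bar> + 1)) * (1/4) ^ Suc n < \<eta> / 2) sequentially"
    by (rule order_tendstoD(2)[OF L0]) (use \<eta> in simp)
  have e2: "eventually (\<lambda>n. dist (m n * \<epsilon> n) \<theta> < min 1 (\<eta> / 2)) sequentially"
    using m \<eta> by (intro tendstoD) auto
  from e1 e2 show ?thesis
  proof eventually_elim
    case (elim n)
    have em: "0 < \<epsilon> n" by (rule eps_pos)
    have mb: "\<bar>m n\<bar> * \<epsilon> n \<le> \<bar>\<theta>\<bar> + 1" "\<bar>m n * \<epsilon> n - \<theta>\<bar> < \<eta> / 2"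
      using elim(2) em abs_mult[of "m n" "\<epsilon> n"] by (auto simp: dist_real_def)
    show ?case
    proof (intro allI)
      fix x y
      let ?s = "sigma (m n) x y"
      have "?s + psi x y ?s = m n" using tau_sigma[of x y "m n"] by (simp add: tau_def)
      then have "\<bar>?s - m n\<bar> = \<bar>Wk 0 x y ?s\<bar>" unfolding Wk_0 by linarith
      also have "\<dots> \<le> 2 * \<beta> n + (2 * (q n / real (Suc n)) + \<bar>?s\<bar> * \<epsilon> n)"
        using Wk_estimate[of 0 x y ?s n] q_power_gd_diff(1)[of n 0 "ur n x y" "?s * \<epsilon> n"] by simp
      also have "\<dots> \<le> 2 * \<beta> n + (2 * \<beta> n + 3/2 * (\<bar>\<theta>\<bar> + 1))"
      proof -
        have "q n / real (Suc n) \<le> q n / 1" using q_pos_real[of n] by (intro divide_left_mono) auto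
        then have "q n / real (Suc n) \<le> \<beta> n" using beta_q[of n] by simp
        moreover have "\<bar>?s\<bar> * \<epsilon> n \<le> 3/2 * (\<bar>m n\<bar> * \<epsilon> n)"
          using mult_right_mono[OF sigma_bound[of "m n" x y], of "\<epsilon> n"] em by (simp only: mult.assoc less_imp_le)
        moreover have "2 * b + (2 * a + c) \<le> 2 * b + (2 * b + 3/2 * (d + 1))"
          if "a \<le> b" "c \<le> 3/2 * e" "e \<le> d + 1" for a b c d e :: real
        proof -
          have "c \<le> 3/2 * (d + 1)" using that(2,3) mult_left_mono[of e "d + 1" "3/2"] by linarith
          then show ?thesis using that(1) by (intro add_mono) auto
        qed
        ultimately show ?thesis using mb(1) by blast
      qed
      finally have "\<bar>?s - m n\<bar> \<le> 4 * \<beta> n + 3/2 * (\<bar>\<theta>\<bar> + 1)" by simp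
      then have "\<bar>?s - m n\<bar> * \<epsilon> n \<le> (4 * \<beta> n + 3/2 * (\<bar>\<theta>\<bar> + 1)) * \<epsilon> n" using em by (intro mult_right_mono) auto
      also have "\<dots> = 4 * (\<epsilon> n * \<beta> n) + 3/2 * (\<bar>\<theta>\<bar> + 1) * \<epsilon> n" by (simp add: algebra_simps)
      also have "\<dots> \<le> 4 * (1/4) ^ Suc n + 3/2 * (\<bar>\<theta>\<bar> + 1) * (1/4) ^ Suc n"
        using eps_beta[of n] eps_le[of n] by (intro add_mono mult_left_mono) auto
      also have "\<dots> = (4 + 3/2 * (\<bar>\<theta>\<bar> + 1)) * (1/4) ^ Suc n" by (simp only: distrib_right)
      finally have "\<bar>?s - m n\<bar> * \<epsilon> n < \<eta> / 2" using elim(1) by linarith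
      moreover have "?s * \<epsilon> n - m n * \<epsilon> n = (?s - m n) * \<epsilon> n" by (simp add: algebra_simps)
      then have "\<bar>?s * \<epsilon> n - m n * \<epsilon> n\<bar> = \<bar>?s - m n\<bar> * \<epsilon> n" using em by (simp add: abs_mult)
      ultimately show "\<bar>?s * \<epsilon> n - \<theta>\<bar> < \<eta>" using mb(2) by linarith
    qed
  qed
qed

text \<open>\<open>K\<close> is a set of phases on which shifting by approximately \<open>\<theta>\<close> shears strongly, at scale \<open>n\<close>
  with \<open>n\<close> tending to infinity.\<close>

definition shearing :: "real set \<Rightarrow> real \<Rightarrow> bool" where
  "shearing K \<theta> \<longleftrightarrow> (\<exists>\<eta>>0. \<forall>L::real. eventually (\<lambda>n. \<forall>u\<in>K. \<forall>h. \<bar>h - \<theta>\<bar> < \<eta> \<longrightarrow>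
     L \<le> \<bar>gd 1 n (u + h) - gd 1 n u\<bar> \<and> L * \<bar>gd 2 n (u + h) - gd 2 n u\<bar> \<le> (gd 1 n (u + h) - gd 1 n u)\<^sup>2) sequentially)"

text \<open>The lower bound on \<open>L\<close> keeps the other scales below half of the leading
  term \<open>q n * D\<close>. In the second derivative the leading term is
  \<open>q n ^ 2 * E\<close> with \<open>L * \<bar>E\<bar> \<le> D\<^sup>2\<close>, and the rest is
  at most a constant times \<open>q n ^ 2 * D\<^sup>2 / L\<close>, because
  \<open>D\<^sup>2 \<ge> L\<close>.\<close>

lemma shear_estimates:
  fixes L \<Theta> s x y :: real and n :: nat
  assumes L: "L \<ge> 4 + 8 * \<Theta>" and \<Theta>: "\<Theta> \<ge> 0" and s: "\<bar>s\<bar> * \<epsilon> n \<le> \<Theta>"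
    and D: "L \<le> \<bar>gd 1 n (ur n x y + s * \<epsilon> n) - gd 1 n (ur n x y)\<bar>"
    and E: "L * \<bar>gd 2 n (ur n x y + s * \<epsilon> n) - gd 2 n (ur n x y)\<bar> \<le> (gd 1 n (ur n x y + s * \<epsilon> n) - gd 1 n (ur n x y))\<^sup>2"
  shows "\<bar>Wk 1 x y s\<bar> \<ge> q n * L / 2" "\<bar>Wk 2 x y s\<bar> / (Wk 1 x y s)\<^sup>2 \<le> (20 + 24 * \<Theta>) / L"
proof -
  define D where "D = gd 1 n (ur n x y + s * \<epsilon> n) - gd 1 n (ur n x y)"
  define E where "E = gd 2 n (ur n x y + s * \<epsilon> n) - gd 2 n (ur n x y)"
  define Q where "Q = real_of_int (q n)"
  have Q: "Q \<ge> 1" unfolding Q_def by (rule q_pos_real)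
  have L4: "L \<ge> 4" using L \<Theta> by linarith
  have DL: "L \<le> \<bar>D\<bar>" "L * \<bar>E\<bar> \<le> D\<^sup>2" using assms by (auto simp: D_def E_def)
  have Qn: "Q / real (Suc n) \<le> Q" using Q by (simp add: divide_le_eq)
  have \<Theta>Q: "\<Theta> \<le> \<Theta> * Q" using Q \<Theta> by (simp add: mult_le_cancel_left1)
  have "\<bar>Wk 1 x y s - Q * D\<bar> \<le> 2 * (Q / real (Suc n)) + 2 * (\<bar>s\<bar> * \<epsilon> n)"
    using Wk_estimate[of 1 x y s n] by (simp add: Q_def D_def)
  also have "\<dots> \<le> 2 * Q + 2 * (\<Theta> * Q)" using Qn s \<Theta>Q by linarith
  also have "\<dots> = Q * (2 + 2 * \<Theta>)" by (simp add: algebra_simps)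
  also have "\<dots> \<le> Q * (\<bar>D\<bar> / 2)" using Q L DL \<Theta> by (intro mult_left_mono) auto
  finally have "\<bar>Wk 1 x y s - Q * D\<bar> \<le> Q * \<bar>D\<bar> / 2" by simp
  moreover have "\<bar>Q * D\<bar> = Q * \<bar>D\<bar>" using Q by (simp add: abs_mult)
  ultimately have W: "\<bar>Wk 1 x y s\<bar> \<ge> Q * \<bar>D\<bar> / 2" by linarith
  have "Q * L / 2 \<le> Q * \<bar>D\<bar> / 2" using DL Q by simp
  with W show "\<bar>Wk 1 x y s\<bar> \<ge> q n * L / 2" by (simp add: Q_def)
  have "(Q * \<bar>D\<bar> / 2)\<^sup>2 \<le> \<bar>Wk 1 x y s\<bar>\<^sup>2" using W Q by (intro power_mono) auto
  then have W2: "Q\<^sup>2 * D\<^sup>2 / 4 \<le> (Wk 1 x y s)\<^sup>2" by (simp add: power_mult_distrib power_divide)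
  have D0: "D\<^sup>2 \<ge> L\<^sup>2" using power_mono[OF DL(1), of 2] L4 by simp
  have "L\<^sup>2 > 0" using L4 by simp
  with D0 have D2: "D\<^sup>2 > 0" by linarith
  have Q2: "Q\<^sup>2 > 0" using Q by simp
  have "\<bar>Wk 2 x y s - Q\<^sup>2 * E\<bar> \<le> 4 * (Q / real (Suc n)) + 6 * (\<bar>s\<bar> * \<epsilon> n)"
    using Wk_estimate[of 2 x y s n] by (simp add: Q_def E_def eval_nat_numeral)
  also have "\<dots> \<le> 4 * Q + 6 * (\<Theta> * Q)" using Qn s \<Theta>Q by linarith
  also have "\<dots> = (4 + 6 * \<Theta>) * Q" by (simp add: algebra_simps)
  also have "\<dots> \<le> (4 + 6 * \<Theta>) * Q\<^sup>2" using Q \<Theta> by (intro mult_left_mono) (auto simp: power2_eq_square)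
  finally have "\<bar>Wk 2 x y s\<bar> \<le> \<bar>Q\<^sup>2 * E\<bar> + (4 + 6 * \<Theta>) * Q\<^sup>2" by linarith
  also have "\<bar>Q\<^sup>2 * E\<bar> = Q\<^sup>2 * \<bar>E\<bar>" by (simp add: abs_mult)
  also have "Q\<^sup>2 * \<bar>E\<bar> \<le> Q\<^sup>2 * (D\<^sup>2 / L)" using DL(2) L4 by (intro mult_left_mono) (auto simp: field_simps)
  also have "(4 + 6 * \<Theta>) * Q\<^sup>2 \<le> (4 + 6 * \<Theta>) * Q\<^sup>2 * (D\<^sup>2 / L)"
  proof -
    have "L * 1 \<le> L * L" using L4 by (intro mult_left_mono) auto
    then have "L \<le> D\<^sup>2" using D0 by (simp add: power2_eq_square)
    then have "1 \<le> D\<^sup>2 / L" using L4 by simp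
    then show ?thesis using \<Theta> mult_left_mono[of 1 "D\<^sup>2 / L" "(4 + 6 * \<Theta>) * Q\<^sup>2"] by simp
  qed
  finally have "\<bar>Wk 2 x y s\<bar> \<le> (5 + 6 * \<Theta>) * (Q\<^sup>2 * D\<^sup>2) / L" by (simp add: algebra_simps add_divide_distrib)
  then have "\<bar>Wk 2 x y s\<bar> / (Wk 1 x y s)\<^sup>2 \<le> ((5 + 6 * \<Theta>) * (Q\<^sup>2 * D\<^sup>2) / L) / (Q\<^sup>2 * D\<^sup>2 / 4)"
    using W2 D2 Q2 L4 \<Theta> by (intro frac_le) auto
  also have "\<dots> = (20 + 24 * \<Theta>) / L" using D2 Q2 L4 by (simp add: field_simps)
  finally show "\<bar>Wk 2 x y s\<bar> / (Wk 1 x y s)\<^sup>2 \<le> (20 + 24 * \<Theta>) / L" .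
qed

text \<open>Every term left by the integration by parts is at most a constant over \<open>L\<close>,
  with constants that depend neither on \<open>n\<close> nor on \<open>y\<close>; shear allows any
  \<open>L\<close> once \<open>n\<close> is large.\<close>

lemma oscillatory_integral_tendsto:
  fixes k l :: int and a ax :: "real \<Rightarrow> real \<Rightarrow> real" and \<omega> \<omega>' :: "real \<Rightarrow> real"
  assumes \<kappa>: "k * \<alpha> + l \<noteq> 0" and m: "(\<lambda>n. m n * \<epsilon> n) \<longlonglongrightarrow> \<theta>" and sh: "shearing K \<theta>"
    and d\<omega>: "\<And>u. (\<omega> has_real_derivative \<omega>' u) (at u)" and per\<omega>: "\<And>u i. \<omega> (u + of_int i) = \<omega> u"
    and K: "closed K" and off: "\<And>u. u \<notin> K \<Longrightarrow> \<omega> u = 0"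
    and b\<omega>: "\<And>u. \<bar>\<omega> u\<bar> \<le> 1" "\<And>u. \<bar>\<omega>' u\<bar> \<le> X"
    and da: "\<And>x y. ((\<lambda>x. a x y) has_real_derivative ax x y) (at x)" and pera: "\<And>y. a 1 y = a 0 y"
    and ba: "\<And>x y. \<bar>a x y\<bar> \<le> A" "\<And>x y. \<bar>ax x y\<bar> \<le> A"
    and e: "e > 0"
  shows "eventually (\<lambda>n. \<forall>y::real. norm (integral {0..1} (\<lambda>x.
      of_real (\<omega> (ur n x y) * a x y * v x y / v (x + \<alpha> * sigma (m n) x y) (y + sigma (m n) x y)) *
      cis (2 * pi * (k * x + l * y + (k * \<alpha> + l) * sigma (m n) x y)))) \<le> e) sequentially"
proof -
  define \<kappa>' where "\<kappa>' = k * \<alpha> + l"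
  define \<Theta> where "\<Theta> = \<bar>\<theta>\<bar> + 1"
  have A0: "A \<ge> 0" using ba(1)[of 0 0] by linarith
  have X0: "X \<ge> 0" using b\<omega>(2)[of 0] by linarith
  \<comment> \<open>The three summands bound, with rounding, the terms in which the cut-off, the
    amplitude times the density, and \<open>1 / W\<close> are differentiated.\<close>
  define C where "C = 3 * A * X + 4 * A + 2 * A * (22 + 24 * \<Theta>)"
  have \<Theta>: "\<Theta> \<ge> 0" by (simp add: \<Theta>_def)
  have C0: "C \<ge> 0" using A0 X0 \<Theta> by (simp add: C_def)
  define B where "B = \<bar>real_of_int k\<bar> / \<bar>\<kappa>'\<bar> * (3 * A) + C / (2 * pi * \<bar>\<kappa>'\<bar>)"
  have B0: "B \<ge> 0" using A0 C0 by (simp add: B_def)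
  define L where "L = max (4 + 8 * \<Theta>) (B / e)"
  have L: "L \<ge> 4 + 8 * \<Theta>" "B / e \<le> L" by (auto simp: L_def)
  have L0: "L > 0" using L(1) \<Theta> by linarith
  obtain \<eta> where \<eta>: "\<eta> > 0" and ev: "eventually (\<lambda>n. \<forall>u\<in>K. \<forall>h. \<bar>h - \<theta>\<bar> < \<eta> \<longrightarrow>
     L \<le> \<bar>gd 1 n (u + h) - gd 1 n u\<bar> \<and> L * \<bar>gd 2 n (u + h) - gd 2 n u\<bar> \<le> (gd 1 n (u + h) - gd 1 n u)\<^sup>2) sequentially"
    using sh unfolding shearing_def by blast
  have ev2: "eventually (\<lambda>n. \<forall>x y. \<bar>sigma (m n) x y * \<epsilon> n - \<theta>\<bar> < min 1 \<eta>) sequentially"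
    by (rule sigma_scaled_limit[OF m]) (use \<eta> in simp)
  from ev ev2 show ?thesis
  proof eventually_elim
    case (elim n)
    show ?case
    proof
      fix y
      define s where "s x = sigma (m n) x y" for x
      define W where "W x = Wk 1 x y (s x)" for x
      define vT where "vT x = v (x + \<alpha> * s x) (y + s x)" for x
      define W' where "W' x = Wk 2 x y (s x) - W x / vT x * Vk 1 x y (s x)" for x
      have s\<Theta>: "\<bar>s x\<bar> * \<epsilon> n \<le> \<Theta>" for x
      proof -
        have "\<bar>s x * \<epsilon> n - \<theta>\<bar> < 1" using elim(2) by (simp add: s_def)
        then have "\<bar>s x * \<epsilon> n\<bar> \<le> \<Theta>" unfolding \<Theta>_def by linarith
        then show ?thesis using eps_pos[of n] by (simp add: abs_mult)
      qed
      have near: "\<bar>s x * \<epsilon> n - \<theta>\<bar> < \<eta>" for x using elim(2) by (simp add: s_def)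
      have est: "\<bar>W x\<bar> \<ge> q n * L / 2" "\<bar>Wk 2 x y (s x)\<bar> / (W x)\<^sup>2 \<le> (20 + 24 * \<Theta>) / L" if "ur n x y \<in> K" for x
        using shear_estimates[OF L(1) \<Theta> s\<Theta>[of x]] elim(1)[rule_format, OF that near[of x]] unfolding W_def by blast+
      have q1: "real_of_int (q n) \<ge> 1" by (rule q_pos_real)
      have W0: "\<bar>W x\<bar> > 0" if "ur n x y \<in> K" for x
      proof -
        have "0 < q n * L / 2" using q1 L0 by simp
        then show ?thesis using est(1)[OF that] by linarith
      qed
      \<comment> \<open>The derivative of the cut-off at the phase carries a factor
        \<open>q n\<close>. It is harmless because \<open>W\<close> itself is at least
        \<open>q n * L / 2\<close> in absolute value.\<close>
      have Winv: "1 / \<bar>W x\<bar> \<le> 2 / L" "q n / \<bar>W x\<bar> \<le> 2 / L" if "ur n x y \<in> K" for x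
      proof -
        have "q n * L \<le> 2 * \<bar>W x\<bar>" using est(1)[OF that] by simp
        then show 2: "q n / \<bar>W x\<bar> \<le> 2 / L" using L0 W0[OF that] by (simp add: field_simps)
        have "1 / \<bar>W x\<bar> \<le> q n / \<bar>W x\<bar>" using q1 by (intro divide_right_mono) auto
        with 2 show "1 / \<bar>W x\<bar> \<le> 2 / L" by linarith
      qed
      have W'b: "\<bar>W' x\<bar> / (W x)\<^sup>2 \<le> (22 + 24 * \<Theta>) / L" if "ur n x y \<in> K" for x
      proof -
        have "\<bar>W x / vT x * Vk 1 x y (s x)\<bar> = \<bar>W x\<bar> * (\<bar>Vk 1 x y (s x)\<bar> / vT x)"
          using v_pos[of "x + \<alpha> * s x" "y + s x"] by (simp add: abs_mult abs_divide vT_def)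
        also have "\<dots> \<le> \<bar>W x\<bar> * ((2/3) / (2/3))"
          using Vk_bound[of 1 x y "s x"] v_bounds(1)[of "x + \<alpha> * s x" "y + s x"] unfolding vT_def
          by (intro mult_left_mono frac_le) auto
        finally have "\<bar>W x / vT x * Vk 1 x y (s x)\<bar> \<le> \<bar>W x\<bar>" by simp
        then have "\<bar>W' x\<bar> \<le> \<bar>Wk 2 x y (s x)\<bar> + \<bar>W x\<bar>"
          unfolding W'_def by (rule order.trans[OF abs_triangle_ineq4 add_left_mono])
        then have "\<bar>W' x\<bar> / (W x)\<^sup>2 \<le> (\<bar>Wk 2 x y (s x)\<bar> + \<bar>W x\<bar>) / (W x)\<^sup>2" by (rule divide_right_mono) simp
        also have "\<dots> = \<bar>Wk 2 x y (s x)\<bar> / (W x)\<^sup>2 + 1 / \<bar>W x\<bar>"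
        proof -
          have "(W x)\<^sup>2 = \<bar>W x\<bar> * \<bar>W x\<bar>" by (simp add: power2_eq_square)
          then have "\<bar>W x\<bar> / (W x)\<^sup>2 = 1 / \<bar>W x\<bar>" using W0[OF that] by (simp del: abs_mult_self_eq)
          then show ?thesis by (simp only: add_divide_distrib)
        qed
        also have "\<dots> \<le> (20 + 24 * \<Theta>) / L + 2 / L" using est(2)[OF that] Winv(1)[OF that] by (rule add_mono)
        also have "\<dots> = (22 + 24 * \<Theta>) / L" by (simp add: add_divide_distrib[symmetric])
        finally show ?thesis .
      qed
      have av: "\<bar>a x y * v x y\<bar> \<le> A * (4/3)" for x
        unfolding abs_mult using ba(1)[of x y] v_bounds[of x y] A0 by (intro mult_mono) auto
      have dav: "\<bar>ax x y * v x y + a x y * density_deriv 1 0 x y\<bar> \<le> 2 * A" for x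
      proof -
        have "\<bar>ax x y * v x y\<bar> \<le> A * (4/3)"
          unfolding abs_mult using ba(2)[of x y] v_bounds[of x y] A0 by (intro mult_mono) auto
        moreover have "\<bar>a x y * density_deriv 1 0 x y\<bar> \<le> A * (2/3)"
          unfolding abs_mult using ba(1)[of x y] density_deriv_10_bound[of x y] A0 by (intro mult_mono) auto
        ultimately show ?thesis by linarith
      qed
      have "norm (integral {0..1} (\<lambda>x. of_real (\<omega> (ur n x y) * a x y * v x y / vT x) *
         cis (2 * pi * (k * x + l * y + \<kappa>' * s x)))) \<le> \<bar>real_of_int k\<bar> / \<bar>\<kappa>'\<bar> * (3 * A / L) + (C / L) / (2 * pi * \<bar>\<kappa>'\<bar>)"
        unfolding \<kappa>'_def s_def vT_def
      proof (rule oscillatory_integral_bound[OF \<kappa> d\<omega> per\<omega> K off da pera, where ?\<delta>1.0 = "3 * A / L" and ?\<delta>2.0 = "C / L"])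
        fix x assume x: "ur n x y \<in> K"
        show "Wk 1 x y (sigma (m n) x y) \<noteq> 0" using W0[OF x] by (simp add: W_def s_def)
        have "\<bar>\<omega> (ur n x y) * a x y * v x y / W x\<bar> = \<bar>\<omega> (ur n x y)\<bar> * (\<bar>a x y * v x y\<bar> * (1 / \<bar>W x\<bar>))"
          by (simp add: abs_mult abs_divide)
        also have "\<dots> \<le> 1 * (A * (4/3) * (2 / L))"
          using b\<omega>(1) av[of x] Winv(1)[OF x] A0 by (intro mult_mono) auto
        also have "\<dots> \<le> 3 * A / L" using A0 L0 by (simp add: field_simps)
        finally show "\<bar>\<omega> (ur n x y) * a x y * v x y / Wk 1 x y (sigma (m n) x y)\<bar> \<le> 3 * A / L"
          by (simp add: W_def s_def)
        have t1: "\<bar>\<omega>' (ur n x y) * q n * a x y * v x y / W x\<bar> \<le> X * (A * (4/3)) * (2 / L)"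
        proof -
          have "\<bar>\<omega>' (ur n x y) * q n * a x y * v x y / W x\<bar> = \<bar>\<omega>' (ur n x y)\<bar> * \<bar>a x y * v x y\<bar> * (q n / \<bar>W x\<bar>)"
            using q1 by (simp add: abs_mult abs_divide)
          also have "\<dots> \<le> X * (A * (4/3)) * (2 / L)"
            using b\<omega>(2) av[of x] Winv(2)[OF x] A0 X0 q1 by (intro mult_mono) auto
          finally show ?thesis .
        qed
        have t2: "\<bar>\<omega> (ur n x y) * (ax x y * v x y + a x y * density_deriv 1 0 x y) / W x\<bar> \<le> 1 * (2 * A) * (2 / L)"
        proof -
          have "\<bar>\<omega> (ur n x y) * (ax x y * v x y + a x y * density_deriv 1 0 x y) / W x\<bar> =
             \<bar>\<omega> (ur n x y)\<bar> * \<bar>ax x y * v x y + a x y * density_deriv 1 0 x y\<bar> * (1 / \<bar>W x\<bar>)"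
            by (simp add: abs_mult abs_divide)
          also have "\<dots> \<le> 1 * (2 * A) * (2 / L)"
            using b\<omega>(1) dav[of x] Winv(1)[OF x] A0 by (intro mult_mono) auto
          finally show ?thesis .
        qed
        have t3: "\<bar>\<omega> (ur n x y) * a x y * v x y * W' x / (W x)\<^sup>2\<bar> \<le> 1 * (A * (4/3)) * ((22 + 24 * \<Theta>) / L)"
        proof -
          have "\<bar>\<omega> (ur n x y) * a x y * v x y * W' x / (W x)\<^sup>2\<bar> = \<bar>\<omega> (ur n x y)\<bar> * \<bar>a x y * v x y\<bar> * (\<bar>W' x\<bar> / (W x)\<^sup>2)"
            by (simp add: abs_mult abs_divide)
          also have "\<dots> \<le> 1 * (A * (4/3)) * ((22 + 24 * \<Theta>) / L)"
            using b\<omega>(1) av[of x] W'b[OF x] A0 by (intro mult_mono) auto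
          finally show ?thesis .
        qed
        have "X * (A * (4/3)) * (2 / L) + 1 * (2 * A) * (2 / L) + 1 * (A * (4/3)) * ((22 + 24 * \<Theta>) / L)
           = ((8/3) * (A * X) + 4 * A + (4/3) * (A * (22 + 24 * \<Theta>))) / L"
          using L0 by (simp add: field_simps)
        also have "\<dots> \<le> C / L"
        proof (rule divide_right_mono)
          have "0 \<le> A * X" "0 \<le> A * (22 + 24 * \<Theta>)" using A0 X0 \<Theta> by auto
          then show "(8/3) * (A * X) + 4 * A + (4/3) * (A * (22 + 24 * \<Theta>)) \<le> C"
            unfolding C_def mult.assoc by linarith
        qed (use L0 in simp)
        finally have "\<bar>\<omega>' (ur n x y) * q n * a x y * v x y / W x + \<omega> (ur n x y) * (ax x y * v x y + a x y * density_deriv 1 0 x y) / W x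
          - \<omega> (ur n x y) * a x y * v x y * W' x / (W x)\<^sup>2\<bar> \<le> C / L"
          using t1 t2 t3 by linarith
        then show "\<bar>(\<omega>' (ur n x y) * q n * a x y * v x y + \<omega> (ur n x y) * (ax x y * v x y + a x y * density_deriv 1 0 x y))
           / Wk 1 x y (sigma (m n) x y) - \<omega> (ur n x y) * a x y * v x y *
          (Wk 2 x y (sigma (m n) x y) - Wk 1 x y (sigma (m n) x y) / v (x + \<alpha> * sigma (m n) x y) (y + sigma (m n) x y) * Vk 1 x y (sigma (m n) x y))
          / (Wk 1 x y (sigma (m n) x y))\<^sup>2\<bar> \<le> C / L"
          by (simp add: W_def W'_def vT_def s_def add_divide_distrib)
      qed (use A0 L0 C0 in auto)
      also have "\<dots> = B / L" using L0 by (simp add: B_def field_simps)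
      also have "\<dots> \<le> e" using L(2) L0 e by (simp add: field_simps)
      finally show "norm (integral {0..1} (\<lambda>x. of_real (\<omega> (ur n x y) * a x y * v x y / v (x + \<alpha> * sigma (m n) x y) (y + sigma (m n) x y)) *
        cis (2 * pi * (k * x + l * y + (k * \<alpha> + l) * sigma (m n) x y)))) \<le> e"
        by (simp add: \<kappa>'_def s_def vT_def)
    qed
  qed
qed

end

section \<open>Decorrelation\<close>

inductive_set trig_poly :: "(real \<Rightarrow> real \<Rightarrow> complex) set" where
  char: "(\<lambda>x y. cis (2 * pi * (of_int k * x + of_int l * y))) \<in> trig_poly" for k l :: int
| add: "f \<in> trig_poly \<Longrightarrow> g \<in> trig_poly \<Longrightarrow> (\<lambda>x y. f x y + g x y) \<in> trig_poly"
| scale: "f \<in> trig_poly \<Longrightarrow> (\<lambda>x y. c * f x y) \<in> trig_poly"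

lemma trig_poly_const: "(\<lambda>x y. c) \<in> trig_poly"
  using trig_poly.scale[OF trig_poly.char[of 0 0], of c] by simp

lemma trig_poly_mult:
  assumes "f \<in> trig_poly" "g \<in> trig_poly"
  shows "(\<lambda>x y. f x y * g x y) \<in> trig_poly"
  using assms
proof (induction f rule: trig_poly.induct)
  case (char k l)
  from char show ?case
  proof (induction g rule: trig_poly.induct)
    case (char k' l')
    have "(\<lambda>x y. cis (2 * pi * (of_int (k + k') * x + of_int (l + l') * y))) \<in> trig_poly" by (rule trig_poly.char)
    moreover have "cis (2 * pi * (of_int (k + k') * x + of_int (l + l') * y)) =
       cis (2 * pi * (of_int k * x + of_int l * y)) * cis (2 * pi * (of_int k' * x + of_int l' * y))" for x y
      by (simp add: cis_mult algebra_simps)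
    ultimately show ?case by simp
  next
    case (add f g)
    from trig_poly.add[OF add.IH] show ?case by (simp add: distrib_left)
  next
    case (scale f c)
    from trig_poly.scale[OF scale.IH, of c] show ?case by (simp add: mult_ac)
  qed
next
  case (add f f')
  have "(\<lambda>x y. f x y * g x y) \<in> trig_poly" "(\<lambda>x y. f' x y * g x y) \<in> trig_poly" using add by auto
  from trig_poly.add[OF this] show ?case by (simp add: distrib_right)
next
  case (scale f c)
  have "(\<lambda>x y. f x y * g x y) \<in> trig_poly" using scale by auto
  from trig_poly.scale[OF this, of c] show ?case by (simp add: mult_ac)
qed

lemma trig_poly_cnj:
  assumes "f \<in> trig_poly"
  shows "(\<lambda>x y. cnj (f x y)) \<in> trig_poly"
  using assms
proof (induction f rule: trig_poly.induct)
  case (char k l)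
  show ?case using trig_poly.char[of "- k" "- l"] by (simp add: cis_cnj algebra_simps)
next
  case (add f g)
  from trig_poly.add[OF add.IH] show ?case by simp
next
  case (scale f c)
  from trig_poly.scale[OF scale.IH, of "cnj c"] show ?case by simp
qed

lemma trig_poly_bounded_linear:
  assumes h: "bounded_linear (h :: complex \<times> complex \<Rightarrow> real)"
  shows "(\<lambda>x y. of_real (h (torus_proj (x, y)))) \<in> trig_poly"
proof -
  interpret bounded_linear h by fact
  have Re: "(\<lambda>x y. of_real (Re (f x y))) \<in> trig_poly" and Im: "(\<lambda>x y. of_real (Im (f x y))) \<in> trig_poly" if f: "f \<in> trig_poly" for f
  proof -
    have "(\<lambda>x y. (1/2) * (f x y + cnj (f x y))) \<in> trig_poly"
      by (intro trig_poly.scale trig_poly.add trig_poly_cnj f)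
    then show "(\<lambda>x y. of_real (Re (f x y))) \<in> trig_poly" by (simp add: complex_add_cnj)
    have "(\<lambda>x y. (1/(2 * \<i>)) * (f x y + (- 1) * cnj (f x y))) \<in> trig_poly"
      by (intro trig_poly.scale trig_poly.add trig_poly_cnj f)
    moreover have "(1/(2 * \<i>)) * (w + (- 1) * cnj w) = of_real (Im w)" for w
      by (simp add: complex_eq_iff)
    ultimately show "(\<lambda>x y. of_real (Im (f x y))) \<in> trig_poly" by (simp only:)
  qed
  have e1: "(\<lambda>x y. cis (2 * pi * x)) \<in> trig_poly" and e2: "(\<lambda>x y. cis (2 * pi * y)) \<in> trig_poly"
    using trig_poly.char[of 1 0] trig_poly.char[of 0 1] by simp_all
  have X: "(\<lambda>x y. of_real (h (1, 0)) * of_real (Re (cis (2 * pi * x))) + of_real (h (\<i>, 0)) * of_real (Im (cis (2 * pi * x))) +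
     (of_real (h (0, 1)) * of_real (Re (cis (2 * pi * y))) + of_real (h (0, \<i>)) * of_real (Im (cis (2 * pi * y))))) \<in> trig_poly"
    by (intro trig_poly.add trig_poly.scale Re Im e1 e2)
  have hh: "h (z, w) = h (1, 0) * Re z + h (\<i>, 0) * Im z + (h (0, 1) * Re w + h (0, \<i>) * Im w)" for z w
  proof -
    have "(z, w) = (Re z *\<^sub>R (1, 0) + Im z *\<^sub>R (\<i>, 0)) + (Re w *\<^sub>R (0, 1) + Im w *\<^sub>R (0, \<i>))"
      by (simp add: complex_eq_iff)
    then have "h (z, w) = h ((Re z *\<^sub>R (1, 0) + Im z *\<^sub>R (\<i>, 0)) + (Re w *\<^sub>R (0, 1) + Im w *\<^sub>R (0, \<i>)))" by (rule arg_cong)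
    then show ?thesis by (simp only: add scaleR real_scaleR_def mult.commute)
  qed
  have Y: "complex_of_real (h (torus_proj (x, y))) = of_real (h (1, 0)) * of_real (Re (cis (2 * pi * x))) + of_real (h (\<i>, 0)) * of_real (Im (cis (2 * pi * x))) +
     (of_real (h (0, 1)) * of_real (Re (cis (2 * pi * y))) + of_real (h (0, \<i>)) * of_real (Im (cis (2 * pi * y))))" for x y
    unfolding torus_proj_def fst_conv snd_conv hh[of "cis (2 * pi * x)" "cis (2 * pi * y)"] by (simp only: of_real_add of_real_mult)
  show ?thesis using X by (simp only: Y)
qed

text \<open>On the torus the real coordinates of the ambient space are real and imaginary parts of
  characters, and trigonometric polynomials are closed under products. This carries the
  Stone-Weierstrass theorem for polynomial functions over to characters.\<close>

lemma trig_poly_real_polynomial: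
  assumes "real_polynomial_function (h :: complex \<times> complex \<Rightarrow> real)"
  shows "(\<lambda>x y. of_real (h (torus_proj (x, y)))) \<in> trig_poly"
  using assms
proof (induction h rule: real_polynomial_function.induct)
  case (linear f)
  then show ?case by (rule trig_poly_bounded_linear)
next
  case (const c)
  show ?case using trig_poly_const by simp
next
  case (add f g)
  from trig_poly.add[OF add.IH] show ?case by simp
next
  case (mult f g)
  from trig_poly_mult[OF mult.IH] show ?case by simp
qed

lemma trig_poly_C1:
  assumes "f \<in> trig_poly"
  shows "\<exists>fx B. (\<forall>x y. ((\<lambda>x. f x y) has_vector_derivative fx x y) (at x)) \<and> (\<forall>x y. norm (f x y) \<le> B \<and> norm (fx x y) \<le> B)"
  using assms
proof (induction f rule: trig_poly.induct)
  case (char k l)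
  let ?fx = "\<lambda>x y. (2 * pi * of_int k) *\<^sub>R (\<i> * cis (2 * pi * (of_int k * x + of_int l * y)))"
  have 1: "(cis has_vector_derivative \<i> * cis t) (at t)" for t
  proof -
    have "((\<lambda>t. exp (\<i> * of_real t)) has_vector_derivative \<i> * exp (\<i> * of_real t)) (at t)"
      by (intro has_vector_derivative_real_field) (auto intro!: derivative_eq_intros)
    then show ?thesis by (simp add: cis_conv_exp[abs_def])
  qed
  have "((\<lambda>x. cis (2 * pi * (of_int k * x + of_int l * y))) has_vector_derivative ?fx x y) (at x)" for x y
  proof -
    have "((\<lambda>x. 2 * pi * (of_int k * x + of_int l * y)) has_vector_derivative 2 * pi * of_int k) (at x)"
      unfolding has_real_derivative_iff_has_vector_derivative[symmetric] by (auto intro!: derivative_eq_intros)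
    from vector_diff_chain_at[OF this 1] show ?thesis by (simp add: o_def)
  qed
  moreover have "norm (cis (2 * pi * (of_int k * x + of_int l * y))) \<le> 1 + \<bar>2 * pi * of_int k\<bar>" "norm (?fx x y) \<le> 1 + \<bar>2 * pi * of_int k\<bar>" for x y
    by (simp_all add: norm_mult)
  ultimately show ?case
    by (intro exI[of _ ?fx] exI[of _ "1 + \<bar>2 * pi * of_int k\<bar>"]) blast
next
  case (add f g)
  then obtain fx B gx B' where f: "\<And>x y. ((\<lambda>x. f x y) has_vector_derivative fx x y) (at x)" "\<And>x y. norm (f x y) \<le> B" "\<And>x y. norm (fx x y) \<le> B"
    and g: "\<And>x y. ((\<lambda>x. g x y) has_vector_derivative gx x y) (at x)" "\<And>x y. norm (g x y) \<le> B'" "\<And>x y. norm (gx x y) \<le> B'"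
    by blast
  have "((\<lambda>x. f x y + g x y) has_vector_derivative fx x y + gx x y) (at x)" for x y
    by (intro has_vector_derivative_add f g)
  moreover have "norm (f x y + g x y) \<le> B + B'" "norm (fx x y + gx x y) \<le> B + B'" for x y
    by (intro norm_triangle_mono f g)+
  ultimately show ?case
    by (intro exI[of _ "\<lambda>x y. fx x y + gx x y"] exI[of _ "B + B'"]) blast
next
  case (scale f c)
  then obtain fx B where f: "\<And>x y. ((\<lambda>x. f x y) has_vector_derivative fx x y) (at x)" "\<And>x y. norm (f x y) \<le> B" "\<And>x y. norm (fx x y) \<le> B"
    by blast
  have "((\<lambda>x. c * f x y) has_vector_derivative c * fx x y) (at x)" for x y
    by (rule has_vector_derivative_mult_right[OF f(1)])
  moreover have "norm (c * f x y) \<le> norm c * B" "norm (c * fx x y) \<le> norm c * B" for x y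
    using f by (auto simp: norm_mult intro!: mult_left_mono)
  ultimately show ?case
    by (intro exI[of _ "\<lambda>x y. c * fx x y"] exI[of _ "norm c * B"]) blast
qed

lemma trig_poly_continuous:
  assumes "f \<in> trig_poly"
  shows "continuous_on UNIV (\<lambda>p. f (fst p) (snd p))"
  using assms
proof (induction f rule: trig_poly.induct)
  case (char k l)
  show ?case unfolding cis_conv_exp by (intro continuous_intros)
qed (auto intro!: continuous_intros)

lemma trig_poly_periodic:
  assumes "f \<in> trig_poly"
  shows "f (x + of_int i) (y + of_int j) = f x y"
  using assms
proof (induction f rule: trig_poly.induct)
  case (char k l)
  have "2 * pi * (of_int k * (x + of_int i) + of_int l * (y + of_int j)) = 2 * pi * ((of_int k * x + of_int l * y) + of_int (k * i + l * j))"
    by (simp add: algebra_simps)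
  then show ?case by (simp only: cis_2pi_shift)
qed auto

text \<open>\<open>torus_coord\<close> is discontinuous at the seams. The map \<open>F\<close>,
  built from the logarithms of the quotients by the coordinates of \<open>z0\<close>, which are
  close to 1 near \<open>z0\<close>, is a right inverse of \<open>torus_proj\<close> on the torus
  and continuous at \<open>z0\<close>; it differs from \<open>torus_coord\<close> by integers, which
  \<open>f\<close> does not see.\<close>

lemma continuous_on_torus_lift:
  fixes f :: "real \<times> real \<Rightarrow> real"
  assumes f: "continuous_on UNIV f" and per: "\<And>x y i j. f (x + of_int i, y + of_int j) = f (x, y)"
  shows "continuous_on torus (\<lambda>z. f (torus_coord z))"
  unfolding continuous_on_eq_continuous_within
proof
  fix z0 assume z0: "z0 \<in> torus"
  define x0 where "x0 = torus_coord z0"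
  have p0: "torus_proj x0 = z0" using torus_proj_coord[OF z0] by (simp add: x0_def)
  define F where "F z = (fst x0 + Im (Ln (fst z / fst z0)) / (2 * pi), snd x0 + Im (Ln (snd z / snd z0)) / (2 * pi))" for z
  have nz: "fst z0 \<noteq> 0" "snd z0 \<noteq> 0" using z0 by (auto simp: torus_def)
  have "isCont (\<lambda>z. f (F z)) z0"
  proof -
    have "isCont F z0" unfolding F_def
      using nz by (intro continuous_intros) (auto simp: nonpos_Reals_def)
    moreover have "isCont f (F z0)" by (rule continuous_on_interior[OF f]) simp
    ultimately show ?thesis by (rule isCont_o2)
  qed
  then have c: "continuous (at z0 within torus) (\<lambda>z. f (F z))" by (rule continuous_at_imp_continuous_at_within)
  have eq: "f (F z) = f (torus_coord z)" if z: "z \<in> torus" for z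
  proof -
    have cis_Ln: "cis (2 * pi * (x + Im (Ln w) / (2 * pi))) = cis (2 * pi * x) * w" if "norm w = 1" for x w
    proof -
      have w0: "w \<noteq> 0" using that by auto
      have "exp (Ln w) = of_real (exp (Re (Ln w))) * cis (Im (Ln w))" by (simp add: exp_eq_polar)
      moreover have "exp (Re (Ln w)) = 1" using that w0 by (simp add: Re_Ln)
      ultimately have "cis (Im (Ln w)) = w" using w0 by simp
      then show ?thesis by (simp add: distrib_left cis_mult[symmetric])
    qed
    have n1: "norm (fst z / fst z0) = 1" "norm (snd z / snd z0) = 1" using z z0 by (auto simp: torus_def norm_divide)
    have p0': "cis (2 * pi * fst x0) = fst z0" "cis (2 * pi * snd x0) = snd z0"
      using p0 by (auto simp: torus_proj_def)
    have "torus_proj (F z) = z"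
      unfolding torus_proj_def F_def fst_conv snd_conv cis_Ln[OF n1(1)] cis_Ln[OF n1(2)] p0' using nz by simp
    then have "torus_coord z = (frac (fst (F z)), frac (snd (F z)))"
      using torus_coord_proj[of "fst (F z)" "snd (F z)"] by simp
    then show ?thesis
      using per[of "fst (F z)" "- \<lfloor>fst (F z)\<rfloor>" "snd (F z)" "- \<lfloor>snd (F z)\<rfloor>"] by (simp add: frac_def)
  qed
  show "continuous (at z0 within torus) (\<lambda>z. f (torus_coord z))"
    by (rule continuous_transform_within[OF c zero_less_one z0]) (rule eq)
qed

lemma compact_torus: "compact torus"
  unfolding torus_def by (intro compact_Times compact_sphere)

text \<open>Regularity gives a compact \<open>K\<close> inside \<open>A\<close> and an open
  \<open>U\<close> around \<open>A\<close> whose measures differ by at most \<open>e\<close>; a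
  Urysohn function between them errs only on \<open>U - K\<close>.\<close>

lemma indicator_L1_approx:
  fixes N :: "'a::euclidean_space measure"
  assumes N: "finite_measure N" and M: "sets N = sets borel" and A: "A \<in> sets borel" and e: "e > 0"
  shows "\<exists>f. continuous_on UNIV f \<and> (\<forall>x. 0 \<le> f x \<and> f x \<le> 1) \<and> (\<integral>x. \<bar>indicator A x - f x\<bar> \<partial>N) \<le> (e :: real)"
proof -
  interpret finite_measure N by fact
  have fin: "emeasure N (space N) \<noteq> \<infinity>" by (simp add: emeasure_eq_measure)
  obtain K where K: "K \<subseteq> A" "compact K" "measure N A - e / 2 \<le> measure N K"
  \<comment> \<open>\<open>ennreal\<close> truncates negative numbers to 0, so a strict inequality
    below the supremum is guaranteed only for \<open>measure N A \<ge> e / 2\<close>; otherwise the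
    empty set serves.\<close>
  proof (cases "measure N A < e / 2")
    case True
    then show ?thesis using that[of "{}"] by simp
  next
    case False
    then have "ennreal (measure N A - e / 2) < emeasure N A"
      using e by (simp add: emeasure_eq_measure ennreal_less_iff)
    then obtain K where K: "K \<subseteq> A" "compact K" "ennreal (measure N A - e / 2) < emeasure N K"
      unfolding inner_regular[OF M fin A] less_SUP_iff by blast
    then have "measure N A - e / 2 < measure N K"
      using False by (simp add: emeasure_eq_measure ennreal_less_iff)
    then show ?thesis using that[of K] K by simp
  qed
  have "emeasure N A < ennreal (measure N A + e / 2)"
    using e by (simp add: emeasure_eq_measure ennreal_less_iff)
  then obtain U where U: "A \<subseteq> U" "open U" "emeasure N U < ennreal (measure N A + e / 2)"
    unfolding outer_regular[OF M fin A] INF_less_iff by blast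
  then have U3: "measure N U < measure N A + e / 2"
    by (simp add: emeasure_eq_measure ennreal_less_iff)
  obtain f :: "'a \<Rightarrow> real" where f: "continuous_on UNIV f" "\<And>x. f x \<in> closed_segment 1 0" "\<And>x. x \<in> K \<Longrightarrow> f x = 1" "\<And>x. x \<in> - U \<Longrightarrow> f x = 0"
    by (rule Urysohn[of K "- U" 1 0]) (use K U compact_imp_closed in auto)
  have f01: "0 \<le> f x" "f x \<le> 1" for x
    using f(2)[of x] by (auto simp: closed_segment_eq_real_ivl)
  have sK: "K \<in> sets N" and sU: "U \<in> sets N" and sA: "A \<in> sets N"
    using K(2) U(2) A M by (auto intro: borel_compact)
  have "(\<integral>x. \<bar>indicator A x - f x\<bar> \<partial>N) \<le> (\<integral>x. indicator (U - K) x \<partial>N)"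
  proof (rule integral_mono)
    have fm: "f \<in> borel_measurable N"
      using borel_measurable_continuous_onI[OF f(1)] by (simp cong: measurable_cong_sets add: M)
    show "integrable N (\<lambda>x. \<bar>indicator A x - f x\<bar>)"
    proof (rule integrable_const_bound[where B = 1])
      show "AE x in N. norm \<bar>indicator A x - f x\<bar> \<le> 1"
        using f01 by (auto simp: indicator_def)
      show "(\<lambda>x. \<bar>indicator A x - f x\<bar>) \<in> borel_measurable N"
        using fm sA by measurable
    qed
    show "integrable N (indicator (U - K) :: 'a \<Rightarrow> real)" using sU sK by (simp add: emeasure_eq_measure)
    show "\<bar>indicator A x - f x\<bar> \<le> indicator (U - K) x" for x
      using f01[of x] f(3)[of x] f(4)[of x] K(1) U(1) by (auto simp: indicator_def)
  qed
  also have "\<dots> = measure N U - measure N K"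
    using finite_measure_Diff[OF sU sK] K(1) U(1) sU sK by auto
  also have "\<dots> \<le> e" using K(3) U3 by linarith
  finally show ?thesis using f(1) f01 by blast
qed

context mixing_flow
begin

section \<open>Decorrelation of characters and of sets\<close>

text \<open>An integer relation with \<open>k \<noteq> 0\<close> would make
  \<open>k * \<epsilon> n\<close> an integer for every \<open>n\<close>, although it is nonzero and
  tends to 0.\<close>

lemma alpha_irrational:
  fixes k l :: int
  assumes "k * \<alpha> + l = 0"
  shows "k = 0 \<and> l = 0"
proof (cases "k = 0")
  case False
  have "(\<lambda>n. (1/4::real) ^ Suc n) \<longlonglongrightarrow> 0" using summable_LIMSEQ_zero[OF quarter_summable] .
  then have "eventually (\<lambda>n. (1/4::real) ^ Suc n < 1 / \<bar>real_of_int k\<bar>) sequentially"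
    by (rule order_tendstoD(2)) (use False in simp)
  then obtain n where "(1/4::real) ^ Suc n < 1 / \<bar>real_of_int k\<bar>" by (auto simp: eventually_sequentially)
  then have "\<epsilon> n < 1 / \<bar>real_of_int k\<bar>" using eps_le[of n] by linarith
  then have lt: "\<bar>real_of_int k\<bar> * \<epsilon> n < 1" using False by (simp add: field_simps)
  have "k * \<epsilon> n = q n * (k * \<alpha>) - k * p n" by (simp add: \<epsilon>_def algebra_simps)
  also have "\<dots> = of_int (- (q n * l) - k * p n)" using assms by (simp add: eq_neg_iff_add_eq_0[symmetric])
  finally have eq: "k * \<epsilon> n = of_int (- (q n * l) - k * p n)" .
  have "\<bar>real_of_int k * \<epsilon> n\<bar> < 1" using lt eps_pos[of n] by (simp add: abs_mult)
  then have "\<bar>- (q n * l) - k * p n\<bar> < 1" unfolding eq by linarith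
  then have "k * \<epsilon> n = 0" using eq by simp
  then show ?thesis using False eps_pos[of n] by simp
qed (use assms in simp)

definition vz :: "complex \<times> complex \<Rightarrow> real" where "vz z = v (fst (torus_coord z)) (snd (torus_coord z))"

text \<open>Computed in the fundamental domain, so it agrees with \<open>ur\<close> only modulo
  integers; this is why \<open>un_proj\<close> speaks of periodic functions of it.\<close>

definition un :: "nat \<Rightarrow> complex \<times> complex \<Rightarrow> real" where "un n z = ur n (fst (torus_coord z)) (snd (torus_coord z))"

lemma vz_proj: "vz (torus_proj (x, y)) = v x y"
  by (simp add: vz_def torus_coord_proj v_frac)

lemma un_proj:
  assumes "\<And>u i. \<omega> (u + of_int i) = \<omega> u"
  shows "\<omega> (un n (torus_proj (x, y))) = \<omega> (ur n x y)"
  using assms[of "ur n x y" "q n * (- \<lfloor>x\<rfloor>) - p n * (- \<lfloor>y\<rfloor>)"] ur_shift[of n x "- \<lfloor>x\<rfloor>" y "- \<lfloor>y\<rfloor>"]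
  by (simp add: un_def torus_coord_proj frac_def)

lemma vz_measurable [measurable]: "vz \<in> borel_measurable torus_borel"
  unfolding vz_def[abs_def] by (rule measurable_compose[OF torus_coord_measurable v_measurable])

lemma un_measurable [measurable]: "un n \<in> borel_measurable torus_borel"
  unfolding un_def[abs_def]
proof (rule measurable_compose[OF torus_coord_measurable])
  show "(\<lambda>w. ur n (fst w) (snd w)) \<in> borel_measurable borel"
    unfolding ur_def by (intro borel_measurable_continuous_onI continuous_intros)
qed

lemma mu_integrable:
  fixes F :: "complex \<times> complex \<Rightarrow> 'b::{banach, second_countable_topology}"
  assumes "F \<in> borel_measurable torus_borel" "\<And>z. z \<in> torus \<Longrightarrow> norm (F z) \<le> B"
  shows "integrable \<mu> F"
proof -
  interpret prob_space \<mu> by (rule prob_space_mu)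
  show ?thesis
  proof (rule integrable_const_bound[where B = B])
    show "AE z in \<mu>. norm (F z) \<le> B" using assms(2) by (intro AE_I2) simp
    show "F \<in> borel_measurable \<mu>" using assms(1) by (simp cong: measurable_cong_sets)
  qed
qed

lemma integral_mu:
  fixes F :: "complex \<times> complex \<Rightarrow> complex"
  assumes F [measurable]: "F \<in> borel_measurable torus_borel" and B: "\<And>z. z \<in> torus \<Longrightarrow> norm (F z) \<le> B"
  shows "integral\<^sup>L \<mu> F = (LINT y|lborel. indicator {0..<1} y *\<^sub>R (LINT x|lborel. indicator {0..<1} x *\<^sub>R (of_real (v x y) * F (torus_proj (x, y)))))"
proof -
  let ?I = "{0..<1} \<times> {0..<1} :: (real \<times> real) set"
  have I: "?I \<in> sets borel" by (intro borel_Times) auto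
  have B0: "B \<ge> 0" using B[OF torus_proj_in_torus] norm_ge_zero order.trans by blast
  define G where "G w = of_real (v (fst w) (snd w)) * F (torus_proj w)" for w
  have Gm: "G \<in> borel_measurable borel" unfolding G_def by measurable
  have bG: "norm (G w) \<le> 4/3 * B" for w
    unfolding G_def norm_mult using v_bounds[of "fst w" "snd w"] B[of "torus_proj w"] by (intro mult_mono) auto
  have "integral\<^sup>L \<mu> F = (\<integral>z. vz z *\<^sub>R F z \<partial>torus_lebesgue)"
    unfolding \<mu>_def vz_def[symmetric]
    by (intro integral_density) (auto simp: vz_def less_imp_le[OF v_pos] cong: measurable_cong_sets)
  also have "\<dots> = (\<integral>w. vz (torus_proj w) *\<^sub>R F (torus_proj w) \<partial>restrict_space lborel ?I)"
    unfolding torus_lebesgue_def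
  proof (rule integral_distr)
    show "torus_proj \<in> restrict_space lborel ?I \<rightarrow>\<^sub>M torus_borel"
      by (rule measurable_restrict_space1) (simp add: measurable_lborel1)
    show "(\<lambda>z. vz z *\<^sub>R F z) \<in> borel_measurable torus_borel" by measurable
  qed
  also have "\<dots> = (\<integral>w. G w \<partial>restrict_space lborel ?I)"
    by (intro Bochner_Integration.integral_cong refl) (auto simp: G_def vz_proj scaleR_conv_of_real)
  also have "\<dots> = (\<integral>w. indicator ?I w *\<^sub>R G w \<partial>lborel)"
    using I by (intro integral_restrict_space) simp
  also have "\<dots> = (\<integral>w. indicator ?I w *\<^sub>R G w \<partial>(lborel \<Otimes>\<^sub>M lborel))" by (simp add: lborel_prod)
  also have "\<dots> = (LINT y|lborel. LINT x|lborel. indicator ?I (x, y) *\<^sub>R G (x, y))"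
  proof (rule lborel_pair.integral_snd[symmetric, of "\<lambda>x y. indicator ?I (x, y) *\<^sub>R G (x, y)", unfolded case_prod_unfold prod.collapse])
    have "integrable lborel (\<lambda>w. indicator ?I w *\<^sub>R G w)"
    proof (rule integrableI_bounded_set_indicator[where B = "4/3 * B"])
      have "emeasure lborel ?I = emeasure (lborel \<Otimes>\<^sub>M lborel) ?I" by (simp add: lborel_prod)
      also have "\<dots> = 1" by (subst lborel.emeasure_pair_measure_Times) auto
      finally show "emeasure lborel ?I < \<infinity>" by simp
    qed (use I Gm bG in auto)
    then show "integrable (lborel \<Otimes>\<^sub>M lborel) (\<lambda>w. indicator ?I w *\<^sub>R G w)" by (simp add: lborel_prod)
  qed
  also have "\<dots> = (LINT y|lborel. indicator {0..<1} y *\<^sub>R (LINT x|lborel. indicator {0..<1} x *\<^sub>R G (x, y)))"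
  proof (rule Bochner_Integration.integral_cong[OF refl])
    fix y :: real
    show "(LINT x|lborel. indicator ?I (x, y) *\<^sub>R G (x, y)) = indicator {0..<1} y *\<^sub>R (LINT x|lborel. indicator {0..<1} x *\<^sub>R G (x, y))"
      by (cases "y \<in> {0..<1}") (auto simp: indicator_times)
  qed
  finally show ?thesis by (simp add: G_def)
qed

lemma LINT_Ico_eq_integral:
  fixes f :: "real \<Rightarrow> complex"
  assumes "continuous_on {0..1} f"
  shows "(LINT x|lborel. indicator {0..<1} x *\<^sub>R f x) = integral {0..1} f"
proof -
  have "(LINT x|lborel. indicator {0..<1} x *\<^sub>R f x) = (LINT x|lborel. indicator {0..1} x *\<^sub>R f x)"
    by (rule integral_discrete_difference[of "{1}"]) (auto simp: indicator_def)
  also have "\<dots> = integral {0..1} f"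
    using set_borel_integral_eq_integral(2)[OF borel_integrable_atLeastAtMost'[OF assms]] by (simp add: set_lebesgue_integral_def)
  finally show ?thesis .
qed

text \<open>Fubini reduces an integral over the torus to the horizontal circles, where the
  oscillatory bound is uniform in \<open>y\<close>.\<close>

lemma norm_integral_mu_le:
  fixes F :: "complex \<times> complex \<Rightarrow> complex"
  assumes F: "F \<in> borel_measurable torus_borel" and B: "\<And>z. z \<in> torus \<Longrightarrow> norm (F z) \<le> B"
    and c: "\<And>y. continuous_on UNIV (\<lambda>x. F (torus_proj (x, y)))"
    and e: "\<And>y. norm (integral {0..1} (\<lambda>x. of_real (v x y) * F (torus_proj (x, y)))) \<le> e"
  shows "norm (integral\<^sup>L \<mu> F) \<le> e"
proof -
  have e0: "e \<ge> 0" using e[of 0] norm_ge_zero order.trans by blast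
  define J where "J y = (LINT x|lborel. indicator {0..<1} x *\<^sub>R (of_real (v x y) * F (torus_proj (x, y))))" for y
  have Jb: "norm (J y) \<le> e" for y
  proof -
    have "continuous_on UNIV (\<lambda>x. (\<lambda>w. v (fst w) (snd w)) (x, y))"
      by (rule continuous_on_compose2[OF v_continuous]) (auto intro!: continuous_intros)
    then have "continuous_on {0..1} (\<lambda>x. of_real (v x y) * F (torus_proj (x, y)))"
      using c[of y] by (auto intro!: continuous_intros elim: continuous_on_subset)
    then show ?thesis using e[of y] unfolding J_def by (simp only: LINT_Ico_eq_integral)
  qed
  have "norm (LINT y|lborel. indicator {0..<1} y *\<^sub>R J y) \<le> e"
  proof (cases "integrable lborel (\<lambda>y. indicator {0..<1} y *\<^sub>R J y)")
    case True
    have "norm (LINT y|lborel. indicator {0..<1} y *\<^sub>R J y) \<le> (LINT y|lborel. norm (indicator {0..<1} y *\<^sub>R J y))"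
      by (rule integral_norm_bound)
    also have "\<dots> \<le> (LINT y|lborel. indicator {0..<1::real} y * e)"
    proof (rule integral_mono)
      show "integrable lborel (\<lambda>y. indicator {0..<1::real} y * e)" by (intro integrable_mult_left integrable_real_indicator) auto
      show "norm (indicator {0..<1} y *\<^sub>R J y) \<le> indicator {0..<1} y * e" for y
        using Jb[of y] by (auto simp: indicator_def)
    qed (rule integrable_norm[OF True])
    also have "\<dots> = e" by simp
    finally show ?thesis .
  next
    \<comment> \<open>A nonintegrable function has Bochner integral 0 by convention, so the bound
      holds trivially.\<close>
    case False
    then show ?thesis using e0 by (simp add: not_integrable_integral_eq)
  qed
  moreover have "integral\<^sup>L \<mu> F = (LINT y|lborel. indicator {0..<1} y *\<^sub>R J y)"
    unfolding J_def by (rule integral_mu[OF F B])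
  ultimately show ?thesis by simp
qed

definition character :: "int \<Rightarrow> int \<Rightarrow> real \<Rightarrow> real \<Rightarrow> complex" where
  "character k l x y = cis (2 * pi * (of_int k * x + of_int l * y))"

text \<open>Division by the density turns the integral against \<open>\<mu>\<close> into a Lebesgue
  integral over the unit square, where nontrivial characters have mean zero. Composed with the flow
  it produces the factor \<open>1 / v\<close> at the image point that the oscillatory integral
  contains.\<close>

definition lift_quot :: "(real \<Rightarrow> real \<Rightarrow> complex) \<Rightarrow> complex \<times> complex \<Rightarrow> complex" where
  "lift_quot f z = f (fst (torus_coord z)) (snd (torus_coord z)) / of_real (vz z)"

lemma lift_quot_proj:
  assumes "f \<in> trig_poly"
  shows "lift_quot f (torus_proj (x, y)) = f x y / of_real (v x y)"
  using trig_poly_periodic[OF assms, of x "- \<lfloor>x\<rfloor>" y "- \<lfloor>y\<rfloor>"] by (simp add: lift_quot_def torus_coord_proj vz_proj frac_def)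

lemma lift_quot_measurable:
  assumes "f \<in> trig_poly"
  shows "lift_quot f \<in> borel_measurable torus_borel"
proof -
  have "(\<lambda>z. (\<lambda>w. f (fst w) (snd w)) (torus_coord z)) \<in> borel_measurable torus_borel"
    by (rule measurable_compose[OF torus_coord_measurable borel_measurable_continuous_onI[OF trig_poly_continuous[OF assms]]])
  then show ?thesis unfolding lift_quot_def[abs_def] by measurable
qed

lemma lift_quot_bound:
  assumes "\<And>x y. norm (f x y) \<le> B"
  shows "norm (lift_quot f z) \<le> 3/2 * B"
proof -
  have "norm (lift_quot f z) = norm (f (fst (torus_coord z)) (snd (torus_coord z))) / vz z"
    using v_pos by (simp add: lift_quot_def norm_divide vz_def less_imp_le)
  also have "\<dots> \<le> B / (2/3)"
    using assms order.trans[OF norm_ge_zero assms] v_bounds(1) by (intro frac_le) (auto simp: vz_def)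
  finally show ?thesis by simp
qed

lemma integral_character:
  assumes "(k, l) \<noteq> (0, 0)"
  shows "integral\<^sup>L \<mu> (lift_quot (character k l)) = 0"
proof -
  have tp: "character k l \<in> trig_poly" unfolding character_def[abs_def] by (rule trig_poly.char)
  have one: "(LINT x|lborel. indicator {0..<1} x *\<^sub>R cis (2 * pi * (of_int i * x))) = (if i = 0 then 1 else 0)" for i :: int
  proof -
    have "(LINT x|lborel. indicator {0..<1} x *\<^sub>R cis (2 * pi * (of_int i * x))) = integral {0..1} (\<lambda>x. cis (2 * pi * (of_int i * x)))"
      by (rule LINT_Ico_eq_integral) (auto simp: cis_conv_exp intro!: continuous_intros)
    also have "\<dots> = (if i = 0 then 1 else 0)"
    proof (cases "i = 0")
      case False
      let ?c = "2 * pi * of_int i"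
      have "((\<lambda>x. cis (2 * pi * (of_int i * x))) has_integral
          exp (\<i> * ?c * of_real 1) / (\<i> * ?c) - exp (\<i> * ?c * of_real 0) / (\<i> * ?c)) {0..1}"
      proof (rule fundamental_theorem_of_calculus)
        fix x :: real
        have "((\<lambda>z. exp (\<i> * ?c * z) / (\<i> * ?c)) has_field_derivative exp (\<i> * ?c * of_real x)) (at (of_real x))"
          using False by (auto intro!: derivative_eq_intros)
        then have "((\<lambda>x. exp (\<i> * ?c * of_real x) / (\<i> * ?c)) has_vector_derivative exp (\<i> * ?c * of_real x)) (at x within {0..1})"
          by (rule has_vector_derivative_real_field)
        then show "((\<lambda>x. exp (\<i> * ?c * of_real x) / (\<i> * ?c)) has_vector_derivative cis (2 * pi * (of_int i * x))) (at x within {0..1})"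
          by (simp add: cis_conv_exp mult_ac)
      qed simp
      moreover have "exp (\<i> * ?c * of_real 1) = 1"
        using cis_2pi_shift[of 0 i] by (simp add: cis_conv_exp)
      ultimately show ?thesis using False by (simp add: integral_unique)
    qed simp
    finally show ?thesis .
  qed
  have "integral\<^sup>L \<mu> (lift_quot (character k l)) = (LINT y|lborel. indicator {0..<1} y *\<^sub>R (LINT x|lborel. indicator {0..<1} x *\<^sub>R
      (of_real (v x y) * lift_quot (character k l) (torus_proj (x, y)))))"
    by (rule integral_mu[OF lift_quot_measurable[OF tp] lift_quot_bound[of _ 1]]) (simp add: character_def)
  also have "\<dots> = (LINT y|lborel. indicator {0..<1} y *\<^sub>R (LINT x|lborel. cis (2 * pi * (of_int l * y)) * (indicator {0..<1} x *\<^sub>R cis (2 * pi * (of_int k * x)))))"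
  proof (intro Bochner_Integration.integral_cong refl arg_cong2[of _ _ _ _ scaleR])
    fix x y :: real
    have "of_real (v x y) * lift_quot (character k l) (torus_proj (x, y)) = character k l x y"
      using lift_quot_proj[OF tp] v_pos[of x y] by simp
    also have "\<dots> = cis (2 * pi * (of_int l * y)) * cis (2 * pi * (of_int k * x))"
      by (simp add: character_def cis_mult distrib_left add.commute)
    finally show "indicator {0..<1} x *\<^sub>R (of_real (v x y) * lift_quot (character k l) (torus_proj (x, y))) =
       cis (2 * pi * (of_int l * y)) * (indicator {0..<1} x *\<^sub>R cis (2 * pi * (of_int k * x)))" by simp
  qed
  also have "\<dots> = (LINT y|lborel. indicator {0..<1} y *\<^sub>R (cis (2 * pi * (of_int l * y)) * (if k = 0 then 1 else 0)))"
    by (simp only: integral_mult_right_zero one)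
  also have "\<dots> = 0"
    using assms one[of l] by (cases "k = 0") auto
  finally show ?thesis .
qed

text \<open>A cut-off in the phase supported where the shear is strong. It has to be differentiable
  with bounded derivative because the integration by parts differentiates it.\<close>

definition shear_weight :: "real \<Rightarrow> (real \<Rightarrow> real) \<Rightarrow> bool" where
  "shear_weight \<theta> \<omega> \<longleftrightarrow> (\<exists>K \<omega>' X. shearing K \<theta> \<and> closed K \<and> (\<forall>u. u \<notin> K \<longrightarrow> \<omega> u = 0) \<and>
     (\<forall>u. (\<omega> has_real_derivative \<omega>' u) (at u)) \<and> (\<forall>u i. \<omega> (u + of_int i) = \<omega> u) \<and>
     (\<forall>u. 0 \<le> \<omega> u \<and> \<omega> u \<le> 1) \<and> (\<forall>u. \<bar>\<omega>' u\<bar> \<le> X))"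

lemma shear_weight_facts:
  assumes "shear_weight \<theta> \<omega>"
  shows "continuous_on UNIV \<omega>" "\<omega> (u + of_int i) = \<omega> u" "0 \<le> \<omega> u" "\<omega> u \<le> 1" "\<omega> \<in> borel_measurable borel"
proof -
  show c: "continuous_on UNIV \<omega>"
  proof -
    obtain \<omega>' where "\<And>u. (\<omega> has_real_derivative \<omega>' u) (at u)" using assms unfolding shear_weight_def by blast
    then show ?thesis by (intro continuous_at_imp_continuous_on ballI DERIV_isCont)
  qed
  show "\<omega> \<in> borel_measurable borel" by (rule borel_measurable_continuous_onI[OF c])
qed (use assms in \<open>auto simp: shear_weight_def\<close>)

lemma flow_measurable' [measurable]: "flow t \<in> measurable torus_borel torus_borel"
  using flow_measurable[of t] by (simp cong: measurable_cong_sets)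

lemma flow_proj_continuous: "continuous_on UNIV (\<lambda>x. (x + \<alpha> * sigma t x y, y + sigma t x y))"
proof -
  have "continuous_on UNIV (\<lambda>x. (\<lambda>(t, x, y). sigma t x y) (t, x, y))"
    by (rule continuous_on_compose2[OF sigma_continuous]) (auto intro!: continuous_intros)
  then show ?thesis by (auto intro!: continuous_intros)
qed

text \<open>The oscillatory integrals are uniformly small on all horizontal circles: irrationality
  of \<alpha> makes the frequency \<open>k * \<alpha> + l\<close> of the character along the linear
  flow nonzero.\<close>

lemma decorrelation_character:
  assumes w: "shear_weight \<theta> \<omega>" and m: "(\<lambda>n. m n * \<epsilon> n) \<longlonglongrightarrow> \<theta>" and kl: "(k, l) \<noteq> (0, 0)"
    and \<phi>: "real_polynomial_function \<phi>"
  shows "(\<lambda>n. integral\<^sup>L \<mu> (\<lambda>z. of_real (\<omega> (un n z) * \<phi> z) * lift_quot (character k l) (flow (m n) z))) \<longlonglongrightarrow> 0"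
proof (rule tendstoI)
  fix e :: real assume e: "e > 0"
  note wf = shear_weight_facts[OF w]
  have tp: "character k l \<in> trig_poly" unfolding character_def[abs_def] by (rule trig_poly.char)
  obtain K \<omega>' X where K: "shearing K \<theta>" "closed K" "\<And>u. u \<notin> K \<Longrightarrow> \<omega> u = 0" "\<And>u. (\<omega> has_real_derivative \<omega>' u) (at u)"
    "\<And>u. \<bar>\<omega>' u\<bar> \<le> X"
    using w unfolding shear_weight_def by blast
  define f where "f x y = complex_of_real (\<phi> (torus_proj (x, y)))" for x y
  have ftp: "f \<in> trig_poly" unfolding f_def[abs_def] by (rule trig_poly_real_polynomial[OF \<phi>])
  obtain fx A where fx: "\<And>x y. ((\<lambda>x. f x y) has_vector_derivative fx x y) (at x)" "\<And>x y. norm (f x y) \<le> A" "\<And>x y. norm (fx x y) \<le> A"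
    using trig_poly_C1[OF ftp] by blast
  define a where "a x y = \<phi> (torus_proj (x, y))" for x y
  have da: "((\<lambda>x. a x y) has_real_derivative Re (fx x y)) (at x)" for x y
    using bounded_linear.has_vector_derivative[OF bounded_linear_Re fx(1)[of y x]]
    by (simp add: f_def a_def has_real_derivative_iff_has_vector_derivative)
  have ba: "\<bar>a x y\<bar> \<le> A" "\<bar>Re (fx x y)\<bar> \<le> A" for x y
    using fx(2)[of x y] order.trans[OF abs_Re_le_cmod fx(3)[of x y]] by (auto simp: f_def a_def)
  have pera: "a 1 y = a 0 y" for y using torus_proj_shift[of 0 1 y 0] by (simp add: a_def)
  have \<kappa>: "k * \<alpha> + l \<noteq> 0" using alpha_irrational[of k l] kl by auto
  have "eventually (\<lambda>n. \<forall>y::real. norm (integral {0..1} (\<lambda>x.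
      of_real (\<omega> (ur n x y) * a x y * v x y / v (x + \<alpha> * sigma (m n) x y) (y + sigma (m n) x y)) *
      cis (2 * pi * (k * x + l * y + (k * \<alpha> + l) * sigma (m n) x y)))) \<le> e / 2) sequentially"
    by (rule oscillatory_integral_tendsto[OF \<kappa> m K(1) K(4) wf(2) K(2,3) _ K(5) da pera ba]) (use wf(3,4) e in auto)
  then show "eventually (\<lambda>n. dist (integral\<^sup>L \<mu> (\<lambda>z. of_real (\<omega> (un n z) * \<phi> z) * lift_quot (character k l) (flow (m n) z))) 0 < e) sequentially"
  proof eventually_elim
    case (elim n)
    define F where "F z = of_real (\<omega> (un n z) * \<phi> z) * lift_quot (character k l) (flow (m n) z)" for z
    have \<phi>m: "\<phi> \<in> borel_measurable torus_borel"
      by (rule measurable_restrict_space1[OF borel_measurable_continuous_onI])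
         (use \<phi> continuous_real_polymonial_function in \<open>auto intro: continuous_at_imp_continuous_on\<close>)
    have "norm (integral\<^sup>L \<mu> F) \<le> e / 2"
    proof (rule norm_integral_mu_le)
      have "(\<lambda>z. \<omega> (un n z)) \<in> borel_measurable torus_borel" by (rule measurable_compose[OF un_measurable wf(5)])
      moreover have "(\<lambda>z. lift_quot (character k l) (flow (m n) z)) \<in> borel_measurable torus_borel"
        by (rule measurable_compose[OF flow_measurable' lift_quot_measurable[OF tp]])
      ultimately show "F \<in> borel_measurable torus_borel" unfolding F_def[abs_def] using \<phi>m by measurable
      fix z :: "complex \<times> complex" assume z: "z \<in> torus"
      obtain x y where xy: "z = torus_proj (x, y)" by (rule torus_cases[OF z]) (rule that)
      have "norm (F z) = \<bar>\<omega> (un n z)\<bar> * \<bar>a x y\<bar> * norm (lift_quot (character k l) (flow (m n) z))"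
        by (simp add: F_def norm_mult abs_mult xy a_def)
      also have "\<dots> \<le> 1 * A * (3/2 * 1)"
        using wf(3,4) ba(1) lift_quot_bound[of "character k l" 1] order.trans[OF abs_ge_zero ba(1)] by (intro mult_mono) (auto simp: character_def)
      finally show "norm (F z) \<le> 1 * A * (3/2 * 1)" .
    next
      fix y :: real
      have Fxy: "F (torus_proj (x, y)) = of_real (\<omega> (ur n x y) * a x y) *
         (character k l (x + \<alpha> * sigma (m n) x y) (y + sigma (m n) x y) / of_real (v (x + \<alpha> * sigma (m n) x y) (y + sigma (m n) x y)))" for x
        unfolding F_def flow_proj lift_quot_proj[OF tp] un_proj[of \<omega>, OF wf(2)] a_def ..
      have c1: "continuous_on UNIV (\<lambda>x. \<omega> (ur n x y))"
        by (rule continuous_on_compose2[OF wf(1)]) (auto simp: ur_def intro!: continuous_intros)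
      have c2: "continuous_on UNIV (\<lambda>x. a x y)"
        using da by (auto intro!: continuous_at_imp_continuous_on DERIV_isCont)
      have c3: "continuous_on UNIV (\<lambda>x. character k l (x + \<alpha> * sigma (m n) x y) (y + sigma (m n) x y))"
        using continuous_on_compose2[OF trig_poly_continuous[OF tp] flow_proj_continuous] by simp
      have c4: "continuous_on UNIV (\<lambda>x. v (x + \<alpha> * sigma (m n) x y) (y + sigma (m n) x y))"
        using continuous_on_compose2[OF v_continuous flow_proj_continuous] by simp
      show "continuous_on UNIV (\<lambda>x. F (torus_proj (x, y)))"
        unfolding Fxy using v_pos
        by (intro continuous_on_mult continuous_on_of_real continuous_on_divide c1 c2 c3 c4) (auto simp: less_imp_neq[symmetric])
      have "of_real (v x y) * F (torus_proj (x, y)) = of_real (\<omega> (ur n x y) * a x y * v x y / v (x + \<alpha> * sigma (m n) x y) (y + sigma (m n) x y)) *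
        cis (2 * pi * (k * x + l * y + (k * \<alpha> + l) * sigma (m n) x y))" for x :: real
      proof -
        have "character k l (x + \<alpha> * sigma (m n) x y) (y + sigma (m n) x y) = cis (2 * pi * (k * x + l * y + (k * \<alpha> + l) * sigma (m n) x y))"
          unfolding character_def by (rule arg_cong[of _ _ cis]) (simp add: algebra_simps)
        then show ?thesis unfolding Fxy by simp
      qed
      then show "norm (integral {0..1} (\<lambda>x. of_real (v x y) * F (torus_proj (x, y)))) \<le> e / 2"
        using elim by simp
    qed
    then show ?case using e unfolding F_def[abs_def] by simp
  qed
qed

lemma lift_quot_integrable:
  assumes f: "f \<in> trig_poly" and a [measurable]: "a \<in> borel_measurable torus_borel" and B: "\<And>z. z \<in> torus \<Longrightarrow> \<bar>a z\<bar> \<le> B"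
  shows "integrable \<mu> (\<lambda>z. of_real (a z) * lift_quot f (flow t z))"
proof -
  obtain X where X: "\<And>x y. norm (f x y) \<le> X" using trig_poly_C1[OF f] by blast
  have [measurable]: "(\<lambda>z. lift_quot f (flow t z)) \<in> borel_measurable torus_borel"
    by (rule measurable_compose[OF flow_measurable' lift_quot_measurable[OF f]])
  show ?thesis
  proof (rule mu_integrable)
    fix z :: "complex \<times> complex" assume z: "z \<in> torus"
    show "norm (of_real (a z) * lift_quot f (flow t z)) \<le> B * (3/2 * X)"
      unfolding norm_mult norm_of_real using B[OF z] order.trans[OF abs_ge_zero B[OF z]] lift_quot_bound[of f X] X by (intro mult_mono) auto
  qed measurable
qed

lemma real_polynomial_torus:
  assumes "real_polynomial_function \<phi>"
  shows "\<phi> \<in> borel_measurable torus_borel" "\<exists>B. \<forall>z\<in>torus. \<bar>\<phi> z\<bar> \<le> B"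
proof -
  have c: "continuous_on UNIV \<phi>"
    using assms continuous_real_polymonial_function by (auto intro: continuous_at_imp_continuous_on)
  show "\<phi> \<in> borel_measurable torus_borel"
    by (rule measurable_restrict_space1[OF borel_measurable_continuous_onI[OF c]])
  have "bounded (\<phi> ` torus)"
    by (intro compact_imp_bounded compact_continuous_image compact_torus continuous_on_subset[OF c]) auto
  then show "\<exists>B. \<forall>z\<in>torus. \<bar>\<phi> z\<bar> \<le> B" unfolding bounded_iff by auto
qed

text \<open>Only the zero frequency fails to decorrelate; \<open>c\<close> accumulates its
  coefficient through the induction.\<close>

lemma decorrelation_trig:
  assumes w: "shear_weight \<theta> \<omega>" and m: "(\<lambda>n. m n * \<epsilon> n) \<longlonglongrightarrow> \<theta>" and f: "f \<in> trig_poly"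
  shows "\<exists>c. (\<lambda>x y. f x y - c) \<in> trig_poly \<and> integral\<^sup>L \<mu> (lift_quot (\<lambda>x y. f x y - c)) = 0 \<and>
    (\<forall>\<phi>. real_polynomial_function \<phi> \<longrightarrow>
      (\<lambda>n. integral\<^sup>L \<mu> (\<lambda>z. of_real (\<omega> (un n z) * \<phi> z) * lift_quot (\<lambda>x y. f x y - c) (flow (m n) z))) \<longlonglongrightarrow> 0)"
  using f
proof (induction f rule: trig_poly.induct)
  case (char k l)
  show ?case
  proof (cases "(k, l) = (0, 0)")
    case True
    then show ?thesis using trig_poly_const[of 0] by (intro exI[of _ 1]) (simp add: lift_quot_def[abs_def])
  next
    case False
    have tp: "character k l \<in> trig_poly" unfolding character_def[abs_def] by (rule trig_poly.char)
    show ?thesis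
      using integral_character[OF False] decorrelation_character[OF w m False] tp
      unfolding character_def[abs_def] by (intro exI[of _ 0]) simp
  qed
next
  case (add f g)
  then obtain c d where c: "(\<lambda>x y. f x y - c) \<in> trig_poly" "integral\<^sup>L \<mu> (lift_quot (\<lambda>x y. f x y - c)) = 0"
      "\<And>\<phi>. real_polynomial_function \<phi> \<Longrightarrow>
      (\<lambda>n. integral\<^sup>L \<mu> (\<lambda>z. of_real (\<omega> (un n z) * \<phi> z) * lift_quot (\<lambda>x y. f x y - c) (flow (m n) z))) \<longlonglongrightarrow> 0"
    and d: "(\<lambda>x y. g x y - d) \<in> trig_poly" "integral\<^sup>L \<mu> (lift_quot (\<lambda>x y. g x y - d)) = 0"
      "\<And>\<phi>. real_polynomial_function \<phi> \<Longrightarrow>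
      (\<lambda>n. integral\<^sup>L \<mu> (\<lambda>z. of_real (\<omega> (un n z) * \<phi> z) * lift_quot (\<lambda>x y. g x y - d) (flow (m n) z))) \<longlonglongrightarrow> 0"
    by blast
  have tp: "(\<lambda>x y. f x y + g x y - (c + d)) \<in> trig_poly"
    using trig_poly.add[OF c(1) d(1)] by (simp add: algebra_simps)
  have eq: "lift_quot (\<lambda>x y. f x y + g x y - (c + d)) z = lift_quot (\<lambda>x y. f x y - c) z + lift_quot (\<lambda>x y. g x y - d) z" for z
    by (simp add: lift_quot_def add_divide_distrib diff_divide_distrib)
  have int0: "integrable \<mu> (lift_quot h)" if h: "h \<in> trig_poly" for h
  proof -
    obtain X where X: "\<And>x y. norm (h x y) \<le> X" using trig_poly_C1[OF h] by blast
    show ?thesis by (rule mu_integrable[OF lift_quot_measurable[OF h] lift_quot_bound[OF X]])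
  qed
  have "integral\<^sup>L \<mu> (lift_quot (\<lambda>x y. f x y + g x y - (c + d))) = 0"
    unfolding eq[abs_def] using c(2) d(2) by (simp add: Bochner_Integration.integral_add[OF int0[OF c(1)] int0[OF d(1)]])
  moreover have "(\<lambda>n. integral\<^sup>L \<mu> (\<lambda>z. of_real (\<omega> (un n z) * \<phi> z) * lift_quot (\<lambda>x y. f x y + g x y - (c + d)) (flow (m n) z))) \<longlonglongrightarrow> 0"
    if \<phi>: "real_polynomial_function \<phi>" for \<phi>
  proof -
    obtain B where B: "\<And>z. z \<in> torus \<Longrightarrow> \<bar>\<phi> z\<bar> \<le> B" using real_polynomial_torus(2)[OF \<phi>] by blast
    have meas: "(\<lambda>z. \<omega> (un n z) * \<phi> z) \<in> borel_measurable torus_borel" for n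
      using measurable_compose[OF un_measurable shear_weight_facts(5)[OF w]] real_polynomial_torus(1)[OF \<phi>] by simp
    have bd: "\<bar>\<omega> (un n z) * \<phi> z\<bar> \<le> 1 * B" if "z \<in> torus" for n z
      unfolding abs_mult using shear_weight_facts(3,4)[OF w] B[OF that] by (intro mult_mono) auto
    have "integral\<^sup>L \<mu> (\<lambda>z. of_real (\<omega> (un n z) * \<phi> z) * lift_quot (\<lambda>x y. f x y + g x y - (c + d)) (flow (m n) z)) =
       integral\<^sup>L \<mu> (\<lambda>z. of_real (\<omega> (un n z) * \<phi> z) * lift_quot (\<lambda>x y. f x y - c) (flow (m n) z)) +
       integral\<^sup>L \<mu> (\<lambda>z. of_real (\<omega> (un n z) * \<phi> z) * lift_quot (\<lambda>x y. g x y - d) (flow (m n) z))" for n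
      unfolding eq distrib_left
      by (rule Bochner_Integration.integral_add[OF lift_quot_integrable[OF c(1) meas bd] lift_quot_integrable[OF d(1) meas bd]])
    then show ?thesis using tendsto_add[OF c(3)[OF \<phi>] d(3)[OF \<phi>]] by simp
  qed
  ultimately show ?case using tp by blast
next
  case (scale f a)
  then obtain c where c: "(\<lambda>x y. f x y - c) \<in> trig_poly" "integral\<^sup>L \<mu> (lift_quot (\<lambda>x y. f x y - c)) = 0"
      "\<And>\<phi>. real_polynomial_function \<phi> \<Longrightarrow>
      (\<lambda>n. integral\<^sup>L \<mu> (\<lambda>z. of_real (\<omega> (un n z) * \<phi> z) * lift_quot (\<lambda>x y. f x y - c) (flow (m n) z))) \<longlonglongrightarrow> 0"
    by blast
  have tp: "(\<lambda>x y. a * f x y - a * c) \<in> trig_poly"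
    using trig_poly.scale[OF c(1), of a] by (simp add: algebra_simps)
  have eq: "lift_quot (\<lambda>x y. a * f x y - a * c) z = a * lift_quot (\<lambda>x y. f x y - c) z" for z
    by (simp add: lift_quot_def right_diff_distrib[symmetric])
  have "integral\<^sup>L \<mu> (lift_quot (\<lambda>x y. a * f x y - a * c)) = 0"
    unfolding eq[abs_def] using c(2) by simp
  moreover have "(\<lambda>n. integral\<^sup>L \<mu> (\<lambda>z. of_real (\<omega> (un n z) * \<phi> z) * lift_quot (\<lambda>x y. a * f x y - a * c) (flow (m n) z))) \<longlonglongrightarrow> 0"
    if \<phi>: "real_polynomial_function \<phi>" for \<phi>
  proof -
    have e: "of_real (\<omega> (un n z) * \<phi> z) * lift_quot (\<lambda>x y. a * f x y - a * c) (flow (m n) z) =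
      a * (of_real (\<omega> (un n z) * \<phi> z) * lift_quot (\<lambda>x y. f x y - c) (flow (m n) z))" for n z
      unfolding eq by (rule mult.left_commute)
    have "(\<lambda>n. a * integral\<^sup>L \<mu> (\<lambda>z. of_real (\<omega> (un n z) * \<phi> z) * lift_quot (\<lambda>x y. f x y - c) (flow (m n) z))) \<longlonglongrightarrow> a * 0"
      by (intro tendsto_mult tendsto_const c(3)[OF \<phi>])
    then show ?thesis unfolding e by simp
  qed
  ultimately show ?case using tp by blast
qed

lemma mu_L1_approx:
  assumes A: "A \<in> sets torus_borel" and e: "e > 0"
  shows "\<exists>a. continuous_on UNIV a \<and> (\<forall>z. 0 \<le> a z \<and> a z \<le> 1) \<and> (\<integral>z. \<bar>indicator A z - a z\<bar> \<partial>\<mu>) \<le> (e :: real)"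
proof -
  interpret prob_space \<mu> by (rule prob_space_mu)
  have id: "(\<lambda>z. z) \<in> \<mu> \<rightarrow>\<^sub>M borel"
    using measurable_restrict_space1[of "\<lambda>z. z" borel borel torus] by (simp cong: measurable_cong_sets)
  have "torus \<in> sets borel" using compact_torus by (simp add: borel_compact)
  then have Ab: "A \<in> sets borel" using A by (auto simp: sets_restrict_space)
  have "finite_measure (distr \<mu> borel (\<lambda>z. z))" by (rule prob_space.finite_measure[OF prob_space_distr[OF id]])
  from indicator_L1_approx[OF this _ Ab e] obtain a where a: "continuous_on UNIV a" "\<And>z. 0 \<le> a z \<and> a z \<le> 1"
    "(\<integral>z. \<bar>indicator A z - a z\<bar> \<partial>distr \<mu> borel (\<lambda>z. z)) \<le> e" by auto
  have "a \<in> borel_measurable borel" by (rule borel_measurable_continuous_onI[OF a(1)])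
  then have "(\<integral>z. \<bar>indicator A z - a z\<bar> \<partial>distr \<mu> borel (\<lambda>z. z)) = (\<integral>z. \<bar>indicator A z - a z\<bar> \<partial>\<mu>)"
    using Ab by (intro integral_distr[OF id]) simp
  with a show ?thesis by auto
qed

lemma integral_mu_flow:
  fixes F :: "complex \<times> complex \<Rightarrow> real"
  assumes "F \<in> borel_measurable torus_borel"
  shows "(\<integral>z. F (flow t z) \<partial>\<mu>) = (\<integral>z. F z \<partial>\<mu>)"
proof -
  have f: "flow t \<in> \<mu> \<rightarrow>\<^sub>M \<mu>" using flow_measurable[of t] by (simp cong: measurable_cong_sets)
  have "(\<integral>z. F z \<partial>\<mu>) = (\<integral>z. F z \<partial>distr \<mu> \<mu> (flow t))"
    using measure_preserving_flow_flow by (simp add: measure_preserving_flow_def measure_preserving_def)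
  also have "\<dots> = (\<integral>z. F (flow t z) \<partial>\<mu>)"
    using assms by (intro integral_distr[OF f]) (simp cong: measurable_cong_sets)
  finally show ?thesis ..
qed

lemma vz_continuous: "continuous_on torus vz"
proof -
  have "v (x + of_int i) (y + of_int j) = v x y" for x y i j by (simp add: v_periodic)
  then show ?thesis
    using continuous_on_torus_lift[of "\<lambda>w. v (fst w) (snd w)"] v_continuous by (simp add: vz_def[abs_def])
qed

text \<open>The indicators are replaced in mean by continuous functions, where invariance of
  \<open>\<mu>\<close> transports the error for \<open>B\<close> along the flow; these are replaced
  uniformly by polynomials, to which the case of trigonometric polynomials applies.\<close>

lemma decorrelation:
  assumes w: "shear_weight \<theta> \<omega>" and m: "(\<lambda>n. m n * \<epsilon> n) \<longlonglongrightarrow> \<theta>"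
    and A: "A \<in> sets torus_borel" and B: "B \<in> sets torus_borel"
  shows "(\<lambda>n. \<integral>z. \<omega> (un n z) * indicator A z * (indicator B (flow (m n) z) - measure \<mu> B) \<partial>\<mu>) \<longlonglongrightarrow> 0"
proof (rule tendstoI)
  fix e' :: real assume e': "e' > 0"
  define e where "e = min 1 (e' / 40)"
  have e: "e > 0" "e \<le> 1" "40 * e \<le> e'" using e' by (auto simp: e_def)
  interpret prob_space \<mu> by (rule prob_space_mu)
  note wf = shear_weight_facts[OF w]
  have p1: "measure \<mu> torus = 1" using prob_space by simp
  have BT: "B \<inter> torus = B" using sets.sets_into_space[OF B] by auto
  obtain a where a: "continuous_on UNIV a" "\<And>z. 0 \<le> a z \<and> a z \<le> 1" "(\<integral>z. \<bar>indicator A z - a z\<bar> \<partial>\<mu>) \<le> e"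
    using mu_L1_approx[OF A e(1)] by blast
  obtain b where b: "continuous_on UNIV b" "\<And>z. 0 \<le> b z \<and> b z \<le> 1" "(\<integral>z. \<bar>indicator B z - b z\<bar> \<partial>\<mu>) \<le> e"
    using mu_L1_approx[OF B e(1)] by blast
  have am [measurable]: "a \<in> borel_measurable torus_borel" and bm [measurable]: "b \<in> borel_measurable torus_borel"
    using measurable_restrict_space1[OF borel_measurable_continuous_onI[OF a(1)]] measurable_restrict_space1[OF borel_measurable_continuous_onI[OF b(1)]] by auto
  have Am [measurable]: "A \<in> sets torus_borel" and Bm [measurable]: "B \<in> sets torus_borel" by fact+
  define I where "I = (\<integral>z. b z \<partial>\<mu>)"
  have ib: "integrable \<mu> b" by (rule mu_integrable[OF bm, of 1]) (use b(2) in auto)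
  have iB: "integrable \<mu> (indicator B :: _ \<Rightarrow> real)" by (rule mu_integrable[of _ 1]) (auto simp: indicator_def)
  have iBb: "integrable \<mu> (\<lambda>z. \<bar>indicator B z - b z\<bar>)"
    using ib iB by (intro integrable_abs Bochner_Integration.integrable_diff)
  have I01: "0 \<le> I" "I \<le> 1"
  proof -
    show "0 \<le> I" unfolding I_def using b(2) by (intro integral_nonneg_AE) auto
    have "I \<le> (\<integral>z. 1 \<partial>\<mu>)" unfolding I_def using b(2) by (intro integral_mono ib) auto
    then show "I \<le> 1" by (simp add: p1)
  qed
  have BI: "\<bar>measure \<mu> B - I\<bar> \<le> e"
  proof -
    have "measure \<mu> B - I = (\<integral>z. indicator B z - b z \<partial>\<mu>)"
      using B by (simp add: BT I_def Bochner_Integration.integral_diff[OF iB ib])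
    also have "\<bar>\<dots>\<bar> \<le> (\<integral>z. \<bar>indicator B z - b z\<bar> \<partial>\<mu>)" by (rule integral_abs_bound)
    finally show ?thesis using b(3) by linarith
  qed
  \<comment> \<open>The centred function is multiplied by the density before the approximation
    because \<open>lift_quot\<close> divides by it.\<close>
  have "continuous_on torus (\<lambda>z. (b z - I) * vz z)"
    by (intro continuous_intros vz_continuous continuous_on_subset[OF b(1)]) auto
  from Stone_Weierstrass_real_polynomial_function[OF compact_torus this e(1)] have "\<exists>h. real_polynomial_function h \<and> (\<forall>z\<in>torus. \<bar>(b z - I) * vz z - h z\<bar> < e)" by metis
  then obtain Q where Q: "real_polynomial_function Q" "\<And>z. z \<in> torus \<Longrightarrow> \<bar>(b z - I) * vz z - Q z\<bar> < e"
    by blast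
  have "continuous_on torus a" by (rule continuous_on_subset[OF a(1)]) auto
  from Stone_Weierstrass_real_polynomial_function[OF compact_torus this e(1)] have "\<exists>h. real_polynomial_function h \<and> (\<forall>z\<in>torus. \<bar>a z - h z\<bar> < e)" by metis
  then obtain \<phi> where \<phi>: "real_polynomial_function \<phi>" "\<And>z. z \<in> torus \<Longrightarrow> \<bar>a z - \<phi> z\<bar> < e"
    by blast
  have \<phi>m [measurable]: "\<phi> \<in> borel_measurable torus_borel" by (rule real_polynomial_torus[OF \<phi>(1)])
  have Qm [measurable]: "Q \<in> borel_measurable torus_borel" by (rule real_polynomial_torus[OF Q(1)])
  obtain c where c: "(\<lambda>x y. of_real (Q (torus_proj (x, y))) - c) \<in> trig_poly"
    "integral\<^sup>L \<mu> (lift_quot (\<lambda>x y. of_real (Q (torus_proj (x, y))) - c)) = 0"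
    "(\<lambda>n. integral\<^sup>L \<mu> (\<lambda>z. of_real (\<omega> (un n z) * \<phi> z) * lift_quot (\<lambda>x y. of_real (Q (torus_proj (x, y))) - c) (flow (m n) z))) \<longlonglongrightarrow> 0"
    using decorrelation_trig[OF w m trig_poly_real_polynomial[OF Q(1)]] \<phi>(1) by blast
  define h where "h = lift_quot (\<lambda>x y. of_real (Q (torus_proj (x, y))) - c)"
  have hm [measurable]: "h \<in> borel_measurable torus_borel" unfolding h_def by (rule lift_quot_measurable[OF c(1)])
  have hz: "h z = of_real (Q z / vz z) - c * of_real (1 / vz z)" if "z \<in> torus" for z
    using torus_proj_coord[OF that] by (simp add: h_def lift_quot_def diff_divide_distrib)
  have vz: "2/3 \<le> vz z" "vz z \<le> 4/3" for z using v_bounds by (auto simp: vz_def)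
  have Qb: "\<bar>(b z - I) - Q z / vz z\<bar> \<le> 3/2 * e" if "z \<in> torus" for z
  proof -
    have "(b z - I) - Q z / vz z = ((b z - I) * vz z - Q z) / vz z"
      using vz(1)[of z] by (simp add: field_simps)
    also have "\<bar>\<dots>\<bar> = \<bar>(b z - I) * vz z - Q z\<bar> / vz z" using vz(1)[of z] by (simp add: abs_divide)
    also have "\<dots> \<le> e / (2/3)" using Q(2)[OF that] vz(1)[of z] by (intro frac_le) auto
    finally show ?thesis by simp
  qed
  have iQ: "integrable \<mu> (\<lambda>z. Q z / vz z)"
  proof (rule mu_integrable[of _ "1 + 3/2 * e"])
    show "norm (Q z / vz z) \<le> 1 + 3/2 * e" if "z \<in> torus" for z
      using Qb[OF that] b(2)[of z] I01 unfolding real_norm_def abs_le_iff by linarith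
  qed measurable
  have iv: "integrable \<mu> (\<lambda>z. 1 / vz z)"
  proof (rule mu_integrable[of _ "3/2"])
    show "norm (1 / vz z) \<le> 3/2" for z using vz(1)[of z] by (simp add: field_simps)
  qed measurable
  \<comment> \<open>Both \<open>h\<close> and \<open>b - I\<close> have mean zero, so
    \<open>c\<close> can only come from the approximation error; the mean of \<open>1 / vz\<close>
    is at least 3/4.\<close>
  have cb: "norm c \<le> 2 * e"
  proof -
    have "integral\<^sup>L \<mu> h = (\<integral>z. of_real (Q z / vz z) - c * of_real (1 / vz z) \<partial>\<mu>)"
      by (rule Bochner_Integration.integral_cong) (auto simp: hz)
    also have "\<dots> = of_real (\<integral>z. Q z / vz z \<partial>\<mu>) - c * of_real (\<integral>z. 1 / vz z \<partial>\<mu>)"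
      using iQ iv by (subst Bochner_Integration.integral_diff) (auto simp del: of_real_divide)
    finally have "c * of_real (\<integral>z. 1 / vz z \<partial>\<mu>) = of_real (\<integral>z. Q z / vz z \<partial>\<mu>)"
      using c(2) by (simp add: h_def)
    then have "norm (c * of_real (\<integral>z. 1 / vz z \<partial>\<mu>)) = norm (complex_of_real (\<integral>z. Q z / vz z \<partial>\<mu>))" by (rule arg_cong)
    then have nc: "norm c * \<bar>\<integral>z. 1 / vz z \<partial>\<mu>\<bar> = \<bar>\<integral>z. Q z / vz z \<partial>\<mu>\<bar>" by (simp only: norm_mult norm_of_real)
    moreover have "\<bar>\<integral>z. Q z / vz z \<partial>\<mu>\<bar> \<le> 3/2 * e"
    proof -
      have i2: "integrable \<mu> (\<lambda>z. (b z - I) - Q z / vz z)" using ib iQ by (intro Bochner_Integration.integrable_diff) auto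
      have "(\<integral>z. (b z - I) - Q z / vz z \<partial>\<mu>) = (\<integral>z. b z - I \<partial>\<mu>) - (\<integral>z. Q z / vz z \<partial>\<mu>)"
        by (rule Bochner_Integration.integral_diff) (use ib iQ in auto)
      also have "(\<integral>z. b z - I \<partial>\<mu>) = 0" using ib by (simp add: I_def p1)
      finally have "\<bar>\<integral>z. Q z / vz z \<partial>\<mu>\<bar> = \<bar>\<integral>z. (b z - I) - Q z / vz z \<partial>\<mu>\<bar>" by simp
      also have "\<dots> \<le> (\<integral>z. \<bar>(b z - I) - Q z / vz z\<bar> \<partial>\<mu>)" by (rule integral_abs_bound)
      also have "\<dots> \<le> (\<integral>z. 3/2 * e \<partial>\<mu>)"
        by (rule integral_mono) (use i2 Qb in \<open>auto intro: integrable_abs\<close>)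
      finally show ?thesis by (simp add: p1)
    qed
    moreover have "3/4 \<le> (\<integral>z. 1 / vz z \<partial>\<mu>)"
    proof -
      have "(\<integral>z. 3/4 \<partial>\<mu>) \<le> (\<integral>z. 1 / vz z \<partial>\<mu>)"
      proof (rule integral_mono)
        show "3/4 \<le> 1 / vz z" for z using vz[of z] by (simp add: field_simps)
      qed (use iv in auto)
      then show ?thesis by (simp add: p1)
    qed
    ultimately have "norm c * (3/4) \<le> 3/2 * e"
      using nc mult_left_mono[of "3/4" "\<bar>\<integral>z. 1 / vz z \<partial>\<mu>\<bar>" "norm c"] by linarith
    then show ?thesis by simp
  qed
  have hb: "norm (of_real (b z - I) - h z) \<le> 9/2 * e" if z: "z \<in> torus" for z
  proof -
    have "of_real (b z - I) - h z = of_real ((b z - I) - Q z / vz z) + c * of_real (1 / vz z)" by (simp add: hz[OF z])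
    also have "norm \<dots> \<le> \<bar>(b z - I) - Q z / vz z\<bar> + norm c * \<bar>1 / vz z\<bar>"
      by (rule order.trans[OF norm_triangle_ineq]) (simp only: norm_mult norm_of_real order_refl)
    also have "\<dots> \<le> 3/2 * e + 2 * e * (3/2)"
      using Qb[OF z] cb vz(1)[of z] e(1) by (intro add_mono mult_mono) (auto simp: field_simps)
    finally show ?thesis by simp
  qed
  have h6: "norm (h z) \<le> 6" if z: "z \<in> torus" for z
  proof -
    have "norm (h z) \<le> norm (of_real (b z - I) - h z) + norm (of_real (b z - I) :: complex)"
      using norm_triangle_ineq4[of "of_real (b z - I)" "of_real (b z - I) - h z"] by simp
    moreover have "norm (of_real (b z - I) :: complex) \<le> 1" unfolding norm_of_real using b(2)[of z] I01 by (simp only: abs_le_iff) linarith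
    ultimately show ?thesis using hb[OF z] e by linarith
  qed
  define P where "P n = integral\<^sup>L \<mu> (\<lambda>z. of_real (\<omega> (un n z) * \<phi> z) * h (flow (m n) z))" for n
  define D where "D n = (\<integral>z. \<omega> (un n z) * indicator A z * (indicator B (flow (m n) z) - measure \<mu> B) \<partial>\<mu>)" for n
  have wm [measurable]: "(\<lambda>z. \<omega> (un n z)) \<in> borel_measurable torus_borel" for n by (rule measurable_compose[OF un_measurable wf(5)])
  have hfm [measurable]: "(\<lambda>z. h (flow (m n) z)) \<in> borel_measurable torus_borel" for n by (rule measurable_compose[OF flow_measurable' hm])
  have iBfm [measurable]: "(\<lambda>z. indicator B (flow (m n) z) :: real) \<in> borel_measurable torus_borel" for n
    by (rule measurable_compose[OF flow_measurable']) simp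
  have bfm [measurable]: "(\<lambda>z. b (flow (m n) z)) \<in> borel_measurable torus_borel" for n
    by (rule measurable_compose[OF flow_measurable' bm])
  \<comment> \<open>The errors add up to \<open>e + 11/2 * e + 6 * (e + e) \<le> 19 * e\<close>,
    where 6 is the bound for \<open>h\<close>.\<close>
  have close: "norm (of_real (D n) - P n) \<le> 19 * e" for n
  proof -
    obtain X where X: "\<And>z. z \<in> torus \<Longrightarrow> \<bar>\<phi> z\<bar> \<le> X" using real_polynomial_torus(2)[OF \<phi>(1)] by blast
    let ?d = "\<lambda>z. \<omega> (un n z) * indicator A z * (indicator B (flow (m n) z) - measure \<mu> B)"
    let ?p = "\<lambda>z. of_real (\<omega> (un n z) * \<phi> z) * h (flow (m n) z)"
    have id: "integrable \<mu> (\<lambda>z. complex_of_real (?d z))"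
    proof (rule mu_integrable[of _ "1 * 1 * 1"])
      show "norm (complex_of_real (?d z)) \<le> 1 * 1 * 1" for z
        unfolding norm_of_real abs_mult using wf(3,4) measure_nonneg[of \<mu> B] prob_le_1[of B]
        by (intro mult_mono) (auto simp: indicator_def)
    qed measurable
    have ip: "integrable \<mu> ?p"
    proof -
      have "\<bar>\<omega> (un n z) * \<phi> z\<bar> \<le> 1 * X" if "z \<in> torus" for z
        unfolding abs_mult using wf(3,4) X[OF that] by (intro mult_mono) auto
      from lift_quot_integrable[OF c(1) _ this, where t = "m n"] show ?thesis unfolding h_def by simp
    qed
    have i1: "integrable \<mu> (\<lambda>z. \<bar>indicator B (flow (m n) z) - b (flow (m n) z)\<bar>)"
    proof (rule mu_integrable[of _ 1])
      show "norm \<bar>indicator B (flow (m n) z) - b (flow (m n) z)\<bar> \<le> 1" for z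
        using b(2)[of "flow (m n) z"] by (auto simp: indicator_def)
    qed measurable
    have i2: "integrable \<mu> (\<lambda>z. \<bar>indicator A z - a z\<bar>)"
    proof (rule mu_integrable[of _ 1])
      show "norm \<bar>indicator A z - a z\<bar> \<le> 1" for z using a(2)[of z] by (auto simp: indicator_def)
    qed measurable
    have pt: "norm (of_real (?d z) - ?p z) \<le> \<bar>indicator B (flow (m n) z) - b (flow (m n) z)\<bar> + 11/2 * e + 6 * (\<bar>indicator A z - a z\<bar> + e)"
      if z: "z \<in> torus" for z
    proof -
      let ?Z = "flow (m n) z"
      have Z: "?Z \<in> torus" using flow_in_torus z by blast
      define d1 where "d1 = complex_of_real (indicator B ?Z - measure \<mu> B) - h ?Z"
      have n1: "norm d1 \<le> \<bar>indicator B ?Z - b ?Z\<bar> + 11/2 * e"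
      proof -
        have "norm d1 = norm (of_real ((indicator B ?Z - b ?Z) - (measure \<mu> B - I)) + (of_real (b ?Z - I) - h ?Z))" unfolding d1_def by (rule arg_cong[of _ _ norm]) simp
        also have "\<dots> \<le> \<bar>(indicator B ?Z - b ?Z) - (measure \<mu> B - I)\<bar> + norm (of_real (b ?Z - I) - h ?Z)"
          by (rule order.trans[OF norm_triangle_ineq]) (simp only: norm_of_real order_refl)
        also have "\<dots> \<le> \<bar>indicator B ?Z - b ?Z\<bar> + \<bar>measure \<mu> B - I\<bar> + norm (of_real (b ?Z - I) - h ?Z)" by (intro add_right_mono abs_triangle_ineq4)
        finally show ?thesis using hb[OF Z] BI by linarith
      qed
      have "of_real (?d z) - ?p z = of_real (\<omega> (un n z)) * (of_real (indicator A z) * d1 + of_real (indicator A z - \<phi> z) * h ?Z)"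
        by (simp add: d1_def algebra_simps)
      then have "norm (of_real (?d z) - ?p z) = norm (of_real (\<omega> (un n z)) * (of_real (indicator A z) * d1 + of_real (indicator A z - \<phi> z) * h ?Z))" by (rule arg_cong)
      also have "\<dots> = \<bar>\<omega> (un n z)\<bar> * norm (of_real (indicator A z) * d1 + of_real (indicator A z - \<phi> z) * h ?Z)" by (simp only: norm_mult norm_of_real)
      also have "\<dots> \<le> 1 * norm (of_real (indicator A z) * d1 + of_real (indicator A z - \<phi> z) * h ?Z)"
        using wf(3,4) by (intro mult_right_mono) auto
      also have "\<dots> \<le> \<bar>indicator A z\<bar> * norm d1 + \<bar>indicator A z - \<phi> z\<bar> * norm (h ?Z)"
        unfolding mult_1 by (rule order.trans[OF norm_triangle_ineq]) (simp only: norm_mult norm_of_real order_refl)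
      also have "\<dots> \<le> 1 * norm d1 + (\<bar>indicator A z - a z\<bar> + e) * 6"
        using h6[OF Z] \<phi>(2)[OF z] e(1) by (intro add_mono mult_mono) (auto simp: indicator_def)
      finally show ?thesis using n1 by linarith
    qed
    have oD: "complex_of_real (D n) = (\<integral>z. complex_of_real (?d z) \<partial>\<mu>)"
      unfolding D_def by (rule integral_complex_of_real[symmetric])
    have "of_real (D n) - P n = (\<integral>z. of_real (?d z) - ?p z \<partial>\<mu>)"
      unfolding P_def Bochner_Integration.integral_diff[OF id ip] oD ..
    then have "norm (of_real (D n) - P n) = norm (\<integral>z. of_real (?d z) - ?p z \<partial>\<mu>)" by (rule arg_cong)
    also have "\<dots> \<le> (\<integral>z. norm (of_real (?d z) - ?p z) \<partial>\<mu>)" by (rule integral_norm_bound)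
    also have "\<dots> \<le> (\<integral>z. \<bar>indicator B (flow (m n) z) - b (flow (m n) z)\<bar> + 11/2 * e + 6 * (\<bar>indicator A z - a z\<bar> + e) \<partial>\<mu>)"
    proof (rule integral_mono)
      show "integrable \<mu> (\<lambda>z. norm (of_real (?d z) - ?p z))" by (intro integrable_norm Bochner_Integration.integrable_diff id ip)
      show "integrable \<mu> (\<lambda>z. \<bar>indicator B (flow (m n) z) - b (flow (m n) z)\<bar> + 11/2 * e + 6 * (\<bar>indicator A z - a z\<bar> + e))"
        by (intro Bochner_Integration.integrable_add integrable_mult_right i1 i2 integrable_const)
    qed (use pt in simp)
    also have "\<dots> = (\<integral>z. \<bar>indicator B (flow (m n) z) - b (flow (m n) z)\<bar> \<partial>\<mu>) + 11/2 * e + 6 * ((\<integral>z. \<bar>indicator A z - a z\<bar> \<partial>\<mu>) + e)"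
      using i1 i2 by (simp add: p1)
    also have "(\<integral>z. \<bar>indicator B (flow (m n) z) - b (flow (m n) z)\<bar> \<partial>\<mu>) = (\<integral>z. \<bar>indicator B z - b z\<bar> \<partial>\<mu>)"
      by (rule integral_mu_flow) measurable
    finally have "norm (of_real (D n) - P n) \<le> (\<integral>z. \<bar>indicator B z - b z\<bar> \<partial>\<mu>) + 11/2 * e + 6 * ((\<integral>z. \<bar>indicator A z - a z\<bar> \<partial>\<mu>) + e)" .
    moreover have "x \<le> 19 * e" if "x \<le> E1 + 11/2 * e + 6 * (E2 + e)" "E1 \<le> e" "E2 \<le> e" for x E1 E2 :: real
      using that e(1) by (simp add: algebra_simps)
    ultimately show ?thesis using a(3) b(3) by blast
  qed
  have "P \<longlonglongrightarrow> 0" unfolding P_def[abs_def] h_def by (rule c(3))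
  then have "eventually (\<lambda>n. norm (P n) < e) sequentially" using e(1) by (auto dest: tendstoD)
  then show "eventually (\<lambda>n. dist (\<integral>z. \<omega> (un n z) * indicator A z * (indicator B (flow (m n) z) - measure \<mu> B) \<partial>\<mu>) 0 < e') sequentially"
  proof eventually_elim
    case (elim n)
    have "norm (complex_of_real (D n)) \<le> norm (of_real (D n) - P n) + norm (P n)"
      using norm_triangle_ineq[of "of_real (D n) - P n" "P n"] by simp
    then have "\<bar>D n\<bar> < e'" unfolding norm_of_real using close[of n] elim e by linarith
    then show ?case by (simp add: D_def)
  qed
qed

section \<open>Triple correlations\<close>

text \<open>One weight has to serve all \<open>n\<close> with the same error, since decorrelation is
  a limit in \<open>n\<close> for a fixed weight.\<close>

definition shear_exhausts :: "real \<Rightarrow> real set \<Rightarrow> bool" where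
  "shear_exhausts \<theta> G \<longleftrightarrow> G \<in> sets borel \<and>
     (\<forall>e>0. \<exists>\<omega>. shear_weight \<theta> \<omega> \<and> (\<forall>n. (\<integral>z. indicator G (un n z) * (1 - \<omega> (un n z)) \<partial>\<mu>) \<le> e))"

text \<open>The counterpart of \<open>shearing\<close>: at these phases, before and after a shift by
  nearly \<open>\<theta>\<close>, the \<open>n\<close>-th summand contributes almost
  nothing.\<close>

definition quiet :: "real \<Rightarrow> real set \<Rightarrow> bool" where
  "quiet \<theta> G \<longleftrightarrow> (\<exists>\<eta>>0. \<forall>e>0. eventually (\<lambda>n. \<forall>u\<in>G. \<forall>h. \<bar>h - \<theta>\<bar> < \<eta> \<longrightarrow>
     \<bar>gd 0 n u\<bar> \<le> e \<and> \<bar>gd 0 n (u + h)\<bar> \<le> e) sequentially)"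

lemma flow_vimage_measurable:
  assumes "B \<in> sets torus_borel"
  shows "flow t -` B \<inter> torus \<in> sets torus_borel"
  using measurable_sets[OF flow_measurable' assms] by simp

lemma integrable_mu_01:
  fixes f :: "complex \<times> complex \<Rightarrow> real"
  assumes "f \<in> borel_measurable torus_borel" "\<And>z. \<bar>f z\<bar> \<le> 1"
  shows "integrable \<mu> f"
  using mu_integrable[OF assms(1), of 1] assms(2) by simp

text \<open>A weight that is nearly 1 on the whole torus loses at most \<open>e / 2\<close>, and
  what it keeps decorrelates.\<close>

lemma tendsto_measure_flow:
  assumes ex: "shear_exhausts \<theta> UNIV" and m: "(\<lambda>n. m n * \<epsilon> n) \<longlonglongrightarrow> \<theta>"
    and A: "A \<in> sets torus_borel" and B: "B \<in> sets torus_borel"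
  shows "(\<lambda>n. measure \<mu> (A \<inter> (flow (m n) -` B \<inter> torus))) \<longlonglongrightarrow> measure \<mu> A * measure \<mu> B"
proof (rule tendstoI)
  fix e :: real assume e: "e > 0"
  interpret prob_space \<mu> by (rule prob_space_mu)
  from ex e obtain \<omega> where w: "shear_weight \<theta> \<omega>" and small: "\<And>n. (\<integral>z. 1 - \<omega> (un n z) \<partial>\<mu>) \<le> e / 2"
    unfolding shear_exhausts_def by (auto dest: spec[of _ "e / 2"])
  note wf = shear_weight_facts[OF w]
  have wm [measurable]: "(\<lambda>z. \<omega> (un n z)) \<in> borel_measurable torus_borel" for n by (rule measurable_compose[OF un_measurable wf(5)])
  note A [measurable] B [measurable]
  have Bm [measurable]: "(\<lambda>z. indicator B (flow (m n) z) :: real) \<in> borel_measurable torus_borel" for n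
    by (rule measurable_compose[OF flow_measurable']) simp
  let ?D = "\<lambda>n. \<integral>z. \<omega> (un n z) * indicator A z * (indicator B (flow (m n) z) - measure \<mu> B) \<partial>\<mu>"
  have B1: "0 \<le> measure \<mu> B" "measure \<mu> B \<le> 1" by auto
  have AT: "A \<subseteq> torus" using sets.sets_into_space[OF A] by simp
  have close: "\<bar>measure \<mu> (A \<inter> (flow (m n) -` B \<inter> torus)) - measure \<mu> A * measure \<mu> B - ?D n\<bar> \<le> e / 2" for n
  proof -
    have i1: "integrable \<mu> (\<lambda>z. indicator A z * indicator B (flow (m n) z) :: real)"
      by (rule integrable_mu_01) (auto simp: indicator_def)
    have i2: "integrable \<mu> (\<lambda>z. indicator A z * measure \<mu> B)"
      by (rule integrable_mu_01) (use B1 in \<open>auto simp: indicator_def\<close>)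
    have b3: "\<bar>\<omega> (un n z) * indicator A z * (indicator B (flow (m n) z) - measure \<mu> B)\<bar> \<le> 1 * 1 * 1" for z
      unfolding abs_mult using wf(3,4) B1 by (intro mult_mono) (auto simp: indicator_def)
    have i3: "integrable \<mu> (\<lambda>z. \<omega> (un n z) * indicator A z * (indicator B (flow (m n) z) - measure \<mu> B))"
      by (rule integrable_mu_01) (use b3 in auto)
    have i4: "integrable \<mu> (\<lambda>z. 1 - \<omega> (un n z))"
      by (rule integrable_mu_01) (use wf(3,4) in auto)
    have "measure \<mu> (A \<inter> (flow (m n) -` B \<inter> torus)) = (\<integral>z. indicator (A \<inter> (flow (m n) -` B \<inter> torus)) z \<partial>\<mu>)"
      using AT by (simp add: Int_absorb2 le_infI1)
    also have "\<dots> = (\<integral>z. indicator A z * indicator B (flow (m n) z) \<partial>\<mu>)"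
      by (rule Bochner_Integration.integral_cong) (auto simp: indicator_def)
    finally have M: "measure \<mu> (A \<inter> (flow (m n) -` B \<inter> torus)) = (\<integral>z. indicator A z * indicator B (flow (m n) z) \<partial>\<mu>)" .
    have "measure \<mu> A * measure \<mu> B = (\<integral>z. indicator A z * measure \<mu> B \<partial>\<mu>)" using AT by (simp add: Int_absorb2)
    then have "measure \<mu> (A \<inter> (flow (m n) -` B \<inter> torus)) - measure \<mu> A * measure \<mu> B - ?D n =
      (\<integral>z. indicator A z * indicator B (flow (m n) z) - indicator A z * measure \<mu> B -
        \<omega> (un n z) * indicator A z * (indicator B (flow (m n) z) - measure \<mu> B) \<partial>\<mu>)"
      unfolding M by (simp only: Bochner_Integration.integral_diff[OF Bochner_Integration.integrable_diff[OF i1 i2] i3] Bochner_Integration.integral_diff[OF i1 i2])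
    then have "\<bar>measure \<mu> (A \<inter> (flow (m n) -` B \<inter> torus)) - measure \<mu> A * measure \<mu> B - ?D n\<bar> =
      \<bar>\<integral>z. indicator A z * indicator B (flow (m n) z) - indicator A z * measure \<mu> B -
        \<omega> (un n z) * indicator A z * (indicator B (flow (m n) z) - measure \<mu> B) \<partial>\<mu>\<bar>" by (rule arg_cong)
    also have "\<dots> \<le> (\<integral>z. \<bar>indicator A z * indicator B (flow (m n) z) - indicator A z * measure \<mu> B -
        \<omega> (un n z) * indicator A z * (indicator B (flow (m n) z) - measure \<mu> B)\<bar> \<partial>\<mu>)" by (rule integral_abs_bound)
    also have "\<dots> \<le> (\<integral>z. 1 - \<omega> (un n z) \<partial>\<mu>)"
    proof (rule integral_mono[OF _ i4])
      show "integrable \<mu> (\<lambda>z. \<bar>indicator A z * indicator B (flow (m n) z) - indicator A z * measure \<mu> B -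
        \<omega> (un n z) * indicator A z * (indicator B (flow (m n) z) - measure \<mu> B)\<bar>)"
        by (intro integrable_abs Bochner_Integration.integrable_diff i1 i2 i3)
      fix z
      have "indicator A z * indicator B (flow (m n) z) - indicator A z * measure \<mu> B -
        \<omega> (un n z) * indicator A z * (indicator B (flow (m n) z) - measure \<mu> B) =
        (1 - \<omega> (un n z)) * (indicator A z * (indicator B (flow (m n) z) - measure \<mu> B))"
        by (simp add: algebra_simps)
      then have "\<bar>indicator A z * indicator B (flow (m n) z) - indicator A z * measure \<mu> B -
        \<omega> (un n z) * indicator A z * (indicator B (flow (m n) z) - measure \<mu> B)\<bar> =
        \<bar>1 - \<omega> (un n z)\<bar> * \<bar>indicator A z * (indicator B (flow (m n) z) - measure \<mu> B)\<bar>" by (simp only: abs_mult)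
      also have "\<dots> \<le> (1 - \<omega> (un n z)) * 1"
        using wf(3,4) B1 by (intro mult_mono) (auto simp: indicator_def)
      finally show "\<bar>indicator A z * indicator B (flow (m n) z) - indicator A z * measure \<mu> B -
        \<omega> (un n z) * indicator A z * (indicator B (flow (m n) z) - measure \<mu> B)\<bar> \<le> 1 - \<omega> (un n z)" by simp
    qed
    finally show ?thesis using small[of n] by linarith
  qed
  have "eventually (\<lambda>n. \<bar>?D n\<bar> < e / 2) sequentially"
    using tendstoD[OF decorrelation[OF w m A B], of "e / 2"] e by (simp add: dist_real_def)
  then show "eventually (\<lambda>n. dist (measure \<mu> (A \<inter> (flow (m n) -` B \<inter> torus))) (measure \<mu> A * measure \<mu> B) < e) sequentially"
  proof eventually_elim
    case (elim n)
    have "\<bar>a - b\<bar> < e" if "\<bar>a - b - d\<bar> \<le> e / 2" "\<bar>d\<bar> < e / 2" for a b d :: real using that by linarith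
    from this[OF close[of n] elim] show ?case by (simp only: dist_real_def)
  qed
qed

text \<open>At phases in \<open>G\<close> the condition at the second time is dropped and the first
  two sets decorrelate; at phases in \<open>G'\<close> the condition at the first time is dropped
  instead. Each case contributes at most \<open>(measure \<mu> A)\<^sup>2\<close> in the
  limit.\<close>

lemma triple_correlation_upper:
  assumes ex: "shear_exhausts \<theta> G" "shear_exhausts \<theta>' G'" and cover: "G \<union> G' = UNIV"
    and m: "(\<lambda>n. m n * \<epsilon> n) \<longlonglongrightarrow> \<theta>" "(\<lambda>n. m' n * \<epsilon> n) \<longlonglongrightarrow> \<theta>'"
    and A: "A \<in> sets torus_borel" and e: "e > 0"
  shows "eventually (\<lambda>n. measure \<mu> (A \<inter> (flow (m n) -` A \<inter> torus) \<inter> (flow (m' n) -` A \<inter> torus)) \<le> 2 * (measure \<mu> A)\<^sup>2 + e) sequentially"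
proof -
  interpret prob_space \<mu> by (rule prob_space_mu)
  note A [measurable]
  have AT: "A \<subseteq> torus" using sets.sets_into_space[OF A] by simp
  have A1: "0 \<le> measure \<mu> A" "measure \<mu> A \<le> 1" by auto
  have Am [measurable]: "(\<lambda>z. indicator A (flow t z) :: real) \<in> borel_measurable torus_borel" for t
    by (rule measurable_compose[OF flow_measurable']) simp
  have part: "\<exists>\<omega>. shear_weight \<theta> \<omega> \<and> (\<forall>n. (\<integral>z. indicator G (un n z) * (1 - \<omega> (un n z)) \<partial>\<mu>) \<le> e / 4) \<and>
     eventually (\<lambda>n. (\<integral>z. \<omega> (un n z) * indicator A z * indicator A (flow (m n) z) \<partial>\<mu>) \<le> (measure \<mu> A)\<^sup>2 + e / 4) sequentially"
    if ex: "shear_exhausts \<theta> G" and m: "(\<lambda>n. m n * \<epsilon> n) \<longlonglongrightarrow> \<theta>" for \<theta> G m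
  proof -
    from ex e obtain \<omega> where w: "shear_weight \<theta> \<omega>" and small: "\<forall>n. (\<integral>z. indicator G (un n z) * (1 - \<omega> (un n z)) \<partial>\<mu>) \<le> e / 4"
      unfolding shear_exhausts_def by (auto dest: spec[of _ "e / 4"])
    note wf = shear_weight_facts[OF w]
    have wm [measurable]: "(\<lambda>z. \<omega> (un n z)) \<in> borel_measurable torus_borel" for n by (rule measurable_compose[OF un_measurable wf(5)])
    let ?D = "\<lambda>n. \<integral>z. \<omega> (un n z) * indicator A z * (indicator A (flow (m n) z) - measure \<mu> A) \<partial>\<mu>"
    have bd: "(\<integral>z. \<omega> (un n z) * indicator A z * indicator A (flow (m n) z) \<partial>\<mu>) \<le> (measure \<mu> A)\<^sup>2 + ?D n" for n
    proof -
      have i1: "integrable \<mu> (\<lambda>z. \<omega> (un n z) * indicator A z)"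
        by (rule integrable_mu_01) (use wf(3,4) in \<open>auto simp: indicator_def\<close>)
      have b2: "\<bar>\<omega> (un n z) * indicator A z * (indicator A (flow (m n) z) - measure \<mu> A)\<bar> \<le> 1 * 1 * 1" for z
        unfolding abs_mult using wf(3,4) A1 by (intro mult_mono) (auto simp: indicator_def)
      have i2: "integrable \<mu> (\<lambda>z. \<omega> (un n z) * indicator A z * (indicator A (flow (m n) z) - measure \<mu> A))"
        by (rule integrable_mu_01) (use b2 in auto)
      have iA: "integrable \<mu> (indicator A :: _ \<Rightarrow> real)" by (rule integrable_mu_01) (auto simp: indicator_def)
      have "(\<integral>z. \<omega> (un n z) * indicator A z * indicator A (flow (m n) z) \<partial>\<mu>) =
        (\<integral>z. \<omega> (un n z) * indicator A z * measure \<mu> A + \<omega> (un n z) * indicator A z * (indicator A (flow (m n) z) - measure \<mu> A) \<partial>\<mu>)"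
        by (rule Bochner_Integration.integral_cong) (auto simp: algebra_simps)
      also have "\<dots> = (\<integral>z. \<omega> (un n z) * indicator A z \<partial>\<mu>) * measure \<mu> A + ?D n"
        by (subst Bochner_Integration.integral_add) (use i1 i2 in auto)
      also have "(\<integral>z. \<omega> (un n z) * indicator A z \<partial>\<mu>) \<le> (\<integral>z. indicator A z \<partial>\<mu>)"
        by (rule integral_mono[OF i1 iA]) (use wf(4) in \<open>auto simp: indicator_def\<close>)
      also have "(\<integral>z. indicator A z \<partial>\<mu>) = measure \<mu> A" using AT by (simp add: Int_absorb2)
      finally show ?thesis using A1 by (simp add: power2_eq_square mult_right_mono)
    qed
    have "eventually (\<lambda>n. \<bar>?D n\<bar> < e / 4) sequentially"
      using tendstoD[OF decorrelation[OF w m A A], of "e / 4"] e by (simp add: dist_real_def)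
    then have "eventually (\<lambda>n. (\<integral>z. \<omega> (un n z) * indicator A z * indicator A (flow (m n) z) \<partial>\<mu>) \<le> (measure \<mu> A)\<^sup>2 + e / 4) sequentially"
    proof eventually_elim
      case (elim n)
      then show ?case using bd[of n] by linarith
    qed
    then show ?thesis using w small by blast
  qed
  obtain \<omega> where w: "shear_weight \<theta> \<omega>" "\<And>n. (\<integral>z. indicator G (un n z) * (1 - \<omega> (un n z)) \<partial>\<mu>) \<le> e / 4"
    and ev: "eventually (\<lambda>n. (\<integral>z. \<omega> (un n z) * indicator A z * indicator A (flow (m n) z) \<partial>\<mu>) \<le> (measure \<mu> A)\<^sup>2 + e / 4) sequentially"
    using part[OF ex(1) m(1)] by blast
  obtain \<omega>' where w': "shear_weight \<theta>' \<omega>'" "\<And>n. (\<integral>z. indicator G' (un n z) * (1 - \<omega>' (un n z)) \<partial>\<mu>) \<le> e / 4"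
    and ev': "eventually (\<lambda>n. (\<integral>z. \<omega>' (un n z) * indicator A z * indicator A (flow (m' n) z) \<partial>\<mu>) \<le> (measure \<mu> A)\<^sup>2 + e / 4) sequentially"
    using part[OF ex(2) m(2)] by blast
  note wf = shear_weight_facts[OF w(1)] and wf' = shear_weight_facts[OF w'(1)]
  have [measurable]: "(\<lambda>z. \<omega> (un n z)) \<in> borel_measurable torus_borel" "(\<lambda>z. \<omega>' (un n z)) \<in> borel_measurable torus_borel" for n
    by (rule measurable_compose[OF un_measurable wf(5)], rule measurable_compose[OF un_measurable wf'(5)])
  have [measurable]: "G \<in> sets borel" "G' \<in> sets borel" using ex by (auto simp: shear_exhausts_def)
  have [measurable]: "(\<lambda>z. indicator G (un n z) :: real) \<in> borel_measurable torus_borel" "(\<lambda>z. indicator G' (un n z) :: real) \<in> borel_measurable torus_borel" for n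
    by (rule measurable_compose[OF un_measurable], simp)+
  from ev ev' show ?thesis
  proof eventually_elim
    case (elim n)
    let ?f = "\<lambda>z. \<omega> (un n z) * indicator A z * indicator A (flow (m n) z)"
    let ?f' = "\<lambda>z. \<omega>' (un n z) * indicator A z * indicator A (flow (m' n) z)"
    let ?r = "\<lambda>z. indicator G (un n z) * (1 - \<omega> (un n z))"
    let ?r' = "\<lambda>z. indicator G' (un n z) * (1 - \<omega>' (un n z))"
    have i: "integrable \<mu> ?f" "integrable \<mu> ?f'" "integrable \<mu> ?r" "integrable \<mu> ?r'"
      by (rule integrable_mu_01; (use wf(3,4) wf'(3,4) in \<open>auto simp: indicator_def\<close>))+
    let ?S = "A \<inter> (flow (m n) -` A \<inter> torus) \<inter> (flow (m' n) -` A \<inter> torus)"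
    have S: "?S \<in> sets \<mu>" using A flow_vimage_measurable[OF A] by auto
    have iS: "integrable \<mu> (indicator ?S :: _ \<Rightarrow> real)"
      using S by (intro integrable_mu_01) (auto simp: indicator_def)
    have "measure \<mu> ?S = (\<integral>z. indicator ?S z \<partial>\<mu>)" using AT by (simp add: Int_absorb2 le_infI1)
    also have "\<dots> \<le> (\<integral>z. (?f z + ?f' z) + (?r z + ?r' z) \<partial>\<mu>)"
    proof (rule integral_mono[OF iS])
      show "integrable \<mu> (\<lambda>z. (?f z + ?f' z) + (?r z + ?r' z))" by (intro Bochner_Integration.integrable_add i)
      fix z
      have nn: "0 \<le> ?f z" "0 \<le> ?f' z" "0 \<le> ?r z" "0 \<le> ?r' z" using wf(3,4) wf'(3,4) by auto
      show "indicator ?S z \<le> (?f z + ?f' z) + (?r z + ?r' z)"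
      proof (cases "z \<in> ?S")
        case True
        then have zs: "?f z = \<omega> (un n z)" "?f' z = \<omega>' (un n z)" by auto
        have "un n z \<in> G \<or> un n z \<in> G'" using cover by blast
        then have "?f z + ?r z \<ge> 1 \<or> ?f' z + ?r' z \<ge> 1" unfolding zs by auto
        moreover have "indicator ?S z = (1 :: real)" using True by simp
        ultimately show ?thesis using nn by linarith
      next
        case False
        then have "indicator ?S z = (0 :: real)" by simp
        then show ?thesis using nn by linarith
      qed
    qed
    also have "\<dots> = (integral\<^sup>L \<mu> ?f + integral\<^sup>L \<mu> ?f') + (integral\<^sup>L \<mu> ?r + integral\<^sup>L \<mu> ?r')"
      by (simp only: Bochner_Integration.integral_add[OF i(1,2)] Bochner_Integration.integral_add[OF i(3,4)]
         Bochner_Integration.integral_add[OF Bochner_Integration.integrable_add[OF i(1,2)] Bochner_Integration.integrable_add[OF i(3,4)]])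
    also have "\<dots> \<le> ((measure \<mu> A)\<^sup>2 + e / 4 + ((measure \<mu> A)\<^sup>2 + e / 4)) + (e / 4 + e / 4)"
      by (intro add_mono elim w(2) w'(2))
    finally show ?case by simp
  qed
qed

lemma nn_integral_ur:
  assumes f: "f \<in> borel_measurable borel" and per: "\<And>u i. f (u + of_int i) = (f u :: ennreal)"
  shows "(\<integral>\<^sup>+x. f (ur n x y) * indicator {0..<1} x \<partial>lborel) = (\<integral>\<^sup>+x. f x * indicator {0..<1} x \<partial>lborel)"
proof -
  have "f (x + 1) = f x" for x using per[of x 1] by simp
  from nn_integral_periodic_dilation[OF f this, of "nat (q n)" "- (of_int (p n) * y)"] q_pos[of n]
  show ?thesis by (simp add: ur_def)
qed

text \<open>On a horizontal circle the phase runs \<open>q n\<close> times around at constant speed,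
  so it is uniformly distributed modulo 1 for Lebesgue measure; the density is at most 4/3. The
  bound is therefore the same for all \<open>n\<close>.\<close>

lemma nn_integral_un_le:
  assumes f [measurable]: "f \<in> borel_measurable borel" and per: "\<And>u i. f (u + of_int i) = (f u :: ennreal)"
  shows "(\<integral>\<^sup>+z. f (un n z) \<partial>\<mu>) \<le> ennreal (4/3) * (\<integral>\<^sup>+x. f x * indicator {0..<1} x \<partial>lborel)"
proof -
  let ?I = "\<integral>\<^sup>+x. f x * indicator {0..<1} x \<partial>lborel"
  have [measurable]: "(\<lambda>z. f (un n z)) \<in> borel_measurable torus_borel" by (rule measurable_compose[OF un_measurable f])
  have [measurable]: "(\<lambda>x. f (ur n x y)) \<in> borel_measurable borel" for y
    by (rule measurable_compose[OF _ f]) (simp add: ur_def)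
  have "(\<integral>\<^sup>+z. f (un n z) \<partial>\<mu>) =
    (\<integral>\<^sup>+y. (\<integral>\<^sup>+x. ennreal (v x y) * f (un n (torus_proj (x, y))) * indicator {0..<1} x \<partial>lborel) * indicator {0..<1} y \<partial>lborel)"
    by (rule nn_integral_mu) simp
  also have "\<dots> \<le> (\<integral>\<^sup>+y. (ennreal (4/3) * ?I) * indicator {0..<1::real} y \<partial>lborel)"
  proof (intro nn_integral_mono mult_right_mono)
    fix y :: real
    have eq: "f (un n (torus_proj (x, y))) = f (ur n x y)" for x
      using per[of "ur n x y" "q n * (- \<lfloor>x\<rfloor>) - p n * (- \<lfloor>y\<rfloor>)"] ur_shift[of n x "- \<lfloor>x\<rfloor>" y "- \<lfloor>y\<rfloor>"]
      by (simp add: un_def torus_coord_proj frac_def)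
    have "(\<integral>\<^sup>+x. ennreal (v x y) * f (un n (torus_proj (x, y))) * indicator {0..<1} x \<partial>lborel)
       \<le> (\<integral>\<^sup>+x. ennreal (4/3) * (f (ur n x y) * indicator {0..<1} x) \<partial>lborel)"
      unfolding eq mult.assoc using v_bounds(2) by (intro nn_integral_mono mult_right_mono ennreal_leI) auto
    also have "\<dots> = ennreal (4/3) * ?I"
      by (subst nn_integral_cmult) (simp_all add: nn_integral_ur[OF f per])
    finally show "(\<integral>\<^sup>+x. ennreal (v x y) * f (un n (torus_proj (x, y))) * indicator {0..<1} x \<partial>lborel) \<le> ennreal (4/3) * ?I" .
  qed simp
  also have "\<dots> = ennreal (4/3) * ?I" by (subst nn_integral_cmult) auto
  finally show ?thesis .
qed

section \<open>Rigidity at multiples of the denominators\<close>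

text \<open>At time \<open>m = k * q n\<close> the linear flow moves \<open>y\<close> by an integer
  and \<open>x\<close> by \<open>k * \<epsilon> n\<close> modulo 1, which the coarser summands
  hardly notice; the phases of the finer ones move too slowly to matter. The change of the
  \<open>n\<close>-th summand is bounded by its values at the two end phases.\<close>

lemma psi_rigid:
  fixes k :: int
  assumes m: "m = of_int (k * q n)"
  shows "\<bar>psi x y m\<bar> \<le> \<bar>gd 0 n (ur n x y)\<bar> + \<bar>gd 0 n (ur n x y + m * \<epsilon> n)\<bar> + 2 * (\<bar>m * \<epsilon> n\<bar> / real (Suc n))"
proof -
  define a where "a j = gd 0 j (ur j x y + m * \<epsilon> j) - gd 0 j (ur j x y)" for j
  have bd: "\<bar>a j\<bar> \<le> \<bar>m\<bar> * \<epsilon> j * \<beta> j" for j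
  proof -
    have "\<bar>a j\<bar> * 1 \<le> \<bar>a j\<bar> * of_int (q j)" using q_pos_real by (intro mult_left_mono) auto
    also have "\<dots> \<le> \<beta> j * \<bar>m * \<epsilon> j\<bar>"
      using gd_lipschitz[of 0 j "ur j x y + m * \<epsilon> j" "ur j x y"] by (simp add: a_def)
    finally show ?thesis using eps_pos[of j] by (simp add: abs_mult mult_ac)
  qed
  have sm: "summable a"
  proof (rule summable_quarter_bound[of _ "\<bar>m\<bar>"])
    show "\<bar>a j\<bar> \<le> \<bar>m\<bar> * (1/4) ^ Suc j" for j
      using bd[of j] mult_left_mono[OF eps_beta[of j] abs_ge_zero[of m]] by (simp only: mult.assoc)
  qed
  have "suminf a = (\<Sum>j. a (j + Suc n)) + (\<Sum>j<Suc n. a j)"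
    by (rule suminf_split_initial_segment[OF sm])
  then have eq: "psi x y m = (\<Sum>j. a (j + Suc n)) + (\<Sum>j<n. a j) + a n" unfolding psi_def a_def[symmetric] by simp
  have tail: "\<bar>\<Sum>j. a (j + Suc n)\<bar> \<le> \<bar>m * \<epsilon> n\<bar> / real (Suc n)"
  proof -
    have "\<bar>a (j + Suc n)\<bar> \<le> (\<bar>m * \<epsilon> n\<bar> / real (Suc n)) * (1/4) ^ Suc j" for j
    proof -
      have "\<bar>a (j + Suc n)\<bar> \<le> \<bar>m\<bar> * (\<epsilon> (j + Suc n) * \<beta> (j + Suc n))" using bd[of "j + Suc n"] by (simp only: mult.assoc)
      also have "\<dots> \<le> \<bar>m\<bar> * ((1/4) ^ Suc (j + Suc n) * \<epsilon> n)" by (intro mult_left_mono eps_tail) auto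
      also have "\<dots> = \<bar>m * \<epsilon> n\<bar> * ((1/4) ^ Suc n * (1/4) ^ Suc j)" using eps_pos[of n] by (simp add: abs_mult power_add mult_ac)
      also have "\<dots> \<le> \<bar>m * \<epsilon> n\<bar> * ((1 / real (Suc n)) * (1/4) ^ Suc j)"
      proof (intro mult_left_mono mult_right_mono)
        have "real (Suc n) \<le> 2 ^ Suc n" using of_nat_mono[OF less_imp_le[OF less_exp[of "Suc n"]], where 'a = real] by simp
        also have "\<dots> \<le> (4::real) ^ Suc n" by (intro power_mono) auto
        finally show "(1/4) ^ Suc n \<le> 1 / real (Suc n)" by (simp add: field_simps power_one_over)
      qed auto
      finally show ?thesis by simp
    qed
    then have "\<bar>\<Sum>j. a (j + Suc n)\<bar> \<le> (\<bar>m * \<epsilon> n\<bar> / real (Suc n)) / 3" by (rule suminf_quarter_bound)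
    also have "\<dots> \<le> \<bar>m * \<epsilon> n\<bar> / real (Suc n)"
    proof -
      have third: "t / 3 \<le> t" if "0 \<le> t" for t :: real using that by simp
      show ?thesis by (rule third) simp
    qed
    finally show ?thesis .
  qed
  have head: "\<bar>\<Sum>j<n. a j\<bar> \<le> \<bar>m * \<epsilon> n\<bar> / real (Suc n)"
  proof -
    have "\<bar>a j\<bar> \<le> \<bar>real_of_int k\<bar> * \<epsilon> n * \<beta> j" for j
    proof -
      \<comment> \<open>modulo 1 the phase shift at scale \<open>j\<close> is governed by \<open>\<epsilon> n\<close>, since \<open>m\<close> is a multiple of \<open>q n\<close>\<close>
      have "ur j x y + m * \<epsilon> j = (ur j x y + real_of_int (q j) * (k * \<epsilon> n)) + of_int (q j * k * p n - m' * p j)" if "m' = k * q n" for m'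
        unfolding m that by (simp add: \<epsilon>_def algebra_simps)
      then have "a j = gd 0 j (ur j x y + real_of_int (q j) * (k * \<epsilon> n)) - gd 0 j (ur j x y)"
        unfolding a_def by (simp only: gd_periodic)
      then have "\<bar>a j\<bar> * of_int (q j) \<le> \<beta> j * \<bar>real_of_int (q j) * (k * \<epsilon> n)\<bar>"
        using gd_lipschitz[of 0 j "ur j x y + real_of_int (q j) * (k * \<epsilon> n)" "ur j x y"] by simp
      also have "\<dots> = (\<bar>real_of_int k\<bar> * \<epsilon> n * \<beta> j) * of_int (q j)"
        using eps_pos[of n] q_pos_real[of j] by (simp add: abs_mult mult_ac)
      finally show ?thesis using q_pos_real[of j] by (simp add: mult_le_cancel_right)
    qed
    then have "\<bar>\<Sum>j<n. a j\<bar> \<le> (\<Sum>j<n. \<bar>real_of_int k\<bar> * \<epsilon> n * \<beta> j)"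
      by (intro order.trans[OF sum_abs] sum_mono)
    also have "\<dots> \<le> \<bar>real_of_int k\<bar> * \<epsilon> n * (q n / real (Suc n))"
      unfolding sum_distrib_left[symmetric] using beta_head[of n] eps_pos[of n] by (intro mult_left_mono) auto
    also have "\<dots> = \<bar>m * \<epsilon> n\<bar> / real (Suc n)"
      using eps_pos[of n] q_pos_real[of n] by (simp add: m abs_mult)
    finally show ?thesis .
  qed
  have "\<bar>A + B + C\<bar> \<le> y + x + 2 * e" if "\<bar>A\<bar> \<le> e" "\<bar>B\<bar> \<le> e" "\<bar>C\<bar> \<le> x + y" for A B C e x y :: real
    using that by linarith
  from this[OF tail head abs_triangle_ineq4[of "gd 0 n (ur n x y + m * \<epsilon> n)" "gd 0 n (ur n x y)", folded a_def]]
  show ?thesis unfolding eq .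
qed

lemma sigma_rigid:
  fixes k :: "nat \<Rightarrow> int"
  assumes G: "quiet \<theta> G" and m: "(\<lambda>n. of_int (k n * q n) * \<epsilon> n) \<longlonglongrightarrow> \<theta>" and e: "e > 0"
  shows "eventually (\<lambda>n. \<forall>x y. ur n x y \<in> G \<longrightarrow> \<bar>sigma (of_int (k n * q n)) x y - of_int (k n * q n)\<bar> \<le> e) sequentially"
proof -
  obtain \<eta> where \<eta>: "\<eta> > 0" and ev: "eventually (\<lambda>n. \<forall>u\<in>G. \<forall>h. \<bar>h - \<theta>\<bar> < \<eta> \<longrightarrow> \<bar>gd 0 n u\<bar> \<le> e / 6 \<and> \<bar>gd 0 n (u + h)\<bar> \<le> e / 6) sequentially"
  proof -
    have "e / 6 > 0" using e by simp
    then show ?thesis using G that unfolding quiet_def by blast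
  qed
  have ev2: "eventually (\<lambda>n. \<bar>of_int (k n * q n) * \<epsilon> n - \<theta>\<bar> < \<eta>) sequentially"
    using tendstoD[OF m \<eta>] unfolding dist_real_def .
  have lim: "(\<lambda>n. 2 * (\<bar>of_int (k n * q n) * \<epsilon> n\<bar> / real (Suc n))) \<longlonglongrightarrow> 2 * (\<bar>\<theta>\<bar> * 0)"
    unfolding divide_inverse by (intro tendsto_mult tendsto_const tendsto_rabs m LIMSEQ_inverse_real_of_nat)
  have ev3: "eventually (\<lambda>n. 2 * (\<bar>of_int (k n * q n) * \<epsilon> n\<bar> / real (Suc n)) < e / 6) sequentially"
    by (rule order_tendstoD(2)[OF lim]) (use e in simp)
  from ev ev2 ev3 show ?thesis
  proof eventually_elim
    case (elim n)
    let ?m = "of_int (k n * q n) :: real"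
    show ?case
    proof (intro allI impI)
      fix x y assume "ur n x y \<in> G"
      with elim(1,2) have "\<bar>gd 0 n (ur n x y)\<bar> \<le> e / 6" "\<bar>gd 0 n (ur n x y + ?m * \<epsilon> n)\<bar> \<le> e / 6" by blast+
      \<comment> \<open>Three errors of \<open>e / 6\<close> bound \<open>psi\<close> by
        \<open>e / 2\<close>, which the expansion factor 2/3 of \<open>tau\<close> turns into at
        most \<open>e\<close>.\<close>
      with psi_rigid[of ?m "k n" n x y] elim(3) have "\<bar>psi x y ?m\<bar> \<le> e / 2" by linarith
      moreover have "2 / 3 * \<bar>sigma ?m x y - ?m\<bar> \<le> \<bar>tau x y (sigma ?m x y) - tau x y ?m\<bar>" by (rule tau_diff_ge)
      moreover have "tau x y (sigma ?m x y) - tau x y ?m = - psi x y ?m" by (simp only: tau_sigma) (simp add: tau_def)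
      moreover have "a \<le> e" if "\<bar>p'\<bar> \<le> e / 2" "2 / 3 * a \<le> \<bar>t\<bar>" "t = - p'" for a t p' :: real
        using that e by linarith
      ultimately show "\<bar>sigma ?m x y - ?m\<bar> \<le> e" by blast
    qed
  qed
qed

text \<open>The multiples of \<open>q n * \<epsilon> n\<close> form a grid whose mesh is at most
  \<open>\<epsilon> n * \<beta> n\<close> and hence tends to 0.\<close>

lemma multiples_exist: "\<exists>k :: nat \<Rightarrow> int. (\<lambda>n. of_int (k n * q n) * \<epsilon> n) \<longlonglongrightarrow> \<theta>"
proof -
  define k where "k n = \<lfloor>\<theta> / (q n * \<epsilon> n)\<rfloor>" for n
  have qe: "0 < q n * \<epsilon> n" "q n * \<epsilon> n \<le> (1/4) ^ Suc n" for n
  proof -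
    show "0 < q n * \<epsilon> n" using eps_pos[of n] q_pos_real[of n] by simp
    have "q n * \<epsilon> n \<le> \<beta> n * \<epsilon> n" using beta_q eps_pos[of n] by (intro mult_right_mono) auto
    then show "q n * \<epsilon> n \<le> (1/4) ^ Suc n" using eps_beta[of n] by (simp add: mult.commute)
  qed
  have bd: "norm (of_int (k n * q n) * \<epsilon> n - \<theta>) \<le> (1/4) ^ Suc n" for n
  proof -
    have "k n \<le> \<theta> / (q n * \<epsilon> n)" "\<theta> / (q n * \<epsilon> n) < k n + 1" unfolding k_def by linarith+
    then have "k n * (q n * \<epsilon> n) \<le> \<theta>" "\<theta> < (k n + 1) * (q n * \<epsilon> n)"
      using qe(1)[of n] by (simp_all add: pos_le_divide_eq pos_divide_less_eq)
    then have "\<bar>k n * (q n * \<epsilon> n) - \<theta>\<bar> \<le> q n * \<epsilon> n" by (simp add: distrib_right)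
    then show ?thesis using qe(2)[of n] by (simp add: mult.assoc)
  qed
  have "(\<lambda>n. of_int (k n * q n) * \<epsilon> n - \<theta>) \<longlonglongrightarrow> 0"
    by (rule Lim_null_comparison[OF _ summable_LIMSEQ_zero[OF quarter_summable]]) (use bd in simp)
  from LIM_zero_cancel[OF this] show ?thesis by (rule exI[of _ k])
qed

text \<open>Membership depends on \<open>y\<close> only: when the linear time is close to an
  integer, \<open>y\<close> nearly returns, wherever \<open>x\<close> goes.\<close>

definition band :: "real \<Rightarrow> (complex \<times> complex) set" where
  "band l = {z \<in> torus. snd (torus_coord z) < l}"

lemma band_measurable: "band l \<in> sets torus_borel"
proof -
  have "(\<lambda>z. snd (torus_coord z)) \<in> borel_measurable torus_borel"
    by (rule measurable_compose[OF torus_coord_measurable borel_measurable_continuous_onI]) (intro continuous_intros)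
  then have "{z \<in> space torus_borel. snd (torus_coord z) < l} \<in> sets torus_borel" by measurable
  then show ?thesis by (simp add: band_def)
qed

lemma measure_band:
  assumes "0 \<le> l" "l \<le> 1"
  shows "measure \<mu> (band l) = l"
proof -
  have "emeasure \<mu> (band l) = (\<integral>\<^sup>+z. indicator (band l) z \<partial>\<mu>)" using band_measurable by simp
  also have "\<dots> = (\<integral>\<^sup>+y. (\<integral>\<^sup>+x. ennreal (v x y) * indicator (band l) (torus_proj (x, y)) * indicator {0..<1} x \<partial>lborel) * indicator {0..<1} y \<partial>lborel)"
    by (rule nn_integral_mu) (use band_measurable in simp)
  also have "\<dots> = (\<integral>\<^sup>+y. indicator {0..<l} y \<partial>lborel)"
  proof (rule nn_integral_cong)
    fix y :: real
    have "indicator (band l) (torus_proj (x, y)) = (indicator {..<l} (frac y) :: ennreal)" for x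
      by (simp add: band_def torus_coord_proj indicator_def)
    then have "(\<integral>\<^sup>+x. ennreal (v x y) * indicator (band l) (torus_proj (x, y)) * indicator {0..<1} x \<partial>lborel) =
      (\<integral>\<^sup>+x. indicator {..<l} (frac y) * (ennreal (v x y) * indicator {0..<1} x) \<partial>lborel)"
      by (simp add: mult_ac)
    also have "\<dots> = indicator {..<l} (frac y) * (\<integral>\<^sup>+x. ennreal (v x y) * indicator {0..<1} x \<partial>lborel)"
    proof (rule nn_integral_cmult)
      have "(\<lambda>x. (\<lambda>w. v (fst w) (snd w)) (x, y)) \<in> borel_measurable borel"
        by (rule measurable_compose[OF _ v_measurable]) simp
      then show "(\<lambda>x. ennreal (v x y) * indicator {0..<1} x) \<in> borel_measurable lborel" by simp
    qed
    finally have "(\<integral>\<^sup>+x. ennreal (v x y) * indicator (band l) (torus_proj (x, y)) * indicator {0..<1} x \<partial>lborel) = indicator {..<l} (frac y)"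
      by (simp add: nn_integral_v)
    moreover have "indicator {..<l} (frac y) * indicator {0..<1} y = (indicator {0..<l} y :: ennreal)"
      using assms by (auto simp: indicator_def frac_eq)
    ultimately show "(\<integral>\<^sup>+x. ennreal (v x y) * indicator (band l) (torus_proj (x, y)) * indicator {0..<1} x \<partial>lborel) * indicator {0..<1} y = indicator {0..<l} y"
      by simp
  qed
  also have "\<dots> = ennreal l" using assms by simp
  finally show ?thesis using assms by (simp add: measure_def)
qed

lemma band_rigid:
  fixes k :: int
  assumes y: "l / 4 \<le> y" "y < 3 * l / 4" and l: "0 < l" "l \<le> 1"
    and s: "\<bar>sigma (of_int (k * q n)) x y - of_int (k * q n)\<bar> \<le> l / 4"
  shows "flow (of_int (k * q n)) (torus_proj (x, y)) \<in> band l"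
proof -
  define d where "d = sigma (of_int (k * q n)) x y - of_int (k * q n)"
  have r: "0 \<le> y + d" "y + d < l" using y s l unfolding d_def abs_le_iff by linarith+
  have "frac (y + sigma (of_int (k * q n)) x y) = frac ((y + d) + of_int (k * q n))" by (rule arg_cong) (simp add: d_def)
  also have "\<dots> = y + d" using r l by (simp add: frac_eq frac_def del: of_int_mult) linarith
  finally show ?thesis using r by (simp add: flow_proj band_def torus_coord_proj)
qed

text \<open>Points with phase in \<open>G\<close> and \<open>y\<close> in the middle half of the
  band are still in the band at both times. The density is at least 2/3 and the middle half has
  width \<open>l / 2\<close>, whence the factor \<open>l / 3\<close>.\<close>

lemma triple_correlation_lower:
  fixes k k' :: "nat \<Rightarrow> int"
  assumes G: "quiet \<theta> G" "quiet \<theta>' G" and m: "(\<lambda>n. of_int (k n * q n) * \<epsilon> n) \<longlonglongrightarrow> \<theta>" "(\<lambda>n. of_int (k' n * q n) * \<epsilon> n) \<longlonglongrightarrow> \<theta>'"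
    and Gm [measurable]: "G \<in> sets borel" and per: "\<And>u i. u + of_int i \<in> G \<longleftrightarrow> u \<in> G"
    and l: "0 < l" "l \<le> 1"
  shows "eventually (\<lambda>n. measure lborel (G \<inter> {0..<1}) * l / 3 \<le>
    measure \<mu> (band l \<inter> (flow (of_int (k n * q n)) -` band l \<inter> torus) \<inter> (flow (of_int (k' n * q n)) -` band l \<inter> torus))) sequentially"
proof -
  have "l / 4 > 0" using l by simp
  from sigma_rigid[OF G(1) m(1) this] sigma_rigid[OF G(2) m(2) this] show ?thesis
  proof eventually_elim
    case (elim n)
    interpret prob_space \<mu> by (rule prob_space_mu)
    let ?S = "band l \<inter> (flow (of_int (k n * q n)) -` band l \<inter> torus) \<inter> (flow (of_int (k' n * q n)) -` band l \<inter> torus)"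
    have Sm: "?S \<in> sets torus_borel" using band_measurable flow_vimage_measurable[OF band_measurable] by auto
    define I where "I = measure lborel (G \<inter> {0..<1})"
    have I0: "I \<ge> 0" by (simp add: I_def)
    have "(\<integral>\<^sup>+x. indicator G x * indicator {0..<1} x \<partial>lborel) = (\<integral>\<^sup>+x. indicator (G \<inter> {0..<1}) x \<partial>lborel)"
      by (intro nn_integral_cong) (auto simp: indicator_def)
    also have "\<dots> = emeasure lborel (G \<inter> {0..<1})" by simp
    also have "\<dots> = ennreal I"
    proof -
      have "emeasure lborel (G \<inter> {0..<1}) \<le> emeasure lborel {0..<1::real}" by (rule emeasure_mono) auto
      then have "emeasure lborel (G \<inter> {0..<1}) \<noteq> \<infinity>" by (auto simp: top_unique)
      then show ?thesis unfolding I_def by (intro emeasure_eq_ennreal_measure) simp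
    qed
    finally have GI: "(\<integral>\<^sup>+x. indicator G x * indicator {0..<1} x \<partial>lborel) = ennreal I" .
    have per': "indicator G (u + of_int i) = (indicator G u :: ennreal)" for u i using per by (auto simp: indicator_def)
    have urm [measurable]: "(\<lambda>x. indicator G (ur n x y) :: ennreal) \<in> borel_measurable borel" for y
      by (rule measurable_compose[where N = borel]) (simp_all add: ur_def)
    have "ennreal (I * l / 3) = (\<integral>\<^sup>+y. ennreal (2/3 * I) * indicator {l/4..<3*l/4} y \<partial>lborel)"
      using l I0 by (simp add: nn_integral_cmult ennreal_mult[symmetric])
    also have "\<dots> \<le> (\<integral>\<^sup>+y. (\<integral>\<^sup>+x. ennreal (v x y) * indicator ?S (torus_proj (x, y)) * indicator {0..<1} x \<partial>lborel) * indicator {0..<1} y \<partial>lborel)"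
    proof (rule nn_integral_mono)
      fix y :: real
      show "ennreal (2/3 * I) * indicator {l/4..<3*l/4} y \<le> (\<integral>\<^sup>+x. ennreal (v x y) * indicator ?S (torus_proj (x, y)) * indicator {0..<1} x \<partial>lborel) * indicator {0..<1} y"
      proof (cases "y \<in> {l/4..<3*l/4}")
        case True
        then have y: "l / 4 \<le> y" "y < 3 * l / 4" and y1: "y \<in> {0..<1}" using l by auto
        have "ennreal (2/3 * I) = ennreal (2/3) * (\<integral>\<^sup>+x. indicator G (ur n x y) * indicator {0..<1} x \<partial>lborel)"
          using I0 by (simp only: nn_integral_ur[OF borel_measurable_indicator[OF Gm] per'] GI) (simp only: ennreal_mult)
        also have "\<dots> = (\<integral>\<^sup>+x. ennreal (2/3) * (indicator G (ur n x y) * indicator {0..<1} x) \<partial>lborel)"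
          by (rule nn_integral_cmult[symmetric]) simp
        also have "\<dots> \<le> (\<integral>\<^sup>+x. ennreal (v x y) * (indicator ?S (torus_proj (x, y)) * indicator {0..<1} x) \<partial>lborel)"
        proof (intro nn_integral_mono mult_mono ennreal_leI v_bounds)
          fix x
          show "indicator G (ur n x y) \<le> (indicator ?S (torus_proj (x, y)) :: ennreal)"
          proof (cases "ur n x y \<in> G")
            case True
            have "frac y = y" using y1 by (simp add: frac_eq)
            then have "torus_proj (x, y) \<in> band l" using y l by (simp add: band_def torus_coord_proj)
            moreover have "flow (of_int (k n * q n)) (torus_proj (x, y)) \<in> band l"
              by (rule band_rigid[OF y l]) (use elim(1) True in blast)
            moreover have "flow (of_int (k' n * q n)) (torus_proj (x, y)) \<in> band l"
              by (rule band_rigid[OF y l]) (use elim(2) True in blast)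
            ultimately have "torus_proj (x, y) \<in> ?S" by (simp del: of_int_mult)
            then show ?thesis by (simp only: indicator_simps) (simp add: indicator_def)
          qed simp
        qed auto
        finally show ?thesis using y1 True by (simp add: mult.assoc)
      qed simp
    qed
    also have "\<dots> = (\<integral>\<^sup>+z. indicator ?S z \<partial>\<mu>)"
      by (rule nn_integral_mu[symmetric]) (use Sm in simp)
    also have "\<dots> = ennreal (measure \<mu> ?S)" using Sm by (simp add: emeasure_eq_measure)
    finally show ?case unfolding I_def[symmetric] using I0 l by (subst (asm) ennreal_le_iff) auto
  qed
qed

text \<open>The lower bound is linear in the width of the band, while the upper bound for every set
  of the same measure is quadratic, so a thin band refutes similarity.\<close>

lemma not_similar_triple_correlations:
  assumes G: "quiet \<theta> G" "quiet \<theta>' G" and Gm: "G \<in> sets borel" and per: "\<And>u i. u + of_int i \<in> G \<longleftrightarrow> u \<in> G"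
    and pos: "measure lborel (G \<inter> {0..<1}) > 0"
    and ex: "shear_exhausts (r * \<theta>) H" "shear_exhausts (r * \<theta>') H'" and cover: "H \<union> H' = UNIV"
  shows "\<not> similar_triple_correlations \<mu> flow r"
proof
  assume sim: "similar_triple_correlations \<mu> flow r"
  obtain k where k: "(\<lambda>n. of_int (k n * q n) * \<epsilon> n) \<longlonglongrightarrow> \<theta>" using multiples_exist by blast
  obtain k' where k': "(\<lambda>n. of_int (k' n * q n) * \<epsilon> n) \<longlonglongrightarrow> \<theta>'" using multiples_exist by blast
  define c where "c = measure lborel (G \<inter> {0..<1}) / 3"
  have c: "c > 0" using pos by (simp add: c_def)
  \<comment> \<open>\<open>l \<le> c / 8\<close> gives \<open>2 * l\<^sup>2 \<le> c * l / 4\<close>;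
    with the error \<open>c * l / 4\<close> the upper bound is at most half of the lower bound
    \<open>c * l\<close>.\<close>
  define l where "l = min 1 (c / 8)"
  have l: "0 < l" "l \<le> 1" "l \<le> c / 8" using c by (auto simp: l_def)
  obtain A where A: "A \<in> sets \<mu>" "measure \<mu> A = l" and corr:
      "\<And>t u. measure \<mu> (band l \<inter> (flow t -` band l \<inter> torus) \<inter> (flow u -` band l \<inter> torus)) =
              measure \<mu> (A \<inter> (flow (r * t) -` A \<inter> torus) \<inter> (flow (r * u) -` A \<inter> torus))"
    using sim band_measurable[of l] measure_band[of l] l unfolding similar_triple_correlations_def by fastforce
  have m: "(\<lambda>n. r * of_int (k n * q n) * \<epsilon> n) \<longlonglongrightarrow> r * \<theta>" "(\<lambda>n. r * of_int (k' n * q n) * \<epsilon> n) \<longlonglongrightarrow> r * \<theta>'"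
    using tendsto_mult_left[OF k, of r] tendsto_mult_left[OF k', of r] by (simp_all only: mult.assoc)
  have "c * l / 4 > 0" using c l by simp
  from triple_correlation_upper[OF ex cover m _ this, of A] A(1)
  have "eventually (\<lambda>n. measure \<mu> (A \<inter> (flow (r * of_int (k n * q n)) -` A \<inter> torus) \<inter> (flow (r * of_int (k' n * q n)) -` A \<inter> torus)) \<le> 2 * l\<^sup>2 + c * l / 4) sequentially"
    using A(2) by simp
  moreover have "eventually (\<lambda>n. c * l \<le>
    measure \<mu> (band l \<inter> (flow (of_int (k n * q n)) -` band l \<inter> torus) \<inter> (flow (of_int (k' n * q n)) -` band l \<inter> torus))) sequentially"
    using triple_correlation_lower[OF G k k' Gm per l(1,2)] by (simp add: c_def)
  ultimately have "eventually (\<lambda>n::nat. c * l \<le> 2 * l\<^sup>2 + c * l / 4) sequentially"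
    by eventually_elim (simp only: corr)
  then have "c * l \<le> 2 * l\<^sup>2 + c * l / 4" by simp
  also have "2 * l\<^sup>2 \<le> c * l / 4" using mult_right_mono[OF l(3), of l] l(1) by (simp add: power2_eq_square)
  finally show False using c l(1) mult_pos_pos[of c l] by linarith
qed

end

section \<open>Exponential profiles\<close>

definition C1_periodic :: "(real \<Rightarrow> real) \<Rightarrow> bool" where
  "C1_periodic f \<longleftrightarrow> (\<exists>f'. (\<forall>u. (f has_real_derivative f' u) (at u)) \<and> continuous_on UNIV f') \<and> (\<forall>u. f (u + 1) = f u)"

lemma periodic_of_int:
  fixes f :: "real \<Rightarrow> 'b"
  assumes "\<And>u. f (u + 1) = f u"
  shows "f (u + of_int i) = f u"
proof -
  have nat: "f (u + real n) = f u" for u n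
  proof (induction n)
    case (Suc n)
    then show ?case using assms[of "u + real n"] by (simp add: add_ac)
  qed simp
  show ?thesis
  proof (cases "i \<ge> 0")
    case True
    then show ?thesis using nat[of u "nat i"] by simp
  next
    case False
    then show ?thesis using nat[of "u + of_int i" "nat (- i)"] by simp
  qed
qed

lemma continuous_periodic_bounded:
  fixes f :: "real \<Rightarrow> real"
  assumes "continuous_on UNIV f" "\<And>u. f (u + 1) = f u"
  shows "\<exists>B. \<forall>u. \<bar>f u\<bar> \<le> B"
proof -
  have "bounded (f ` {0..1})"
    by (intro compact_imp_bounded compact_continuous_image continuous_on_subset[OF assms(1)]) auto
  then obtain B where "\<forall>x\<in>f ` {0..1}. norm x \<le> B" unfolding bounded_iff by blast
  then have B: "\<bar>f u\<bar> \<le> B" if "u \<in> {0..1}" for u using that by auto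
  have "\<bar>f u\<bar> \<le> B" for u
    using B[of "frac u"] periodic_of_int[of f, OF assms(2), of u "- \<lfloor>u\<rfloor>"] frac_lt_1[of u] by (simp add: frac_def)
  then show ?thesis by blast
qed

lemma C1_periodic_continuous: "C1_periodic f \<Longrightarrow> continuous_on UNIV f"
  unfolding C1_periodic_def by (blast intro: continuous_at_imp_continuous_on DERIV_isCont)

lemma C1_periodic_deriv_bounded:
  assumes "C1_periodic f"
  shows "\<exists>f' B. (\<forall>u. (f has_real_derivative f' u) (at u)) \<and> (\<forall>u. \<bar>f' u\<bar> \<le> B)"
proof -
  from assms obtain f' where f': "\<And>u. (f has_real_derivative f' u) (at u)" "continuous_on UNIV f'" and per: "\<And>u. f (u + 1) = f u"
    unfolding C1_periodic_def by blast
  have "f' (u + 1) = f' u" for u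
  proof -
    have "((\<lambda>u. f (u + 1)) has_real_derivative f' (u + 1)) (at u)"
      using f'(1)[of "u + 1"] unfolding DERIV_shift .
    then show ?thesis using f'(1)[of u] DERIV_unique unfolding per by blast
  qed
  with continuous_periodic_bounded[OF f'(2)] f'(1) show ?thesis by blast
qed

lemma C1_periodic_const: "C1_periodic (\<lambda>u. a)"
  unfolding C1_periodic_def by (auto intro!: exI[of _ "\<lambda>_. 0"])

lemma C1_periodic_add:
  assumes "C1_periodic f" "C1_periodic g"
  shows "C1_periodic (\<lambda>u. f u + g u)"
proof -
  from assms obtain f' g' where "\<And>u. (f has_real_derivative f' u) (at u)" "continuous_on UNIV f'"
      "\<And>u. (g has_real_derivative g' u) (at u)" "continuous_on UNIV g'"
    unfolding C1_periodic_def by metis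
  then have "(\<forall>u. ((\<lambda>u. f u + g u) has_real_derivative f' u + g' u) (at u)) \<and> continuous_on UNIV (\<lambda>u. f' u + g' u)"
    by (auto intro!: DERIV_add continuous_on_add)
  then show ?thesis using assms unfolding C1_periodic_def by (intro conjI exI[of _ "\<lambda>u. f' u + g' u"]) auto
qed

lemma C1_periodic_mult:
  assumes "C1_periodic f" "C1_periodic g"
  shows "C1_periodic (\<lambda>u. f u * g u)"
proof -
  from assms obtain f' g' where "\<And>u. (f has_real_derivative f' u) (at u)" "continuous_on UNIV f'"
      "\<And>u. (g has_real_derivative g' u) (at u)" "continuous_on UNIV g'"
    unfolding C1_periodic_def by metis
  then have "(\<forall>u. ((\<lambda>u. f u * g u) has_real_derivative f' u * g u + g' u * f u) (at u)) \<and> continuous_on UNIV (\<lambda>u. f' u * g u + g' u * f u)"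
    using C1_periodic_continuous[OF assms(1)] C1_periodic_continuous[OF assms(2)]
    by (auto intro!: DERIV_mult continuous_on_add continuous_on_mult)
  then show ?thesis using assms unfolding C1_periodic_def by (intro conjI exI[of _ "\<lambda>u. f' u * g u + g' u * f u"]) auto
qed

lemma C1_periodic_shift:
  assumes "C1_periodic f"
  shows "C1_periodic (\<lambda>u. f (u + a))"
proof -
  from assms obtain f' where f': "\<And>u. (f has_real_derivative f' u) (at u)" "continuous_on UNIV f'" and per: "\<And>u. f (u + 1) = f u"
    unfolding C1_periodic_def by blast
  have "((\<lambda>u. f (u + a)) has_real_derivative f' (u + a)) (at u)" for u
    using f'(1)[of "u + a"] unfolding DERIV_shift .
  moreover have "continuous_on UNIV (\<lambda>u. f' (u + a))"
    by (rule continuous_on_compose2[OF f'(2)]) (auto intro!: continuous_intros)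
  moreover have "f (u + 1 + a) = f (u + a)" for u using per[of "u + a"] by (simp add: add_ac)
  ultimately show ?thesis unfolding C1_periodic_def by (intro conjI exI[of _ "\<lambda>u. f' (u + a)"]) simp_all
qed

lemma C1_periodic_compose:
  assumes "C1_periodic f" "\<And>t. (h has_real_derivative h' t) (at t)" "continuous_on UNIV h'"
  shows "C1_periodic (\<lambda>u. h (f u))"
proof -
  from assms(1) obtain f' where f': "\<And>u. (f has_real_derivative f' u) (at u)" "continuous_on UNIV f'" and per: "\<And>u. f (u + 1) = f u"
    unfolding C1_periodic_def by blast
  have "((\<lambda>u. h (f u)) has_real_derivative h' (f u) * f' u) (at u)" for u
    using DERIV_chain[OF assms(2) f'(1)[of u]] by (simp add: o_def)
  moreover have "continuous_on UNIV (\<lambda>u. h' (f u) * f' u)"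
    by (intro continuous_on_mult f'(2) continuous_on_compose2[OF assms(3) C1_periodic_continuous[OF assms(1)]]) auto
  ultimately show ?thesis using per unfolding C1_periodic_def by (intro conjI exI[of _ "\<lambda>u. h' (f u) * f' u"]) simp_all
qed

text \<open>A continuously differentiable stand-in for the positive part, which has a corner at
  0.\<close>

definition ramp :: "real \<Rightarrow> real" where "ramp t = (max 0 t)\<^sup>2"

lemma ramp_deriv: "(ramp has_real_derivative 2 * max 0 t) (at t)"
proof (cases t "0 :: real" rule: linorder_cases)
  case less
  have "((\<lambda>_. 0) has_real_derivative 0) (at t)" by simp
  then have "(ramp has_real_derivative 0) (at t)"
    by (rule has_field_derivative_transform_within_open[where S = "{..<0}"]) (use less in \<open>auto simp: ramp_def\<close>)
  then show ?thesis using less by simp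
next
  case greater
  have "((\<lambda>t. t\<^sup>2) has_real_derivative 2 * t) (at t)" by (auto intro!: derivative_eq_intros)
  then have "(ramp has_real_derivative 2 * t) (at t)"
    by (rule has_field_derivative_transform_within_open[where S = "{0<..}"]) (use greater in \<open>auto simp: ramp_def\<close>)
  then show ?thesis using greater by simp
next
  case equal
  have "((\<lambda>h. (ramp (0 + h) - ramp 0) / h) \<longlongrightarrow> 0) (at 0)"
  proof (rule Lim_null_comparison)
    show "eventually (\<lambda>h. norm ((ramp (0 + h) - ramp 0) / h) \<le> \<bar>h\<bar>) (at 0)"
    proof (rule always_eventually, rule allI)
      fix h :: real
      show "norm ((ramp (0 + h) - ramp 0) / h) \<le> \<bar>h\<bar>"
        by (cases h "0 :: real" rule: linorder_cases) (auto simp: ramp_def power2_eq_square)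
    qed
    show "((\<lambda>h. \<bar>h\<bar>) \<longlongrightarrow> (0::real)) (at 0)" by (rule tendsto_rabs_zero) (rule tendsto_ident_at)
  qed
  then have "(ramp has_real_derivative 0) (at 0)" unfolding DERIV_def .
  then show ?thesis using equal by simp
qed

lemma ramp_nonneg: "0 \<le> ramp t" by (simp add: ramp_def)

lemma ramp_pos: "0 < t \<Longrightarrow> 0 < ramp t" by (simp add: ramp_def)

lemma ramp_ge: "s > 0 \<Longrightarrow> s \<le> ramp t \<Longrightarrow> sqrt s \<le> t"
proof -
  assume s: "s > 0" "s \<le> ramp t"
  then have t: "t > 0" by (cases "t > 0") (auto simp: ramp_def)
  then show "sqrt s \<le> t" using s by (intro real_le_lsqrt) (auto simp: ramp_def)
qed

lemma ramp_le: "\<bar>t\<bar> \<le> B \<Longrightarrow> ramp t \<le> B\<^sup>2"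
  unfolding ramp_def by (rule power_mono) auto

lemma C1_periodic_ramp: "C1_periodic f \<Longrightarrow> C1_periodic (\<lambda>u. ramp (f u))"
  by (rule C1_periodic_compose[OF _ ramp_deriv]) (auto intro!: continuous_intros)

text \<open>A cut-off with value 0 on the nonpositive half-line and limit 1 at infinity; its growing
  argument in \<open>shear_exhausts_positive\<close> makes it exhaust a set.\<close>

definition step :: "real \<Rightarrow> real" where "step t = ramp t / (1 + ramp t)"

lemma C1_periodic_step:
  assumes "C1_periodic f"
  shows "C1_periodic (\<lambda>u. step (f u))"
proof (rule C1_periodic_compose[OF assms])
  have nz: "1 + ramp t \<noteq> 0" for t using ramp_nonneg[of t] by linarith
  have d: "((\<lambda>t. 1 + ramp t) has_real_derivative 2 * max 0 t) (at t)" for t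
    using DERIV_add[OF DERIV_const[of 1] ramp_deriv[of t]] by simp
  show "(step has_real_derivative (2 * max 0 t * (1 + ramp t) - ramp t * (2 * max 0 t)) / ((1 + ramp t) * (1 + ramp t))) (at t)" for t
    unfolding step_def[abs_def]
    by (rule DERIV_divide[OF ramp_deriv d]) (rule nz)
  have c: "continuous_on UNIV ramp" by (intro continuous_at_imp_continuous_on ballI DERIV_isCont[OF ramp_deriv])
  show "continuous_on UNIV (\<lambda>t. (2 * max 0 t * (1 + ramp t) - ramp t * (2 * max 0 t)) / ((1 + ramp t) * (1 + ramp t)))"
    by (intro continuous_on_divide continuous_on_diff continuous_on_mult continuous_on_add c continuous_on_const continuous_on_max continuous_on_id) (use nz in simp)
qed

lemma step_01: "0 \<le> step t" "step t \<le> 1"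
  using ramp_nonneg[of t] by (simp_all add: step_def)

lemma step_0: "t \<le> 0 \<Longrightarrow> step t = 0" by (simp add: step_def ramp_def)

lemma step_large: "t \<ge> 1 \<Longrightarrow> 1 - step t \<le> 1 / t"
proof -
  assume t: "t \<ge> 1"
  have "1 - step t = 1 / (1 + t\<^sup>2)" using t by (simp add: step_def ramp_def field_simps add_nonneg_eq_0_iff)
  also have "\<dots> \<le> 1 / t"
  proof (rule frac_le)
    have "t * 1 \<le> t * t" using t by (intro mult_left_mono) auto
    then show "t \<le> 1 + t\<^sup>2" by (simp add: power2_eq_square)
  qed (use t in auto)
  finally show "1 - step t \<le> 1 / t" .
qed

lemma countable_real_zeros:
  assumes f: "f holomorphic_on UNIV" and nz: "f z0 \<noteq> 0"
  shows "countable {u :: real. f (of_real u) = 0}"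
proof -
  have "countable {z. f z = 0}"
  proof (cases "f constant_on UNIV")
    case True
    then have "{z. f z = 0} = {}" using nz unfolding constant_on_def by auto
    then show ?thesis by simp
  next
    case False
    from holomorphic_countable_zeros[OF f open_UNIV connected_UNIV _ False] show ?thesis by simp
  qed
  then have "countable (complex_of_real ` {u. f (of_real u) = 0})" by (rule countable_subset[rotated]) auto
  then show ?thesis by (rule countable_image_inj_on) (simp add: inj_on_def)
qed

locale exp_flow = mixing_flow "\<lambda>n z. exp (of_nat n * C z)" \<alpha> q p \<beta>
  for C :: "complex \<Rightarrow> complex" and \<alpha> :: real and q p :: "nat \<Rightarrow> int" and \<beta> :: "nat \<Rightarrow> real" +
  assumes C_hol: "C holomorphic_on UNIV" and C_periodic: "C (z + 1) = C z" and C_real: "C (of_real x) \<in> \<real>"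
begin

definition c :: "real \<Rightarrow> real" where "c u = Re (C (of_real u))"
definition c1 :: "real \<Rightarrow> real" where "c1 u = Re (deriv C (of_real u))"
definition c2 :: "real \<Rightarrow> real" where "c2 u = Re (deriv (deriv C) (of_real u))"

lemma of_real_c: "of_real (c u) = C (of_real u)"
  using C_real[of u] by (simp add: c_def of_real_Re)

lemma c_deriv: "(c has_real_derivative c1 u) (at u)"
  unfolding c_def[abs_def] c1_def
  by (rule has_real_derivative_Re_of_real[OF holomorphic_derivI[OF C_hol]]) auto

lemma c1_deriv: "(c1 has_real_derivative c2 u) (at u)"
  unfolding c1_def[abs_def] c2_def
  by (rule has_real_derivative_Re_of_real[OF holomorphic_derivI[OF holomorphic_deriv[OF C_hol]]]) auto

lemma c2_continuous: "continuous_on UNIV c2"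
proof -
  have "continuous_on UNIV (deriv (deriv C))"
    by (intro holomorphic_on_imp_continuous_on holomorphic_deriv C_hol) auto
  then have "continuous_on UNIV (\<lambda>u. deriv (deriv C) (complex_of_real u))"
    by (rule continuous_on_compose2) (auto intro!: continuous_intros)
  then show ?thesis unfolding c2_def[abs_def] by (intro continuous_on_Re)
qed

lemma c1_continuous: "continuous_on UNIV c1"
  by (intro continuous_at_imp_continuous_on ballI DERIV_isCont[OF c1_deriv])

lemma c_periodic: "c (u + 1) = c u" using C_periodic[of "of_real u"] by (simp add: c_def)

lemma c1_periodic: "c1 (u + 1) = c1 u"
proof -
  have "((\<lambda>u. c (u + 1)) has_real_derivative c1 (u + 1)) (at u)" using c_deriv[of "u + 1"] unfolding DERIV_shift .
  then show ?thesis using c_deriv[of u] DERIV_unique unfolding c_periodic by blast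
qed

lemma c2_periodic: "c2 (u + 1) = c2 u"
proof -
  have "((\<lambda>u. c1 (u + 1)) has_real_derivative c2 (u + 1)) (at u)" using c1_deriv[of "u + 1"] unfolding DERIV_shift .
  then show ?thesis using c1_deriv[of u] DERIV_unique unfolding c1_periodic by blast
qed

lemma C1_periodic_c: "C1_periodic c" and C1_periodic_c1: "C1_periodic c1"
  unfolding C1_periodic_def using c_deriv c1_deriv c1_continuous c2_continuous c_periodic c1_periodic by blast+

lemma c_continuous: "continuous_on UNIV c" by (rule C1_periodic_continuous[OF C1_periodic_c])

lemma c_bounds: "\<exists>M\<ge>1. \<forall>u. \<bar>c u\<bar> \<le> M \<and> \<bar>c1 u\<bar> \<le> M \<and> \<bar>c2 u\<bar> \<le> M"
proof -
  obtain A where A: "\<And>u. \<bar>c u\<bar> \<le> A" using continuous_periodic_bounded[OF c_continuous c_periodic] by blast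
  obtain B where B: "\<And>u. \<bar>c1 u\<bar> \<le> B" using continuous_periodic_bounded[OF c1_continuous c1_periodic] by blast
  obtain D where D: "\<And>u. \<bar>c2 u\<bar> \<le> D" using continuous_periodic_bounded[OF c2_continuous c2_periodic] by blast
  show ?thesis
    using order.trans[OF A] order.trans[OF B] order.trans[OF D] by (intro exI[of _ "max 1 (max A (max B D))"]) (simp add: le_max_iff_disj A B D)
qed

lemma gd_exp:
  "gd 0 n u = exp (real n * c u)"
  "gd 1 n u = real n * c1 u * exp (real n * c u)"
  "gd 2 n u = (real n * c2 u + (real n * c1 u)\<^sup>2) * exp (real n * c u)"
proof -
  have 0: "gd 0 n u = exp (real n * c u)" for u
  proof -
    have "complex_of_real (gd 0 n u) = of_real (exp (real n * c u))"
      unfolding gd_0 by (simp add: of_real_c[symmetric] exp_of_real[symmetric])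
    then show ?thesis by (simp only: of_real_eq_iff)
  qed
  have 1: "gd 1 n u = real n * c1 u * exp (real n * c u)" for u
  proof (rule DERIV_unique)
    show "(gd 0 n has_real_derivative gd 1 n u) (at u)" using gd_deriv[of 0 n u] by simp
    show "(gd 0 n has_real_derivative real n * c1 u * exp (real n * c u)) (at u)"
      unfolding 0[abs_def] by (auto intro!: derivative_eq_intros c_deriv)
  qed
  show "gd 2 n u = (real n * c2 u + (real n * c1 u)\<^sup>2) * exp (real n * c u)"
  proof (rule DERIV_unique)
    show "(gd 1 n has_real_derivative gd 2 n u) (at u)" using gd_deriv[of 1 n u] by (simp add: numeral_2_eq_2)
    show "(gd 1 n has_real_derivative (real n * c2 u + (real n * c1 u)\<^sup>2) * exp (real n * c u)) (at u)"
      unfolding 1[abs_def] by (auto intro!: derivative_eq_intros c_deriv c1_deriv simp: algebra_simps power2_eq_square)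
  qed
  show "gd 0 n u = exp (real n * c u)" "gd 1 n u = real n * c1 u * exp (real n * c u)" by (rule 0, rule 1)
qed

lemma c_lipschitz:
  assumes "\<And>u. \<bar>c u\<bar> \<le> M \<and> \<bar>c1 u\<bar> \<le> M \<and> \<bar>c2 u\<bar> \<le> M"
  shows "\<bar>c u - c w\<bar> \<le> M * \<bar>u - w\<bar>" "\<bar>c1 u - c1 w\<bar> \<le> M * \<bar>u - w\<bar>"
proof -
  have "norm (c u - c w) \<le> M * norm (u - w)"
    by (rule field_differentiable_bound[of UNIV]) (use assms c_deriv in auto)
  then show "\<bar>c u - c w\<bar> \<le> M * \<bar>u - w\<bar>" by simp
  have "norm (c1 u - c1 w) \<le> M * norm (u - w)"
    by (rule field_differentiable_bound[of UNIV]) (use assms c1_deriv in auto)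
  then show "\<bar>c1 u - c1 w\<bar> \<le> M * \<bar>u - w\<bar>" by simp
qed

section \<open>Shear produced by the profile\<close>

text \<open>In the difference of \<open>gd 1 n\<close> at \<open>b\<close> and at \<open>a\<close>
  the term at \<open>b\<close> wins: its exponential exceeds the one at \<open>a\<close> by an
  exponential factor, is itself exponentially large, and the coefficient \<open>c1 b\<close> stays
  away from 0.\<close>

definition dominates :: "real \<Rightarrow> real \<Rightarrow> real \<Rightarrow> bool" where
  "dominates \<eta> a b \<longleftrightarrow> \<eta> \<le> c b - c a \<and> \<eta> \<le> c b \<and> \<eta> \<le> \<bar>c1 b\<bar>"

text \<open>Up to constants, the difference of first derivatives is at least
  \<open>n * exp (n * c b)\<close> and that of second derivatives at most
  \<open>n\<^sup>2 * exp (n * c b)\<close>. The square of the former thus exceeds the latter by a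
  factor of order \<open>exp (n * c b)\<close>, and this is at least
  \<open>exp (n * \<eta>)\<close>.\<close>

lemma dominates_shear:
  assumes M: "M \<ge> 1" "\<And>u. \<bar>c u\<bar> \<le> M \<and> \<bar>c1 u\<bar> \<le> M \<and> \<bar>c2 u\<bar> \<le> M"
    and \<eta>: "\<eta> > 0" and ab: "dominates \<eta> a b" and n: "n \<ge> 1"
    and X: "2 * M / \<eta> \<le> exp (real n * \<eta>)" "2 * L / \<eta> \<le> exp (real n * \<eta>)" "16 * L * M\<^sup>2 / \<eta>\<^sup>2 \<le> exp (real n * \<eta>)"
    and L: "L \<ge> 0"
  shows "L \<le> \<bar>gd 1 n b - gd 1 n a\<bar> \<and> L * \<bar>gd 2 n b - gd 2 n a\<bar> \<le> (gd 1 n b - gd 1 n a)\<^sup>2"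
proof -
  define N where "N = real n"
  have N: "N \<ge> 1" using n by (simp add: N_def)
  define X where "X = exp (N * \<eta>)"
  define b' where "b' = exp (N * c b)"
  define a' where "a' = exp (N * c a)"
  have Xpos: "X > 0" and bpos: "b' > 0" and apos: "a' > 0" by (simp_all add: X_def b'_def a'_def)
  have bX: "X \<le> b'" using ab N unfolding X_def b'_def dominates_def by simp
  have aX: "a' * X \<le> b'"
  proof -
    have "N * (c a + \<eta>) \<le> N * c b" using ab N unfolding dominates_def by (intro mult_left_mono) auto
    then show ?thesis unfolding a'_def X_def b'_def exp_add[symmetric] by (simp add: distrib_left)
  qed
  have X2: "2 * M \<le> \<eta> * X" "2 * L \<le> \<eta> * X" "16 * L * M\<^sup>2 \<le> \<eta>\<^sup>2 * X"
    using X \<eta> by (simp_all add: X_def N_def pos_divide_le_eq mult.commute)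
  have aM: "M * a' \<le> \<eta> / 2 * b'"
  proof -
    have "2 * M * a' \<le> \<eta> * X * a'" using X2(1) apos by (intro mult_right_mono) auto
    also have "\<dots> \<le> \<eta> * b'" using aX \<eta> by (simp add: mult.assoc mult.commute[of X] mult_left_mono)
    finally show ?thesis by simp
  qed
  have D: "N * (\<eta> / 2 * b') \<le> \<bar>gd 1 n b - gd 1 n a\<bar>"
  proof -
    have "gd 1 n b - gd 1 n a = N * (c1 b * b' - c1 a * a')" unfolding gd_exp N_def b'_def a'_def by (simp add: algebra_simps)
    then have D': "\<bar>gd 1 n b - gd 1 n a\<bar> = N * \<bar>c1 b * b' - c1 a * a'\<bar>" using N by (simp add: abs_mult)
    have "\<bar>c1 b * b'\<bar> \<ge> \<eta> * b'" unfolding abs_mult using ab bpos by (simp add: dominates_def)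
    moreover have "\<bar>c1 a * a'\<bar> \<le> M * a'" unfolding abs_mult using M(2)[of a] apos by simp
    ultimately have "\<eta> / 2 * b' \<le> \<bar>c1 b * b' - c1 a * a'\<bar>" using aM by linarith
    then show ?thesis unfolding D' using N by (intro mult_left_mono) auto
  qed
  have E: "\<bar>gd 2 n b - gd 2 n a\<bar> \<le> 4 * N\<^sup>2 * M\<^sup>2 * b'"
  proof -
    have co: "\<bar>N * c2 u + (N * c1 u)\<^sup>2\<bar> \<le> 2 * N\<^sup>2 * M\<^sup>2" for u
    proof -
      have "\<bar>N * c2 u + (N * c1 u)\<^sup>2\<bar> \<le> \<bar>N\<bar> * \<bar>c2 u\<bar> + (N * \<bar>c1 u\<bar>)\<^sup>2"
        by (rule order.trans[OF abs_triangle_ineq]) (simp add: abs_mult power_mult_distrib)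
      also have "\<dots> \<le> N\<^sup>2 * M\<^sup>2 + (N * M)\<^sup>2"
      proof (intro add_mono mult_mono power_mono)
        show "\<bar>N\<bar> \<le> N\<^sup>2" using N self_le_power[of N 2] by simp
        show "\<bar>c2 u\<bar> \<le> M\<^sup>2" using M(1) M(2)[of u] self_le_power[of M 2] by simp
      qed (use N M in auto)
      finally show ?thesis by (simp add: power_mult_distrib mult_ac)
    qed
    have "a' \<le> b'" using aX apos X2(1) M(1) ab N \<eta> unfolding a'_def b'_def dominates_def by simp
    have "\<bar>gd 2 n b - gd 2 n a\<bar> \<le> \<bar>gd 2 n b\<bar> + \<bar>gd 2 n a\<bar>" by (rule abs_triangle_ineq4)
    also have "\<dots> \<le> 2 * N\<^sup>2 * M\<^sup>2 * b' + 2 * N\<^sup>2 * M\<^sup>2 * b'"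
    proof (rule add_mono)
      show "\<bar>gd 2 n b\<bar> \<le> 2 * N\<^sup>2 * M\<^sup>2 * b'"
        using co[of b] bpos unfolding gd_exp by (simp add: abs_mult N_def[symmetric] b'_def[symmetric])
      have "\<bar>gd 2 n a\<bar> \<le> 2 * N\<^sup>2 * M\<^sup>2 * a'"
        using co[of a] apos unfolding gd_exp by (simp add: abs_mult N_def[symmetric] a'_def[symmetric])
      also have "\<dots> \<le> 2 * N\<^sup>2 * M\<^sup>2 * b'" using \<open>a' \<le> b'\<close> by (intro mult_left_mono) auto
      finally show "\<bar>gd 2 n a\<bar> \<le> 2 * N\<^sup>2 * M\<^sup>2 * b'" .
    qed
    finally show ?thesis by (simp only: mult_ac)
  qed
  have "L \<le> \<eta> / 2 * X" using X2(2) by simp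
  also have "\<dots> \<le> 1 * (\<eta> / 2 * b')" using bX \<eta> by simp
  also have "\<dots> \<le> N * (\<eta> / 2 * b')" using N \<eta> bpos by (intro mult_right_mono) auto
  finally have 1: "L \<le> \<bar>gd 1 n b - gd 1 n a\<bar>" using D by linarith
  have "L * \<bar>gd 2 n b - gd 2 n a\<bar> \<le> L * (4 * N\<^sup>2 * M\<^sup>2 * b')" using E L by (rule mult_left_mono)
  also have "\<dots> = (16 * L * M\<^sup>2) * (N\<^sup>2 * b' / 4)" by simp
  also have "\<dots> \<le> (\<eta>\<^sup>2 * b') * (N\<^sup>2 * b' / 4)"
    using order.trans[OF X2(3) mult_left_mono[OF bX]] bpos by (intro mult_right_mono) auto
  also have "\<dots> = (N * (\<eta> / 2 * b'))\<^sup>2" by (simp add: power2_eq_square)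
  also have "\<dots> \<le> (gd 1 n b - gd 1 n a)\<^sup>2"
    using power_mono[OF D, of 2] N \<eta> bpos by simp
  finally show ?thesis using 1 by blast
qed

lemma shearing_if_dominates:
  assumes \<eta>: "\<eta> > 0" and K: "\<And>u. u \<in> K \<Longrightarrow> dominates \<eta> u (u + \<theta>) \<or> dominates \<eta> (u + \<theta>) u"
  shows "shearing K \<theta>"
proof -
  obtain M where M: "M \<ge> 1" "\<And>u. \<bar>c u\<bar> \<le> M \<and> \<bar>c1 u\<bar> \<le> M \<and> \<bar>c2 u\<bar> \<le> M" using c_bounds by blast
  \<comment> \<open>A shift error below \<open>\<eta>'\<close> changes \<open>c\<close> and
    \<open>c1\<close> by at most \<open>M * \<eta>' = \<eta> / 2\<close>, so half of the margin
    survives.\<close>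
  define \<eta>' where "\<eta>' = \<eta> / (2 * M)"
  have \<eta>': "\<eta>' > 0" and M\<eta>: "M * \<eta>' = \<eta> / 2" using \<eta> M(1) by (auto simp: \<eta>'_def)
  have dom: "dominates (\<eta> / 2) u (u + h) \<or> dominates (\<eta> / 2) (u + h) u" if u: "u \<in> K" and h: "\<bar>h - \<theta>\<bar> < \<eta>'" for u h
  proof -
    have "M * \<bar>(u + h) - (u + \<theta>)\<bar> \<le> M * \<eta>'" using h M(1) by (intro mult_left_mono) auto
    then have "\<bar>c (u + h) - c (u + \<theta>)\<bar> \<le> \<eta> / 2" "\<bar>c1 (u + h) - c1 (u + \<theta>)\<bar> \<le> \<eta> / 2"
      using c_lipschitz[OF M(2), of "u + h" "u + \<theta>"] M\<eta> by auto
    then show ?thesis using K[OF u] \<eta> unfolding dominates_def by argo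
  qed
  show ?thesis unfolding shearing_def
  proof (intro exI[of _ \<eta>'] conjI \<eta>' allI)
    fix L :: real
    define L' where "L' = max 0 L"
    define X where "X = max (2 * M / (\<eta>/2)) (max (2 * L' / (\<eta>/2)) (16 * L' * M\<^sup>2 / (\<eta>/2)\<^sup>2))"
    have "filterlim (\<lambda>n. exp (real n * (\<eta> / 2))) at_top sequentially"
      using \<eta> by real_asymp
    then have "eventually (\<lambda>n. X \<le> exp (real n * (\<eta> / 2))) sequentially" unfolding filterlim_at_top by blast
    with eventually_ge_at_top[of 1]
    show "eventually (\<lambda>n. \<forall>u\<in>K. \<forall>h. \<bar>h - \<theta>\<bar> < \<eta>' \<longrightarrow>
        L \<le> \<bar>gd 1 n (u + h) - gd 1 n u\<bar> \<and> L * \<bar>gd 2 n (u + h) - gd 2 n u\<bar> \<le> (gd 1 n (u + h) - gd 1 n u)\<^sup>2) sequentially"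
    proof eventually_elim
      case (elim n)
      have shear: "L \<le> \<bar>gd 1 n b - gd 1 n a\<bar> \<and> L * \<bar>gd 2 n b - gd 2 n a\<bar> \<le> (gd 1 n b - gd 1 n a)\<^sup>2" if "dominates (\<eta>/2) a b" for a b
      proof -
        have "L' \<le> \<bar>gd 1 n b - gd 1 n a\<bar> \<and> L' * \<bar>gd 2 n b - gd 2 n a\<bar> \<le> (gd 1 n b - gd 1 n a)\<^sup>2"
          by (rule dominates_shear[OF M _ that elim(1)]) (use elim(2) \<eta> in \<open>auto simp: X_def L'_def\<close>)
        moreover have "L * \<bar>gd 2 n b - gd 2 n a\<bar> \<le> L' * \<bar>gd 2 n b - gd 2 n a\<bar>" by (intro mult_right_mono) (auto simp: L'_def)
        ultimately show ?thesis by (auto simp: L'_def)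
      qed
      show ?case
      proof (intro ballI allI impI)
        fix u h assume "u \<in> K" "\<bar>h - \<theta>\<bar> < \<eta>'"
        from dom[OF this] show "L \<le> \<bar>gd 1 n (u + h) - gd 1 n u\<bar> \<and> L * \<bar>gd 2 n (u + h) - gd 2 n u\<bar> \<le> (gd 1 n (u + h) - gd 1 n u)\<^sup>2"
          using shear[of u "u + h"] shear[of "u + h" u] by (auto simp: abs_minus_commute power2_commute)
      qed
    qed
  qed
qed

text \<open>Positive exactly when the three quantities bounded below in \<open>dominates\<close> are
  positive, yet continuously differentiable in the phase, so that a cut-off can be built from
  it.\<close>

definition gap :: "real \<Rightarrow> real \<Rightarrow> real" where
  "gap a b = ramp (c b - c a) * ramp (c b) * (c1 b)\<^sup>2"

definition shear_gap :: "real \<Rightarrow> real \<Rightarrow> real" where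
  "shear_gap \<theta> u = gap u (u + \<theta>) + gap (u + \<theta>) u"

lemma gap_nonneg: "0 \<le> gap a b" by (simp add: gap_def ramp_nonneg)

text \<open>Each of the three factors is at most \<open>N\<close>, so a product of at least
  \<open>\<eta>\<close> forces each of them to be at least
  \<open>\<eta> / N\<^sup>2\<close>.\<close>

lemma gap_dominates:
  assumes "\<eta> > 0"
  shows "\<exists>\<eta>'>0. \<forall>a b. \<eta> \<le> gap a b \<longrightarrow> dominates \<eta>' a b"
proof -
  obtain M where M: "M \<ge> 1" "\<And>u. \<bar>c u\<bar> \<le> M \<and> \<bar>c1 u\<bar> \<le> M \<and> \<bar>c2 u\<bar> \<le> M" using c_bounds by blast
  define N where "N = (2 * M)\<^sup>2"
  have N: "N > 0" using M(1) by (simp add: N_def)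
  define s where "s = \<eta> / N\<^sup>2"
  have s: "s > 0" using assms N by (simp add: s_def)
  have "dominates (sqrt s) a b" if ab: "\<eta> \<le> gap a b" for a b
  proof -
    have le: "ramp (c b - c a) \<le> N" "ramp (c b) \<le> N" "(c1 b)\<^sup>2 \<le> N"
    proof -
      show "ramp (c b - c a) \<le> N" unfolding N_def using M(2)[of a] M(2)[of b] by (intro ramp_le) auto
      show "ramp (c b) \<le> N" unfolding N_def using M(1) M(2)[of b] by (intro ramp_le) auto
      show "(c1 b)\<^sup>2 \<le> N" unfolding N_def using M(1) M(2)[of b] by (intro abs_le_square_iff[THEN iffD1]) auto
    qed
    have fact: "s \<le> x" if "\<eta> \<le> x * (y * z)" "0 \<le> x" "0 \<le> y" "0 \<le> z" "y \<le> N" "z \<le> N" for x y z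
    proof -
      have "x * (y * z) \<le> x * (N * N)" using that N by (intro mult_left_mono mult_mono) auto
      then show ?thesis using that(1) N by (simp add: s_def pos_divide_le_eq power2_eq_square)
    qed
    note r = ramp_nonneg[of "c b - c a"] ramp_nonneg[of "c b"] zero_le_power2[of "c1 b"]
    have "s \<le> ramp (c b - c a)" using fact[of "ramp (c b - c a)" "ramp (c b)" "(c1 b)\<^sup>2"] ab r le by (simp add: gap_def mult.assoc)
    moreover have "s \<le> ramp (c b)" using fact[of "ramp (c b)" "ramp (c b - c a)" "(c1 b)\<^sup>2"] ab r le by (simp add: gap_def mult_ac)
    moreover have "s \<le> (c1 b)\<^sup>2" using fact[of "(c1 b)\<^sup>2" "ramp (c b - c a)" "ramp (c b)"] ab r le by (simp add: gap_def mult_ac)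
    ultimately show ?thesis unfolding dominates_def using s ramp_ge real_sqrt_le_mono[of s "(c1 b)\<^sup>2"] by simp
  qed
  then show ?thesis using s by (intro exI[of _ "sqrt s"]) auto
qed

lemma C1_periodic_shear_gap: "C1_periodic (shear_gap \<theta>)"
proof -
  have neg: "C1_periodic (\<lambda>u. - f u)" if "C1_periodic f" for f
    using C1_periodic_mult[OF C1_periodic_const[of "-1"] that] by simp
  have "C1_periodic (\<lambda>u. (ramp (c (u + \<theta>) + - c u) * ramp (c (u + \<theta>))) * (c1 (u + \<theta>) * c1 (u + \<theta>)) +
      (ramp (c u + - c (u + \<theta>)) * ramp (c u)) * (c1 u * c1 u))"
    by (intro C1_periodic_add C1_periodic_mult C1_periodic_ramp neg C1_periodic_shift C1_periodic_c C1_periodic_c1)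
  then show ?thesis by (simp add: shear_gap_def[abs_def] gap_def power2_eq_square)
qed

text \<open>The weight vanishes where \<open>shear_gap\<close> is below \<open>\<eta>\<close>;
  elsewhere one of its two summands is at least \<open>\<eta> / 2\<close>, and the phase on that
  side dominates.\<close>

lemma shear_weight_step:
  assumes \<eta>: "\<eta> > 0"
  shows "shear_weight \<theta> (\<lambda>u. step (shear_gap \<theta> u / \<eta> - 1))"
proof -
  let ?\<omega> = "\<lambda>u. step (shear_gap \<theta> u / \<eta> - 1)"
  define K where "K = {u. \<eta> \<le> shear_gap \<theta> u}"
  have "C1_periodic (\<lambda>u. step ((1 / \<eta>) * shear_gap \<theta> u + - 1))"
    by (intro C1_periodic_step C1_periodic_add C1_periodic_mult C1_periodic_const C1_periodic_shear_gap)
  then have c1p: "C1_periodic ?\<omega>" by simp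
  then obtain \<omega>' X where "\<forall>u. (?\<omega> has_real_derivative \<omega>' u) (at u)" "\<forall>u. \<bar>\<omega>' u\<bar> \<le> X"
    using C1_periodic_deriv_bounded by blast
  moreover have "closed K" unfolding K_def
    by (rule closed_Collect_le) (auto intro!: continuous_intros C1_periodic_continuous[OF C1_periodic_shear_gap])
  moreover have "shearing K \<theta>"
  proof -
    obtain \<eta>' where "\<eta>' > 0" "\<And>a b. \<eta> / 2 \<le> gap a b \<Longrightarrow> dominates \<eta>' a b" using gap_dominates[of "\<eta> / 2"] \<eta> by auto
    moreover have "\<eta> / 2 \<le> gap u (u + \<theta>) \<or> \<eta> / 2 \<le> gap (u + \<theta>) u" if "u \<in> K" for u
      using that unfolding K_def shear_gap_def by auto
    ultimately show ?thesis by (intro shearing_if_dominates[of \<eta>']) blast+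
  qed
  moreover have "?\<omega> u = 0" if "u \<notin> K" for u using that \<eta> by (intro step_0) (simp add: K_def)
  moreover have "?\<omega> (u + of_int i) = ?\<omega> u" for u i
    by (rule periodic_of_int) (use c1p in \<open>simp add: C1_periodic_def\<close>)
  ultimately show ?thesis unfolding shear_weight_def using step_01 by blast
qed

text \<open>Where \<open>c\<close> is positive at one of the two phases, a vanishing gap means equal
  values or a critical point at the phase with the larger value. Both are zeros of entire functions
  that do not vanish identically, which is where analyticity of the profile enters.\<close>

lemma shear_gap_zero_countable:
  assumes "c (u0 + \<theta>) \<noteq> c u0"
  shows "countable {u. (c u > 0 \<or> c (u + \<theta>) > 0) \<and> shear_gap \<theta> u = 0}"
proof -
  define F where "F z = C (z + of_real \<theta>) - C z" for z
  have "countable {u :: real. F (of_real u) = 0}"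
  proof (rule countable_real_zeros)
    have "(\<lambda>z. C (z + of_real \<theta>)) holomorphic_on UNIV"
    proof -
      have "(C \<circ> (\<lambda>z. z + of_real \<theta>)) holomorphic_on UNIV"
        by (rule holomorphic_on_compose_gen[OF _ C_hol]) (auto intro!: holomorphic_intros)
      then show ?thesis by (simp add: o_def)
    qed
    then show "F holomorphic_on UNIV" unfolding F_def[abs_def] by (intro holomorphic_on_diff C_hol)
    show "F (of_real u0) \<noteq> 0" using assms of_real_c[of "u0 + \<theta>"] of_real_c[of u0] unfolding F_def
      by (metis eq_iff_diff_eq_0 of_real_add of_real_eq_iff)
  qed
  moreover have d: "countable {u :: real. deriv C (of_real u) = 0}"
  proof -
    have "\<exists>z. deriv C z \<noteq> 0"
    proof (rule ccontr)
      assume "\<not> ?thesis"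
      then have "c1 u = 0" for u by (simp add: c1_def)
      then have "(c has_real_derivative 0) (at u)" for u using c_deriv[of u] by simp
      then have "c (u0 + \<theta>) = c u0" by (intro DERIV_isconst_all) simp
      then show False using assms by simp
    qed
    then show ?thesis using countable_real_zeros[OF holomorphic_deriv[OF C_hol open_UNIV]] by blast
  qed
  moreover have "countable {u :: real. deriv C (of_real (u + \<theta>)) = 0}"
  proof -
    have "u \<in> (\<lambda>u. u - \<theta>) ` {u :: real. deriv C (of_real u) = 0}" if "deriv C (of_real (u + \<theta>)) = 0" for u
      by (rule image_eqI[of _ _ "u + \<theta>"]) (use that in simp_all)
    then have "{u :: real. deriv C (of_real (u + \<theta>)) = 0} \<subseteq> (\<lambda>u. u - \<theta>) ` {u. deriv C (of_real u) = 0}" by blast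
    then show ?thesis by (rule countable_subset[OF _ countable_image[OF d]])
  qed
  ultimately have "countable ({u :: real. F (of_real u) = 0} \<union> {u. deriv C (of_real u) = 0} \<union> {u. deriv C (of_real (u + \<theta>)) = 0})"
    by (intro countable_Un)
  then show ?thesis
  proof (rule countable_subset[rotated], intro subsetI)
    fix u assume u: "u \<in> {u. (c u > 0 \<or> c (u + \<theta>) > 0) \<and> shear_gap \<theta> u = 0}"
    have g0: "gap u (u + \<theta>) = 0" "gap (u + \<theta>) u = 0"
      using u gap_nonneg[of u "u + \<theta>"] gap_nonneg[of "u + \<theta>" u] unfolding shear_gap_def by auto
    have real_deriv: "deriv C (of_real w) = 0" if "c1 w = 0" for w
    proof -
      have "(C has_field_derivative deriv C (of_real w)) (at (of_real w))" by (rule holomorphic_derivI[OF C_hol]) auto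
      then have "((\<lambda>u. C (of_real u)) has_vector_derivative deriv C (of_real w)) (at w)" by (rule has_vector_derivative_real_field)
      moreover have "((\<lambda>u. C (of_real u)) has_vector_derivative of_real (c1 w)) (at w)"
        unfolding of_real_c[symmetric] using c_deriv[of w] by (simp add: has_vector_derivative_of_real has_real_derivative_iff_has_vector_derivative)
      ultimately show ?thesis using that vector_derivative_unique_at by fastforce
    qed
    show "u \<in> {u :: real. F (of_real u) = 0} \<union> {u. deriv C (of_real u) = 0} \<union> {u. deriv C (of_real (u + \<theta>)) = 0}"
    proof (cases "c u" "c (u + \<theta>)" rule: linorder_cases)
      case less
      then have "ramp (c (u + \<theta>) - c u) > 0" "ramp (c (u + \<theta>)) > 0" using u by (auto intro!: ramp_pos)
      then have "c1 (u + \<theta>) = 0" using g0(1) by (simp add: gap_def)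
      then show ?thesis using real_deriv by blast
    next
      case greater
      then have "ramp (c u - c (u + \<theta>)) > 0" "ramp (c u) > 0" using u by (auto intro!: ramp_pos)
      then have "c1 u = 0" using g0(2) by (simp add: gap_def)
      then show ?thesis using real_deriv by blast
    next
      case equal
      then have "complex_of_real (c u) = of_real (c (u + \<theta>))" by simp
      then show ?thesis unfolding of_real_c by (simp add: F_def)
    qed
  qed
qed

text \<open>Weights with thresholds \<open>1 / Suc k\<close> tend to 1 at all but countably many
  phases of the set. Dominated convergence over one period makes the loss small, and the uniform
  distribution of the phase transfers this to all \<open>n\<close> at once.\<close>

lemma shear_exhausts_positive:
  assumes "c (u0 + \<theta>) \<noteq> c u0"
  shows "shear_exhausts \<theta> {u. c u > 0 \<or> c (u + \<theta>) > 0}"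
proof -
  define G where "G = {u. c u > 0 \<or> c (u + \<theta>) > 0}"
  have c': "continuous_on UNIV (\<lambda>u. c (u + \<theta>))" by (rule C1_periodic_continuous[OF C1_periodic_shift[OF C1_periodic_c]])
  have "open G" unfolding G_def by (intro open_Collect_disj open_Collect_less continuous_on_const c_continuous c')
  then have Gm [measurable]: "G \<in> sets borel" by simp
  define \<omega> where "\<omega> k u = step (shear_gap \<theta> u / (1 / real (Suc k)) - 1)" for k u
  have w: "shear_weight \<theta> (\<omega> k)" for k unfolding \<omega>_def[abs_def] by (rule shear_weight_step) simp
  have wm [measurable]: "\<omega> k \<in> borel_measurable borel" for k by (rule shear_weight_facts(5)[OF w])
  have w01: "0 \<le> \<omega> k u" "\<omega> k u \<le> 1" for k u by (rule shear_weight_facts[OF w])+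
  define f where "f k u = indicator G u * (1 - \<omega> k u)" for k u
  have f01: "0 \<le> f k u" "f k u \<le> 1" for k u using w01 by (auto simp: f_def indicator_def)
  have fm [measurable]: "f k \<in> borel_measurable borel" for k unfolding f_def[abs_def] by measurable
  have fper: "f k (u + of_int i) = f k u" for k u i
  proof -
    have "c (u + of_int i) = c u" for u by (rule periodic_of_int[of c, OF c_periodic])
    from this[of u] this[of "u + \<theta>"] have "u + of_int i \<in> G \<longleftrightarrow> u \<in> G" by (simp add: G_def add_ac)
    then show ?thesis using shear_weight_facts(2)[OF w] by (simp add: f_def indicator_def)
  qed
  have lim_aux: "filterlim (\<lambda>k. s * real (Suc k) - 1) at_top sequentially" if "s > 0" for s :: real
    using that by real_asymp
  have ptw: "(\<lambda>k. f k u) \<longlonglongrightarrow> 0" if "u \<notin> {u. (c u > 0 \<or> c (u + \<theta>) > 0) \<and> shear_gap \<theta> u = 0}" for u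
  proof (cases "u \<in> G")
    case True
    then have s: "shear_gap \<theta> u > 0" using that gap_nonneg[of u "u + \<theta>"] gap_nonneg[of "u + \<theta>" u] unfolding G_def shear_gap_def by auto
    have lim: "filterlim (\<lambda>k. shear_gap \<theta> u * real (Suc k) - 1) at_top sequentially" by (rule lim_aux[OF s])
    then have "eventually (\<lambda>k. 1 \<le> shear_gap \<theta> u * real (Suc k) - 1) sequentially" unfolding filterlim_at_top by blast
    then have "eventually (\<lambda>k. norm (f k u) \<le> 1 / (shear_gap \<theta> u * real (Suc k) - 1)) sequentially"
    proof eventually_elim
      case (elim k)
      from step_large[OF this] show ?case using f01(1)[of k u] True by (simp add: f_def \<omega>_def)
    qed
    moreover have "(\<lambda>k. 1 / (shear_gap \<theta> u * real (Suc k) - 1)) \<longlonglongrightarrow> 0"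
      using tendsto_inverse_0_at_top[OF lim] by (simp only: inverse_eq_divide)
    ultimately show ?thesis by (rule Lim_null_comparison)
  qed (simp add: f_def)
  have "(\<lambda>k. \<integral>u. f k u * indicator {0..<1} u \<partial>lborel) \<longlonglongrightarrow> (LINT u|(lborel :: real measure). 0)"
  proof (rule integral_dominated_convergence[where w = "indicator {0..<1}"])
    show "integrable lborel (indicator {0..<1} :: real \<Rightarrow> real)" by (rule integrable_real_indicator) auto
    have "{u. (c u > 0 \<or> c (u + \<theta>) > 0) \<and> shear_gap \<theta> u = 0} \<in> null_sets lborel"
      by (rule countable_imp_null_set_lborel[OF shear_gap_zero_countable[OF assms]])
    from AE_not_in[OF this] show "AE u in lborel. (\<lambda>k. f k u * indicator {0..<1} u) \<longlonglongrightarrow> 0"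
      by eventually_elim (use tendsto_mult_left_zero[OF ptw] in blast)
    show "AE u in lborel. norm (f k u * indicator {0..<1} u) \<le> indicator {0..<1} u" for k
      using f01 by (auto simp: indicator_def)
  qed simp_all
  then have lim: "(\<lambda>k. \<integral>u. f k u * indicator {0..<1} u \<partial>lborel) \<longlonglongrightarrow> 0" by simp
  show ?thesis unfolding G_def[symmetric] shear_exhausts_def
  proof (intro conjI allI impI Gm)
    fix e :: real assume e: "e > 0"
    \<comment> \<open>The factor 3/4 offsets the bound 4/3 on the density.\<close>
    then have "eventually (\<lambda>k. (\<integral>u. f k u * indicator {0..<1} u \<partial>lborel) < 3/4 * e) sequentially"
      using order_tendstoD(2)[OF lim, of "3/4 * e"] by simp
    then obtain k where k: "(\<integral>u. f k u * indicator {0..<1} u \<partial>lborel) < 3/4 * e"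
      unfolding eventually_sequentially by auto
    have "(\<integral>z. f k (un n z) \<partial>\<mu>) \<le> e" for n
    proof -
      have i: "integrable lborel (\<lambda>u. f k u * indicator {0..<1} u)"
      proof (rule Bochner_Integration.integrable_bound)
        show "integrable lborel (indicator {0..<1} :: real \<Rightarrow> real)" by (rule integrable_real_indicator) auto
        show "AE u in lborel. norm (f k u * indicator {0..<1} u) \<le> norm (indicator {0..<1} u :: real)"
          using f01 by (auto simp: indicator_def)
      qed simp
      have im: "integrable \<mu> (\<lambda>z. f k (un n z))"
        by (rule integrable_mu_01[OF measurable_compose[OF un_measurable fm]]) (use f01 in auto)
      have "ennreal (\<integral>z. f k (un n z) \<partial>\<mu>) = (\<integral>\<^sup>+z. ennreal (f k (un n z)) \<partial>\<mu>)"
        by (rule nn_integral_eq_integral[symmetric, OF im]) (use f01 in auto)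
      also have "\<dots> \<le> ennreal (4/3) * (\<integral>\<^sup>+u. ennreal (f k u) * indicator {0..<1} u \<partial>lborel)"
        by (rule nn_integral_un_le) (simp_all add: fper)
      also have "(\<integral>\<^sup>+u. ennreal (f k u) * indicator {0..<1} u \<partial>lborel) = (\<integral>\<^sup>+u. ennreal (f k u * indicator {0..<1} u) \<partial>lborel)"
        by (intro nn_integral_cong) (auto simp: indicator_def)
      also have "\<dots> = ennreal (\<integral>u. f k u * indicator {0..<1} u \<partial>lborel)"
        by (rule nn_integral_eq_integral[OF i]) (use f01 in \<open>auto simp: indicator_def\<close>)
      also have "ennreal (4/3) * \<dots> \<le> ennreal (4/3) * ennreal (3/4 * e)"
        using k by (intro mult_left_mono ennreal_leI) auto
      also have "\<dots> = ennreal (4/3 * (3/4 * e))" using e by (intro ennreal_mult[symmetric]) auto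
      finally show ?thesis using e by (simp add: ennreal_le_iff)
    qed
    then show "\<exists>\<omega>. shear_weight \<theta> \<omega> \<and> (\<forall>n. (\<integral>z. indicator G (un n z) * (1 - \<omega> (un n z)) \<partial>\<mu>) \<le> e)"
      using w[of k] by (intro exI[of _ "\<omega> k"]) (simp add: f_def)
  qed
qed

text \<open>The summand \<open>exp (n * c)\<close> decays where \<open>c\<close> is negative. Half
  of the margin \<open>2 * \<kappa>\<close> absorbs, through the Lipschitz bound, a shift error
  below \<open>\<kappa> / M\<close>.\<close>

lemma quiet_negative:
  assumes \<kappa>: "\<kappa> > 0" and G: "\<And>u. u \<in> G \<Longrightarrow> c u \<le> - 2 * \<kappa> \<and> c (u + \<theta>) \<le> - 2 * \<kappa>"
  shows "quiet \<theta> G"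
proof -
  obtain M where M: "M \<ge> 1" "\<And>u. \<bar>c u\<bar> \<le> M \<and> \<bar>c1 u\<bar> \<le> M \<and> \<bar>c2 u\<bar> \<le> M" using c_bounds by blast
  show ?thesis unfolding quiet_def
  proof (intro exI[of _ "\<kappa> / M"] conjI allI impI)
    show "\<kappa> / M > 0" using \<kappa> M(1) by simp
    fix e :: real assume e: "e > 0"
    have "(\<lambda>n. exp (- (real n * \<kappa>))) \<longlonglongrightarrow> 0" using \<kappa> by real_asymp
    then have "eventually (\<lambda>n. exp (- (real n * \<kappa>)) < e) sequentially" using e by (rule order_tendstoD(2))
    then show "eventually (\<lambda>n. \<forall>u\<in>G. \<forall>h. \<bar>h - \<theta>\<bar> < \<kappa> / M \<longrightarrow> \<bar>gd 0 n u\<bar> \<le> e \<and> \<bar>gd 0 n (u + h)\<bar> \<le> e) sequentially"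
    proof eventually_elim
      case (elim n)
      have small: "\<bar>gd 0 n u\<bar> \<le> e" if "c u \<le> - \<kappa>" for u
      proof -
        have "real n * c u \<le> real n * (- \<kappa>)" using that by (rule mult_left_mono) simp
        then have "exp (real n * c u) \<le> exp (- (real n * \<kappa>))" by simp
        then have "exp (real n * c u) \<le> e" using elim by linarith
        then show ?thesis unfolding gd_exp abs_exp_cancel .
      qed
      show ?case
      proof (intro ballI allI impI conjI small)
        fix u h assume u: "u \<in> G" and h: "\<bar>h - \<theta>\<bar> < \<kappa> / M"
        show "c u \<le> - \<kappa>" using G[OF u] \<kappa> by linarith
        have "M * \<bar>(u + h) - (u + \<theta>)\<bar> \<le> M * (\<kappa> / M)" using h M(1) by (intro mult_left_mono) auto
        then have "\<bar>c (u + h) - c (u + \<theta>)\<bar> \<le> \<kappa>" using c_lipschitz(1)[OF M(2), of "u + h" "u + \<theta>"] M(1) by simp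
        then show "c (u + h) \<le> - \<kappa>" using G[OF u] by linarith
      qed
    qed
  qed
qed

text \<open>\<open>G\<close> is an open periodic neighbourhood of 0 on which all three phases are
  negative, and its positive measure gives the lower bound. \<open>pos\<close> provides the cover
  for the upper bound; \<open>nc\<close> says that the rescaled shifts are not periods of the
  profile, since a shift by a period would produce no shear.\<close>

lemma not_similar:
  assumes neg: "c 0 < 0" "c \<theta> < 0" "c \<theta>' < 0"
    and pos: "\<And>u. c u > 0 \<or> c (u + r * \<theta>) > 0 \<or> c (u + r * \<theta>') > 0"
    and nc: "c (u0 + r * \<theta>) \<noteq> c u0" "c (u1 + r * \<theta>') \<noteq> c u1"
  shows "\<not> similar_triple_correlations \<mu> flow r"
proof -
  define \<kappa> where "\<kappa> = min (- c 0) (min (- c \<theta>) (- c \<theta>')) / 4"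
  have \<kappa>: "\<kappa> > 0" "c 0 < - 2 * \<kappa>" "c \<theta> < - 2 * \<kappa>" "c \<theta>' < - 2 * \<kappa>" using neg by (auto simp: \<kappa>_def min_def)
  define G where "G = {u. c u < - 2 * \<kappa> \<and> c (u + \<theta>) < - 2 * \<kappa> \<and> c (u + \<theta>') < - 2 * \<kappa>}"
  have cs: "continuous_on UNIV (\<lambda>u. c (u + t))" for t by (rule C1_periodic_continuous[OF C1_periodic_shift[OF C1_periodic_c]])
  have Go: "open G" unfolding G_def by (intro open_Collect_conj open_Collect_less continuous_on_const c_continuous cs)
  have "0 \<in> G" using \<kappa> by (simp add: G_def)
  then obtain d where d: "d > 0" "ball 0 d \<subseteq> G" using Go open_contains_ball by blast
  have Gm: "G \<in> sets borel" using Go by simp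
  have pos_measure: "measure lborel (G \<inter> {0..<1}) > 0"
  proof -
    define d' where "d' = min d 1"
    have d': "0 < d'" "{0..<d'} \<subseteq> G \<inter> {0..<1}" using d by (auto simp: d'_def dist_real_def)
    have "emeasure lborel (G \<inter> {0..<1}) \<le> emeasure lborel {0..<1::real}" using Gm by (intro emeasure_mono) auto
    then have fin: "G \<inter> {0..<1} \<in> fmeasurable lborel" using Gm by (intro fmeasurableI) (auto simp: less_top[symmetric] top_unique)
    have "d' = measure lborel {0..<d'}" using d'(1) by simp
    also have "\<dots> \<le> measure lborel (G \<inter> {0..<1})" by (rule measure_mono_fmeasurable[OF d'(2) _ fin]) simp
    finally show ?thesis using d'(1) by linarith
  qed
  have per: "u + of_int i \<in> G \<longleftrightarrow> u \<in> G" for u i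
  proof -
    have "c (w + of_int i) = c w" for w by (rule periodic_of_int[of c, OF c_periodic])
    from this[of u] this[of "u + \<theta>"] this[of "u + \<theta>'"] show ?thesis by (simp add: G_def add_ac)
  qed
  show ?thesis
  proof (rule not_similar_triple_correlations[OF _ _ Gm per pos_measure shear_exhausts_positive[OF nc(1)] shear_exhausts_positive[OF nc(2)]])
    show "quiet \<theta> G" "quiet \<theta>' G" by (rule quiet_negative[OF \<kappa>(1)]; auto simp: G_def)+
    show "{u. c u > 0 \<or> c (u + r * \<theta>) > 0} \<union> {u. c u > 0 \<or> c (u + r * \<theta>') > 0} = UNIV" using pos by auto
  qed
qed

lemma weakly_mixing_flow:
  assumes pos: "\<And>u. c u > 0 \<or> c (u + 1/2) > 0" and nc: "c (u0 + 1/2) \<noteq> c u0"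
  shows "weakly_mixing \<mu> flow"
proof (rule weakly_mixing_if_mixing_sequence[OF prob_space_mu measure_preserving_flow_flow])
  fix A B assume AB: "A \<in> sets \<mu>" "B \<in> sets \<mu>"
  have "{u. c u > 0 \<or> c (u + 1/2) > 0} = UNIV" using pos by auto
  then have ex: "shear_exhausts (1/2) UNIV" using shear_exhausts_positive[OF nc] by simp
  have "(\<lambda>n. (1/2 / \<epsilon> n) * \<epsilon> n) \<longlonglongrightarrow> 1/2" using eps_pos by (simp add: less_imp_neq[symmetric])
  from tendsto_measure_flow[OF ex this, of A B] AB
  show "(\<lambda>n. measure \<mu> (A \<inter> (flow (1/2 / \<epsilon> n) -` B \<inter> space \<mu>))) \<longlonglongrightarrow> measure \<mu> A * measure \<mu> B" by simp
qed

end

section \<open>Parameters and profile\<close>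

text \<open>The pair of the denominator \<open>Q\<^sub>j\<close> and \<open>\<beta>\<^sub>0 + \<dots> + \<beta>\<^sub>j\<close>; below, \<open>\<alpha>\<close> is the sum of all \<open>1 / Q\<^sub>j\<close>.\<close>

fun denominators :: "(nat \<Rightarrow> nat \<Rightarrow> real) \<Rightarrow> nat \<Rightarrow> nat \<times> real" where
  "denominators B 0 = (2, B 0 2)"
| "denominators B (Suc j) = (case denominators B j of (Q, S) \<Rightarrow>
     let Q' = Q * nat \<lceil>(2 * 4 ^ Suc j + real (j + 2)) * (S * real Q)\<rceil> in (Q', S + B (Suc j) Q'))"

text \<open>Each denominator is the previous one times \<open>N n\<close>, so partial sums of the
  series for \<alpha> have denominator \<open>Q n\<close>, and the distance
  \<open>Q n * \<alpha> - p n\<close> is \<open>Q n\<close> times a tail, at most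
  \<open>2 / N n\<close>. \<open>N n\<close> is chosen after \<open>\<beta> n\<close>, which may
  therefore depend on \<open>Q n\<close> through \<open>b\<close>. In \<open>N n\<close> the summand
  with \<open>4 ^ Suc n\<close> serves the smallness of these distances against
  \<open>\<beta> n\<close>, the summand \<open>n + 2\<close> the dominance of the next denominator
  over all \<open>\<beta>\<close> so far.\<close>

lemma liouville_parameters:
  fixes b :: "nat \<Rightarrow> nat \<Rightarrow> real"
  shows "\<exists>(\<alpha> :: real) (q :: nat \<Rightarrow> nat) (p :: nat \<Rightarrow> nat) (\<beta> :: nat \<Rightarrow> real). \<forall>n. q n \<ge> 1 \<and> p n \<le> q n \<and> b n (q n) \<le> \<beta> n \<and> 1 \<le> \<beta> n \<and> real (q n) \<le> \<beta> n \<and>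
     0 < real (q n) * \<alpha> - real (p n) \<and> (real (q n) * \<alpha> - real (p n)) * \<beta> n \<le> (1/4) ^ Suc n \<and>
     (\<forall>j>n. (real (q j) * \<alpha> - real (p j)) * \<beta> j \<le> (1/4) ^ Suc j * (real (q n) * \<alpha> - real (p n))) \<and>
     (\<Sum>j<n. \<beta> j) \<le> real (q n) / real (Suc n)"
proof -
  define B where "B n Q = max 1 (max (b n Q) (real Q))" for n Q
  define Q where "Q n = fst (denominators B n)" for n
  define \<beta> where "\<beta> n = B n (Q n)" for n
  define S where "S n = (\<Sum>i\<le>n. \<beta> i)" for n
  define N where "N n = nat \<lceil>(2 * 4 ^ Suc n + real (n + 2)) * (S n * real (Q n))\<rceil>" for n
  have B1: "\<beta> n \<ge> 1" for n by (simp add: \<beta>_def B_def)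
  have D: "denominators B n = (Q n, S n)" for n
  proof (induction n)
    case (Suc n)
    have "denominators B (Suc n) = (Q (Suc n), snd (denominators B (Suc n)))" by (simp add: Q_def)
    moreover have "snd (denominators B (Suc n)) = S n + B (Suc n) (Q (Suc n))"
      by (simp add: Q_def[of "Suc n"] Suc.IH Let_def)
    ultimately show ?case by (simp add: S_def \<beta>_def)
  qed (simp add: Q_def S_def \<beta>_def)
  have Q0: "Q 0 = 2" by (simp add: Q_def)
  have QS: "Q (Suc n) = Q n * N n" for n
    using D[of n] by (simp add: Q_def[of "Suc n"] N_def Let_def)
  have Qpos: "Q n \<ge> 1" and Nge: "(2 * 4 ^ Suc n + real (n + 2)) * (S n * real (Q n)) \<le> real (N n)" and N2: "N n \<ge> 2" for n
  proof -
    have nge: "(2 * 4 ^ Suc n + real (n + 2)) * (S n * real (Q n)) \<le> real (N n)" for n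
      unfolding N_def by linarith
    have S1: "S n \<ge> 1" for n
    proof -
      have "\<beta> n \<le> S n" unfolding S_def by (rule member_le_sum) (use B1 order.trans[OF zero_le_one B1] in auto)
      then show ?thesis using B1[of n] by linarith
    qed
    have n2: "N n \<ge> 2" if "Q n \<ge> 1" for n
    proof -
      have "1 * 1 \<le> S n * real (Q n)" using S1[of n] that by (intro mult_mono) auto
      moreover have "2 \<le> 2 * 4 ^ Suc n + real (n + 2)" by (intro add_increasing) auto
      ultimately have "2 * 1 \<le> (2 * 4 ^ Suc n + real (n + 2)) * (S n * real (Q n))" by (intro mult_mono) auto
      then show ?thesis using nge[of n] by linarith
    qed
    have q1: "Q n \<ge> 1" for n
    proof (induction n)
      case (Suc n)
      then show ?case using n2[of n] by (simp add: QS)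
    qed (simp add: Q0)
    show "Q n \<ge> 1" "(2 * 4 ^ Suc n + real (n + 2)) * (S n * real (Q n)) \<le> real (N n)" "N n \<ge> 2" by (rule q1, rule nge, rule n2[OF q1])
  qed
  have grow: "2 ^ i * Q n \<le> Q (i + n)" for i n
  proof (induction i)
    case (Suc i)
    have "2 ^ Suc i * Q n \<le> 2 * Q (i + n)" using Suc.IH by simp
    also have "\<dots> \<le> Q (i + n) * N (i + n)" using N2[of "i + n"] by (simp add: mult.commute)
    finally show ?case by (simp add: QS)
  qed simp
  have dvd: "Q i dvd Q n" if "i \<le> n" for i n
    using that by (induction rule: dec_induct) (auto simp: QS)
  have le: "Q i \<le> Q n" if "i \<le> n" for i n
    using dvd[OF that] Qpos[of n] by (intro dvd_imp_le) auto
  define a where "a i = 1 / real (Q i)" for i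
  have apos: "a i > 0" for i using Qpos[of i] by (simp add: a_def)
  have abd: "a (i + n) \<le> (1/2) ^ i * a n" for i n
  proof -
    have "real (2 ^ i * Q n) \<le> real (Q (i + n))" using grow[of i n] by (simp only: of_nat_le_iff)
    then have "2 ^ i * real (Q n) \<le> real (Q (i + n))" by simp
    then have "1 / real (Q (i + n)) \<le> 1 / (2 ^ i * real (Q n))"
      using Qpos[of n] by (intro frac_le mult_pos_pos) auto
    then show ?thesis by (simp add: a_def power_one_over)
  qed
  have geo: "summable (\<lambda>i. (1/2) ^ i * a n)" "(\<Sum>i. (1/2) ^ i * a n) = 2 * a n" for n
  proof -
    have "(\<lambda>i. (1/2) ^ i * a n) sums (1 / (1 - 1/2) * a n)" by (intro sums_mult2 geometric_sums) simp
    then show "summable (\<lambda>i. (1/2) ^ i * a n)" "(\<Sum>i. (1/2) ^ i * a n) = 2 * a n" by (auto simp: sums_iff)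
  qed
  have sm: "summable (\<lambda>i. a (i + n))" for n
    by (rule summable_comparison_test'[OF geo(1)]) (use abd less_imp_le[OF apos] in auto)
  have tail_le: "(\<Sum>i. a (i + n)) \<le> 2 * a n" for n
    unfolding geo(2)[symmetric] by (rule suminf_le[OF abd sm geo(1)])
  have tail_ge: "a n \<le> (\<Sum>i. a (i + n))" for n
    using sum_le_suminf[OF sm, of "{0}" n] less_imp_le[OF apos] by simp
  define \<alpha> where "\<alpha> = (\<Sum>i. a i)"
  define p where "p n = (\<Sum>i\<le>n. Q n div Q i)" for n
  have pn: "real (p n) = real (Q n) * (\<Sum>i<Suc n. a i)" for n
  proof -
    have "real (Q n div Q i) = real (Q n) * a i" if "i \<le> n" for i
      unfolding a_def using dvd[OF that] by (simp add: real_of_nat_div)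
    then show ?thesis by (simp add: p_def sum_distrib_left lessThan_Suc_atMost)
  qed
  have eps: "real (Q n) * \<alpha> - real (p n) = real (Q n) * (\<Sum>i. a (i + Suc n))" for n
  proof -
    have "\<alpha> = (\<Sum>i. a (i + Suc n)) + (\<Sum>i<Suc n. a i)"
      unfolding \<alpha>_def using sm[of 0] by (intro suminf_split_initial_segment) simp
    then show ?thesis unfolding pn by (simp add: distrib_left)
  qed
  have eps_le: "real (Q n) * \<alpha> - real (p n) \<le> 2 / real (N n)" for n
  proof -
    have "real (Q n) * (\<Sum>i. a (i + Suc n)) \<le> real (Q n) * (2 * a (Suc n))" by (intro mult_left_mono tail_le) auto
    also have "\<dots> = 2 / real (N n)" using Qpos[of n] by (simp add: a_def QS)
    finally show ?thesis unfolding eps .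
  qed
  have eps_ge: "1 / real (Q j) \<le> real (Q n) * \<alpha> - real (p n)" if "n < j" for n j
  proof -
    have "1 / real (Q j) \<le> 1 / real (Q (Suc n))"
      using le[of "Suc n" j] that Qpos[of "Suc n"] by (intro divide_left_mono) auto
    also have "\<dots> \<le> (\<Sum>i. a (i + Suc n))" using tail_ge[of "Suc n"] by (simp add: a_def)
    also have "\<dots> \<le> real (Q n) * (\<Sum>i. a (i + Suc n))"
      using Qpos[of n] tail_ge[of "Suc n"] apos[of "Suc n"] mult_right_mono[of 1 "real (Q n)" "\<Sum>i. a (i + Suc n)"] by simp
    finally show ?thesis unfolding eps .
  qed
  have eps_pos: "0 < real (Q n) * \<alpha> - real (p n)" for n
  proof -
    have "0 < 1 / real (Q (Suc n))" using Qpos[of "Suc n"] by simp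
    then show ?thesis using eps_ge[of n "Suc n"] by linarith
  qed
  have S_ge: "\<beta> n \<le> S n" for n
    unfolding S_def by (rule member_le_sum) (use order.trans[OF zero_le_one B1] in auto)
  \<comment> \<open>The factor \<open>1 / Q n\<close> makes the bound small against all earlier
    distances, since each of them is at least \<open>1 / Q n\<close>.\<close>
  have key: "(real (Q n) * \<alpha> - real (p n)) * \<beta> n \<le> (1/4) ^ Suc n * (1 / real (Q n))" for n
  proof -
    have "2 * 4 ^ Suc n * (\<beta> n * real (Q n)) \<le> (2 * 4 ^ Suc n + real (n + 2)) * (S n * real (Q n))"
      using S_ge[of n] B1[of n] by (intro mult_mono) auto
    then have NN: "2 * 4 ^ Suc n * (\<beta> n * real (Q n)) \<le> real (N n)" using Nge[of n] by linarith
    have "(real (Q n) * \<alpha> - real (p n)) * \<beta> n \<le> 2 / real (N n) * \<beta> n" using eps_le[of n] B1[of n] by (intro mult_right_mono) auto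
    also have "\<dots> \<le> (1/4) ^ Suc n * (1 / real (Q n))"
      using NN N2[of n] Qpos[of n] by (simp add: field_simps power_one_over)
    finally show ?thesis .
  qed
  have "Q n \<ge> 1 \<and> p n \<le> Q n \<and> b n (Q n) \<le> \<beta> n \<and> 1 \<le> \<beta> n \<and> real (Q n) \<le> \<beta> n \<and>
     0 < real (Q n) * \<alpha> - real (p n) \<and> (real (Q n) * \<alpha> - real (p n)) * \<beta> n \<le> (1/4) ^ Suc n \<and>
     (\<forall>j>n. (real (Q j) * \<alpha> - real (p j)) * \<beta> j \<le> (1/4) ^ Suc j * (real (Q n) * \<alpha> - real (p n))) \<and>
     (\<Sum>j<n. \<beta> j) \<le> real (Q n) / real (Suc n)" for n
  proof (intro conjI allI impI)
    \<comment> \<open>The starting value \<open>Q 0 = 2\<close> gives \<alpha> \<le> 1.\<close>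
    show "p n \<le> Q n"
    proof -
      have "real (p n) \<le> real (Q n) * \<alpha>" using eps_pos[of n] by linarith
      also have "\<alpha> \<le> 1" using tail_le[of 0] by (simp add: \<alpha>_def a_def Q0)
      finally show ?thesis by (simp add: mult_left_mono)
    qed
    show "(real (Q n) * \<alpha> - real (p n)) * \<beta> n \<le> (1/4) ^ Suc n"
      using order.trans[OF key[of n] mult_left_mono[of "1 / real (Q n)" 1 "(1/4) ^ Suc n"]] Qpos[of n] by simp
    show "(real (Q j) * \<alpha> - real (p j)) * \<beta> j \<le> (1/4) ^ Suc j * (real (Q n) * \<alpha> - real (p n))" if "n < j" for j
      by (rule order.trans[OF key mult_left_mono[OF eps_ge[OF that]]]) simp
    show "(\<Sum>j<n. \<beta> j) \<le> real (Q n) / real (Suc n)"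
    proof (cases n)
      case (Suc k)
      have S0: "0 \<le> S k" using S_ge[of k] B1[of k] by linarith
      have "S k * real (k + 2) \<le> (2 * 4 ^ Suc k + real (k + 2)) * (S k * real (Q k))"
      proof -
        have "real (k + 2) * (S k * 1) \<le> (2 * 4 ^ Suc k + real (k + 2)) * (S k * real (Q k))"
          using S0 Qpos[of k] by (intro mult_mono) auto
        then show ?thesis by (simp only: mult_1_right mult.commute)
      qed
      also have "\<dots> \<le> real (N k)" by (rule Nge)
      also have "\<dots> \<le> real (Q n)" using Qpos[of k] mult_right_mono[of 1 "real (Q k)" "real (N k)"] by (simp add: Suc QS)
      finally have "S k \<le> real (Q n) / real (k + 2)" by (simp add: pos_le_divide_eq)
      then show ?thesis by (simp add: Suc S_def lessThan_Suc_atMost)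
    qed simp
  qed (use Qpos[of n] eps_pos[of n] in \<open>auto simp: \<beta>_def B_def\<close>)
  then show ?thesis by blast
qed

lemma periodic_strip_bounded:
  assumes "C holomorphic_on UNIV" "\<And>z. C (z + 1) = C z"
  shows "\<exists>B. \<forall>z. \<bar>Im z\<bar> \<le> r \<longrightarrow> norm (C z :: complex) \<le> B"
proof -
  have "compact (cbox (Complex 0 (- r)) (Complex 1 r))" by simp
  moreover have "continuous_on (cbox (Complex 0 (- r)) (Complex 1 r)) C"
    by (rule continuous_on_subset[OF holomorphic_on_imp_continuous_on[OF assms(1)]]) simp
  ultimately have "bounded (C ` cbox (Complex 0 (- r)) (Complex 1 r))"
    by (intro compact_imp_bounded compact_continuous_image)
  then obtain B where "\<forall>x\<in>C ` cbox (Complex 0 (- r)) (Complex 1 r). norm x \<le> B" unfolding bounded_iff by blast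
  then have B: "norm (C z) \<le> B" if "0 \<le> Re z" "Re z \<le> 1" "\<bar>Im z\<bar> \<le> r" for z
  proof -
    have "z \<in> cbox (Complex 0 (- r)) (Complex 1 r)" using that by (auto simp: in_cbox_complex_iff)
    then show ?thesis using \<open>\<forall>x\<in>_. norm x \<le> B\<close> by blast
  qed
  have per: "C (z + of_int i) = C z" for z i
    using periodic_of_int[of "\<lambda>u. C (z + of_real u)" 0 i] assms(2)[of "z + of_real _"] by (simp add: add.assoc)
  have "norm (C z) \<le> B" if "\<bar>Im z\<bar> \<le> r" for z
  proof -
    have "norm (C (z + of_int (- \<lfloor>Re z\<rfloor>))) \<le> B" using that by (intro B) (auto, linarith+)
    then show ?thesis unfolding per .
  qed
  then show ?thesis by blast
qed

lemma exp_flow_exists: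
  assumes hol: "C holomorphic_on UNIV" and per: "\<And>z. C (z + 1) = C z" and re: "\<And>x. C (of_real x) \<in> \<real>"
  shows "\<exists>\<alpha> q p \<beta>. exp_flow C \<alpha> q p \<beta>"
proof -
  have "\<exists>B. \<forall>z. \<bar>Im z\<bar> \<le> 2 * real Q + 2 \<longrightarrow> norm (exp (of_nat n * C z)) \<le> B" for n Q :: nat
    by (rule periodic_strip_bounded) (auto intro!: holomorphic_intros hol simp: per)
  then have ex: "\<exists>B. \<forall>z. \<bar>Im z\<bar> \<le> 2 * real Q + 2 \<longrightarrow> norm (exp (of_nat n * C z)) \<le> B" for n Q .
  \<comment> \<open>The bound depends on the width of the strip, hence on a denominator not yet
    chosen; it is therefore handed over as a function of \<open>Q\<close>.\<close>
  define b where "b n Q = (SOME B. \<forall>z. \<bar>Im z\<bar> \<le> 2 * real Q + 2 \<longrightarrow> norm (exp (of_nat n * C z)) \<le> B)" for n Q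
  have b: "norm (exp (of_nat n * C z)) \<le> b n Q" if "\<bar>Im z\<bar> \<le> 2 * real Q + 2" for n Q z
    using someI_ex[OF ex[of Q n]] that unfolding b_def by blast
  obtain \<alpha> :: real and q p :: "nat \<Rightarrow> nat" and \<beta> :: "nat \<Rightarrow> real" where P: "\<And>n. q n \<ge> 1 \<and> p n \<le> q n \<and> b n (q n) \<le> \<beta> n \<and> 1 \<le> \<beta> n \<and> real (q n) \<le> \<beta> n \<and>
     0 < real (q n) * \<alpha> - real (p n) \<and> (real (q n) * \<alpha> - real (p n)) * \<beta> n \<le> (1/4) ^ Suc n \<and>
     (\<forall>j>n. (real (q j) * \<alpha> - real (p j)) * \<beta> j \<le> (1/4) ^ Suc j * (real (q n) * \<alpha> - real (p n))) \<and>
     (\<Sum>j<n. \<beta> j) \<le> real (q n) / real (Suc n)"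
    using liouville_parameters[of b] by blast
  have "exp_flow C \<alpha> (\<lambda>n. int (q n)) (\<lambda>n. int (p n)) \<beta>"
  proof unfold_locales
    fix j :: nat and z :: complex and x :: real
    show "(\<lambda>z. exp (of_nat j * C z)) holomorphic_on UNIV" by (intro holomorphic_intros hol)
    show "exp (of_nat j * C (of_real x)) \<in> \<real>"
    proof -
      obtain y where "C (of_real x) = of_real y" using re[of x] by (auto elim: Reals_cases)
      then have "exp (of_nat j * C (of_real x)) = of_real (exp (real j * y))" by (simp add: exp_of_real[symmetric])
      then show ?thesis by simp
    qed
  qed (use P per re hol order.trans[OF b] in auto)
  then show ?thesis by blast
qed

section \<open>The asymmetric profile\<close>

text \<open>Each factor is nonnegative on the real line with a double zero at one of the three
  points modulo 1; subtracting a small constant gives the profile.\<close>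

definition tooth :: "complex \<Rightarrow> complex" where
  "tooth z = (1 - cos (2 * of_real pi * z)) * (1 - cos (2 * of_real pi * (z - 1/10))) * (1 - cos (2 * of_real pi * (z - 3/10)))"

lemma tooth_facts:
  "tooth holomorphic_on UNIV" "tooth (z + 1) = tooth z"
  "tooth (of_real u) = of_real ((1 - cos (2 * pi * u)) * (1 - cos (2 * pi * (u - 1/10))) * (1 - cos (2 * pi * (u - 3/10))))"
proof -
  show "tooth holomorphic_on UNIV" unfolding tooth_def[abs_def] by (intro holomorphic_intros)
  have "cos (2 * of_real pi * (z + 1 - a)) = cos (2 * of_real pi * (z - a))" for a :: complex
  proof -
    have "2 * of_real pi * (z + 1 - a) = 2 * of_real pi * (z - a) + of_real (2 * pi)" by (simp add: algebra_simps)
    then show ?thesis by (simp add: cos_add cos_of_real sin_of_real)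
  qed
  from this[of 0] this[of "1/10"] this[of "3/10"] show "tooth (z + 1) = tooth z" by (simp add: tooth_def)
  show "tooth (of_real u) = of_real ((1 - cos (2 * pi * u)) * (1 - cos (2 * pi * (u - 1/10))) * (1 - cos (2 * pi * (u - 3/10))))"
    unfolding tooth_def by (simp add: cos_of_real[symmetric])
qed

definition tooth_real :: "real \<Rightarrow> real" where
  "tooth_real u = (1 - cos (2 * pi * u)) * (1 - cos (2 * pi * (u - 1/10))) * (1 - cos (2 * pi * (u - 3/10)))"

lemma tooth_real_nonneg: "0 \<le> tooth_real u"
  by (simp add: tooth_real_def)

lemma tooth_real_continuous: "continuous_on UNIV tooth_real"
  unfolding tooth_real_def[abs_def] by (intro continuous_intros)

text \<open>Zeros are recorded in tenths, so that coincidences between translates become congruences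
  modulo 10.\<close>

lemma tooth_real_zero:
  assumes "tooth_real u = 0"
  shows "\<exists>A i. A \<in> {0, 1, 3} \<and> 10 * u = of_int (A + 10 * i)"
proof -
  have one: "\<exists>i. w = of_int i" if c: "cos (2 * pi * w) = 1" for w
  proof -
    obtain n :: int where "2 * pi * w = real_of_int n * 2 * pi" using c unfolding cos_one_2pi_int by blast
    then have "w = of_int n" by simp
    then show ?thesis by blast
  qed
  from assms consider "cos (2 * pi * u) = 1" | "cos (2 * pi * (u - 1/10)) = 1" | "cos (2 * pi * (u - 3/10)) = 1"
    unfolding tooth_real_def by force
  then show ?thesis
  proof cases
    case 1
    from one[OF 1] obtain i where "u = of_int i" by blast
    then show ?thesis by (intro exI[of _ 0] exI[of _ i]) simp
  next
    case 2
    from one[OF 2] obtain i where "u - 1/10 = of_int i" by blast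
    then show ?thesis by (intro exI[of _ 1] exI[of _ i]) (simp add: field_simps)
  next
    case 3
    from one[OF 3] obtain i where "u - 3/10 = of_int i" by blast
    then show ?thesis by (intro exI[of _ 3] exI[of _ i]) (simp add: field_simps)
  qed
qed

text \<open>No two of 0, 1, 3 differ by 5 modulo 10. If \<open>A\<close> and \<open>A - 1\<close>
  both lie in this set modulo 10, then \<open>A\<close> is 1 and \<open>A - 3\<close> is 8, outside
  the set: it contains no translate of its reflection.\<close>

lemma tooth_real_cover:
  "0 < tooth_real u + tooth_real (u + 1/2)"
  "0 < tooth_real u + tooth_real (u - 1/10) + tooth_real (u - 3/10)"
proof -
  show "0 < tooth_real u + tooth_real (u + 1/2)"
  proof (rule ccontr)
    assume "\<not> ?thesis"
    then have "tooth_real u = 0" "tooth_real (u + 1/2) = 0"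
      using tooth_real_nonneg[of u] tooth_real_nonneg[of "u + 1/2"] by linarith+
    then obtain A i A' i' where A: "A \<in> {0, 1, 3}" "10 * u = of_int (A + 10 * i)"
      and A': "A' \<in> {0, 1, 3}" "10 * (u + 1/2) = of_int (A' + 10 * i')"
      using tooth_real_zero by meson
    have "real_of_int (A + 10 * i + 5) = of_int (A' + 10 * i')" using A(2) A'(2) by simp
    then have "A + 10 * i + 5 = A' + 10 * i'" by (simp only: of_int_eq_iff)
    then show False using A(1) A'(1) by auto presburger+
  qed
  show "0 < tooth_real u + tooth_real (u - 1/10) + tooth_real (u - 3/10)"
  proof (rule ccontr)
    assume "\<not> ?thesis"
    then have "tooth_real u = 0" "tooth_real (u - 1/10) = 0" "tooth_real (u - 3/10) = 0"
      using tooth_real_nonneg[of u] tooth_real_nonneg[of "u - 1/10"] tooth_real_nonneg[of "u - 3/10"] by linarith+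
    then obtain A i A' i' A'' i'' where A: "A \<in> {0, 1, 3}" "10 * u = of_int (A + 10 * i)"
      and A': "A' \<in> {0, 1, 3}" "10 * (u - 1/10) = of_int (A' + 10 * i')"
      and A'': "A'' \<in> {0, 1, 3}" "10 * (u - 3/10) = of_int (A'' + 10 * i'')"
      using tooth_real_zero by meson
    have "real_of_int (A + 10 * i - 1) = of_int (A' + 10 * i')" using A(2) A'(2) by simp
    then have 1: "A + 10 * i - 1 = A' + 10 * i'" by (simp only: of_int_eq_iff)
    have "real_of_int (A + 10 * i - 3) = of_int (A'' + 10 * i'')" using A(2) A''(2) by simp
    then have 2: "A + 10 * i - 3 = A'' + 10 * i''" by (simp only: of_int_eq_iff)
    have "A = 0 \<or> A = 1 \<or> A = 3" "A' = 0 \<or> A' = 1 \<or> A' = 3" using A(1) A'(1) by auto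
    then have "A = 1" using 1 by (elim disjE; simp; presburger)
    moreover have "A'' = 0 \<or> A'' = 1 \<or> A'' = 3" using A''(1) by auto
    ultimately show False using 2 by (elim disjE; simp; presburger)
  qed
qed

text \<open>By periodicity and compactness both sums have a positive minimum. The largest of at most
  three nonnegative summands is at least a third of their sum; division by 4 makes the inequality
  strict.\<close>

lemma tooth_threshold:
  "\<exists>d>0. \<forall>u. d < max (tooth_real u) (tooth_real (u + 1/2)) \<and> d < max (tooth_real u) (max (tooth_real (u - 1/10)) (tooth_real (u - 3/10)))"
proof -
  have per: "tooth_real (u + of_int i) = tooth_real u" for u i
  proof (rule periodic_of_int)
    fix u
    have "complex_of_real (tooth_real (u + 1)) = of_real (tooth_real u)"
      using tooth_facts(2)[of "of_real u"] tooth_facts(3)[of u] tooth_facts(3)[of "u + 1"] unfolding tooth_real_def by simp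
    then show "tooth_real (u + 1) = tooth_real u" by (simp only: of_real_eq_iff)
  qed
  have bd: "\<exists>d>0. \<forall>u. d \<le> F u" if c: "continuous_on UNIV F" and p: "\<And>u. 0 < F u" and per: "\<And>u i. F (u + of_int i) = F u" for F :: "real \<Rightarrow> real"
  proof -
    obtain x where x: "x \<in> {0..1::real}" "\<And>y. y \<in> {0..1} \<Longrightarrow> F x \<le> F y"
      using continuous_attains_inf[of "{0..1::real}" F] continuous_on_subset[OF c] by auto
    have "F x \<le> F u" for u
      using x(2)[of "frac u"] per[of u "- \<lfloor>u\<rfloor>"] frac_lt_1[of u] by (simp add: frac_def)
    then show ?thesis using p by blast
  qed
  have cs: "continuous_on UNIV (\<lambda>u. tooth_real (u + t))" for t
    by (rule continuous_on_compose2[OF tooth_real_continuous]) (auto intro!: continuous_intros)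
  have ps: "tooth_real (u + of_int i + t) = tooth_real (u + t)" for u t i using per[of "u + t" i] by (simp add: add_ac)
  obtain d where d: "d > 0" "\<And>u. d \<le> tooth_real u + tooth_real (u + 1/2)"
    using bd[of "\<lambda>u. tooth_real u + tooth_real (u + 1/2)"] tooth_real_cover(1) ps per
      continuous_on_add[OF tooth_real_continuous cs] by auto
  obtain d' where d': "d' > 0" "\<And>u. d' \<le> tooth_real u + tooth_real (u - 1/10) + tooth_real (u - 3/10)"
    using bd[of "\<lambda>u. tooth_real u + tooth_real (u - 1/10) + tooth_real (u - 3/10)"] tooth_real_cover(2) ps[of _ _ "- 1/10"] ps[of _ _ "- 3/10"] per
      continuous_on_add[OF continuous_on_add[OF tooth_real_continuous cs[of "- 1/10"]] cs[of "- 3/10"]] by auto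
  have "min d d' / 4 < max (tooth_real u) (tooth_real (u + 1/2)) \<and>
      min d d' / 4 < max (tooth_real u) (max (tooth_real (u - 1/10)) (tooth_real (u - 3/10)))" for u
    using d(1) d'(1) d(2)[of u] d'(2)[of u] by (auto simp: max_def min_def)
  then show ?thesis using d(1) d'(1) by (intro exI[of _ "min d d' / 4"]) auto
qed

lemma profile_exists:
  "\<exists>C c. C holomorphic_on UNIV \<and> (\<forall>z. C (z + 1) = C z) \<and> (\<forall>u. C (of_real u) = complex_of_real (c u)) \<and>
    c 0 < 0 \<and> c (1/10) < 0 \<and> c (3/10) < 0 \<and>
    (\<forall>u. 0 < c u \<or> 0 < c (u + 1/2)) \<and> (\<forall>u. 0 < c u \<or> 0 < c (u - 1/10) \<or> 0 < c (u - 3/10))"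
proof -
  obtain d where d: "d > 0" "\<And>u. d < max (tooth_real u) (tooth_real (u + 1/2))"
    "\<And>u. d < max (tooth_real u) (max (tooth_real (u - 1/10)) (tooth_real (u - 3/10)))" using tooth_threshold by blast
  have "(\<lambda>z. tooth z - of_real d) holomorphic_on UNIV" by (intro holomorphic_intros tooth_facts)
  moreover have "tooth_real 0 = 0" "tooth_real (1/10) = 0" "tooth_real (3/10) = 0" by (simp_all add: tooth_real_def)
  moreover have "tooth (of_real u) - of_real d = complex_of_real (tooth_real u - d)" for u
    unfolding tooth_facts(3) tooth_real_def by simp
  moreover have "0 < tooth_real u - d \<or> 0 < tooth_real (u + 1/2) - d" for u using d(2)[of u] by (auto simp: max_def split: if_splits)
  moreover have "0 < tooth_real u - d \<or> 0 < tooth_real (u - 1/10) - d \<or> 0 < tooth_real (u - 3/10) - d" for u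
    using d(3)[of u] by (auto simp: max_def split: if_splits)
  ultimately show ?thesis using d(1) tooth_facts(2)
    by (intro exI[of _ "\<lambda>z. tooth z - of_real d"] exI[of _ "\<lambda>u. tooth_real u - d"]) (simp del: of_real_diff)
qed

context exp_flow
begin

text \<open>Both delays are taken equal to \<open>1 / (2 * R)\<close> with \<open>R\<close> a power
  of \<open>r\<close>, large enough to put this delay into a neighbourhood of 0 on which
  \<open>c\<close> is negative.\<close>

lemma not_similar_if_large:
  assumes neg: "c 0 < 0" and pos: "\<And>u. 0 < c u \<or> 0 < c (u + 1/2)" and r: "\<bar>r\<bar> > 1"
  shows "\<not> similar_triple_correlations \<mu> flow r"
proof
  assume sim: "similar_triple_correlations \<mu> flow r"
  have "isCont c 0" by (rule DERIV_isCont[OF c_deriv])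
  then have "(c \<longlongrightarrow> c 0) (nhds 0)" by (simp add: isCont_def tendsto_at_iff_tendsto_nhds)
  then have "eventually (\<lambda>u. c u < 0) (nhds 0)" using neg by (rule order_tendstoD(2))
  then obtain d where d: "d > 0" "\<And>u. \<bar>u\<bar> < d \<Longrightarrow> c u < 0"
    unfolding eventually_nhds_metric by (auto simp: dist_real_def)
  obtain k where k: "1 / d < \<bar>r\<bar> ^ k" using real_arch_pow[OF r] by blast
  define R where "R = r ^ Suc k"
  have "\<bar>r\<bar> ^ k \<le> \<bar>r\<bar> ^ Suc k" using r by (intro power_increasing) auto
  then have R: "1 / d < \<bar>R\<bar>" using k unfolding R_def power_abs by linarith
  then have R0: "R \<noteq> 0" using d(1) by auto
  have "1 < \<bar>R\<bar> * d" using R d(1) by (simp add: pos_divide_less_eq)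
  then have "\<bar>1 / (2 * R)\<bar> < d" using R0 d(1) by (simp add: abs_mult pos_divide_less_eq mult_ac)
  then have n: "c (1 / (2 * R)) < 0" by (rule d(2))
  have half: "R * (1 / (2 * R)) = 1/2" using R0 by simp
  have nc: "c (0 + 1/2) \<noteq> c 0" using pos[of 0] neg by auto
  have "\<not> similar_triple_correlations \<mu> flow R"
    by (rule not_similar[OF neg n n, of R 0 0, unfolded half]) (use pos nc in auto)
  then show False using similar_triple_correlations_power[OF sim, of k] by (simp add: R_def)
qed

text \<open>Neither 1/10 nor 3/10 is a period of \<open>c\<close>: five steps of 1/10 lead from 1/2
  to 0, five steps of 3/10 lead from 3/2 to 0, and \<open>c\<close> differs at 0 and 1/2. So both
  reversed shifts produce shear.\<close>

lemma not_similar_minus_one: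
  assumes neg: "c 0 < 0" "c (1/10) < 0" "c (3/10) < 0" and half: "c 0 \<noteq> c (1/2)"
    and pos: "\<And>u. 0 < c u \<or> 0 < c (u - 1/10) \<or> 0 < c (u - 3/10)"
  shows "\<not> similar_triple_correlations \<mu> flow (- 1)"
proof -
  have a: "\<exists>u. c (u + - 1 * (1/10)) \<noteq> c u"
  proof (rule ccontr)
    assume "\<not> ?thesis"
    then have e: "c u = c (u - 1/10)" for u by auto
    have "c (1/2) = c 0" using e[of "1/2"] e[of "4/10"] e[of "3/10"] e[of "2/10"] e[of "1/10"] by simp
    then show False using half by simp
  qed
  have b: "\<exists>u. c (u + - 1 * (3/10)) \<noteq> c u"
  proof (rule ccontr)
    assume "\<not> ?thesis"
    then have e: "c u = c (u - 3/10)" for u by auto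
    have "c (1/2 + 1) = c 0" using e[of "15/10"] e[of "12/10"] e[of "9/10"] e[of "6/10"] e[of "3/10"] by simp
    then show False using half c_periodic[of "1/2"] by simp
  qed
  from a b show ?thesis using not_similar[OF neg, of "- 1"] pos by auto
qed

end

theorem corollary6p9:
  shows "\<exists>(T :: real \<Rightarrow> complex \<times> complex \<Rightarrow> complex \<times> complex) (\<mu> :: (complex \<times> complex) measure).
           real_analytic_torus_flow T \<and>
           smooth_torus_measure \<mu> \<and> prob_space \<mu> \<and>
           measure_preserving_flow \<mu> T \<and>
           weakly_mixing \<mu> T \<and>
           \<not> reversible \<mu> T \<and>
           (\<forall>s\<in>\<rat>. s \<noteq> 1 \<longrightarrow> \<not> self_similarity_scale \<mu> T s)"
proof -
  obtain C c' where C: "C holomorphic_on UNIV" "\<And>z. C (z + 1) = C z" "\<And>u. C (of_real u) = complex_of_real (c' u)"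
    and c': "c' 0 < 0" "c' (1/10) < 0" "c' (3/10) < 0" "\<And>u. 0 < c' u \<or> 0 < c' (u + 1/2)"
      "\<And>u. 0 < c' u \<or> 0 < c' (u - 1/10) \<or> 0 < c' (u - 3/10)"
    using profile_exists by blast
  obtain \<alpha> q p \<beta> where "exp_flow C \<alpha> q p \<beta>" using exp_flow_exists[OF C(1,2)] C(3) by auto
  then interpret exp_flow C \<alpha> q p \<beta> .
  have c: "c = c'" by (rule ext) (simp add: c_def C(3))
  have half: "c 0 < c (1/2)" using c'(1) c'(4)[of 0] by (simp add: c)
  have scale: "\<not> self_similarity_scale \<mu> flow s" if "s \<noteq> 1" for s
  proof
    note s1 = that
    assume s: "self_similarity_scale \<mu> flow s"
    then have s0: "s \<noteq> 0" by (simp add: self_similarity_scale_def)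
    note sim = self_similarity_scale_imp_similar[OF measure_preserving_flow_flow s]
    have "\<bar>1 / s\<bar> > 1" if "\<bar>s\<bar> < 1" using that s0 by simp
    then consider "\<bar>s\<bar> > 1" | "\<bar>1 / s\<bar> > 1" | "s = - 1"
      using s1 by linarith
    then show False
      using not_similar_if_large[of s] not_similar_if_large[of "1 / s"] not_similar_minus_one sim c' half
      unfolding c by cases auto
  qed
  have "weakly_mixing \<mu> flow" by (rule weakly_mixing_flow[of 0]) (use c'(4) half in \<open>auto simp: c\<close>)
  moreover have "\<not> reversible \<mu> flow" using reversible_imp_self_similarity_scale scale[of "- 1"] by auto
  ultimately show ?thesis
    using real_analytic_torus_flow_flow smooth_torus_measure_mu prob_space_mu measure_preserving_flow_flow scale by blast
qed

end
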